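(* In the setting described in the context, the curve $D = \{F = G = 0\} \subset \mathbb{P}^3$ is a non-singular intersection of two quadrics, the map $\pi = (r_1 : \cdots : r_4) : D \to C$ is a morphism of degree $2$, and $D$ has hyperplane section $\pi^*\mathfrak{a}_1 \sim \pi^*\mathfrak{a}_2$.
   Context: $K$ is a number field, $C \subset \mathbb{P}^3$ a non-singular intersection of two quadrics over $K$ with Jacobian $E$. The four singular quadrics in the pencil defining $C$ are cones over conics $\Gamma_1,\ldots,\Gamma_4$; projection from the vertex of the $i$-th cone gives a degree-2 morphism $\nu_i : C\to\Gamma_i$ with fibre $\mathfrak{a}_i$. Fix $0\ne T\in E(K)[2]$ and order the $\Gamma_i$ so that $\mathfrak{a}_1-\mathfrak{a}_2\sim\mathfrak{a}_3-\mathfrak{a}_4$ represents $T$ in $\operatorname{Pic}^0(C)\cong E$. Assume the Galois action on the $\Gamma_i$ has image in $\langle(12),(34)\rangle$. Construction of $D$. Non-split case ($\Gamma_1,\Gamma_2$ defined over a quadratic extension $L = K(\beta)$ and $\operatorname{Gal}(L/K)$-conjugate): $\Gamma_1$ is defined by $q \in L[X,Y,Z]$ and the cone over it is $q(m_1,m_2,m_3) = 0$ with linear forms $m_i \in L[x_1,\ldots,x_4]$. Given a point $P_1 \in \Gamma_1(L)$, parametrise $\Gamma_1$ as $(X:Y:Z) = (Q_1(\lambda,\mu):Q_2(\lambda,\mu):Q_3(\lambda,\mu))$ with binary quadratic forms $Q_i$ over $L$. Write $m_i(x_1,\ldots,x_4) = Q_i(x+\beta y, u+\beta v)$ for $i=1,2,3$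 and expand in the basis $1,\beta$ of $L/K$, giving six equations over $K$ whose left sides are linear forms in $x_1,\dots,x_4$ and right sides quadratic forms in $x,y,u,v$. Taking $K$-linear combinations these become $x_i = r_i(x,y,u,v)$ ($i=1,\ldots,4$) together with $F(x,y,u,v) = G(x,y,u,v) = 0$, with $r_i,F,G$ quadratic forms over $K$. Split case ($\Gamma_1,\Gamma_2$ defined over $K$): the cones are $q(m_1,m_2,m_3)=0$ and $q'(n_1,n_2,n_3)=0$ with $m_i,n_i$ linear forms over $K$; using $K$-points $P_1\in\Gamma_1$, $P_2\in\Gamma_2$ parametrise $\Gamma_1$ by $(Q_1:Q_2:Q_3)(c,d)$ and $\Gamma_2$ by $(R_1:R_2:R_3)(\theta,\psi)$ over $K$; the six equations $m_i(x_1,\ldots,x_4) = Q_i(c,d)$, $n_i(x_1,\ldots,x_4) = R_i(\theta,\psi)$ are likewise rewritten as $x_i = r_i(c,d,\theta,\psi)$ and $F = G = 0$. *)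

theory Defs
  imports "HOL-Analysis.Analysis" "HOL-Algebra.Ideal_Product" "HOL-Algebra.Algebraic_Closure_Type"
begin

text \<open>
  Geometry is done over an algebraically closed field \<open>'a\<close> in the style of
  classical varieties: fields of definition (\<open>K\<close>, \<open>L\<close>) are subsets of \<open>'a\<close>, polynomials
  are identified with the functions they induce (harmless, as \<open>'a\<close> is infinite),
  and a projective set is its set of \<open>'a\<close>-valued points.
\<close>

section \<open>Fields\<close>

definition number_field :: "'a::field_char_0 set \<Rightarrow> bool" where
  "number_field K \<longleftrightarrow> subfield K ring_of_type_algebra \<and>
     ring.finite_dimension ring_of_type_algebra \<rat> K"

text \<open>Together with algebraic closedness of \<open>'a\<close> this says that \<open>'a\<close> is an algebraic closure of \<open>K\<close>.\<close>

definition algebraic_over_all :: "'a::field set \<Rightarrow> bool" where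
  "algebraic_over_all K \<longleftrightarrow> (\<forall>z. \<exists>p. p \<noteq> 0 \<and> (\<forall>i. Polynomial.coeff p i \<in> K) \<and> poly p z = 0)"

definition gal :: "'a::field set \<Rightarrow> ('a \<Rightarrow> 'a) set" where
  "gal K = {\<sigma>. bij \<sigma> \<and> (\<forall>x y. \<sigma> (x + y) = \<sigma> x + \<sigma> y) \<and> (\<forall>x y. \<sigma> (x * y) = \<sigma> x * \<sigma> y)
                \<and> (\<forall>k\<in>K. \<sigma> k = k)}"

definition quadratic_extension :: "'a::field set \<Rightarrow> 'a set \<Rightarrow> 'a \<Rightarrow> bool" where
  "quadratic_extension K L \<beta> \<longleftrightarrow>
     L = ring.simple_extension ring_of_type_algebra K \<beta> \<and>
     ring.dimension ring_of_type_algebra 2 K L"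

section \<open>Forms and projective sets\<close>

definition is_form :: "'a::field set \<Rightarrow> nat \<Rightarrow> ('a^'n \<Rightarrow> 'a) \<Rightarrow> bool" where
  "is_form S d f \<longleftrightarrow> (\<exists>c :: ('n \<Rightarrow> nat) \<Rightarrow> 'a. (\<forall>e. c e \<in> S) \<and>
     f = (\<lambda>x. \<Sum>e | sum e UNIV = d. c e * (\<Prod>i\<in>UNIV. (x $ i) ^ e i)))"

definition forms_over :: "'a::field set \<Rightarrow> nat \<Rightarrow> ('a^'m \<Rightarrow> 'a^'n) \<Rightarrow> bool" where
  "forms_over S d r \<longleftrightarrow> (\<forall>i. is_form S d (\<lambda>x. r x $ i))"

text \<open>Formal partial derivative: the linear coefficient of \<open>t \<mapsto> f (x + t e\<^sub>i)\<close>.\<close>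

definition partial :: "'n \<Rightarrow> ('a::field^'n \<Rightarrow> 'a) \<Rightarrow> 'a^'n \<Rightarrow> 'a" where
  "partial i f x = poly (pderiv (THE p. \<forall>t. poly p t = f (x + t *s axis i 1))) 0"

definition hpoint :: "'a::field^'n \<Rightarrow> ('a^'n) set" where
  "hpoint x = {c *s x |c. c \<noteq> 0}"

definition zeros :: "('a::field^'n \<Rightarrow> 'a) set \<Rightarrow> ('a^'n) set set" where
  "zeros E = {hpoint x |x. x \<noteq> 0 \<and> (\<forall>f\<in>E. f x = 0)}"

definition vanishes_at :: "('a::field^'n \<Rightarrow> 'a) \<Rightarrow> ('a^'n) set \<Rightarrow> bool" where
  "vanishes_at f P \<longleftrightarrow> (\<forall>x\<in>P. f x = 0)"

definition rational_point :: "'a::field set \<Rightarrow> ('a^'n) set \<Rightarrow> bool" where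
  "rational_point S P \<longleftrightarrow> (\<exists>x. (\<forall>i. x $ i \<in> S) \<and> P = hpoint x)"

definition gal_point :: "('a \<Rightarrow> 'a) \<Rightarrow> ('a::field^'n) set \<Rightarrow> ('a^'n) set" where
  "gal_point \<sigma> P = (\<lambda>x. \<chi> i. \<sigma> (x $ i)) ` P"

text \<open>Jacobian criterion: the gradients of the two quadrics are linearly independent
  at every geometric point of the intersection.\<close>

definition nonsingular_quadric_intersection ::
    "'a::field set \<Rightarrow> ('a^4 \<Rightarrow> 'a) \<Rightarrow> ('a^4 \<Rightarrow> 'a) \<Rightarrow> bool" where
  "nonsingular_quadric_intersection S A B \<longleftrightarrow> is_form S 2 A \<and> is_form S 2 B \<and>
     (\<forall>x. x \<noteq> 0 \<longrightarrow> A x = 0 \<longrightarrow> B x = 0 \<longrightarrow>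
        (\<forall>s t. (\<forall>i. s * partial i A x + t * partial i B x = 0) \<longrightarrow> s = 0 \<and> t = 0))"

section \<open>Function fields, valuations and divisors of projective curves\<close>

text \<open>The field of rational functions over \<open>S\<close> on an irreducible projective set \<open>V\<close>:
  classes of fractions of forms of equal degree with coefficients in \<open>S\<close>.
  Local rings, valuations and divisors are geometric, i.e. use \<open>S = UNIV\<close>.\<close>

definition fracs :: "'a::field set \<Rightarrow> ('a^'n) set set \<Rightarrow> (('a^'n \<Rightarrow> 'a) \<times> ('a^'n \<Rightarrow> 'a)) set" where
  "fracs S V = {(f, g). (\<exists>d. is_form S d f \<and> is_form S d g) \<and> (\<exists>P\<in>V. \<not> vanishes_at g P)}"

definition frac_rel :: "'a::field set \<Rightarrow> ('a^'n) set set \<Rightarrow>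
    ((('a^'n \<Rightarrow> 'a) \<times> ('a^'n \<Rightarrow> 'a)) \<times> (('a^'n \<Rightarrow> 'a) \<times> ('a^'n \<Rightarrow> 'a))) set" where
  "frac_rel S V = {((f, g), (f', g')). (f, g) \<in> fracs S V \<and> (f', g') \<in> fracs S V \<and>
     (\<forall>P\<in>V. vanishes_at (\<lambda>x. f x * g' x - f' x * g x) P)}"

type_synonym ('a, 'n) ratfun = "(('a^'n \<Rightarrow> 'a) \<times> ('a^'n \<Rightarrow> 'a)) set"

definition ratio :: "'a::field set \<Rightarrow> ('a^'n) set set \<Rightarrow> ('a^'n \<Rightarrow> 'a) \<Rightarrow> ('a^'n \<Rightarrow> 'a) \<Rightarrow> ('a, 'n) ratfun" where
  "ratio S V f g = frac_rel S V `` {(f, g)}"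

definition function_field :: "'a::field set \<Rightarrow> ('a^'n) set set \<Rightarrow> ('a, 'n) ratfun ring" where
  "function_field S V = \<lparr>
     carrier = fracs S V // frac_rel S V,
     monoid.mult = (\<lambda>U N. \<Union>(f, g)\<in>U. \<Union>(f', g')\<in>N.
        ratio S V (\<lambda>x. f x * f' x) (\<lambda>x. g x * g' x)),
     one = ratio S V (\<lambda>_. 1) (\<lambda>_. 1),
     ring.zero = ratio S V (\<lambda>_. 0) (\<lambda>_. 1),
     add = (\<lambda>U N. \<Union>(f, g)\<in>U. \<Union>(f', g')\<in>N.
        ratio S V (\<lambda>x. f x * g' x + f' x * g x) (\<lambda>x. g x * g' x)) \<rparr>"

definition nonzero_functions :: "('a::field^'n) set set \<Rightarrow> ('a, 'n) ratfun set" where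
  "nonzero_functions V = carrier (function_field UNIV V) - {\<zero>\<^bsub>function_field UNIV V\<^esub>}"

definition local_ring :: "('a::field^'n) set set \<Rightarrow> ('a^'n) set \<Rightarrow> ('a, 'n) ratfun set" where
  "local_ring V P = {U \<in> carrier (function_field UNIV V). \<exists>(f, g)\<in>U. \<not> vanishes_at g P}"

definition local_max_ideal :: "('a::field^'n) set set \<Rightarrow> ('a^'n) set \<Rightarrow> ('a, 'n) ratfun set" where
  "local_max_ideal V P = {U \<in> carrier (function_field UNIV V).
     \<exists>(f, g)\<in>U. \<not> vanishes_at g P \<and> vanishes_at f P}"

primrec local_max_ideal_power ::
    "('a::field^'n) set set \<Rightarrow> ('a^'n) set \<Rightarrow> nat \<Rightarrow> ('a, 'n) ratfun set" where
  "local_max_ideal_power V P 0 = local_ring V P"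
| "local_max_ideal_power V P (Suc n) =
     ideal_prod (function_field UNIV V \<lparr> carrier := local_ring V P \<rparr>)
       (local_max_ideal V P) (local_max_ideal_power V P n)"

definition local_ord :: "('a::field^'n) set set \<Rightarrow> ('a^'n) set \<Rightarrow> ('a, 'n) ratfun \<Rightarrow> nat" where
  "local_ord V P U = (GREATEST n. U \<in> local_max_ideal_power V P n)"

text \<open>Extension of the valuation from the local ring to its fraction field.\<close>

definition ordv :: "('a::field^'n) set set \<Rightarrow> ('a^'n) set \<Rightarrow> ('a, 'n) ratfun \<Rightarrow> int" where
  "ordv V P U = (THE k. \<exists>N \<in> local_ring V P \<inter> nonzero_functions V.
                        \<exists>W \<in> local_ring V P \<inter> nonzero_functions V.
      U \<otimes>\<^bsub>function_field UNIV V\<^esub> W = N \<and> k = int (local_ord V P N) - int (local_ord V P W))"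

type_synonym ('a, 'n) divisor = "('a^'n) set \<Rightarrow> int"

definition div_of :: "('a::field^'n) set set \<Rightarrow> ('a, 'n) ratfun \<Rightarrow> ('a, 'n) divisor" where
  "div_of V U = (\<lambda>P. if P \<in> V then ordv V P U else 0)"

definition principal_divisors :: "('a::field^'n) set set \<Rightarrow> ('a, 'n) divisor set" where
  "principal_divisors V = div_of V ` nonzero_functions V"

definition lin_equiv :: "('a::field^'n) set set \<Rightarrow> ('a, 'n) divisor \<Rightarrow> ('a, 'n) divisor \<Rightarrow> bool" where
  "lin_equiv V d e \<longleftrightarrow> (\<lambda>P. d P - e P) \<in> principal_divisors V"

definition point_divisor :: "('a::field^'n) set \<Rightarrow> ('a, 'n) divisor" where
  "point_divisor Q = (\<lambda>P. if P = Q then 1 else 0)"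

text \<open>Intersection divisor of \<open>V\<close> with the hyperplane \<open>h = 0\<close>; locally at \<open>P\<close> the form \<open>h\<close> is
  dehomogenised by a linear form not vanishing at \<open>P\<close>.\<close>

definition hyperplane_divisor :: "('a::field^'n) set set \<Rightarrow> ('a^'n \<Rightarrow> 'a) \<Rightarrow> ('a, 'n) divisor" where
  "hyperplane_divisor V h = (\<lambda>P. if P \<in> V
     then ordv V P (ratio UNIV V h (SOME g. is_form UNIV 1 g \<and> \<not> vanishes_at g P)) else 0)"

definition deg0_divisors :: "('a::field^'n) set set \<Rightarrow> ('a, 'n) divisor monoid" where
  "deg0_divisors V = \<lparr>
     carrier = {d. finite {P. d P \<noteq> 0} \<and> {P. d P \<noteq> 0} \<subseteq> V \<and> (\<Sum>P | d P \<noteq> 0. d P) = 0},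
     monoid.mult = (\<lambda>d e P. d P + e P),
     one = (\<lambda>P. 0) \<rparr>"

definition Pic0 :: "('a::field^'n) set set \<Rightarrow> ('a, 'n) divisor set monoid" where
  "Pic0 V = deg0_divisors V Mod principal_divisors V"

definition Pic0_class :: "('a::field^'n) set set \<Rightarrow> ('a, 'n) divisor \<Rightarrow> ('a, 'n) divisor set" where
  "Pic0_class V d = principal_divisors V #>\<^bsub>deg0_divisors V\<^esub> d"

definition gal_divisor :: "('a \<Rightarrow> 'a) \<Rightarrow> ('a::field, 'n::finite) divisor \<Rightarrow> ('a, 'n) divisor" where
  "gal_divisor \<sigma> d = (\<lambda>P. d (gal_point (inv_into UNIV \<sigma>) P))"

text \<open>The Jacobian \<open>E\<close> of \<open>C\<close> enters through its identification with \<open>Pic\<^sup>0(C)\<close>, so that \<open>E(K)\<close> is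
  the subgroup of Galois-invariant geometric divisor classes.\<close>

definition jacobian_rational_points ::
    "'a::field set \<Rightarrow> ('a^'n) set set \<Rightarrow> ('a, 'n) divisor set set" where
  "jacobian_rational_points K V =
     {T \<in> carrier (Pic0 V). \<forall>\<sigma>\<in>gal K. gal_divisor \<sigma> ` T = T}"

section \<open>Rational maps and morphisms\<close>

definition rational_map :: "'a::field set \<Rightarrow> ('a^'m) set set \<Rightarrow> ('a^'n) set set \<Rightarrow> ('a^'m \<Rightarrow> 'a^'n) \<Rightarrow> bool" where
  "rational_map S V Y r \<longleftrightarrow> (\<exists>d. forms_over S d r) \<and> (\<exists>P\<in>V. \<exists>x\<in>P. r x \<noteq> 0) \<and>
     (\<forall>P\<in>V. \<forall>x\<in>P. r x \<noteq> 0 \<longrightarrow> hpoint (r x) \<in> Y)"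

text \<open>\<open>s\<close> is another tuple of forms giving the same rational map as \<open>r\<close> (where nonzero), and
  defined at \<open>P\<close>.\<close>

definition represents_at :: "('a::field^'m) set set \<Rightarrow> ('a^'m \<Rightarrow> 'a^'n) \<Rightarrow> ('a^'m) set \<Rightarrow> ('a^'m \<Rightarrow> 'a^'n) \<Rightarrow> bool" where
  "represents_at V r P s \<longleftrightarrow> (\<exists>d. forms_over UNIV d s) \<and>
     (\<forall>Q\<in>V. \<forall>x\<in>Q. \<forall>i j. r x $ i * s x $ j = r x $ j * s x $ i) \<and> (\<forall>x\<in>P. s x \<noteq> 0)"

definition map_point :: "('a::field^'m) set set \<Rightarrow> ('a^'m \<Rightarrow> 'a^'n) \<Rightarrow> ('a^'m) set \<Rightarrow> ('a^'n) set" where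
  "map_point V r P = (THE Q. \<exists>s. represents_at V r P s \<and> (\<exists>x\<in>P. Q = hpoint (s x)))"

definition is_morphism :: "'a::field set \<Rightarrow> ('a^'m) set set \<Rightarrow> ('a^'n) set set \<Rightarrow> ('a^'m \<Rightarrow> 'a^'n) \<Rightarrow> bool" where
  "is_morphism S V Y r \<longleftrightarrow> rational_map S V Y r \<and>
     (\<forall>P\<in>V. (\<exists>s. represents_at V r P s) \<and> map_point V r P \<in> Y)"

definition pullback_fun :: "'a::field set \<Rightarrow> ('a^'m) set set \<Rightarrow> ('a^'m \<Rightarrow> 'a^'n) \<Rightarrow> ('a, 'n) ratfun \<Rightarrow> ('a, 'm) ratfun" where
  "pullback_fun S V r U = (\<Union>(f, g)\<in>U. ratio S V (f \<circ> r) (g \<circ> r))"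

definition has_degree :: "'a::field set \<Rightarrow> ('a^'m) set set \<Rightarrow> ('a^'n) set set \<Rightarrow> ('a^'m \<Rightarrow> 'a^'n) \<Rightarrow> nat \<Rightarrow> bool" where
  "has_degree S V Y r n \<longleftrightarrow>
     ring.dimension (function_field S V) n
       (pullback_fun S V r ` carrier (function_field S Y)) (carrier (function_field S V))"

text \<open>Ramification index: the order at \<open>Q\<close> of the pullback of a uniformiser at the image of \<open>Q\<close>.\<close>

definition ram_index :: "('a::field^'m) set set \<Rightarrow> ('a^'n) set set \<Rightarrow> ('a^'m \<Rightarrow> 'a^'n) \<Rightarrow> ('a^'m) set \<Rightarrow> int" where
  "ram_index V Y r Q = (THE e. \<forall>t \<in> nonzero_functions Y.
     ordv Y (map_point V r Q) t = 1 \<longrightarrow> ordv V Q (pullback_fun UNIV V r t) = e)"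

definition pullback_divisor :: "('a::field^'m) set set \<Rightarrow> ('a^'n) set set \<Rightarrow> ('a^'m \<Rightarrow> 'a^'n) \<Rightarrow> ('a, 'n) divisor \<Rightarrow> ('a, 'm) divisor" where
  "pullback_divisor V Y r d =
     (\<lambda>Q. if Q \<in> V then ram_index V Y r Q * d (map_point V r Q) else 0)"

section \<open>Singular quadrics in the pencil\<close>

definition singular_pencil_members :: "('a::field^4 \<Rightarrow> 'a) \<Rightarrow> ('a^4 \<Rightarrow> 'a) \<Rightarrow> ('a^4 \<Rightarrow> 'a) set" where
  "singular_pencil_members A B = {W. (\<exists>s t. (s, t) \<noteq> (0, 0) \<and> W = (\<lambda>x. s * A x + t * B x)) \<and>
     (\<exists>x. x \<noteq> 0 \<and> W x = 0 \<and> (\<forall>i. partial i W x = 0))}"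

text \<open>The quadric \<open>q (m\<^sub>1, m\<^sub>2, m\<^sub>3) = 0\<close> as a cone over the conic \<open>q = 0\<close>; surjectivity of \<open>m\<close> says that the
  linear forms \<open>m\<^sub>i\<close> are independent, i.e. \<open>m\<close> is the projection away from a single vertex.\<close>

definition cone_over_conic :: "'a::field set \<Rightarrow> ('a^3 \<Rightarrow> 'a) \<Rightarrow> ('a^4 \<Rightarrow> 'a^3) \<Rightarrow> bool" where
  "cone_over_conic S q m \<longleftrightarrow> is_form S 2 q \<and> forms_over S 1 m \<and> surj m"

text \<open>Every singular quadric of the pencil is, up to scaling, exactly one of the four cones.\<close>

definition four_cones :: "('a::field^4 \<Rightarrow> 'a) \<Rightarrow> ('a^4 \<Rightarrow> 'a) \<Rightarrow> (4 \<Rightarrow> 'a^3 \<Rightarrow> 'a) \<Rightarrow> (4 \<Rightarrow> 'a^4 \<Rightarrow> 'a^3) \<Rightarrow> bool" where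
  "four_cones A B q m \<longleftrightarrow>
     (\<forall>i. cone_over_conic UNIV (q i) (m i) \<and> q i \<circ> m i \<in> singular_pencil_members A B) \<and>
     (\<forall>W\<in>singular_pencil_members A B. \<exists>!i. \<exists>c. W = (\<lambda>x. c * q i (m i x)))"

section \<open>The construction of \<open>D\<close>\<close>

definition join :: "'a^'m \<Rightarrow> 'a^'n \<Rightarrow> 'a^('m + 'n)" where
  "join x y = (\<chi> i. case i of Inl j \<Rightarrow> x $ j | Inr k \<Rightarrow> y $ k)"

text \<open>\<open>Q\<close> is a parametrisation of the conic \<open>q = 0\<close> by binary quadratic forms over \<open>S\<close>.\<close>

definition parametrises :: "'a::field set \<Rightarrow> ('a^2 \<Rightarrow> 'a^3) \<Rightarrow> ('a^3 \<Rightarrow> 'a) \<Rightarrow> bool" where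
  "parametrises S Q q \<longleftrightarrow> forms_over S 2 Q \<and>
     (\<forall>z. z \<noteq> 0 \<longrightarrow> hpoint (Q z) \<in> zeros {q}) \<and>
     (\<forall>P\<in>zeros {q}. \<exists>!Z. \<exists>z. z \<noteq> 0 \<and> Z = hpoint z \<and> hpoint (Q z) = P)"

text \<open>An invertible \<open>K\<close>-linear recombination turns the six equations \<open>l x = s w\<close> into
  \<open>x\<^sub>i = r\<^sub>i w\<close> (\<open>i = 1, \<dots>, 4\<close>) and \<open>F w = G w = 0\<close>.\<close>

definition recombines_to :: "'a::field set \<Rightarrow> ('a^4 \<Rightarrow> 'a^(3+3)) \<Rightarrow> ('a^4 \<Rightarrow> 'a^(3+3)) \<Rightarrow>
    ('a^4 \<Rightarrow> 'a^4) \<Rightarrow> ('a^4 \<Rightarrow> 'a) \<Rightarrow> ('a^4 \<Rightarrow> 'a) \<Rightarrow> bool" where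
  "recombines_to K l s r F G \<longleftrightarrow> (\<exists>M :: 'a^(3+3)^(4+2).
     (\<forall>i j. M $ i $ j \<in> K) \<and> invertible M \<and>
     (\<forall>x. M *v l x = join x 0) \<and> (\<forall>w. M *v s w = join (r w) (vector [F w, G w])))"

text \<open>Coordinates on the ambient space of \<open>D\<close> are \<open>w = (x, y, u, v)\<close>; \<open>l0 + \<beta> l1\<close> and \<open>s0 + \<beta> s1\<close> are the
  expansions in the basis \<open>1, \<beta>\<close> of the two sides of \<open>m\<^sub>i = Q\<^sub>i(x + \<beta> y, u + \<beta> v)\<close>.\<close>

definition nonsplit_construction :: "'a::field set \<Rightarrow> 'a set \<Rightarrow> 'a \<Rightarrow>
    ('a^3 \<Rightarrow> 'a) \<Rightarrow> ('a^4 \<Rightarrow> 'a^3) \<Rightarrow> ('a^3 \<Rightarrow> 'a) \<Rightarrow> ('a^4 \<Rightarrow> 'a^3) \<Rightarrow> ('a^3) set \<Rightarrow> ('a^2 \<Rightarrow> 'a^3) \<Rightarrow>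
    ('a^4 \<Rightarrow> 'a^4) \<Rightarrow> ('a^4 \<Rightarrow> 'a) \<Rightarrow> ('a^4 \<Rightarrow> 'a) \<Rightarrow> bool" where
  "nonsplit_construction K L \<beta> q1 m1 q2 m2 P1 Q r F G \<longleftrightarrow>
     quadratic_extension K L \<beta> \<and>
     cone_over_conic L q1 m1 \<and> cone_over_conic L q2 m2 \<and>
     (\<forall>\<sigma>\<in>gal K. \<sigma> \<beta> \<noteq> \<beta> \<longrightarrow> gal_point \<sigma> ` zeros {q1 \<circ> m1} = zeros {q2 \<circ> m2}) \<and>
     P1 \<in> zeros {q1} \<and> rational_point L P1 \<and> parametrises L Q q1 \<and>
     (\<exists>(l0 :: 'a^4 \<Rightarrow> 'a^3) (l1 :: 'a^4 \<Rightarrow> 'a^3) (s0 :: 'a^4 \<Rightarrow> 'a^3) (s1 :: 'a^4 \<Rightarrow> 'a^3).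
        forms_over K 1 l0 \<and> forms_over K 1 l1 \<and> forms_over K 2 s0 \<and> forms_over K 2 s1 \<and>
        (\<forall>x. m1 x = l0 x + \<beta> *s l1 x) \<and>
        (\<forall>w. Q (vector [w $ 1 + \<beta> * w $ 2, w $ 3 + \<beta> * w $ 4]) = s0 w + \<beta> *s s1 w) \<and>
        recombines_to K (\<lambda>x. join (l0 x) (l1 x)) (\<lambda>w. join (s0 w) (s1 w)) r F G)"

text \<open>Coordinates on the ambient space of \<open>D\<close> are \<open>w = (c, d, \<theta>, \<psi>)\<close>.\<close>

definition split_construction :: "'a::field set \<Rightarrow>
    ('a^3 \<Rightarrow> 'a) \<Rightarrow> ('a^4 \<Rightarrow> 'a^3) \<Rightarrow> ('a^3 \<Rightarrow> 'a) \<Rightarrow> ('a^4 \<Rightarrow> 'a^3) \<Rightarrow> ('a^3) set \<Rightarrow> ('a^3) set \<Rightarrow>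
    ('a^2 \<Rightarrow> 'a^3) \<Rightarrow> ('a^2 \<Rightarrow> 'a^3) \<Rightarrow> ('a^4 \<Rightarrow> 'a^4) \<Rightarrow> ('a^4 \<Rightarrow> 'a) \<Rightarrow> ('a^4 \<Rightarrow> 'a) \<Rightarrow> bool" where
  "split_construction K q1 m1 q2 m2 P1 P2 Q R r F G \<longleftrightarrow>
     cone_over_conic K q1 m1 \<and> cone_over_conic K q2 m2 \<and>
     P1 \<in> zeros {q1} \<and> rational_point K P1 \<and> P2 \<in> zeros {q2} \<and> rational_point K P2 \<and>
     parametrises K Q q1 \<and> parametrises K R q2 \<and>
     recombines_to K (\<lambda>x. join (m1 x) (m2 x))
       (\<lambda>w. join (Q (vector [w $ 1, w $ 2])) (R (vector [w $ 3, w $ 4]))) r F G"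

end

theory Submission
  imports Defs
begin

no_notation fps_nth (infixl \<open>$\<close> 75)

text \<open>
  Over the algebraically closed field, suitable coordinates bring the two curves into the normal forms
  \<open>C: \<psi>\<^sup>2 = c d, \<theta>\<^sup>2 = (\<alpha> c + \<beta> d) (\<gamma> c + \<delta> d)\<close> and \<open>D: s'\<^sup>2 = \<alpha> s\<^sup>2 + \<beta> t\<^sup>2, t'\<^sup>2 = \<gamma> s\<^sup>2 + \<delta> t\<^sup>2\<close>,
  with \<open>\<pi> = (s\<^sup>2, t\<^sup>2, s' t', s t)\<close>, so \<open>D\<close> is smooth because \<open>C\<close> is. If \<open>p\<close> is the image of the parameter
  \<open>z\<^sub>0\<close>, then the linear form in \<open>(s, t)\<close> that vanishes at \<open>z\<^sub>0\<close> cuts out exactly the pullback of \<open>\<aa>\<^sub>1\<close>, and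
  likewise for \<open>\<aa>\<^sub>2\<close> and \<open>(s', t')\<close>. The covering involution is \<open>(s, t, s', t') \<mapsto> (s, t, -s', -t')\<close>; after scaling
  it is defined over \<open>K\<close>, and the function field of \<open>D\<close> splits into its even part, which is the function field
  of \<open>C\<close>, and its odd part, which is spanned by one anti-invariant quotient of quadratic forms. In the
  non-split case the second cone is the conjugate of the first one under an automorphism extending
  the nontrivial one of \<open>L/K\<close>, which identifies the second parametrisation with the conjugate of the first.
\<close>

section \<open>Forms\<close>

text \<open>Orders, ramification indices and divisors are defined through powers of local maximal
  ideals and definite descriptions, from which nothing can be computed directly. Everything is
  therefore reduced to identities between forms: a point is smooth when some linear form
  \<open>t\<close> divides every form vanishing there, up to forms that are nonzero at the point,
  and when divisibility by powers of \<open>t\<close> is bounded. Both curves are of one kind, a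
  cover of the line by two square roots of products of binary linear forms with pairwise distinct
  zeros, so irreducibility and smoothness are proved once, with the norm down to the line.

  The normal form comes from the vertices of the cones: neither lies on the other cone, so each
  projects to a point off the other conic, and the two tangents from that point give the coordinates
  in which the quadrics decouple. These coordinates are built over the closure, while the degree is
  asked for over \<open>K\<close>; hence the descent of invariant forms.\<close>

definition coeff_ring :: "'a::field set \<Rightarrow> bool" where
  "coeff_ring S \<longleftrightarrow> 0 \<in> S \<and> 1 \<in> S \<and> (\<forall>x\<in>S. \<forall>y\<in>S. x + y \<in> S \<and> x * y \<in> S) \<and> (\<forall>x\<in>S. - x \<in> S)"

definition coeff_field :: "'a::field set \<Rightarrow> bool" where
  "coeff_field S \<longleftrightarrow> coeff_ring S \<and> (\<forall>x\<in>S. inverse x \<in> S)"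

lemma coeff_ringD:
  assumes "coeff_ring S"
  shows "0 \<in> S" "1 \<in> S" "x \<in> S \<Longrightarrow> y \<in> S \<Longrightarrow> x + y \<in> S" "x \<in> S \<Longrightarrow> y \<in> S \<Longrightarrow> x * y \<in> S"
    "x \<in> S \<Longrightarrow> - x \<in> S" "x \<in> S \<Longrightarrow> y \<in> S \<Longrightarrow> x - y \<in> S"
  using assms unfolding coeff_ring_def by (auto, metis diff_conv_add_uminus)

lemma coeff_ring_UNIV [simp]: "coeff_ring UNIV"
  by (simp add: coeff_ring_def)

lemma coeff_field_ring: "coeff_field S \<Longrightarrow> coeff_ring S"
  by (simp add: coeff_field_def)

lemma coeff_field_divide: "coeff_field S \<Longrightarrow> x \<in> S \<Longrightarrow> y \<in> S \<Longrightarrow> x / y \<in> S"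
  unfolding coeff_field_def divide_inverse by (blast intro: coeff_ringD)

lemma coeff_ring_sum: "coeff_ring S \<Longrightarrow> (\<And>i. i \<in> I \<Longrightarrow> f i \<in> S) \<Longrightarrow> sum f I \<in> S"
  by (induction I rule: infinite_finite_induct) (auto intro: coeff_ringD)

lemma coeff_ring_prod: "coeff_ring S \<Longrightarrow> (\<And>i. i \<in> I \<Longrightarrow> f i \<in> S) \<Longrightarrow> prod f I \<in> S"
  by (induction I rule: infinite_finite_induct) (auto intro: coeff_ringD)

lemma coeff_ring_power: "coeff_ring S \<Longrightarrow> x \<in> S \<Longrightarrow> x ^ n \<in> S"
  by (induction n) (auto intro: coeff_ringD)

lemma coeff_ring_of_nat: "coeff_ring S \<Longrightarrow> of_nat n \<in> S"
  by (induction n) (auto intro: coeff_ringD)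

lemma coeff_ring_numeral: "coeff_ring S \<Longrightarrow> numeral n \<in> S"
  using coeff_ring_of_nat[of S "numeral n"] by simp

text \<open>Addition and multiplication of \<open>ring_of_type_algebra\<close> unfold to those of
  the type class, but its additive and multiplicative inverses are defined abstractly; uniqueness of
  inverses identifies them.\<close>

lemma subfield_coeff_field:
  fixes K :: "'a::field set"
  assumes "subfield K ring_of_type_algebra"
  shows "coeff_field K"
proof -
  interpret R: Ring.field "ring_of_type_algebra :: 'a ring" by blast
  have sr: "subring K ring_of_type_algebra" using assms by (rule subfieldE(1))
  have ring: "coeff_ring K"
    unfolding coeff_ring_def
  proof (intro conjI ballI)
    show "0 \<in> K" using subringE(2)[OF sr] by (simp add: ring_of_type_algebra_def)
    show "1 \<in> K" using subringE(3)[OF sr] by (simp add: ring_of_type_algebra_def)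
    show "x + y \<in> K" if "x \<in> K" "y \<in> K" for x y
      using subringE(7)[OF sr that] by (simp add: ring_of_type_algebra_def)
    show "x * y \<in> K" if "x \<in> K" "y \<in> K" for x y
      using subringE(6)[OF sr that] by (simp add: ring_of_type_algebra_def)
    show "- x \<in> K" if x: "x \<in> K" for x
    proof -
      have "\<ominus>\<^bsub>ring_of_type_algebra\<^esub> x \<oplus>\<^bsub>ring_of_type_algebra\<^esub> x = \<zero>\<^bsub>ring_of_type_algebra\<^esub>"
        by (rule R.l_neg) (simp add: ring_of_type_algebra_def)
      hence "\<ominus>\<^bsub>ring_of_type_algebra\<^esub> x + x = 0"
        by (simp add: ring_of_type_algebra_def)
      hence "\<ominus>\<^bsub>ring_of_type_algebra\<^esub> x = - x" by (rule add_eq_0_iff2[THEN iffD1])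
      thus ?thesis using subringE(5)[OF sr x] by simp
    qed
  qed
  have "inverse x \<in> K" if x: "x \<in> K" for x
  proof (cases "x = 0")
    case True thus ?thesis using coeff_ringD(1)[OF ring] by simp
  next
    case False
    hence "x \<in> K - {\<zero>\<^bsub>ring_of_type_algebra\<^esub>}" using x by (simp add: ring_of_type_algebra_def)
    from R.subfield_m_inv[OF assms this]
    have i: "inv\<^bsub>ring_of_type_algebra\<^esub> x \<in> K"
      and e: "x \<otimes>\<^bsub>ring_of_type_algebra\<^esub> inv\<^bsub>ring_of_type_algebra\<^esub> x = \<one>\<^bsub>ring_of_type_algebra\<^esub>" by auto
    from e have "x * inv\<^bsub>ring_of_type_algebra\<^esub> x = 1" by (simp add: ring_of_type_algebra_def)
    hence "inv\<^bsub>ring_of_type_algebra\<^esub> x = inverse x" by (rule inverse_unique[symmetric])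
    with i show ?thesis by simp
  qed
  with ring show ?thesis by (simp add: coeff_field_def)
qed

section \<open>Homogeneous forms as functions\<close>

lemma finite_exponents: "finite {e :: 'n::finite \<Rightarrow> nat. sum e UNIV = d}"
proof (rule finite_subset)
  show "{e :: 'n \<Rightarrow> nat. sum e UNIV = d} \<subseteq> PiE UNIV (\<lambda>_. {..d})"
  proof
    fix e :: "'n \<Rightarrow> nat" assume "e \<in> {e. sum e UNIV = d}"
    moreover have "e i \<le> sum e UNIV" for i by (rule member_le_sum) auto
    ultimately show "e \<in> PiE UNIV (\<lambda>_. {..d})" by (auto simp: PiE_def)
  qed
qed (simp add: finite_PiE)

lemma is_formI: "(\<And>e. c e \<in> S) \<Longrightarrow>
   f = (\<lambda>x. \<Sum>e | sum e UNIV = d. c e * (\<Prod>i\<in>UNIV. (x $ i) ^ e i)) \<Longrightarrow> is_form S d f"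
  unfolding is_form_def by blast

lemma is_formE:
  assumes "is_form S d f"
  obtains c where "\<And>e. c e \<in> S" "f = (\<lambda>x. \<Sum>e | sum e UNIV = d. c e * (\<Prod>i\<in>UNIV. (x $ i) ^ e i))"
  using assms unfolding is_form_def by blast

lemma is_form_zero: "coeff_ring S \<Longrightarrow> is_form S d (\<lambda>_. 0)"
  by (rule is_formI[where c = "\<lambda>_. 0"]) (auto intro: coeff_ringD)

lemma is_form_add:
  assumes "coeff_ring S" "is_form S d f" "is_form S d g"
  shows "is_form S d (\<lambda>x. f x + g x)"
proof -
  obtain c where c: "\<And>e. c e \<in> S" "f = (\<lambda>x. \<Sum>e | sum e UNIV = d. c e * (\<Prod>i\<in>UNIV. (x $ i) ^ e i))"
    using assms(2) by (rule is_formE) (rule that)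
  obtain c' where c': "\<And>e. c' e \<in> S" "g = (\<lambda>x. \<Sum>e | sum e UNIV = d. c' e * (\<Prod>i\<in>UNIV. (x $ i) ^ e i))"
    using assms(3) by (rule is_formE) (rule that)
  show ?thesis
    by (rule is_formI[where c = "\<lambda>e. c e + c' e"])
       (use c c' assms(1) in \<open>auto intro: coeff_ringD simp: distrib_right sum.distrib\<close>)
qed

lemma is_form_smult:
  assumes "coeff_ring S" "k \<in> S" "is_form S d f"
  shows "is_form S d (\<lambda>x. k * f x)"
proof -
  obtain c where c: "\<And>e. c e \<in> S" "f = (\<lambda>x. \<Sum>e | sum e UNIV = d. c e * (\<Prod>i\<in>UNIV. (x $ i) ^ e i))"
    using assms(3) by (rule is_formE) (rule that)
  show ?thesis
    by (rule is_formI[where c = "\<lambda>e. k * c e"])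
       (use c assms in \<open>auto intro: coeff_ringD simp: sum_distrib_left mult.assoc\<close>)
qed

lemma is_form_uminus: "coeff_ring S \<Longrightarrow> is_form S d f \<Longrightarrow> is_form S d (\<lambda>x. - f x)"
  using is_form_smult[of S "-1" d f] by (auto intro: coeff_ringD)

lemma is_form_diff: "coeff_ring S \<Longrightarrow> is_form S d f \<Longrightarrow> is_form S d g \<Longrightarrow> is_form S d (\<lambda>x. f x - g x)"
  using is_form_add[of S d f "\<lambda>x. - g x"] is_form_uminus[of S d g] by simp

lemma is_form_sum:
  "coeff_ring S \<Longrightarrow> (\<And>i. i \<in> I \<Longrightarrow> is_form S d (f i)) \<Longrightarrow> is_form S d (\<lambda>x. \<Sum>i\<in>I. f i x)"
  by (induction I rule: infinite_finite_induct) (auto intro: is_form_zero is_form_add)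

lemma is_form_monomial:
  assumes "coeff_ring S" "k \<in> S" "sum e UNIV = d"
  shows "is_form S d (\<lambda>x. k * (\<Prod>i\<in>UNIV. (x $ i) ^ e i))"
proof (rule is_formI[where c = "\<lambda>e'. if e' = e then k else 0"])
  show "(\<lambda>x. k * (\<Prod>i\<in>UNIV. (x $ i) ^ e i)) =
    (\<lambda>x. \<Sum>e' | sum e' UNIV = d. (if e' = e then k else 0) * (\<Prod>i\<in>UNIV. (x $ i) ^ e' i))"
  proof
    fix x :: "'a^'b"
    have "(\<Sum>e' | sum e' UNIV = d. (if e' = e then k else 0) * (\<Prod>i\<in>UNIV. (x $ i) ^ e' i))
      = (\<Sum>e' | sum e' UNIV = d. (if e' = e then k * (\<Prod>i\<in>UNIV. (x $ i) ^ e' i) else 0))"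
      by (rule sum.cong) auto
    thus "k * (\<Prod>i\<in>UNIV. (x $ i) ^ e i) =
      (\<Sum>e' | sum e' UNIV = d. (if e' = e then k else 0) * (\<Prod>i\<in>UNIV. (x $ i) ^ e' i))"
      using assms(3) by (simp add: finite_exponents)
  qed
qed (use assms coeff_ringD in auto)

lemma is_form_const: "coeff_ring S \<Longrightarrow> k \<in> S \<Longrightarrow> is_form S 0 (\<lambda>_. k)"
  using is_form_monomial[of S k "\<lambda>_. 0" 0] by simp

lemma is_form_mult:
  assumes S: "coeff_ring S" and "is_form S d f" "is_form S d' g"
  shows "is_form S (d + d') (\<lambda>x. f x * g x)"
proof -
  obtain c where c: "\<And>e. c e \<in> S" "f = (\<lambda>x. \<Sum>e | sum e UNIV = d. c e * (\<Prod>i\<in>UNIV. (x $ i) ^ e i))"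
    using assms(2) by (rule is_formE) (rule that)
  obtain c' where c': "\<And>e. c' e \<in> S" "g = (\<lambda>x. \<Sum>e | sum e UNIV = d'. c' e * (\<Prod>i\<in>UNIV. (x $ i) ^ e i))"
    using assms(3) by (rule is_formE) (rule that)
  have eq: "(\<lambda>x. f x * g x) = (\<lambda>x. \<Sum>e | sum e UNIV = d. \<Sum>e' | sum e' UNIV = d'.
      (c e * c' e') * (\<Prod>i\<in>UNIV. (x $ i) ^ (e i + e' i)))"
    unfolding c c' sum_product
    by (intro ext sum.cong refl) (simp add: power_add prod.distrib)
  show ?thesis
    unfolding eq using c(1) c'(1)
    by (intro is_form_sum is_form_monomial S coeff_ringD(4)[OF S]) (auto simp: sum.distrib)
qed

lemma is_form_power: "coeff_ring S \<Longrightarrow> is_form S d f \<Longrightarrow> is_form S (n * d) (\<lambda>x. f x ^ n)"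
  by (induction n) (auto intro: is_form_mult is_form_const coeff_ringD)

lemma is_form_component:
  assumes "coeff_ring S"
  shows "is_form S 1 (\<lambda>x. x $ i)"
proof -
  have "sum (\<lambda>j. if j = i then 1 else 0 :: nat) UNIV = 1" by simp
  from is_form_monomial[OF assms coeff_ringD(2)[OF assms] this]
  have "is_form S 1 (\<lambda>x. \<Prod>j\<in>UNIV. x $ j ^ (if j = i then 1 else 0))" by simp
  moreover have "(\<Prod>j\<in>UNIV. x $ j ^ (if j = i then 1 else 0)) = x $ i" for x :: "'a^'b"
  proof -
    have "(\<Prod>j\<in>UNIV. x $ j ^ (if j = i then 1 else 0)) = (\<Prod>j\<in>UNIV. if j = i then x $ j else 1)"
      by (rule prod.cong) auto
    thus ?thesis by simp
  qed
  ultimately show ?thesis by simp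
qed

lemma is_form_mono: "S \<subseteq> S' \<Longrightarrow> is_form S d f \<Longrightarrow> is_form S' d f"
  by (erule is_formE, rule is_formI) auto

lemma is_form_UNIV: "is_form S d f \<Longrightarrow> is_form UNIV d f"
  by (rule is_form_mono) auto

text \<open>Forms arise from constants by sums of equal degree and by multiplication with a
  coordinate, so later facts about forms need not touch exponent functions. Constants sit only in
  degree 0; the zero form of higher degree is reached by multiplying the constant 0 with
  coordinates.\<close>

lemma is_form_induct [consumes 2, case_names const add mult]:
  fixes f :: "'a::field^'n \<Rightarrow> 'a"
  assumes S: "coeff_ring S" and f: "is_form S d f"
    and const: "\<And>k. k \<in> S \<Longrightarrow> P 0 (\<lambda>_. k)"
    and add: "\<And>d f g. is_form S d f \<Longrightarrow> is_form S d g \<Longrightarrow> P d f \<Longrightarrow> P d g \<Longrightarrow> P d (\<lambda>x. f x + g x)"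
    and mult: "\<And>d f i. is_form S d f \<Longrightarrow> P d f \<Longrightarrow> P (Suc d) (\<lambda>x. x $ i * f x)"
  shows "P d f"
proof -
  have zero: "P d (\<lambda>_. 0)" for d
  proof (induction d)
    case 0 show ?case by (rule const[OF coeff_ringD(1)[OF S]])
  next
    case (Suc d) from mult[OF is_form_zero[OF S] Suc] show ?case by simp
  qed
  have mon: "P d (\<lambda>x. k * (\<Prod>i\<in>UNIV. (x $ i) ^ e i))" if "k \<in> S" "sum e UNIV = d" for k e d
    using that(2)
  proof (induction d arbitrary: e)
    case 0
    hence "e = (\<lambda>_. 0)" by auto
    thus ?case using const[OF that(1)] by simp
  next
    case (Suc d)
    then obtain i where i: "e i > 0" by (metis gr0I nat.distinct(1) sum.neutral)
    define e' where "e' = e(i := e i - 1)"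
    have e: "e = (\<lambda>j. e' j + (if j = i then 1 else 0))" using i by (auto simp: e'_def)
    have "sum e UNIV = sum e' UNIV + 1" by (subst e) (simp add: sum.distrib)
    hence e': "sum e' UNIV = d" using Suc.prems by simp
    have "(\<lambda>x. k * (\<Prod>j\<in>UNIV. (x $ j) ^ e j)) = (\<lambda>x :: 'a^'n. x $ i * (k * (\<Prod>j\<in>UNIV. (x $ j) ^ e' j)))"
    proof
      fix x :: "'a^'n"
      have "(\<Prod>j\<in>UNIV. (x $ j) ^ e j) = (\<Prod>j\<in>UNIV. (x $ j) ^ e' j * (if j = i then x $ j else 1))"
        by (subst e, rule prod.cong) (auto simp: power_add)
      also have "\<dots> = (\<Prod>j\<in>UNIV. (x $ j) ^ e' j) * x $ i" by (simp add: prod.distrib)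
      finally show "k * (\<Prod>j\<in>UNIV. (x $ j) ^ e j) = x $ i * (k * (\<Prod>j\<in>UNIV. (x $ j) ^ e' j))" by simp
    qed
    moreover have "P (Suc d) (\<lambda>x :: 'a^'n. x $ i * (k * (\<Prod>j\<in>UNIV. (x $ j) ^ e' j)))"
      by (rule mult[OF is_form_monomial[OF S that(1) e'] Suc.IH[OF e']])
    ultimately show ?case by simp
  qed
  obtain c where c: "\<And>e. c e \<in> S" "f = (\<lambda>x. \<Sum>e | sum e UNIV = d. c e * (\<Prod>i\<in>UNIV. (x $ i) ^ e i))"
    using f by (rule is_formE) (rule that)
  have "is_form S d (\<lambda>x. \<Sum>e\<in>I. c e * (\<Prod>i\<in>UNIV. (x $ i) ^ e i)) \<and>
        P d (\<lambda>x. \<Sum>e\<in>I. c e * (\<Prod>i\<in>UNIV. (x $ i) ^ e i))"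
    if "finite I" "I \<subseteq> {e. sum e UNIV = d}" for I
    using that
  proof (induction I)
    case empty show ?case by (simp add: zero is_form_zero S)
  next
    case (insert e I)
    hence e: "sum e UNIV = d" and I: "I \<subseteq> {e. sum e UNIV = d}" by auto
    show ?case
      using insert.IH[OF I] insert.hyps is_form_monomial[OF S c(1) e] mon[OF c(1) e]
      by (auto intro!: add is_form_add S)
  qed
  from this[OF finite_exponents order_refl] show ?thesis by (simp add: c(2))
qed

lemma is_form_0D:
  fixes f :: "'a::field^'n \<Rightarrow> 'a"
  assumes "coeff_ring S" "is_form S 0 f"
  shows "\<exists>k\<in>S. f = (\<lambda>_. k)"
proof -
  have "d = 0 \<longrightarrow> (\<exists>k\<in>S. f = (\<lambda>_. k))" if "is_form S d f" for d f
    using assms(1) that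
  proof (induction rule: is_form_induct)
    case (add d f g)
    thus ?case using coeff_ringD(3)[OF assms(1)] by (auto simp: fun_eq_iff)
  qed auto
  thus ?thesis using assms(2) by blast
qed

text \<open>One variable is pulled out of every monomial. This drives the inductions on the degree
  and, applied twice, the separation into even and odd parts.\<close>

lemma is_form_SucD:
  fixes f :: "'a::field^'n \<Rightarrow> 'a"
  assumes "coeff_ring S" "is_form S (Suc d) f"
  shows "\<exists>g. (\<forall>i. is_form S d (g i)) \<and> f = (\<lambda>x. \<Sum>i\<in>UNIV. x $ i * g i x)"
proof -
  have "\<forall>k. d = Suc k \<longrightarrow> (\<exists>g. (\<forall>i. is_form S k (g i)) \<and> f = (\<lambda>x. \<Sum>i\<in>UNIV. x $ i * g i x))"
    if "is_form S d f" for d f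
    using assms(1) that
  proof (induction rule: is_form_induct)
    case (const k) thus ?case by simp
  next
    case (add d f g)
    show ?case
    proof (intro allI impI)
      fix k assume d: "d = Suc k"
      obtain u v where "\<forall>i. is_form S k (u i)" "f = (\<lambda>x. \<Sum>i\<in>UNIV. x $ i * u i x)"
        "\<forall>i. is_form S k (v i)" "g = (\<lambda>x. \<Sum>i\<in>UNIV. x $ i * v i x)"
        using add(3,4)[rule_format, OF d] by blast
      thus "\<exists>h. (\<forall>i. is_form S k (h i)) \<and> (\<lambda>x. f x + g x) = (\<lambda>x. \<Sum>i\<in>UNIV. x $ i * h i x)"
        by (intro exI[of _ "\<lambda>i x. u i x + v i x"])
           (simp add: distrib_left sum.distrib is_form_add assms(1))
    qed
  next
    case (mult d f i)
    show ?case
    proof (intro allI impI)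
      fix k assume "Suc d = Suc k"
      moreover have "(\<Sum>j\<in>UNIV. x $ j * (if j = i then f else (\<lambda>_. 0)) x) = x $ i * f x" for x
      proof -
        have "(\<Sum>j\<in>UNIV. x $ j * (if j = i then f else (\<lambda>_. 0)) x) = (\<Sum>j\<in>UNIV. if j = i then x $ j * f x else 0)"
          by (rule sum.cong) auto
        thus ?thesis by simp
      qed
      ultimately show "\<exists>h. (\<forall>i. is_form S k (h i)) \<and> (\<lambda>x. x $ i * f x) = (\<lambda>x. \<Sum>i\<in>UNIV. x $ i * h i x)"
        using mult(1) by (intro exI[of _ "\<lambda>j. if j = i then f else (\<lambda>_. 0)"]) (simp add: is_form_zero assms(1))
    qed
  qed
  thus ?thesis using assms(2) by blast
qed

lemma is_form_comp:
  assumes S: "coeff_ring S" and f: "is_form S d f" and r: "forms_over S k r"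
  shows "is_form S (d * k) (\<lambda>x. f (r x))"
  using S f
proof (induction rule: is_form_induct)
  case (const k) show ?case using const by (simp add: is_form_const S)
next
  case (add d f g) thus ?case by (simp add: is_form_add S)
next
  case (mult d f i)
  have "is_form S (k + d * k) (\<lambda>x. r x $ i * f (r x))"
    using r mult by (intro is_form_mult S) (auto simp: forms_over_def)
  thus ?case by simp
qed

lemma is_form_comp_linear: "coeff_ring S \<Longrightarrow> is_form S d f \<Longrightarrow> forms_over S 1 r \<Longrightarrow> is_form S d (\<lambda>x. f (r x))"
  using is_form_comp[of S d f 1 r] by simp

lemma forms_over_comp:
  "coeff_ring S \<Longrightarrow> forms_over S d f \<Longrightarrow> forms_over S k r \<Longrightarrow> forms_over S (d * k) (\<lambda>x. f (r x))"
  by (auto simp: forms_over_def intro: is_form_comp)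

lemma forms_over_UNIV: "forms_over S d r \<Longrightarrow> forms_over UNIV d r"
  by (auto simp: forms_over_def intro: is_form_UNIV)

lemma is_form_homogeneous:
  assumes "is_form S d f"
  shows "f (c *s x) = c ^ d * f x"
  using coeff_ring_UNIV is_form_UNIV[OF assms]
  by (induction rule: is_form_induct) (auto simp: algebra_simps)

lemma is_form_at_0: "is_form S d f \<Longrightarrow> d > 0 \<Longrightarrow> f 0 = 0"
  using is_form_homogeneous[of S d f 0 0] by (simp add: zero_power)

text \<open>Restriction to a line turns questions about forms into questions about univariate
  polynomials, where finiteness of roots is at hand.\<close>

lemma is_form_on_line:
  assumes "is_form S d f"
  shows "\<exists>p. \<forall>t. poly p t = f (x + t *s y)"
  using coeff_ring_UNIV is_form_UNIV[OF assms]
proof (induction rule: is_form_induct)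
  case (const k) show ?case by (intro exI[of _ "[:k:]"]) simp
next
  case (add d f g)
  then obtain p q where "\<forall>t. poly p t = f (x + t *s y)" "\<forall>t. poly q t = g (x + t *s y)" by blast
  thus ?case by (intro exI[of _ "p + q"]) simp
next
  case (mult d f i)
  then obtain p where "\<forall>t. poly p t = f (x + t *s y)" by blast
  thus ?case by (intro exI[of _ "[:x $ i, y $ i:] * p"]) (simp add: algebra_simps)
qed

lemma is_form_value_in:
  assumes "coeff_ring S" "is_form S d f" "\<And>i. x $ i \<in> S"
  shows "f x \<in> S"
  using assms(1,2) by (induction rule: is_form_induct) (simp_all add: assms(3) coeff_ringD(3,4)[OF assms(1)])

text \<open>Natural numbers lie in every coefficient ring and are infinitely many in characteristic
  0, so a form is determined by its values at points with coordinates in the ring. The induction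
  frees one coordinate at a time from the restriction to naturals.\<close>

lemma form_eq_0_if_nat_points:
  fixes f :: "'a::field_char_0^'n \<Rightarrow> 'a"
  assumes f: "is_form S d f" and z: "\<And>x. (\<And>i. x $ i \<in> range of_nat) \<Longrightarrow> f x = 0"
  shows "f x = 0"
proof -
  have "finite J \<Longrightarrow> \<forall>x. (\<forall>i. i \<notin> J \<longrightarrow> x $ i \<in> range of_nat) \<longrightarrow> f x = 0" for J
  proof (induction J rule: finite_induct)
    case empty thus ?case using z by auto
  next
    case (insert j J)
    show ?case
    proof (intro allI impI)
      fix x :: "'a^'n" assume x: "\<forall>i. i \<notin> insert j J \<longrightarrow> x $ i \<in> range of_nat"
      \<comment> \<open>The line through \<open>x0\<close> in direction \<open>j\<close> passes
        through \<open>x\<close>, and at natural parameters it meets only points covered by the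
        induction hypothesis.\<close>
      define x0 where "x0 = x - (x $ j) *s axis j 1"
      obtain p where p: "\<forall>t. poly p t = f (x0 + t *s axis j 1)"
        using is_form_on_line[OF f] by metis
      have "poly p t = 0" if "t \<in> range of_nat" for t
        unfolding p[rule_format]
        by (rule insert.IH[rule_format]) (use x that in \<open>auto simp: x0_def axis_def\<close>)
      moreover have "infinite (range of_nat :: 'a set)"
        using range_inj_infinite[of "of_nat :: nat \<Rightarrow> 'a"] by (simp add: inj_of_nat)
      ultimately have "p = 0"
        by (metis (mono_tags, lifting) mem_Collect_eq poly_roots_finite rev_finite_subset subsetI)
      hence "f (x0 + (x $ j) *s axis j 1) = 0" using p by (metis poly_0)
      thus "f x = 0" by (simp add: x0_def)
    qed
  qed
  from this[of UNIV] show ?thesis by simp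
qed

section \<open>Linear forms and linear maps\<close>

lemma linear_form_expand:
  fixes f :: "'a::field^'n \<Rightarrow> 'a"
  assumes S: "coeff_ring S" and f: "is_form S 1 f"
  shows "\<exists>a. (\<forall>i. a i \<in> S) \<and> f = (\<lambda>x. \<Sum>i\<in>UNIV. a i * x $ i)"
proof -
  obtain g where g: "\<And>i. is_form S 0 (g i)" "f = (\<lambda>x. \<Sum>i\<in>UNIV. x $ i * g i x)"
    using is_form_SucD[OF S, of 0 f] f by auto
  have "\<forall>i. \<exists>a\<in>S. g i = (\<lambda>_. a)" using is_form_0D[OF S g(1)] by blast
  then obtain a where "\<And>i. a i \<in> S" "\<And>i. g i = (\<lambda>_. a i)" by metis
  thus ?thesis using g(2) by (intro exI[of _ a]) (auto simp: mult.commute)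
qed

lemma linear_form_add: "is_form S 1 f \<Longrightarrow> f (x + y) = f x + f y"
  using linear_form_expand[OF coeff_ring_UNIV is_form_UNIV, of S f]
  by (auto simp: distrib_left sum.distrib)

lemma linear_form_scale: "is_form S 1 f \<Longrightarrow> f (c *s x) = c * f x"
  using is_form_homogeneous[of S 1 f] by simp

lemma linear_form_diff: "is_form S 1 f \<Longrightarrow> f (x - y) = f x - f y"
  using linear_form_add[of S f "x - y" y] by simp

lemma linear_form_zero: "is_form S 1 f \<Longrightarrow> f 0 = 0"
  by (rule is_form_at_0) auto

lemma linear_formI:
  fixes f :: "'a::field^'n \<Rightarrow> 'a"
  assumes S: "coeff_ring S" and add: "\<And>x y. f (x + y) = f x + f y" and sc: "\<And>c x. f (c *s x) = c * f x"
    and v: "\<And>i. f (axis i 1) \<in> S"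
  shows "is_form S 1 f"
proof -
  have s: "f (\<Sum>i\<in>I. h i) = (\<Sum>i\<in>I. f (h i))" if "finite I" for h :: "'n \<Rightarrow> 'a^'n" and I
    using that
  proof (induction I)
    case empty show ?case using sc[of 0 0] by simp
  qed (simp add: add)
  have "f x = (\<Sum>i\<in>UNIV. f (axis i 1) * x $ i)" for x
  proof -
    have "f x = f (\<Sum>i\<in>UNIV. x $ i *s axis i 1)" by (simp add: basis_expansion)
    also have "\<dots> = (\<Sum>i\<in>UNIV. f (axis i 1) * x $ i)" by (simp add: s sc mult.commute)
    finally show ?thesis .
  qed
  hence "f = (\<lambda>x. \<Sum>i\<in>UNIV. f (axis i 1) * x $ i)" by blast
  moreover have "is_form S 1 (\<lambda>x. \<Sum>i\<in>UNIV. f (axis i 1) * x $ i)"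
    by (intro is_form_sum is_form_smult S is_form_component v)
  ultimately show ?thesis by simp
qed

lemma forms1_add: "forms_over S 1 m \<Longrightarrow> m (x + y) = m x + m y"
  using linear_form_add[of S "\<lambda>x. m x $ i" x y for i] by (simp add: forms_over_def vec_eq_iff)

lemma forms1_scale: "forms_over S 1 m \<Longrightarrow> m (c *s x) = c *s m x"
  using linear_form_scale[of S "\<lambda>x. m x $ i" c x for i] by (simp add: forms_over_def vec_eq_iff)

lemma forms1_diff: "forms_over S 1 m \<Longrightarrow> m (x - y) = m x - m y"
  using forms1_add[of S m "x - y" y] by simp

lemma forms1_zero: "forms_over S 1 m \<Longrightarrow> m 0 = 0"
  using forms1_scale[of S m 0 0] by simp

lemma forms_over1I:
  fixes m :: "'a::field^'k \<Rightarrow> 'a^'n"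
  assumes "\<And>x y. m (x + y) = m x + m y" "\<And>c x. m (c *s x) = c *s m x"
  shows "forms_over UNIV 1 m"
  unfolding forms_over_def by (intro allI linear_formI) (simp_all add: assms)

lemma forms_over_matrix:
  assumes "coeff_ring S" "\<And>i j. M $ i $ j \<in> S"
  shows "forms_over S 1 (\<lambda>x. M *v x)"
  unfolding forms_over_def matrix_vector_mult_def
  by (simp del: One_nat_def) (intro allI is_form_sum is_form_smult is_form_component assms)

lemma matrix_of_forms1:
  fixes m :: "'a::field^'k \<Rightarrow> 'a^'n"
  assumes S: "coeff_ring S" and m: "forms_over S 1 m"
  shows "\<exists>M. (\<forall>i j. M $ i $ j \<in> S) \<and> m = (\<lambda>x. M *v x)"
proof -
  have "\<forall>i. \<exists>a. (\<forall>j. a j \<in> S) \<and> (\<lambda>x. m x $ i) = (\<lambda>x. \<Sum>j\<in>UNIV. a j * x $ j)"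
    using linear_form_expand[OF S] m unfolding forms_over_def by blast
  then obtain a where a: "\<And>i j. a i j \<in> S" "\<And>i. (\<lambda>x. m x $ i) = (\<lambda>x. \<Sum>j\<in>UNIV. a i j * x $ j)" by metis
  show ?thesis
    using a(1) fun_cong[OF a(2)]
    by (intro exI[of _ "\<chi> i j. a i j"]) (auto simp: fun_eq_iff vec_eq_iff matrix_vector_mult_def)
qed

section \<open>Polarisation of quadratic forms\<close>

definition polar :: "('a::field^'n \<Rightarrow> 'a) \<Rightarrow> 'a^'n \<Rightarrow> 'a^'n \<Rightarrow> 'a" where
  "polar f x y = f (x + y) - f x - f y"

lemma polar_sym: "polar f x y = polar f y x"
  by (simp add: polar_def add.commute)

lemma polar_form:
  assumes "is_form S 2 f"
  shows "is_form UNIV 1 (polar f x)"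
proof -
  obtain g where g: "\<And>i. is_form UNIV 1 (g i)" "f = (\<lambda>x. \<Sum>i\<in>UNIV. x $ i * g i x)"
    using is_form_SucD[OF coeff_ring_UNIV, of 1 f] is_form_UNIV[OF assms] by (auto simp: numeral_2_eq_2)
  have eq: "polar f x = (\<lambda>y. \<Sum>i\<in>UNIV. x $ i * g i y + g i x * y $ i)"
    unfolding polar_def g(2) by (simp add: linear_form_add[OF g(1)] fun_eq_iff sum_subtractf sum.distrib algebra_simps)
  show ?thesis
    unfolding eq by (intro is_form_sum is_form_add is_form_smult is_form_component g(1)) auto
qed

lemma polar_simps:
  assumes "is_form S 2 f"
  shows "polar f x (y + z) = polar f x y + polar f x z" "polar f (y + z) x = polar f y x + polar f z x"
    "polar f x (c *s y) = c * polar f x y" "polar f (c *s y) x = c * polar f y x"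
    "polar f x 0 = 0" "polar f 0 x = 0"
  using linear_form_add[OF polar_form[OF assms, of x], of y z]
    linear_form_scale[OF polar_form[OF assms, of x], of c y]
    linear_form_zero[OF polar_form[OF assms, of x]]
  by (simp_all add: polar_sym[of f _ x])

lemma quadratic_form_comb:
  assumes "is_form S 2 f"
  shows "f (s *s x + t *s y) = s^2 * f x + s * t * polar f x y + t^2 * f y"
proof -
  have "f (s *s x + t *s y) = f (s *s x) + f (t *s y) + polar f (s *s x) (t *s y)" by (simp add: polar_def)
  thus ?thesis by (simp add: is_form_homogeneous[OF assms] polar_simps[OF assms] algebra_simps)
qed

lemma quadratic_form_add:
  assumes "is_form S 2 f"
  shows "f (x + t *s y) = f x + t * polar f x y + t^2 * f y"
  using quadratic_form_comb[OF assms, of 1 x t y] by simp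

lemma polar_lincomb: "polar (\<lambda>x. s * f x + t * g x) x y = s * polar f x y + t * polar g x y"
  by (simp add: polar_def algebra_simps)

text \<open>The polar form is the gradient paired with a direction. Unlike partial derivatives it is
  free of coordinates, so singularity can be tested after any linear substitution.\<close>

lemma partial_quadratic:
  fixes f :: "'a::field_char_0^'n \<Rightarrow> 'a"
  assumes "is_form S 2 f"
  shows "partial i f x = polar f x (axis i 1)"
proof -
  let ?p = "[:f x, polar f x (axis i 1), f (axis i 1):]"
  have p: "\<forall>t. poly ?p t = f (x + t *s axis i 1)"
    by (simp add: quadratic_form_add[OF assms] algebra_simps power2_eq_square)
  have "(THE p. \<forall>t. poly p t = f (x + t *s axis i 1)) = ?p"
  proof (rule the_equality)
    show "\<forall>t. poly ?p t = f (x + t *s axis i 1)" by (rule p)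
  next
    fix q assume "\<forall>t. poly q t = f (x + t *s axis i 1)"
    hence "poly q = poly ?p" using p by auto
    thus "q = ?p" by (simp add: poly_eq_poly_eq_iff)
  qed
  thus ?thesis by (simp add: partial_def pderiv_pCons)
qed

lemma linear_form_eq_0:
  assumes "is_form S 1 f" "\<And>i. f (axis i 1) = 0"
  shows "f x = 0"
proof -
  obtain a where a: "f = (\<lambda>x. \<Sum>i\<in>UNIV. a i * x $ i)"
    using linear_form_expand[OF coeff_ring_UNIV is_form_UNIV[OF assms(1)]] by blast
  have "a i = 0" for i
  proof -
    have "(\<Sum>j\<in>UNIV. a j * (axis i 1 :: 'a^'b) $ j) = (\<Sum>j\<in>UNIV. if j = i then a j else 0)"
      by (rule sum.cong) (auto simp: axis_def)
    thus ?thesis using assms(2)[of i] by (simp add: a)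
  qed
  thus ?thesis by (simp add: a)
qed

text \<open>A linear dependence of the two gradients at \<open>x\<close> says that \<open>x\<close>
  lies in the radical of the corresponding member of the pencil. The Jacobian criterion becomes: no
  point of the intersection is a singular point of a member.\<close>

lemma nonsingular_polar:
  fixes A B :: "'a::field_char_0^4 \<Rightarrow> 'a"
  assumes "is_form S 2 A" "is_form S 2 B"
  shows "nonsingular_quadric_intersection S A B \<longleftrightarrow>
    (\<forall>x s t. x \<noteq> 0 \<longrightarrow> A x = 0 \<longrightarrow> B x = 0 \<longrightarrow>
       (\<forall>y. polar (\<lambda>x. s * A x + t * B x) x y = 0) \<longrightarrow> s = 0 \<and> t = 0)"
proof -
  have W: "is_form UNIV 2 (\<lambda>x. s * A x + t * B x)" for s t
    by (intro is_form_add is_form_smult is_form_UNIV[OF assms(1)] is_form_UNIV[OF assms(2)]) auto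
  have "(\<forall>i. s * partial i A x + t * partial i B x = 0) \<longleftrightarrow>
      (\<forall>y. polar (\<lambda>x. s * A x + t * B x) x y = 0)" for s t x
    using linear_form_eq_0[OF polar_form[OF W[of s t], of x]]
    by (auto simp: partial_quadratic[OF assms(1)] partial_quadratic[OF assms(2)] polar_lincomb)
  thus ?thesis unfolding nonsingular_quadric_intersection_def using assms by auto
qed

text \<open>In use \<open>mu p = 1\<close>; then the forms \<open>x $ i - p $ i * mu x\<close>
  vanish at \<open>p\<close> and play the role of generators of its ideal. The clause for
  \<open>d = 0\<close> guards against the truncated degree \<open>d - 1\<close> in the
  induction.\<close>

lemma form_decompose_at:
  fixes f :: "'a::field^'n \<Rightarrow> 'a"
  assumes f: "is_form UNIV d f" and mu: "is_form UNIV 1 mu"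
  shows "\<exists>g. (\<forall>i. is_form UNIV (d - 1) (g i)) \<and> (d = 0 \<longrightarrow> g = (\<lambda>_ _. 0)) \<and>
    (\<forall>x. f x = f p * mu x ^ d + (\<Sum>i\<in>UNIV. (x $ i - p $ i * mu x) * g i x))"
  using coeff_ring_UNIV f
proof (induction rule: is_form_induct)
  case (const k) show ?case by (intro exI[of _ "\<lambda>_ _. 0"]) (auto intro: is_form_zero)
next
  case (add d f g)
  from add(3) obtain u where u: "\<forall>i. is_form UNIV (d - 1) (u i)" "d = 0 \<longrightarrow> u = (\<lambda>_ _. 0)"
    "\<forall>x. f x = f p * mu x ^ d + (\<Sum>i\<in>UNIV. (x $ i - p $ i * mu x) * u i x)" by (elim exE conjE) (rule that)
  from add(4) obtain v where v: "\<forall>i. is_form UNIV (d - 1) (v i)" "d = 0 \<longrightarrow> v = (\<lambda>_ _. 0)"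
    "\<forall>x. g x = g p * mu x ^ d + (\<Sum>i\<in>UNIV. (x $ i - p $ i * mu x) * v i x)" by (elim exE conjE) (rule that)
  show ?case
  proof (intro exI[of _ "\<lambda>i x. u i x + v i x"] conjI allI impI)
    fix x
    have "(\<Sum>i\<in>UNIV. (x $ i - p $ i * mu x) * (u i x + v i x)) =
      (\<Sum>i\<in>UNIV. (x $ i - p $ i * mu x) * u i x) + (\<Sum>i\<in>UNIV. (x $ i - p $ i * mu x) * v i x)"
      by (simp only: distrib_left sum.distrib)
    thus "f x + g x = (f p + g p) * mu x ^ d + (\<Sum>i\<in>UNIV. (x $ i - p $ i * mu x) * (u i x + v i x))"
      using u(3)[rule_format, of x] v(3)[rule_format, of x] by (simp only: distrib_right add_ac)
  qed (use u(1,2) v(1,2) in \<open>auto intro: is_form_add\<close>)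
next
  case (mult d f k)
  from mult(2) obtain u where u: "\<forall>i. is_form UNIV (d - 1) (u i)" "d = 0 \<longrightarrow> u = (\<lambda>_ _. 0)"
    "\<forall>x. f x = f p * mu x ^ d + (\<Sum>i\<in>UNIV. (x $ i - p $ i * mu x) * u i x)" by (elim exE conjE) (rule that)
  \<comment> \<open>The extra summand at \<open>i = k\<close> is the cost of replacing
    \<open>x $ k\<close> by \<open>p $ k * mu x\<close> in the leading term.\<close>
  define v where "v = (\<lambda>i x. x $ k * u i x + (if i = k then f p * mu x ^ d else 0))"
  have "is_form UNIV d (\<lambda>x. x $ k * u i x)" for i
  proof (cases d)
    case 0 thus ?thesis using u(2) by (simp add: is_form_zero)
  next
    case (Suc n)
    have "is_form UNIV (1 + n) (\<lambda>x. x $ k * u i x)"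
      using u(1) Suc by (intro is_form_mult is_form_component) auto
    thus ?thesis using Suc by simp
  qed
  moreover have "is_form UNIV d (\<lambda>x. if i = k then f p * mu x ^ d else 0)" for i
    using is_form_power[OF coeff_ring_UNIV mu, of d] by (cases "i = k") (simp_all add: is_form_zero is_form_smult)
  ultimately have vF: "is_form UNIV d (v i)" for i
    unfolding v_def by (intro is_form_add) auto
  have veq: "x $ k * f x = p $ k * f p * mu x ^ Suc d + (\<Sum>i\<in>UNIV. (x $ i - p $ i * mu x) * v i x)" for x
  proof -
    have "(\<Sum>i\<in>UNIV. (x $ i - p $ i * mu x) * v i x) =
      x $ k * (\<Sum>i\<in>UNIV. (x $ i - p $ i * mu x) * u i x) + (\<Sum>i\<in>UNIV. if i = k then (x $ i - p $ i * mu x) * (f p * mu x ^ d) else 0)"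
      unfolding v_def sum_distrib_left sum.distrib[symmetric] by (rule sum.cong) (auto simp: algebra_simps)
    also have "\<dots> = x $ k * (f x - f p * mu x ^ d) + (x $ k - p $ k * mu x) * (f p * mu x ^ d)"
    proof -
      have "(\<Sum>i\<in>UNIV. (x $ i - p $ i * mu x) * u i x) = f x - f p * mu x ^ d"
        using u(3)[rule_format, of x] by (simp only: add_diff_cancel_left')
      thus ?thesis by simp
    qed
    finally show ?thesis by (simp add: algebra_simps)
  qed
  show ?case by (intro exI[of _ v] conjI allI impI) (rule veq | simp add: vF)+
qed

section \<open>Function fields of irreducible projective sets\<close>

text \<open>Vanishing is tested on the affine cone, the union of all points of \<open>V\<close>;
  identities in the function field then become pointwise identities of vectors.\<close>

definition zero_on :: "('a::field^'n) set set \<Rightarrow> ('a^'n \<Rightarrow> 'a) \<Rightarrow> bool" where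
  "zero_on V f \<longleftrightarrow> (\<forall>x\<in>\<Union>V. f x = 0)"

lemma ball_vanishes_at: "(\<forall>P\<in>V. vanishes_at f P) \<longleftrightarrow> zero_on V f"
  by (auto simp: vanishes_at_def zero_on_def)

lemma hpoint_self [simp]: "x \<in> hpoint x"
  unfolding hpoint_def by (rule CollectI, rule exI[of _ 1]) simp

lemma mem_hpoint_iff: "y \<in> hpoint x \<longleftrightarrow> (\<exists>c. c \<noteq> 0 \<and> y = c *s x)"
  unfolding hpoint_def by auto

lemma hpoint_eqI:
  fixes x :: "'a::field^'n"
  assumes c: "c \<noteq> 0" shows "hpoint (c *s x) = hpoint x"
proof -
  have "k *s x = (k / c) *s (c *s x)" for k using c by simp
  hence "y \<in> hpoint (c *s x) \<longleftrightarrow> y \<in> hpoint x" for y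
    unfolding mem_hpoint_iff using c
    by (metis (no_types, opaque_lifting) divide_eq_0_iff mult_eq_0_iff vector_smult_assoc)
  thus ?thesis by blast
qed

lemma hpoint_eq_iff: "hpoint y = hpoint (x :: 'a::field^'n) \<longleftrightarrow> (\<exists>c. c \<noteq> 0 \<and> y = c *s x)"
proof
  assume "hpoint y = hpoint x"
  hence "y \<in> hpoint x" by (metis hpoint_self)
  thus "\<exists>c. c \<noteq> 0 \<and> y = c *s x" by (auto simp: hpoint_def)
qed (auto simp: hpoint_eqI)

lemma mem_hpointD: "y \<in> hpoint x \<Longrightarrow> hpoint y = hpoint x"
  using mem_hpoint_iff hpoint_eqI by metis

lemma vanishes_at_hpoint:
  assumes "is_form S d f" shows "vanishes_at f (hpoint x) \<longleftrightarrow> f x = 0"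
proof
  assume "f x = 0"
  thus "vanishes_at f (hpoint x)"
    by (auto simp: vanishes_at_def mem_hpoint_iff is_form_homogeneous[OF assms])
qed (simp add: vanishes_at_def)

text \<open>Irreducibility is the primality of the homogeneous vanishing ideal, tested on forms
  alone. It makes equality of fractions transitive and keeps denominators nonzero under
  products.\<close>

locale irreducible_set =
  fixes V :: "('a::field_char_0^'n) set set"
  assumes points: "V \<subseteq> {hpoint x |x. x \<noteq> 0}"
    and nonempty: "V \<noteq> {}"
    and prime: "is_form UNIV d f \<Longrightarrow> is_form UNIV e g \<Longrightarrow> zero_on V (\<lambda>x. f x * g x) \<Longrightarrow>
      zero_on V f \<or> zero_on V g"
begin

lemma point_hpoint: "P \<in> V \<Longrightarrow> x \<in> P \<Longrightarrow> P = hpoint x"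
  using points mem_hpointD by fastforce

lemma hpoint_mem: "x \<in> \<Union>V \<Longrightarrow> hpoint x \<in> V"
  using point_hpoint by auto

lemma point_nonzero: "x \<in> \<Union>V \<Longrightarrow> x \<noteq> 0"
  using points by (auto simp: hpoint_def)

lemma point_exists: "\<exists>x. x \<in> \<Union>V"
proof -
  obtain P where P: "P \<in> V" using nonempty by blast
  then obtain x where "P = hpoint x" using points by blast
  thus ?thesis using P hpoint_self by blast
qed

lemma zero_on_mult_iff:
  "is_form UNIV d f \<Longrightarrow> is_form UNIV e g \<Longrightarrow> zero_on V (\<lambda>x. f x * g x) \<longleftrightarrow> zero_on V f \<or> zero_on V g"
  using prime[of d f e g] by (auto simp: zero_on_def)

lemma zero_on_power:
  assumes "is_form UNIV d f" "\<not> zero_on V f" shows "\<not> zero_on V (\<lambda>x. f x ^ n)"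
proof (induction n)
  case 0 thus ?case using point_exists by (auto simp: zero_on_def)
next
  case (Suc n)
  thus ?case using zero_on_mult_iff[OF assms(1) is_form_power[OF _ assms(1)], of n] assms(2) by simp
qed

lemma cancel_on:
  assumes "is_form UNIV d h" "\<not> zero_on V h" "is_form UNIV e f" "is_form UNIV e g"
    "\<And>x. x \<in> \<Union>V \<Longrightarrow> h x * f x = h x * g x" "x \<in> \<Union>V"
  shows "f x = g x"
proof -
  have "zero_on V (\<lambda>x. h x * (f x - g x))"
    unfolding zero_on_def using assms(5) by (simp add: right_diff_distrib)
  hence "zero_on V (\<lambda>x. f x - g x)"
    using prime[OF assms(1) is_form_diff[OF _ assms(3,4)]] assms(2) by simp
  thus ?thesis using assms(6) by (auto simp: zero_on_def)
qed

lemma fracs_iff: "(f, g) \<in> fracs S V \<longleftrightarrow> (\<exists>d. is_form S d f \<and> is_form S d g) \<and> \<not> zero_on V g"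
  unfolding fracs_def using ball_vanishes_at[of V g] by auto

lemma frac_rel_iff: "((f, g), (f', g')) \<in> frac_rel S V \<longleftrightarrow>
   (f, g) \<in> fracs S V \<and> (f', g') \<in> fracs S V \<and> (\<forall>x\<in>\<Union>V. f x * g' x = f' x * g x)"
  unfolding frac_rel_def using ball_vanishes_at[of V "\<lambda>x. f x * g' x - f' x * g x"]
  by (auto simp: zero_on_def)

lemma equiv_frac_rel: "equiv (fracs S V) (frac_rel S V)"
proof (rule equivI)
  show "frac_rel S V \<subseteq> fracs S V \<times> fracs S V" by (auto simp: frac_rel_iff)
  show "refl_on (fracs S V) (frac_rel S V)"
    by (rule refl_onI) (auto simp: frac_rel_iff)
  show "sym (frac_rel S V)" by (rule symI) (auto simp: frac_rel_iff)
  show "trans (frac_rel S V)"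
  proof (rule transI)
    fix p p' p'' assume pp: "(p, p') \<in> frac_rel S V" "(p', p'') \<in> frac_rel S V"
    obtain f g f' g' f'' g'' where p: "p = (f, g)" "p' = (f', g')" "p'' = (f'', g'')" by (meson prod.exhaust)
    have a: "(f, g) \<in> fracs S V" "(f', g') \<in> fracs S V" "(f'', g'') \<in> fracs S V"
      "\<forall>x\<in>\<Union>V. f x * g' x = f' x * g x" "\<forall>x\<in>\<Union>V. f' x * g'' x = f'' x * g' x"
      using pp unfolding p frac_rel_iff by blast+
    obtain d d' d'' where d: "is_form UNIV d f" "is_form UNIV d g" "is_form UNIV d' g'"
      "is_form UNIV d'' f''" "is_form UNIV d'' g''"
      using a(1-3) unfolding fracs_iff by (meson is_form_UNIV)
    \<comment> \<open>Transitivity first holds only after multiplication by the middle denominator,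
      which primality allows to cancel.\<close>
    have "g' y * (f y * g'' y) = g' y * (f'' y * g y)" if "y \<in> \<Union>V" for y
    proof -
      have "g' y * (f y * g'' y) = (f y * g' y) * g'' y" by (simp only: mult_ac)
      also have "\<dots> = (f' y * g'' y) * g y" using a(4)[rule_format, OF that] by (simp only: mult_ac)
      also have "\<dots> = g' y * (f'' y * g y)" using a(5)[rule_format, OF that] by (simp only: mult_ac)
      finally show ?thesis .
    qed
    moreover have "is_form UNIV (d + d'') (\<lambda>x. f'' x * g x)"
      using is_form_mult[OF _ d(4) d(2)] by (simp add: add.commute)
    ultimately have "f x * g'' x = f'' x * g x" if "x \<in> \<Union>V" for x
      using cancel_on[OF d(3) _ is_form_mult[OF _ d(1) d(5)] _ _ that] a(2) by (simp add: fracs_iff)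
    thus "(p, p'') \<in> frac_rel S V" using a unfolding p frac_rel_iff by blast
  qed
qed

lemma ratio_eq_iff:
  assumes "(f, g) \<in> fracs S V" "(f', g') \<in> fracs S V"
  shows "ratio S V f g = ratio S V f' g' \<longleftrightarrow> (\<forall>x\<in>\<Union>V. f x * g' x = f' x * g x)"
  unfolding ratio_def using eq_equiv_class_iff[OF equiv_frac_rel assms] assms by (simp add: frac_rel_iff)

lemma mem_ratio:
  assumes "(f, g) \<in> fracs S V"
  shows "(f', g') \<in> ratio S V f g \<longleftrightarrow> (f', g') \<in> fracs S V \<and> ratio S V f' g' = ratio S V f g"
proof -
  have "(f', g') \<in> ratio S V f g \<longleftrightarrow> ((f, g), (f', g')) \<in> frac_rel S V" by (simp add: ratio_def)
  thus ?thesis using assms ratio_eq_iff[OF _ assms, of f' g'] by (auto simp: frac_rel_iff)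
qed

abbreviation FF where "FF S \<equiv> function_field S V"

lemma carrier_FF: "carrier (FF S) = {ratio S V f g |f g. (f, g) \<in> fracs S V}"
  unfolding function_field_def quotient_def ratio_def by auto

text \<open>Sums, products and pullbacks in the function field are unions over all representatives;
  once every representative gives the same class, the union collapses to it.\<close>

lemma UN_const_on: "A \<noteq> {} \<Longrightarrow> (\<And>p. p \<in> A \<Longrightarrow> h p = c) \<Longrightarrow> (\<Union>p\<in>A. h p) = c"
  by auto

lemma ratio_nonempty: "(f, g) \<in> fracs S V \<Longrightarrow> ratio S V f g \<noteq> {}"
  using mem_ratio by blast

lemma fracs_mult:
  assumes "coeff_ring S" "(f, g) \<in> fracs S V" "(f', g') \<in> fracs S V"
  shows "(\<lambda>x. f x * f' x, \<lambda>x. g x * g' x) \<in> fracs S V"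
proof -
  obtain d d' where d: "is_form S d f" "is_form S d g" "is_form S d' f'" "is_form S d' g'"
    using assms(2,3) by (auto simp: fracs_iff)
  show ?thesis using assms d is_form_mult[OF assms(1)] zero_on_mult_iff[OF is_form_UNIV[OF d(2)] is_form_UNIV[OF d(4)]]
    unfolding fracs_iff by blast
qed

lemma fracs_add:
  assumes "coeff_ring S" "(f, g) \<in> fracs S V" "(f', g') \<in> fracs S V"
  shows "(\<lambda>x. f x * g' x + f' x * g x, \<lambda>x. g x * g' x) \<in> fracs S V"
proof -
  obtain d d' where d: "is_form S d f" "is_form S d g" "is_form S d' f'" "is_form S d' g'"
    using assms(2,3) by (auto simp: fracs_iff)
  have "is_form S (d + d') (\<lambda>x. f x * g' x + f' x * g x)"
    using is_form_mult[OF assms(1) d(1,4)] is_form_mult[OF assms(1) d(3,2)]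
    by (auto simp: add.commute intro: is_form_add assms(1))
  thus ?thesis using assms d is_form_mult[OF assms(1) d(2,4)]
      zero_on_mult_iff[OF is_form_UNIV[OF d(2)] is_form_UNIV[OF d(4)]]
    unfolding fracs_iff by blast
qed

lemma mult_ratio:
  assumes S: "coeff_ring S" and fg: "(f, g) \<in> fracs S V" "(f', g') \<in> fracs S V"
  shows "ratio S V f g \<otimes>\<^bsub>FF S\<^esub> ratio S V f' g' = ratio S V (\<lambda>x. f x * f' x) (\<lambda>x. g x * g' x)"
proof -
  have "ratio S V (\<lambda>x. u x * u' x) (\<lambda>x. v x * v' x) = ratio S V (\<lambda>x. f x * f' x) (\<lambda>x. g x * g' x)"
    if "(u, v) \<in> ratio S V f g" "(u', v') \<in> ratio S V f' g'" for u v u' v'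
  proof -
    have u: "(u, v) \<in> fracs S V" "(u', v') \<in> fracs S V"
      and e: "ratio S V u v = ratio S V f g" "ratio S V u' v' = ratio S V f' g'"
      using that mem_ratio fg by auto
    have "u x * u' x * (g x * g' x) = f x * f' x * (v x * v' x)" if x: "x \<in> \<Union>V" for x
    proof -
      have "u x * g x = f x * v x" "u' x * g' x = f' x * v' x"
        using e[unfolded ratio_eq_iff[OF u(1) fg(1)] ratio_eq_iff[OF u(2) fg(2)]] x by blast+
      hence "(u x * g x) * (u' x * g' x) = (f x * v x) * (f' x * v' x)" by simp
      thus ?thesis by (simp only: mult_ac)
    qed
    thus ?thesis using ratio_eq_iff[OF fracs_mult[OF S u] fracs_mult[OF S fg]] by blast
  qed
  thus ?thesis unfolding function_field_def
    using ratio_nonempty[OF fg(1)] ratio_nonempty[OF fg(2)]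
    by (auto intro!: UN_const_on)
qed

lemma add_ratio:
  assumes S: "coeff_ring S" and fg: "(f, g) \<in> fracs S V" "(f', g') \<in> fracs S V"
  shows "ratio S V f g \<oplus>\<^bsub>FF S\<^esub> ratio S V f' g' = ratio S V (\<lambda>x. f x * g' x + f' x * g x) (\<lambda>x. g x * g' x)"
proof -
  have "ratio S V (\<lambda>x. u x * v' x + u' x * v x) (\<lambda>x. v x * v' x) =
        ratio S V (\<lambda>x. f x * g' x + f' x * g x) (\<lambda>x. g x * g' x)"
    if "(u, v) \<in> ratio S V f g" "(u', v') \<in> ratio S V f' g'" for u v u' v'
  proof -
    have u: "(u, v) \<in> fracs S V" "(u', v') \<in> fracs S V"
      and e: "ratio S V u v = ratio S V f g" "ratio S V u' v' = ratio S V f' g'"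
      using that mem_ratio fg by auto
    have "(u x * v' x + u' x * v x) * (g x * g' x) = (f x * g' x + f' x * g x) * (v x * v' x)"
      if x: "x \<in> \<Union>V" for x
    proof -
      have "u x * g x = f x * v x" "u' x * g' x = f' x * v' x"
        using e[unfolded ratio_eq_iff[OF u(1) fg(1)] ratio_eq_iff[OF u(2) fg(2)]] x by blast+
      hence "(u x * g x) * (v' x * g' x) + (u' x * g' x) * (v x * g x) =
        (f x * v x) * (v' x * g' x) + (f' x * v' x) * (v x * g x)" by simp
      thus ?thesis by (simp only: distrib_left distrib_right mult_ac)
    qed
    thus ?thesis using ratio_eq_iff[OF fracs_add[OF S u] fracs_add[OF S fg]] by blast
  qed
  thus ?thesis unfolding function_field_def
    using ratio_nonempty[OF fg(1)] ratio_nonempty[OF fg(2)]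
    by (auto intro!: UN_const_on)
qed

lemma zero_FF: "\<zero>\<^bsub>FF S\<^esub> = ratio S V (\<lambda>_. 0) (\<lambda>_. 1)"
  and one_FF: "\<one>\<^bsub>FF S\<^esub> = ratio S V (\<lambda>_. 1) (\<lambda>_. 1)"
  by (simp_all add: function_field_def)

lemma not_zero_on_1: "\<not> zero_on V (\<lambda>_. 1)"
  using point_exists by (auto simp: zero_on_def)

lemma fracs_const: "coeff_ring S \<Longrightarrow> k \<in> S \<Longrightarrow> (\<lambda>_. k, \<lambda>_. 1) \<in> fracs S V"
  unfolding fracs_iff using is_form_const[of S] not_zero_on_1 coeff_ringD(2) by blast

lemma ratio_in_FF: "(f, g) \<in> fracs S V \<Longrightarrow> ratio S V f g \<in> carrier (FF S)"
  unfolding carrier_FF by blast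

lemma FF_cases:
  assumes "U \<in> carrier (FF S)"
  obtains f g where "(f, g) \<in> fracs S V" "U = ratio S V f g"
  using assms unfolding carrier_FF by blast

lemma cring_FF:
  assumes S: "coeff_ring S"
  shows "cring (FF S)"
proof -
  note c0 = fracs_const[OF S coeff_ringD(1)[OF S]] and c1 = fracs_const[OF S coeff_ringD(2)[OF S]]
  note ops = mult_ratio[OF S] add_ratio[OF S] fracs_mult[OF S] fracs_add[OF S] ratio_in_FF c0 c1 zero_FF one_FF
  show ?thesis
  proof (rule cringI)
    show "abelian_group (FF S)"
    proof (rule abelian_groupI)
      show "\<zero>\<^bsub>FF S\<^esub> \<in> carrier (FF S)" by (simp only: ops)
    next
      fix u v assume "u \<in> carrier (FF S)" "v \<in> carrier (FF S)"
      then obtain f g f' g' where uv: "u = ratio S V f g" "v = ratio S V f' g'"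
        and fr: "(f, g) \<in> fracs S V" "(f', g') \<in> fracs S V" by (elim FF_cases) (rule that)
      show "u \<oplus>\<^bsub>FF S\<^esub> v \<in> carrier (FF S)" by (simp only: uv fr ops)
      show "u \<oplus>\<^bsub>FF S\<^esub> v = v \<oplus>\<^bsub>FF S\<^esub> u"
        by (simp only: uv fr ops ratio_eq_iff, simp add: algebra_simps)
    next
      fix u v w assume "u \<in> carrier (FF S)" "v \<in> carrier (FF S)" "w \<in> carrier (FF S)"
      then obtain f g f' g' f'' g'' where uv: "u = ratio S V f g" "v = ratio S V f' g'" "w = ratio S V f'' g''"
        and fr: "(f, g) \<in> fracs S V" "(f', g') \<in> fracs S V" "(f'', g'') \<in> fracs S V"
        by (elim FF_cases) (rule that)
      show "u \<oplus>\<^bsub>FF S\<^esub> v \<oplus>\<^bsub>FF S\<^esub> w = u \<oplus>\<^bsub>FF S\<^esub> (v \<oplus>\<^bsub>FF S\<^esub> w)"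
        by (simp only: uv fr ops ratio_eq_iff, simp add: algebra_simps)
    next
      fix u assume "u \<in> carrier (FF S)"
      then obtain f g where u: "u = ratio S V f g" and fr: "(f, g) \<in> fracs S V" by (elim FF_cases) (rule that)
      show "\<zero>\<^bsub>FF S\<^esub> \<oplus>\<^bsub>FF S\<^esub> u = u" by (simp only: u fr ops ratio_eq_iff, simp)
      have n: "(\<lambda>x. - f x, g) \<in> fracs S V" using fr is_form_uminus[OF S] unfolding fracs_iff by blast
      have "ratio S V (\<lambda>x. - f x) g \<oplus>\<^bsub>FF S\<^esub> u = \<zero>\<^bsub>FF S\<^esub>"
        by (simp only: u fr n ops ratio_eq_iff, simp add: algebra_simps)
      thus "\<exists>v\<in>carrier (FF S). v \<oplus>\<^bsub>FF S\<^esub> u = \<zero>\<^bsub>FF S\<^esub>" using ratio_in_FF[OF n] by blast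
    qed
    show "comm_monoid (FF S)"
    proof (rule comm_monoidI)
      show "\<one>\<^bsub>FF S\<^esub> \<in> carrier (FF S)" by (simp only: ops)
    next
      fix u v assume "u \<in> carrier (FF S)" "v \<in> carrier (FF S)"
      then obtain f g f' g' where uv: "u = ratio S V f g" "v = ratio S V f' g'"
        and fr: "(f, g) \<in> fracs S V" "(f', g') \<in> fracs S V" by (elim FF_cases) (rule that)
      show "u \<otimes>\<^bsub>FF S\<^esub> v \<in> carrier (FF S)" by (simp only: uv fr ops)
      show "u \<otimes>\<^bsub>FF S\<^esub> v = v \<otimes>\<^bsub>FF S\<^esub> u"
        by (simp only: uv fr ops ratio_eq_iff, simp add: algebra_simps)
    next
      fix u v w assume "u \<in> carrier (FF S)" "v \<in> carrier (FF S)" "w \<in> carrier (FF S)"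
      then obtain f g f' g' f'' g'' where uv: "u = ratio S V f g" "v = ratio S V f' g'" "w = ratio S V f'' g''"
        and fr: "(f, g) \<in> fracs S V" "(f', g') \<in> fracs S V" "(f'', g'') \<in> fracs S V"
        by (elim FF_cases) (rule that)
      show "u \<otimes>\<^bsub>FF S\<^esub> v \<otimes>\<^bsub>FF S\<^esub> w = u \<otimes>\<^bsub>FF S\<^esub> (v \<otimes>\<^bsub>FF S\<^esub> w)"
        by (simp only: uv fr ops ratio_eq_iff, simp add: algebra_simps)
    next
      fix u assume "u \<in> carrier (FF S)"
      then obtain f g where u: "u = ratio S V f g" and fr: "(f, g) \<in> fracs S V" by (elim FF_cases) (rule that)
      show "\<one>\<^bsub>FF S\<^esub> \<otimes>\<^bsub>FF S\<^esub> u = u" by (simp only: u fr ops ratio_eq_iff, simp)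
    qed
    fix u v w assume "u \<in> carrier (FF S)" "v \<in> carrier (FF S)" "w \<in> carrier (FF S)"
    then obtain f g f' g' f'' g'' where uv: "u = ratio S V f g" "v = ratio S V f' g'" "w = ratio S V f'' g''"
      and fr: "(f, g) \<in> fracs S V" "(f', g') \<in> fracs S V" "(f'', g'') \<in> fracs S V"
      by (elim FF_cases) (rule that)
    show "(u \<oplus>\<^bsub>FF S\<^esub> v) \<otimes>\<^bsub>FF S\<^esub> w = u \<otimes>\<^bsub>FF S\<^esub> w \<oplus>\<^bsub>FF S\<^esub> v \<otimes>\<^bsub>FF S\<^esub> w"
      by (simp only: uv fr ops ratio_eq_iff, simp add: algebra_simps)
  qed
qed

lemma nonzero_functions_ratio:
  assumes "(f, g) \<in> fracs UNIV V"
  shows "ratio UNIV V f g \<in> nonzero_functions V \<longleftrightarrow> \<not> zero_on V f"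
  using assms ratio_eq_iff[OF assms fracs_const[of UNIV 0]]
  by (auto simp: nonzero_functions_def ratio_in_FF zero_FF zero_on_def)

end

text \<open>Surjectivity on the affine cones is what keeps a pulled-back denominator from vanishing
  identically.\<close>

lemma pullback_fun_ratio:
  assumes V: "irreducible_set V" and Y: "irreducible_set Y" and S: "coeff_ring S" and r: "forms_over S k r"
    and surj: "\<Union>Y = r ` \<Union>V" and fg: "(f, g) \<in> fracs S Y"
  shows "(f \<circ> r, g \<circ> r) \<in> fracs S V"
    "pullback_fun S V r (ratio S Y f g) = ratio S V (f \<circ> r) (g \<circ> r)"
proof -
  interpret V: irreducible_set V by (rule V)
  interpret Y: irreducible_set Y by (rule Y)
  have fr: "(u \<circ> r, v \<circ> r) \<in> fracs S V" if "(u, v) \<in> fracs S Y" for u v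
    using that is_form_comp[OF S _ r] surj unfolding V.fracs_iff Y.fracs_iff zero_on_def o_def by auto
  show "(f \<circ> r, g \<circ> r) \<in> fracs S V" by (rule fr[OF fg])
  have "ratio S V (u \<circ> r) (v \<circ> r) = ratio S V (f \<circ> r) (g \<circ> r)" if "(u, v) \<in> ratio S Y f g" for u v
  proof -
    have u: "(u, v) \<in> fracs S Y" "ratio S Y u v = ratio S Y f g" using that Y.mem_ratio[OF fg] by auto
    have "\<forall>x\<in>\<Union>Y. u x * g x = f x * v x" using u(2) Y.ratio_eq_iff[OF u(1) fg] by blast
    thus ?thesis using V.ratio_eq_iff[OF fr[OF u(1)] fr[OF fg]] surj by auto
  qed
  thus "pullback_fun S V r (ratio S Y f g) = ratio S V (f \<circ> r) (g \<circ> r)"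
    unfolding pullback_fun_def using Y.ratio_nonempty[OF fg] by (auto intro!: V.UN_const_on)
qed

section \<open>Smooth curves and their valuations\<close>

text \<open>\<open>divs V x t t0 d m f\<close>: the germ at \<open>x\<close> of the form \<open>f\<close> of degree \<open>d\<close> is divisible by the \<open>m\<close>-th
  power of the germ of \<open>t / t0\<close>.\<close>

definition divs :: "('a::field^'n) set set \<Rightarrow> 'a^'n \<Rightarrow> ('a^'n \<Rightarrow> 'a) \<Rightarrow> ('a^'n \<Rightarrow> 'a) \<Rightarrow>
    nat \<Rightarrow> nat \<Rightarrow> ('a^'n \<Rightarrow> 'a) \<Rightarrow> bool" where
  "divs V x t t0 d m f \<longleftrightarrow> is_form UNIV d f \<and> (\<exists>e h g. is_form UNIV e h \<and> h x \<noteq> 0 \<and> is_form UNIV (d + e) g \<and>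
     (\<forall>y\<in>\<Union>V. f y * h y * t0 y ^ m = t y ^ m * g y))"

lemma divsI:
  assumes "is_form UNIV d f" "is_form UNIV e h" "h x \<noteq> 0" "is_form UNIV (d + e) g"
    "\<And>y. y \<in> \<Union>V \<Longrightarrow> f y * h y * t0 y ^ m = t y ^ m * g y"
  shows "divs V x t t0 d m f"
  unfolding divs_def using assms by blast

lemma divsE:
  assumes "divs V x t t0 d m f"
  obtains e h g where "is_form UNIV d f" "is_form UNIV e h" "h x \<noteq> 0" "is_form UNIV (d + e) g"
    "\<And>y. y \<in> \<Union>V \<Longrightarrow> f y * h y * t0 y ^ m = t y ^ m * g y"
  using assms unfolding divs_def by blast

section \<open>Orders of forms with respect to a candidate uniformiser\<close>

locale curve_germ = irreducible_set V for V :: "('a::field_char_0^'n) set set" +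
  fixes x :: "'a^'n" and t t0 :: "'a^'n \<Rightarrow> 'a"
  assumes x_mem: "x \<in> \<Union>V"
    and t_form: "is_form UNIV 1 t" and t0_form: "is_form UNIV 1 t0"
    and t_x: "t x = 0" and t0_x: "t0 x \<noteq> 0" and t_nz: "\<not> zero_on V t"
begin

abbreviation "dv \<equiv> divs V x t t0"

lemma divs_0: "is_form UNIV d f \<Longrightarrow> dv d 0 f"
  by (rule divsI[where e = 0 and h = "\<lambda>_. 1" and g = f]) (auto intro: is_form_const)

lemma divs_add:
  assumes "dv d m f" "dv d m f'"
  shows "dv d m (\<lambda>y. f y + f' y)"
proof -
  obtain e h g where 1: "is_form UNIV d f" "is_form UNIV e h" "h x \<noteq> 0" "is_form UNIV (d + e) g"
    "\<And>y. y \<in> \<Union>V \<Longrightarrow> f y * h y * t0 y ^ m = t y ^ m * g y" using assms(1) by (rule divsE) (rule that)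
  obtain e' h' g' where 2: "is_form UNIV d f'" "is_form UNIV e' h'" "h' x \<noteq> 0" "is_form UNIV (d + e') g'"
    "\<And>y. y \<in> \<Union>V \<Longrightarrow> f' y * h' y * t0 y ^ m = t y ^ m * g' y" using assms(2) by (rule divsE) (rule that)
  show ?thesis
  proof (rule divsI[where h = "\<lambda>y. h y * h' y" and g = "\<lambda>y. g y * h' y + g' y * h y" and e = "e + e'"])
    show "is_form UNIV (d + (e + e')) (\<lambda>y. g y * h' y + g' y * h y)"
      using is_form_mult[OF _ 1(4) 2(2)] is_form_mult[OF _ 2(4) 1(2)]
      by (auto intro!: is_form_add simp: ac_simps)
    fix y assume y: "y \<in> \<Union>V"
    have "(f y + f' y) * (h y * h' y) * t0 y ^ m =
        (f y * h y * t0 y ^ m) * h' y + (f' y * h' y * t0 y ^ m) * h y" by (simp add: algebra_simps)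
    also have "\<dots> = t y ^ m * (g y * h' y + g' y * h y)"
      by (simp only: 1(5)[OF y] 2(5)[OF y], simp add: algebra_simps)
    finally show "(f y + f' y) * (h y * h' y) * t0 y ^ m = t y ^ m * (g y * h' y + g' y * h y)" .
  qed (use 1 2 in \<open>auto intro: is_form_mult is_form_add\<close>)
qed

lemma divs_mult:
  assumes "dv d m f" "dv d' m' f'"
  shows "dv (d + d') (m + m') (\<lambda>y. f y * f' y)"
proof -
  obtain e h g where 1: "is_form UNIV d f" "is_form UNIV e h" "h x \<noteq> 0" "is_form UNIV (d + e) g"
    "\<And>y. y \<in> \<Union>V \<Longrightarrow> f y * h y * t0 y ^ m = t y ^ m * g y" using assms(1) by (rule divsE) (rule that)
  obtain e' h' g' where 2: "is_form UNIV d' f'" "is_form UNIV e' h'" "h' x \<noteq> 0" "is_form UNIV (d' + e') g'"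
    "\<And>y. y \<in> \<Union>V \<Longrightarrow> f' y * h' y * t0 y ^ m' = t y ^ m' * g' y" using assms(2) by (rule divsE) (rule that)
  show ?thesis
  proof (rule divsI[where h = "\<lambda>y. h y * h' y" and g = "\<lambda>y. g y * g' y" and e = "e + e'"])
    show "is_form UNIV (d + d' + (e + e')) (\<lambda>y. g y * g' y)"
      using is_form_mult[OF _ 1(4) 2(4)] by (simp add: ac_simps)
    fix y assume y: "y \<in> \<Union>V"
    have "f y * f' y * (h y * h' y) * t0 y ^ (m + m') =
        (f y * h y * t0 y ^ m) * (f' y * h' y * t0 y ^ m')" by (simp add: power_add ac_simps)
    also have "\<dots> = t y ^ (m + m') * (g y * g' y)"
      by (simp only: 1(5)[OF y] 2(5)[OF y], simp add: power_add ac_simps)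
    finally show "f y * f' y * (h y * h' y) * t0 y ^ (m + m') = t y ^ (m + m') * (g y * g' y)" .
  qed (use 1 2 in \<open>auto intro: is_form_mult\<close>)
qed

lemma divs_cong:
  assumes "dv d m f" "is_form UNIV d' f'" "is_form UNIV e u" "u x \<noteq> 0" "is_form UNIV e' u'"
    "d + e' = d' + e" "\<And>y. y \<in> \<Union>V \<Longrightarrow> f' y * u y = f y * u' y"
  shows "dv d' m f'"
proof -
  obtain k h g where 1: "is_form UNIV d f" "is_form UNIV k h" "h x \<noteq> 0" "is_form UNIV (d + k) g"
    "\<And>y. y \<in> \<Union>V \<Longrightarrow> f y * h y * t0 y ^ m = t y ^ m * g y" using assms(1) by (rule divsE) (rule that)
  show ?thesis
  proof (rule divsI[where h = "\<lambda>y. h y * u y" and g = "\<lambda>y. g y * u' y" and e = "k + e"])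
    show "is_form UNIV (d' + (k + e)) (\<lambda>y. g y * u' y)"
    proof -
      have "d' + (k + e) = d + k + e'" using assms(6) by linarith
      moreover have "is_form UNIV (d + k + e') (\<lambda>y. g y * u' y)" by (rule is_form_mult[OF _ 1(4) assms(5)]) simp
      ultimately show ?thesis by (simp only:)
    qed
    fix y assume y: "y \<in> \<Union>V"
    have "f' y * (h y * u y) * t0 y ^ m = (f' y * u y) * h y * t0 y ^ m" by (simp only: mult_ac)
    also have "\<dots> = (f y * h y * t0 y ^ m) * u' y" unfolding assms(7)[OF y] by (simp only: mult_ac)
    also have "\<dots> = t y ^ m * (g y * u' y)" unfolding 1(5)[OF y] by (simp only: mult_ac)
    finally show "f' y * (h y * u y) * t0 y ^ m = t y ^ m * (g y * u' y)" .
  qed (use 1 assms in \<open>auto intro: is_form_mult\<close>)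
qed

text \<open>In the local ring this says that \<open>f\<close> is a unit times the
  \<open>n\<close>-th power of \<open>t / t0\<close>, with denominators cleared.\<close>

definition has_order :: "nat \<Rightarrow> ('a^'n \<Rightarrow> 'a) \<Rightarrow> nat \<Rightarrow> bool" where
  "has_order d f n \<longleftrightarrow> is_form UNIV d f \<and> (\<exists>e h g. is_form UNIV e h \<and> h x \<noteq> 0 \<and> is_form UNIV (d + e) g \<and> g x \<noteq> 0 \<and>
     (\<forall>y\<in>\<Union>V. f y * h y * t0 y ^ n = t y ^ n * g y))"

lemma has_orderI:
  assumes "is_form UNIV d f" "is_form UNIV e h" "h x \<noteq> 0" "is_form UNIV (d + e) g" "g x \<noteq> 0"
    "\<And>y. y \<in> \<Union>V \<Longrightarrow> f y * h y * t0 y ^ n = t y ^ n * g y"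
  shows "has_order d f n"
  unfolding has_order_def using assms by blast

lemma has_orderE:
  assumes "has_order d f n"
  obtains e h g where "is_form UNIV d f" "is_form UNIV e h" "h x \<noteq> 0" "is_form UNIV (d + e) g" "g x \<noteq> 0"
    "\<And>y. y \<in> \<Union>V \<Longrightarrow> f y * h y * t0 y ^ n = t y ^ n * g y"
  using assms unfolding has_order_def by blast

lemma has_order_divs: "has_order d f n \<Longrightarrow> dv d n f"
  by (elim has_orderE) (rule divsI)

text \<open>If \<open>f\<close> were divisible more than \<open>n\<close> times, cancelling
  \<open>t ^ n\<close> would leave an identity of forms whose two sides differ at \<open>x\<close>:
  one is a product of forms nonzero there, the other contains \<open>t\<close>. The degrees may
  differ because one function could be presented as a form in two degrees; it then vanishes on
  \<open>V\<close>.\<close>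

lemma has_order_bound:
  assumes "has_order d f n" "dv d' m f"
  shows "m \<le> n"
proof (rule ccontr)
  assume "\<not> m \<le> n"
  then obtain k where m: "m = n + Suc k" by (metis add_Suc_right less_imp_Suc_add not_le_imp_less)
  obtain e h g where 1: "is_form UNIV d f" "is_form UNIV e h" "h x \<noteq> 0" "is_form UNIV (d + e) g" "g x \<noteq> 0"
    "\<And>y. y \<in> \<Union>V \<Longrightarrow> f y * h y * t0 y ^ n = t y ^ n * g y" using assms(1) by (rule has_orderE) (rule that)
  obtain e' h' g' where 2: "is_form UNIV d' f" "is_form UNIV e' h'" "h' x \<noteq> 0" "is_form UNIV (d' + e') g'"
    "\<And>y. y \<in> \<Union>V \<Longrightarrow> f y * h' y * t0 y ^ m = t y ^ m * g' y" using assms(2) by (rule divsE) (rule that)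
  define A where "A = (\<lambda>y. g y * h' y * t0 y ^ Suc k)"
  define B where "B = (\<lambda>y. t y ^ Suc k * g' y * h y)"
  have A: "is_form UNIV (d + e + e' + Suc k * 1) A" unfolding A_def
    by (intro is_form_mult is_form_power t0_form 1 2) auto
  have B: "is_form UNIV (Suc k * 1 + (d' + e') + e) B" unfolding B_def
    by (intro is_form_mult is_form_power t_form 1 2) auto
  have AB: "t y ^ n * A y = t y ^ n * B y" if y: "y \<in> \<Union>V" for y
  proof -
    have "t y ^ n * A y = (t y ^ n * g y) * (h' y * t0 y ^ Suc k)" by (simp add: A_def ac_simps)
    also have "\<dots> = (f y * h' y * t0 y ^ m) * h y" unfolding 1(6)[OF y, symmetric] m power_add by (simp only: mult_ac)
    also have "\<dots> = t y ^ n * B y" unfolding 2(5)[OF y] by (simp only: B_def m power_add mult_ac)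
    finally show ?thesis .
  qed
  show False
  proof (cases "zero_on V f")
    case True
    have "zero_on V (\<lambda>y. t y ^ n * g y)"
      unfolding zero_on_def
    proof
      fix y assume y: "y \<in> \<Union>V"
      hence "f y = 0" using True by (auto simp: zero_on_def)
      thus "t y ^ n * g y = 0" using 1(6)[OF y] by simp
    qed
    hence "zero_on V (\<lambda>y. t y ^ n) \<or> zero_on V g" using prime[OF is_form_power[OF coeff_ring_UNIV t_form, of n] 1(4)] by simp
    thus False using zero_on_power[OF t_form t_nz] 1(5) x_mem by (auto simp: zero_on_def)
  next
    case False
    have "d = d'"
    proof (rule ccontr)
      assume dd: "d \<noteq> d'"
      have "f y = 0" if y: "y \<in> \<Union>V" for y
      proof -
        have c: "c ^ d * f y = c ^ d' * f y" for c
          by (rule trans[OF sym[OF is_form_homogeneous[OF 1(1)]] is_form_homogeneous[OF 2(1)]])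
        \<comment> \<open>Scaling by 2 tells the degrees apart, since powers of 2 are distinct in
          characteristic 0.\<close>
        from c[of 2] have "(2 ^ d - 2 ^ d') * f y = 0" by (simp add: algebra_simps)
        moreover have "(2::'a) ^ d \<noteq> 2 ^ d'" 
        proof
          assume "(2::'a) ^ d = 2 ^ d'"
          hence "of_nat (2 ^ d) = (of_nat (2 ^ d') :: 'a)" by simp
          hence "(2::nat) ^ d = 2 ^ d'" by (simp only: of_nat_eq_iff)
          thus False using dd by simp
        qed
        ultimately show "f y = 0" by simp
      qed
      thus False using False by (simp add: zero_on_def)
    qed
    hence B': "is_form UNIV (d + e + e' + Suc k * 1) B" using B by (simp add: ac_simps)
    have "A x = B x"
      using cancel_on[OF is_form_power[OF _ t_form] zero_on_power[OF t_form t_nz, of n] A B' AB x_mem] by simp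
    thus False using 1 2 t0_x t_x by (simp add: A_def B_def)
  qed
qed

lemma has_order_unique: "has_order d f n \<Longrightarrow> has_order d' f n' \<Longrightarrow> n = n'"
  using has_order_bound has_order_divs by (meson le_antisym)

lemma divs_iff_order:
  assumes "has_order d f n" shows "dv d m f \<longleftrightarrow> m \<le> n"
proof
  assume "m \<le> n"
  then obtain k where n: "n = m + k" using le_Suc_ex by blast
  obtain e h g where 1: "is_form UNIV d f" "is_form UNIV e h" "h x \<noteq> 0" "is_form UNIV (d + e) g" "g x \<noteq> 0"
    "\<And>y. y \<in> \<Union>V \<Longrightarrow> f y * h y * t0 y ^ n = t y ^ n * g y" using assms by (rule has_orderE) (rule that)
  have k0: "is_form UNIV k (\<lambda>y. t0 y ^ k)" "is_form UNIV k (\<lambda>y. t y ^ k)"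
    using is_form_power[OF _ t0_form, of k] is_form_power[OF _ t_form, of k] by auto
  show "dv d m f"
  proof (rule divsI[where h = "\<lambda>y. h y * t0 y ^ k" and g = "\<lambda>y. t y ^ k * g y" and e = "e + k"])
    show "is_form UNIV (d + (e + k)) (\<lambda>y. t y ^ k * g y)"
      using is_form_mult[OF _ k0(2) 1(4)] by (simp add: ac_simps)
    fix y assume y: "y \<in> \<Union>V"
    show "f y * (h y * t0 y ^ k) * t0 y ^ m = t y ^ m * (t y ^ k * g y)"
      using 1(6)[OF y] unfolding n power_add by (simp only: mult_ac)
  qed (use 1 k0 t0_x in \<open>auto intro: is_form_mult\<close>)
qed (rule has_order_bound[OF assms])

lemma has_order_nonzero: "has_order d f n \<Longrightarrow> \<not> zero_on V f"
proof
  assume "has_order d f n" and z: "zero_on V f"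
  then obtain e h g where 1: "is_form UNIV d f" "is_form UNIV e h" "h x \<noteq> 0" "is_form UNIV (d + e) g" "g x \<noteq> 0"
    "\<And>y. y \<in> \<Union>V \<Longrightarrow> f y * h y * t0 y ^ n = t y ^ n * g y" by (elim has_orderE) (rule that)
  have "zero_on V (\<lambda>y. t y ^ n * g y)"
    unfolding zero_on_def
  proof
    fix y assume y: "y \<in> \<Union>V"
    hence "f y = 0" using z by (auto simp: zero_on_def)
    thus "t y ^ n * g y = 0" using 1(6)[OF y] by simp
  qed
  hence "zero_on V (\<lambda>y. t y ^ n) \<or> zero_on V g" using prime[OF is_form_power[OF coeff_ring_UNIV t_form, of n] 1(4)] by simp
  thus False using zero_on_power[OF t_form t_nz] 1(5) x_mem by (auto simp: zero_on_def)
qed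

lemma has_order_mult:
  assumes "has_order d f n" "has_order d' f' n'"
  shows "has_order (d + d') (\<lambda>y. f y * f' y) (n + n')"
proof -
  obtain e h g where 1: "is_form UNIV d f" "is_form UNIV e h" "h x \<noteq> 0" "is_form UNIV (d + e) g" "g x \<noteq> 0"
    "\<And>y. y \<in> \<Union>V \<Longrightarrow> f y * h y * t0 y ^ n = t y ^ n * g y" using assms(1) by (rule has_orderE) (rule that)
  obtain e' h' g' where 2: "is_form UNIV d' f'" "is_form UNIV e' h'" "h' x \<noteq> 0" "is_form UNIV (d' + e') g'" "g' x \<noteq> 0"
    "\<And>y. y \<in> \<Union>V \<Longrightarrow> f' y * h' y * t0 y ^ n' = t y ^ n' * g' y" using assms(2) by (rule has_orderE) (rule that)
  show ?thesis
  proof (rule has_orderI[where h = "\<lambda>y. h y * h' y" and g = "\<lambda>y. g y * g' y" and e = "e + e'"])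
    show "is_form UNIV (d + d' + (e + e')) (\<lambda>y. g y * g' y)"
      using is_form_mult[OF _ 1(4) 2(4)] by (simp add: ac_simps)
    fix y assume y: "y \<in> \<Union>V"
    have "f y * f' y * (h y * h' y) * t0 y ^ (n + n') =
        (f y * h y * t0 y ^ n) * (f' y * h' y * t0 y ^ n')" by (simp add: power_add ac_simps)
    also have "\<dots> = t y ^ (n + n') * (g y * g' y)"
      by (simp only: 1(6)[OF y] 2(6)[OF y], simp add: power_add ac_simps)
    finally show "f y * f' y * (h y * h' y) * t0 y ^ (n + n') = t y ^ (n + n') * (g y * g' y)" .
  qed (use 1 2 in \<open>auto intro: is_form_mult\<close>)
qed

lemma has_order_0: "is_form UNIV d f \<Longrightarrow> f x \<noteq> 0 \<Longrightarrow> has_order d f 0"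
  by (rule has_orderI[where e = 0 and h = "\<lambda>_. 1" and g = f]) (auto intro: is_form_const)

lemma has_order_t: "has_order 1 t 1"
  by (rule has_orderI[where e = 0 and h = "\<lambda>_. 1" and g = t0])
     (use t_form t0_form t0_x in \<open>auto intro: is_form_const\<close>)

lemma has_order_cong:
  assumes "has_order d f n" "is_form UNIV d f'" "\<And>y. y \<in> \<Union>V \<Longrightarrow> f' y = f y"
  shows "has_order d f' n"
proof -
  obtain e h g where 1: "is_form UNIV d f" "is_form UNIV e h" "h x \<noteq> 0" "is_form UNIV (d + e) g" "g x \<noteq> 0"
    "\<And>y. y \<in> \<Union>V \<Longrightarrow> f y * h y * t0 y ^ n = t y ^ n * g y" using assms(1) by (rule has_orderE) (rule that)
  show ?thesis by (rule has_orderI[OF assms(2) 1(2-5)]) (simp only: assms(3) 1(6))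
qed

lemma has_order_power:
  assumes "has_order d f n" shows "has_order (k * d) (\<lambda>y. f y ^ k) (k * n)"
proof (induction k)
  case 0 show ?case using has_order_0[of 0 "\<lambda>_. 1"] by (simp add: is_form_const)
next
  case (Suc k) show ?case using has_order_mult[OF assms Suc] by simp
qed

end

text \<open>An elementary discrete valuation ring: the first assumption says that
  \<open>t / t0\<close> generates the maximal ideal, the second that no nonzero germ lies in all of
  its powers, in the form of a bound on the exponents.\<close>

locale curve_point = curve_germ +
  assumes vanishing_divs: "is_form UNIV d f \<Longrightarrow> f x = 0 \<Longrightarrow> divs V x t t0 d 1 f"
    and divs_bounded: "is_form UNIV d f \<Longrightarrow> \<not> zero_on V f \<Longrightarrow> \<exists>N. \<forall>m. divs V x t t0 d m f \<longrightarrow> m \<le> N"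
begin

text \<open>At the greatest exponent the cofactor cannot vanish at \<open>x\<close>, or one more
  factor \<open>t\<close> could be taken out.\<close>

lemma has_order_exists:
  assumes f: "is_form UNIV d f" "\<not> zero_on V f"
  shows "\<exists>n. has_order d f n"
proof -
  obtain N where N: "\<And>m. dv d m f \<Longrightarrow> m \<le> N" using divs_bounded[OF f] by blast
  define n where "n = (GREATEST m. dv d m f)"
  have n: "dv d n f" unfolding n_def by (rule GreatestI_nat[where b = N]) (use divs_0[OF f(1)] N in auto)
  have nn: "\<not> dv d (Suc n) f"
  proof
    assume "dv d (Suc n) f"
    hence "Suc n \<le> n" unfolding n_def by (rule Greatest_le_nat[where b = N]) (use N in auto)
    thus False by simp
  qed
  obtain e h g where 1: "is_form UNIV d f" "is_form UNIV e h" "h x \<noteq> 0" "is_form UNIV (d + e) g"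
    "\<And>y. y \<in> \<Union>V \<Longrightarrow> f y * h y * t0 y ^ n = t y ^ n * g y" using n by (rule divsE) (rule that)
  have "g x \<noteq> 0"
  proof
    assume "g x = 0"
    hence "dv (d + e) 1 g" by (rule vanishing_divs[OF 1(4)])
    then obtain k h' g' where 2: "is_form UNIV k h'" "h' x \<noteq> 0" "is_form UNIV (d + e + k) g'"
      "\<And>y. y \<in> \<Union>V \<Longrightarrow> g y * h' y * t0 y ^ 1 = t y ^ 1 * g' y" by (rule divsE) (rule that)
    have "dv d (Suc n) f"
    proof (rule divsI[where h = "\<lambda>y. h y * h' y" and g = g' and e = "e + k"])
      fix y assume y: "y \<in> \<Union>V"
      have "f y * (h y * h' y) * t0 y ^ Suc n = (f y * h y * t0 y ^ n) * (h' y * t0 y)" by (simp add: ac_simps)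
      also have "\<dots> = t y ^ n * (g y * h' y * t0 y ^ 1)" unfolding 1(5)[OF y] by (simp add: ac_simps)
      also have "\<dots> = t y ^ Suc n * g' y" unfolding 2(4)[OF y] by (simp add: ac_simps)
      finally show "f y * (h y * h' y) * t0 y ^ Suc n = t y ^ Suc n * g' y" .
    qed (use 1 2 in \<open>auto intro: is_form_mult simp: add.assoc\<close>)
    thus False using nn by simp
  qed
  from has_orderI[OF 1(1-4) this 1(5)] show ?thesis by blast
qed

lemma at_x: "is_form UNIV d f \<Longrightarrow> vanishes_at f (hpoint x) \<longleftrightarrow> f x = 0"
  by (rule vanishes_at_hpoint)

lemma nonvanishing_not_zero_on: "f x \<noteq> 0 \<Longrightarrow> \<not> zero_on V f"
  using x_mem by (auto simp: zero_on_def)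

lemma fracsI: "is_form UNIV d f \<Longrightarrow> is_form UNIV d g \<Longrightarrow> \<not> zero_on V g \<Longrightarrow> (f, g) \<in> fracs UNIV V"
  unfolding fracs_iff by blast

lemma fracs_atI: "is_form UNIV d f \<Longrightarrow> is_form UNIV d g \<Longrightarrow> g x \<noteq> 0 \<Longrightarrow> (f, g) \<in> fracs UNIV V"
  using nonvanishing_not_zero_on[of g] by (simp add: fracsI)

lemma local_ring_iff: "U \<in> local_ring V (hpoint x) \<longleftrightarrow>
  (\<exists>d f g. is_form UNIV d f \<and> is_form UNIV d g \<and> g x \<noteq> 0 \<and> U = ratio UNIV V f g)"
proof
  assume U: "U \<in> local_ring V (hpoint x)"
  then obtain f g where fg: "(f, g) \<in> U" "\<not> vanishes_at g (hpoint x)" by (auto simp: local_ring_def)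
  obtain u v where uv: "(u, v) \<in> fracs UNIV V" "U = ratio UNIV V u v"
    using U by (auto simp: local_ring_def carrier_FF)
  have fr: "(f, g) \<in> fracs UNIV V" "U = ratio UNIV V f g" using fg(1) uv mem_ratio by auto
  then obtain d where d: "is_form UNIV d f" "is_form UNIV d g" unfolding fracs_iff by blast
  show "\<exists>d f g. is_form UNIV d f \<and> is_form UNIV d g \<and> g x \<noteq> 0 \<and> U = ratio UNIV V f g"
    using d fr(2) fg(2) at_x[OF d(1)] at_x[OF d(2)]
    by (intro exI[of _ d] exI[of _ f] exI[of _ g]) simp
next
  assume "\<exists>d f g. is_form UNIV d f \<and> is_form UNIV d g \<and> g x \<noteq> 0 \<and> U = ratio UNIV V f g"
  then obtain d f g where 1: "is_form UNIV d f" "is_form UNIV d g" "g x \<noteq> 0" "U = ratio UNIV V f g" by blast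
  have fr: "(f, g) \<in> fracs UNIV V" by (rule fracs_atI[OF 1(1,2)], rule 1(3))
  thus "U \<in> local_ring V (hpoint x)"
    unfolding local_ring_def using 1 at_x[OF 1(2)] ratio_in_FF[OF fr] mem_ratio[OF fr, of f g] fr
    by (auto intro!: bexI[of _ "(f, g)"])
qed

lemma local_max_ideal_iff: "U \<in> local_max_ideal V (hpoint x) \<longleftrightarrow>
  (\<exists>d f g. is_form UNIV d f \<and> is_form UNIV d g \<and> g x \<noteq> 0 \<and> f x = 0 \<and> U = ratio UNIV V f g)"
proof
  assume U: "U \<in> local_max_ideal V (hpoint x)"
  then obtain f g where fg: "(f, g) \<in> U" "\<not> vanishes_at g (hpoint x)" "vanishes_at f (hpoint x)"
    by (auto simp: local_max_ideal_def)
  obtain u v where uv: "(u, v) \<in> fracs UNIV V" "U = ratio UNIV V u v"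
    using U by (auto simp: local_max_ideal_def carrier_FF)
  have fr: "(f, g) \<in> fracs UNIV V" "U = ratio UNIV V f g" using fg(1) uv mem_ratio by auto
  then obtain d where d: "is_form UNIV d f" "is_form UNIV d g" unfolding fracs_iff by blast
  show "\<exists>d f g. is_form UNIV d f \<and> is_form UNIV d g \<and> g x \<noteq> 0 \<and> f x = 0 \<and> U = ratio UNIV V f g"
    using d fr(2) fg(2,3) at_x[OF d(1)] at_x[OF d(2)]
    by (intro exI[of _ d] exI[of _ f] exI[of _ g]) simp
next
  assume "\<exists>d f g. is_form UNIV d f \<and> is_form UNIV d g \<and> g x \<noteq> 0 \<and> f x = 0 \<and> U = ratio UNIV V f g"
  then obtain d f g where 1: "is_form UNIV d f" "is_form UNIV d g" "g x \<noteq> 0" "f x = 0" "U = ratio UNIV V f g" by blast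
  have fr: "(f, g) \<in> fracs UNIV V" by (rule fracs_atI[OF 1(1,2)], rule 1(3))
  thus "U \<in> local_max_ideal V (hpoint x)"
    unfolding local_max_ideal_def using 1 at_x[OF 1(2)] at_x[OF 1(1)] ratio_in_FF[OF fr] mem_ratio[OF fr, of f g] fr
    by (auto intro!: bexI[of _ "(f, g)"])
qed

text \<open>The powers of the maximal ideal are abstract ideal products, closed under sums. Since
  the maximal ideal is generated by \<open>t / t0\<close>, each power consists of the multiples of a
  power of \<open>t / t0\<close>, and divisibility of the numerator describes membership.\<close>

lemma local_max_ideal_power_iff: "U \<in> local_max_ideal_power V (hpoint x) n \<longleftrightarrow>
  (\<exists>d f g. dv d n f \<and> is_form UNIV d g \<and> g x \<noteq> 0 \<and> U = ratio UNIV V f g)"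
proof (induction n arbitrary: U)
  case 0
  have "is_form UNIV d f \<longleftrightarrow> dv d 0 f" for d f using divs_0 by (auto elim: divsE)
  thus ?case unfolding local_max_ideal_power.simps local_ring_iff by simp
next
  case (Suc n)
  let ?R = "FF UNIV \<lparr> carrier := local_ring V (hpoint x) \<rparr>"
  note ops = mult_ratio[OF coeff_ring_UNIV] add_ratio[OF coeff_ring_UNIV]
  show ?case
  proof
    assume "U \<in> local_max_ideal_power V (hpoint x) (Suc n)"
    hence "U \<in> ideal_prod ?R (local_max_ideal V (hpoint x)) (local_max_ideal_power V (hpoint x) n)" by simp
    thus "\<exists>d f g. dv d (Suc n) f \<and> is_form UNIV d g \<and> g x \<noteq> 0 \<and> U = ratio UNIV V f g"
    proof (induction rule: ideal_prod.induct)
      case (prod i j)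
      obtain d f g where 1: "is_form UNIV d f" "is_form UNIV d g" "g x \<noteq> 0" "f x = 0" "i = ratio UNIV V f g"
        using prod(1) unfolding local_max_ideal_iff by blast
      obtain d' f' g' where 2: "dv d' n f'" "is_form UNIV d' g'" "g' x \<noteq> 0" "j = ratio UNIV V f' g'"
        using prod(2) unfolding Suc.IH by blast
      have f': "is_form UNIV d' f'" using 2(1) by (rule divsE)
      have fr: "(f, g) \<in> fracs UNIV V" "(f', g') \<in> fracs UNIV V"
        by (rule fracs_atI[OF 1(1,2)], rule 1(3),
            rule fracs_atI[OF f' 2(2)], rule 2(3))
      have "dv (d + d') (1 + n) (\<lambda>y. f y * f' y)"
        by (rule divs_mult[OF vanishing_divs[OF 1(1,4)] 2(1)])
      moreover have "is_form UNIV (d + d') (\<lambda>y. g y * g' y)" by (rule is_form_mult[OF _ 1(2) 2(2)]) simp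
      moreover have "i \<otimes>\<^bsub>?R\<^esub> j = ratio UNIV V (\<lambda>y. f y * f' y) (\<lambda>y. g y * g' y)"
        using ops(1)[OF fr] by (simp add: 1 2)
      ultimately show ?case using 1(3) 2(3)
        by (intro exI[of _ "d + d'"] exI[of _ "\<lambda>y. f y * f' y"] exI[of _ "\<lambda>y. g y * g' y"]) simp
    next
      case (sum s1 s2)
      obtain d f g where 1: "dv d (Suc n) f" "is_form UNIV d g" "g x \<noteq> 0" "s1 = ratio UNIV V f g"
        using sum.IH(1) by blast
      obtain d' f' g' where 2: "dv d' (Suc n) f'" "is_form UNIV d' g'" "g' x \<noteq> 0" "s2 = ratio UNIV V f' g'"
        using sum.IH(2) by blast
      have f: "is_form UNIV d f" "is_form UNIV d' f'" using 1(1) 2(1) by (auto elim: divsE)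
      have fr: "(f, g) \<in> fracs UNIV V" "(f', g') \<in> fracs UNIV V"
        by (rule fracs_atI[OF f(1) 1(2)], rule 1(3),
            rule fracs_atI[OF f(2) 2(2)], rule 2(3))
      have "dv (d + d') (Suc n + 0) (\<lambda>y. f y * g' y)" by (rule divs_mult[OF 1(1) divs_0[OF 2(2)]])
      moreover have "dv (d' + d) (Suc n + 0) (\<lambda>y. f' y * g y)" by (rule divs_mult[OF 2(1) divs_0[OF 1(2)]])
      ultimately have "dv (d + d') (Suc n) (\<lambda>y. f y * g' y + f' y * g y)"
        by (intro divs_add) (auto simp: add.commute)
      moreover have "is_form UNIV (d + d') (\<lambda>y. g y * g' y)" by (rule is_form_mult[OF _ 1(2) 2(2)]) simp
      moreover have "s1 \<oplus>\<^bsub>?R\<^esub> s2 = ratio UNIV V (\<lambda>y. f y * g' y + f' y * g y) (\<lambda>y. g y * g' y)"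
        using ops(2)[OF fr] by (simp add: 1 2)
      ultimately show ?case using 1(3) 2(3)
        by (intro exI[of _ "d + d'"] exI[of _ "\<lambda>y. f y * g' y + f' y * g y"] exI[of _ "\<lambda>y. g y * g' y"]) simp
    qed
  next
    assume "\<exists>d f g. dv d (Suc n) f \<and> is_form UNIV d g \<and> g x \<noteq> 0 \<and> U = ratio UNIV V f g"
    then obtain d f g where 1: "dv d (Suc n) f" "is_form UNIV d g" "g x \<noteq> 0" "U = ratio UNIV V f g" by blast
    obtain e h G where 2: "is_form UNIV d f" "is_form UNIV e h" "h x \<noteq> 0" "is_form UNIV (d + e) G"
      "\<And>y. y \<in> \<Union>V \<Longrightarrow> f y * h y * t0 y ^ Suc n = t y ^ Suc n * G y" using 1(1) by (rule divsE) (rule that)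
    have k0: "is_form UNIV n (\<lambda>y. t0 y ^ n)" "is_form UNIV n (\<lambda>y. t y ^ n)"
      using is_form_power[OF _ t0_form, of n] is_form_power[OF _ t_form, of n] by auto
    \<comment> \<open>The function \<open>f / g\<close> is split as \<open>t / t0\<close> times
      \<open>?N / ?M\<close>; the power of \<open>t0\<close> in the denominator balances the degree
      of the power of \<open>t\<close> in the numerator.\<close>
    let ?N = "\<lambda>y. t y ^ n * G y" and ?M = "\<lambda>y. h y * g y * t0 y ^ n"
    have N: "is_form UNIV (n + (d + e)) ?N" by (rule is_form_mult[OF _ k0(2) 2(4)]) simp
    have M: "is_form UNIV (n + (d + e)) ?M"
      using is_form_mult[OF _ is_form_mult[OF _ 2(2) 1(2)] k0(1)] by (simp add: ac_simps)
    have Mx: "?M x \<noteq> 0" using 1(3) 2(3) t0_x by simp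
    have "dv (n + (d + e)) n ?N"
    proof (rule divsI[where e = 0 and h = "\<lambda>_. 1" and g = "\<lambda>y. G y * t0 y ^ n"])
      show "is_form UNIV (n + (d + e) + 0) (\<lambda>y. G y * t0 y ^ n)"
        using is_form_mult[OF _ 2(4) k0(1)] by (simp add: ac_simps)
    qed (use N in \<open>auto intro: is_form_const\<close>)
    hence j: "ratio UNIV V ?N ?M \<in> local_max_ideal_power V (hpoint x) n"
      unfolding Suc.IH using M Mx
      by (intro exI[of _ "n + (d + e)"] exI[of _ ?N] exI[of _ ?M]) simp
    have i: "ratio UNIV V t t0 \<in> local_max_ideal V (hpoint x)"
      unfolding local_max_ideal_iff using t_form t0_form t_x t0_x
      by (intro exI[of _ 1] exI[of _ t] exI[of _ t0]) simp
    have fr: "(t, t0) \<in> fracs UNIV V" "(?N, ?M) \<in> fracs UNIV V" "(f, g) \<in> fracs UNIV V"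
      by (rule fracs_atI[OF t_form t0_form], rule t0_x,
          rule fracs_atI[OF N M], rule Mx,
          rule fracs_atI[OF 2(1) 1(2)], rule 1(3))
    have "ratio UNIV V t t0 \<otimes>\<^bsub>?R\<^esub> ratio UNIV V ?N ?M = ratio UNIV V (\<lambda>y. t y * ?N y) (\<lambda>y. t0 y * ?M y)"
      using ops(1)[OF fr(1,2)] by simp
    also have "\<dots> = U"
    proof -
      have "t y * ?N y * g y = f y * (t0 y * ?M y)" if y: "y \<in> \<Union>V" for y
      proof -
        have "t y * ?N y * g y = (t y ^ Suc n * G y) * g y" by (simp add: ac_simps)
        also have "\<dots> = f y * (t0 y * ?M y)" unfolding 2(5)[OF y, symmetric] by (simp add: ac_simps)
        finally show ?thesis .
      qed
      thus ?thesis unfolding 1(4) using ratio_eq_iff[OF fracs_mult[OF coeff_ring_UNIV fr(1,2)] fr(3)] by blast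
    qed
    finally show "U \<in> local_max_ideal_power V (hpoint x) (Suc n)"
      using ideal_prod.prod[OF i j, of ?R] by simp
  qed
qed

lemma local_ord_ratio:
  assumes f: "has_order d f n" and g: "is_form UNIV d g" "g x \<noteq> 0"
  shows "local_ord V (hpoint x) (ratio UNIV V f g) = n"
proof -
  have f1: "is_form UNIV d f" using f by (rule has_orderE)
  have "ratio UNIV V f g \<in> local_max_ideal_power V (hpoint x) m \<longleftrightarrow> m \<le> n" for m
  proof
    assume "m \<le> n"
    thus "ratio UNIV V f g \<in> local_max_ideal_power V (hpoint x) m"
      unfolding local_max_ideal_power_iff using divs_iff_order[OF f] g
      by (intro exI[of _ d] exI[of _ f] exI[of _ g]) simp
  next
    assume "ratio UNIV V f g \<in> local_max_ideal_power V (hpoint x) m"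
    then obtain d' f' g' where 1: "dv d' m f'" "is_form UNIV d' g'" "g' x \<noteq> 0" "ratio UNIV V f g = ratio UNIV V f' g'"
      unfolding local_max_ideal_power_iff by blast
    have f': "is_form UNIV d' f'" using 1(1) by (rule divsE)
    have fr: "(f, g) \<in> fracs UNIV V" "(f', g') \<in> fracs UNIV V"
      by (rule fracs_atI[OF f1 g(1)], rule g(2),
          rule fracs_atI[OF f' 1(2)], rule 1(3))
    have "\<forall>y\<in>\<Union>V. f y * g' y = f' y * g y" using 1(4) ratio_eq_iff[OF fr] by blast
    hence "dv d m f" by (intro divs_cong[OF 1(1) f1 1(2,3) g(1)]) auto
    thus "m \<le> n" using divs_iff_order[OF f] by blast
  qed
  thus ?thesis unfolding local_ord_def by (intro Greatest_equality) auto
qed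

text \<open>A common power of \<open>t0\<close> as denominator exhibits the difference of orders.
  For uniqueness, any other presentation as a quotient of local functions gives an identity between
  products of forms, whose two sides have the same order.\<close>

theorem ordv_ratio:
  assumes f: "has_order d f n" and g: "has_order d g k"
  shows "ordv V (hpoint x) (ratio UNIV V f g) = int n - int k"
  unfolding ordv_def
proof (rule the_equality)
  have fg: "is_form UNIV d f" "is_form UNIV d g" using f g by (auto elim: has_orderE)
  have nz: "\<not> zero_on V f" "\<not> zero_on V g" using f g has_order_nonzero by auto
  have fr: "(f, g) \<in> fracs UNIV V" using fg nz fracsI by blast
  have td: "is_form UNIV d (\<lambda>y. t0 y ^ d)" "t0 x ^ d \<noteq> 0" using is_form_power[OF _ t0_form, of d] t0_x by auto
  have frt: "(f, \<lambda>y. t0 y ^ d) \<in> fracs UNIV V" "(g, \<lambda>y. t0 y ^ d) \<in> fracs UNIV V"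
    using fg td by (auto intro!: fracsI nonvanishing_not_zero_on)
  let ?N = "ratio UNIV V f (\<lambda>y. t0 y ^ d)" and ?W = "ratio UNIV V g (\<lambda>y. t0 y ^ d)"
  show "\<exists>N\<in>local_ring V (hpoint x) \<inter> nonzero_functions V. \<exists>W\<in>local_ring V (hpoint x) \<inter> nonzero_functions V.
      ratio UNIV V f g \<otimes>\<^bsub>FF UNIV\<^esub> W = N \<and>
      int n - int k = int (local_ord V (hpoint x) N) - int (local_ord V (hpoint x) W)"
  proof (rule bexI[of _ ?N], rule bexI[of _ ?W], intro conjI)
    show "ratio UNIV V f g \<otimes>\<^bsub>FF UNIV\<^esub> ?W = ?N"
      unfolding mult_ratio[OF coeff_ring_UNIV fr frt(2)]
        ratio_eq_iff[OF fracs_mult[OF coeff_ring_UNIV fr frt(2)] frt(1)] by simp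
    show "int n - int k = int (local_ord V (hpoint x) ?N) - int (local_ord V (hpoint x) ?W)"
      by (simp add: local_ord_ratio[OF f td] local_ord_ratio[OF g td])
    have "?N \<in> local_ring V (hpoint x)"
      unfolding local_ring_iff using fg td by (intro exI[of _ d] exI[of _ f] exI[of _ "\<lambda>y. t0 y ^ d"]) simp
    thus "?N \<in> local_ring V (hpoint x) \<inter> nonzero_functions V"
      using nz nonzero_functions_ratio[OF frt(1)] by simp
    have "?W \<in> local_ring V (hpoint x)"
      unfolding local_ring_iff using fg td by (intro exI[of _ d] exI[of _ g] exI[of _ "\<lambda>y. t0 y ^ d"]) simp
    thus "?W \<in> local_ring V (hpoint x) \<inter> nonzero_functions V"
      using nz nonzero_functions_ratio[OF frt(2)] by simp
  qed
  fix l assume "\<exists>N\<in>local_ring V (hpoint x) \<inter> nonzero_functions V. \<exists>W\<in>local_ring V (hpoint x) \<inter> nonzero_functions V.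
      ratio UNIV V f g \<otimes>\<^bsub>FF UNIV\<^esub> W = N \<and> l = int (local_ord V (hpoint x) N) - int (local_ord V (hpoint x) W)"
  then obtain N W where NW: "N \<in> local_ring V (hpoint x)" "N \<in> nonzero_functions V"
    "W \<in> local_ring V (hpoint x)" "W \<in> nonzero_functions V" "ratio UNIV V f g \<otimes>\<^bsub>FF UNIV\<^esub> W = N"
    "l = int (local_ord V (hpoint x) N) - int (local_ord V (hpoint x) W)" by blast
  obtain c u v where u: "is_form UNIV c u" "is_form UNIV c v" "v x \<noteq> 0" "N = ratio UNIV V u v"
    using NW(1) unfolding local_ring_iff by blast
  obtain c' u' v' where u': "is_form UNIV c' u'" "is_form UNIV c' v'" "v' x \<noteq> 0" "W = ratio UNIV V u' v'"
    using NW(3) unfolding local_ring_iff by blast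
  have fru: "(u, v) \<in> fracs UNIV V" "(u', v') \<in> fracs UNIV V"
    by (rule fracs_atI[OF u(1,2)], rule u(3),
        rule fracs_atI[OF u'(1,2)], rule u'(3))
  have unz: "\<not> zero_on V u" "\<not> zero_on V u'"
    using NW(2,4) nonzero_functions_ratio[OF fru(1)] nonzero_functions_ratio[OF fru(2)] u(4) u'(4) by auto
  obtain a a' where a: "has_order c u a" "has_order c' u' a'"
    using has_order_exists[OF u(1) unz(1)] has_order_exists[OF u'(1) unz(2)] by auto
  have l: "l = int a - int a'" using NW(6) local_ord_ratio[OF a(1) u(2,3)] local_ord_ratio[OF a(2) u'(2,3)] u(4) u'(4) by simp
  have "ratio UNIV V (\<lambda>y. f y * u' y) (\<lambda>y. g y * v' y) = ratio UNIV V u v"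
    using NW(5) mult_ratio[OF coeff_ring_UNIV fr fru(2)] u(4) u'(4) by simp
  hence eq: "\<forall>y\<in>\<Union>V. f y * u' y * v y = u y * (g y * v' y)"
    using ratio_eq_iff[OF fracs_mult[OF coeff_ring_UNIV fr fru(2)] fru(1)] by blast
  have "has_order (d + c' + c) (\<lambda>y. f y * u' y * v y) (n + a' + 0)"
    by (intro has_order_mult f a has_order_0 u)
  moreover have o2: "has_order (c + (d + c')) (\<lambda>y. u y * (g y * v' y)) (a + (k + 0))"
    by (intro has_order_mult g a has_order_0 u')
  hence "has_order (c + (d + c')) (\<lambda>y. f y * u' y * v y) (a + (k + 0))"
  proof (rule has_order_cong)
    show "is_form UNIV (c + (d + c')) (\<lambda>y. f y * u' y * v y)"
      using is_form_mult[OF _ is_form_mult[OF _ fg(1) u'(1)] u(2)] by (simp add: ac_simps)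
  qed (use eq in blast)
  ultimately have "n + a' + 0 = a + (k + 0)" by (rule has_order_unique)
  thus "l = int n - int k" using l by simp
qed

end

lemma curve_point_germ: "curve_point V x t t0 \<Longrightarrow> curve_germ V x t t0"
  by (rule curve_point.axioms(1))

section \<open>Orders independent of the uniformiser\<close>

definition smooth_curve :: "('a::field_char_0^'n) set set \<Rightarrow> bool" where
  "smooth_curve V \<longleftrightarrow> irreducible_set V \<and> (\<forall>x\<in>\<Union>V. \<exists>t t0. curve_point V x t t0)"

lemma (in irreducible_set) point_rep:
  assumes "P \<in> V" obtains x where "x \<in> \<Union>V" "P = hpoint x"
proof -
  obtain x where x: "P = hpoint x" using points assms by blast
  hence "x \<in> \<Union>V" using assms hpoint_self by blast
  thus ?thesis using x that by blast
qed

text \<open>The uniformiser is hidden behind an existential quantifier; \<open>ord_at_any\<close>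
  shows that any other one gives the same order.\<close>

definition ord_at :: "('a::field_char_0^'n) set set \<Rightarrow> 'a^'n \<Rightarrow> nat \<Rightarrow> ('a^'n \<Rightarrow> 'a) \<Rightarrow> nat \<Rightarrow> bool" where
  "ord_at V x d f n \<longleftrightarrow> (\<exists>t t0. curve_point V x t t0 \<and> curve_germ.has_order V x t t0 d f n)"

lemma ord_at_form: "ord_at V x d f n \<Longrightarrow> is_form UNIV d f"
  unfolding ord_at_def by (auto elim: curve_germ.has_orderE[OF curve_point_germ])

lemma ord_at_ordv:
  assumes "ord_at V x d f n" "is_form UNIV d g" "g x \<noteq> 0"
  shows "ordv V (hpoint x) (ratio UNIV V f g) = int n"
proof -
  obtain t t0 where c: "curve_point V x t t0" and o: "curve_germ.has_order V x t t0 d f n"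
    using assms(1) unfolding ord_at_def by blast
  interpret curve_point V x t t0 by (rule c)
  show ?thesis using ordv_ratio[OF o has_order_0[OF assms(2,3)]] by simp
qed

lemma linear_power_nonzero:
  fixes x :: "'a::field^'n"
  assumes "x \<noteq> 0"
  obtains g where "is_form UNIV d g" "g x \<noteq> 0"
proof -
  obtain i where i: "x $ i \<noteq> 0" using assms by (auto simp: vec_eq_iff)
  show ?thesis
    using is_form_power[OF coeff_ring_UNIV is_form_component[OF coeff_ring_UNIV, of i], of d] i
    by (intro that[of "\<lambda>x. x $ i ^ d"]) auto
qed

text \<open>Both numbers equal the valuation, at the common point, of \<open>f\<close> divided by a
  form that does not vanish there, and that valuation mentions neither the uniformiser nor the
  representative.\<close>

lemma ord_at_unique_hpoint:
  assumes "ord_at V x d f n" "ord_at V y d f n'" "hpoint x = hpoint y"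
  shows "n = n'"
proof -
  have x: "x \<noteq> 0"
    using assms(1) unfolding ord_at_def
    using irreducible_set.point_nonzero curve_germ.x_mem curve_germ.axioms(1) curve_point_germ by metis
  obtain g where g: "is_form UNIV d g" "g x \<noteq> 0" using linear_power_nonzero[OF x] by blast
  hence "g y \<noteq> 0" using vanishes_at_hpoint[OF g(1)] assms(3) by metis
  thus ?thesis using ord_at_ordv[OF assms(1) g] ord_at_ordv[OF assms(2) g(1)] assms(3) by simp
qed

lemma ord_at_unique: "ord_at V x d f n \<Longrightarrow> ord_at V x d f n' \<Longrightarrow> n = n'"
  using ord_at_unique_hpoint by blast

lemma ord_at_any:
  assumes "curve_point V x t t0" "ord_at V x d f n"
  shows "curve_germ.has_order V x t t0 d f n"
proof -
  interpret curve_point V x t t0 by (rule assms(1))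
  obtain s s0 where s: "curve_point V x s s0" "curve_germ.has_order V x s s0 d f n"
    using assms(2) unfolding ord_at_def by blast
  have "\<not> zero_on V f" by (rule curve_germ.has_order_nonzero[OF curve_point_germ[OF s(1)] s(2)])
  then obtain k where k: "has_order d f k" using has_order_exists ord_at_form[OF assms(2)] by blast
  hence "ord_at V x d f k" unfolding ord_at_def using assms(1) by blast
  hence "k = n" using ord_at_unique assms(2) by blast
  thus ?thesis using k by simp
qed

lemma smooth_curve_irreducible: "smooth_curve V \<Longrightarrow> irreducible_set V"
  by (simp add: smooth_curve_def)

lemma smooth_curve_point:
  assumes "smooth_curve V" "x \<in> \<Union>V"
  obtains t t0 where "curve_point V x t t0"
  using assms unfolding smooth_curve_def by blast

context
  fixes V :: "('a::field_char_0^'n) set set" and x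
  assumes V: "smooth_curve V" and x: "x \<in> \<Union>V"
begin

lemma ord_at_exists:
  assumes "is_form UNIV d f" "\<not> zero_on V f" obtains n where "ord_at V x d f n"
proof -
  obtain t t0 where c: "curve_point V x t t0" using smooth_curve_point[OF V x] by blast
  interpret curve_point V x t t0 by (rule c)
  show ?thesis using has_order_exists[OF assms] c that unfolding ord_at_def by blast
qed

lemma ord_at_mult:
  assumes "ord_at V x d f n" "ord_at V x d' f' n'"
  shows "ord_at V x (d + d') (\<lambda>y. f y * f' y) (n + n')"
proof -
  obtain t t0 where c: "curve_point V x t t0" using smooth_curve_point[OF V x] by blast
  interpret curve_point V x t t0 by (rule c)
  show ?thesis using has_order_mult[OF ord_at_any[OF c assms(1)] ord_at_any[OF c assms(2)]] c
    unfolding ord_at_def by blast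
qed

lemma ord_at_0:
  assumes "is_form UNIV d f" "f x \<noteq> 0" shows "ord_at V x d f 0"
proof -
  obtain t t0 where c: "curve_point V x t t0" using smooth_curve_point[OF V x] by blast
  interpret curve_point V x t t0 by (rule c)
  show ?thesis using has_order_0[OF assms] c unfolding ord_at_def by blast
qed

lemma ord_at_power:
  assumes "ord_at V x d f n" shows "ord_at V x (k * d) (\<lambda>y. f y ^ k) (k * n)"
proof (induction k)
  case 0 show ?case using ord_at_0[of 0 "\<lambda>_. 1"] by (simp add: is_form_const)
next
  case (Suc k) show ?case using ord_at_mult[OF assms Suc] by simp
qed

lemma ord_at_cong:
  assumes "ord_at V x d f n" "is_form UNIV d f'" "\<And>y. y \<in> \<Union>V \<Longrightarrow> f' y = f y"
  shows "ord_at V x d f' n"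
proof -
  obtain t t0 where c: "curve_point V x t t0" using smooth_curve_point[OF V x] by blast
  interpret curve_point V x t t0 by (rule c)
  show ?thesis using has_order_cong[OF ord_at_any[OF c assms(1)] assms(2,3)] c unfolding ord_at_def by blast
qed

lemma ord_at_nonzero: "ord_at V x d f n \<Longrightarrow> \<not> zero_on V f"
  unfolding ord_at_def using curve_germ.has_order_nonzero curve_point_germ by metis

lemma ord_at_uniformizer:
  obtains t t0 where "curve_point V x t t0" "ord_at V x 1 t 1"
proof -
  obtain t t0 where c: "curve_point V x t t0" using smooth_curve_point[OF V x] by blast
  thus ?thesis using that curve_germ.has_order_t[OF curve_point_germ[OF c]] unfolding ord_at_def by blast
qed

lemma ordv_ratio_ord_at:
  assumes "ord_at V x d f n" "ord_at V x d g k"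
  shows "ordv V (hpoint x) (ratio UNIV V f g) = int n - int k"
proof -
  obtain t t0 where c: "curve_point V x t t0" using smooth_curve_point[OF V x] by blast
  show ?thesis by (rule curve_point.ordv_ratio[OF c ord_at_any[OF c assms(1)] ord_at_any[OF c assms(2)]])
qed

lemma hyperplane_divisor_ord_at:
  assumes "ord_at V x 1 h n"
  shows "hyperplane_divisor V h (hpoint x) = int n"
proof -
  obtain g where g: "is_form UNIV 1 g" "g x \<noteq> 0"
    using linear_power_nonzero[OF irreducible_set.point_nonzero[OF smooth_curve_irreducible[OF V] x]] by blast
  let ?G = "SOME g. is_form UNIV 1 g \<and> \<not> vanishes_at g (hpoint x)"
  have "\<exists>g. is_form UNIV 1 g \<and> \<not> vanishes_at g (hpoint x)"
    using g vanishes_at_hpoint[OF g(1)] by (intro exI[of _ g]) simp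
  hence G: "is_form UNIV 1 ?G \<and> \<not> vanishes_at ?G (hpoint x)" by (rule someI_ex)
  hence "?G x \<noteq> 0" using vanishes_at_hpoint by blast
  hence "ordv V (hpoint x) (ratio UNIV V h ?G) = int n" using ord_at_ordv[OF assms] G by blast
  thus ?thesis unfolding hyperplane_divisor_def
    using irreducible_set.hpoint_mem[OF smooth_curve_irreducible[OF V] x] by simp
qed

end

section \<open>Hyperplane sections, morphisms and ramification\<close>

lemma hyperplane_divisors_lin_equiv:
  fixes V :: "('a::field_char_0^'n) set set"
  assumes V: "smooth_curve V" and h: "is_form UNIV 1 h" "\<not> zero_on V h" "is_form UNIV 1 h'" "\<not> zero_on V h'"
  shows "lin_equiv V (hyperplane_divisor V h) (hyperplane_divisor V h')"
proof -
  interpret irreducible_set V by (rule smooth_curve_irreducible[OF V])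
  have fr: "(h, h') \<in> fracs UNIV V" using h unfolding fracs_iff by blast
  have "(\<lambda>P. hyperplane_divisor V h P - hyperplane_divisor V h' P) = div_of V (ratio UNIV V h h')"
  proof
    fix P
    show "hyperplane_divisor V h P - hyperplane_divisor V h' P = div_of V (ratio UNIV V h h') P"
    proof (cases "P \<in> V")
      case True
      then obtain x where x: "x \<in> \<Union>V" "P = hpoint x" by (rule point_rep)
      obtain n where n1: "ord_at V x 1 h n" using ord_at_exists[OF V x(1) h(1,2)] .
      obtain n' where n2: "ord_at V x 1 h' n'" using ord_at_exists[OF V x(1) h(3,4)] .
      note n = n1 n2
      show ?thesis using True
        unfolding div_of_def x(2) ordv_ratio_ord_at[OF V x(1) n]
          hyperplane_divisor_ord_at[OF V x(1) n(1)] hyperplane_divisor_ord_at[OF V x(1) n(2)] by simp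
    qed (simp add: hyperplane_divisor_def div_of_def)
  qed
  thus ?thesis unfolding lin_equiv_def principal_divisors_def
    using nonzero_functions_ratio[OF fr] h(2) by blast
qed

text \<open>\<open>map_point\<close> ranges over all tuples of forms that represent the map. Where
  \<open>r\<close> itself does not vanish, any such tuple is proportional to it, so the description
  has the expected value.\<close>

lemma map_point_hpoint:
  fixes r :: "'a::field_char_0^'m \<Rightarrow> 'a^'n"
  assumes V: "irreducible_set V" and r: "forms_over UNIV k r" and x: "x \<in> \<Union>V" and rx: "r x \<noteq> 0"
  shows "map_point V r (hpoint x) = hpoint (r x)" "represents_at V r (hpoint x) r"
proof -
  interpret irreducible_set V by (rule V)
  have hom: "r (c *s y) = c ^ k *s r y" for c y
    using r is_form_homogeneous unfolding forms_over_def vec_eq_iff vector_smult_component by blast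
  have nz: "r y \<noteq> 0 \<and> hpoint (r y) = hpoint (r x)" if y: "y \<in> hpoint x" for y
  proof -
    obtain c where c: "c \<noteq> 0" "y = c *s x" using y mem_hpoint_iff by blast
    hence "hpoint (r y) = hpoint (r x)" unfolding c(2) hom by (intro hpoint_eqI) simp
    moreover have "r y \<noteq> 0" unfolding c(2) hom using c(1) rx by simp
    ultimately show ?thesis by simp
  qed
  show rep: "represents_at V r (hpoint x) r"
    unfolding represents_at_def using r nz by auto
  show "map_point V r (hpoint x) = hpoint (r x)"
    unfolding map_point_def
  proof (rule the_equality)
    show "\<exists>s. represents_at V r (hpoint x) s \<and> (\<exists>xa\<in>hpoint x. hpoint (r x) = hpoint (s xa))"
      using rep hpoint_self by blast
    fix Q assume "\<exists>s. represents_at V r (hpoint x) s \<and> (\<exists>xa\<in>hpoint x. Q = hpoint (s xa))"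
    then obtain s y where s: "represents_at V r (hpoint x) s" and y: "y \<in> hpoint x" "Q = hpoint (s y)" by blast
    have sy: "s y \<noteq> 0" using s y(1) by (simp add: represents_at_def)
    have rs: "r y $ i * s y $ j = r y $ j * s y $ i" for i j
      using s y(1) hpoint_mem[OF x] unfolding represents_at_def by blast
    obtain j where j: "r y $ j \<noteq> 0" using nz[OF y(1)] by (auto simp: vec_eq_iff)
    have eq: "s y = (s y $ j / r y $ j) *s r y"
      using rs j by (auto simp: vec_eq_iff field_simps)
    hence "s y $ j / r y $ j \<noteq> 0" using sy by (metis vector_smult_lzero)
    hence "hpoint (s y) = hpoint (r y)" by (subst eq) (rule hpoint_eqI)
    thus "Q = hpoint (r x)" using y(2) nz[OF y(1)] by simp
  qed
qed

lemma zero_on_image: "\<Union>Y = r ` \<Union>V \<Longrightarrow> zero_on V (\<lambda>y. f (r y)) \<longleftrightarrow> zero_on Y f"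
  unfolding zero_on_def by simp

text \<open>Here \<open>e\<close> is the order at \<open>x\<close> of the pullback of a uniformiser.\<close>

lemma ramification_exists:
  fixes r :: "'a::field_char_0^'m \<Rightarrow> 'a^'n"
  assumes V: "smooth_curve V" and Y: "smooth_curve Y" and r: "forms_over UNIV k r"
    and surj: "\<Union>Y = r ` \<Union>V" and x: "x \<in> \<Union>V"
  shows "\<exists>e. ram_index V Y r (hpoint x) = int e \<and>
    (\<forall>d f n. ord_at Y (r x) d f n \<longrightarrow> ord_at V x (d * k) (\<lambda>y. f (r y)) (n * e))"
proof -
  interpret V: irreducible_set V by (rule smooth_curve_irreducible[OF V])
  interpret Y: irreducible_set Y by (rule smooth_curve_irreducible[OF Y])
  have y: "r x \<in> \<Union>Y" unfolding surj using x by (rule imageI)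
  have rx: "r x \<noteq> 0" using Y.point_nonzero[OF y] .
  obtain t t0 where c: "curve_point Y (r x) t t0" and t1: "ord_at Y (r x) 1 t 1"
    using ord_at_uniformizer[OF Y y] by blast
  interpret c: curve_point Y "r x" t t0 by (rule c)
  have comp: "is_form UNIV (d * k) (\<lambda>y. f (r y))" if "is_form UNIV d f" for d f
    by (rule is_form_comp[OF _ that r]) simp
  have "\<not> zero_on V (\<lambda>y. t (r y))" unfolding zero_on_image[OF surj] by (rule c.t_nz)
  then obtain e where e: "ord_at V x (1 * k) (\<lambda>y. t (r y)) e"
    using ord_at_exists[OF V x comp[OF c.t_form]] by blast
  have pull: "ord_at V x (d * k) (\<lambda>y. f (r y)) (n * e)" if f: "ord_at Y (r x) d f n" for d f n
  proof -
    obtain l h g where 1: "is_form UNIV d f" "is_form UNIV l h" "h (r x) \<noteq> 0" "is_form UNIV (d + l) g" "g (r x) \<noteq> 0"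
      "\<And>y. y \<in> \<Union>Y \<Longrightarrow> f y * h y * t0 y ^ n = t y ^ n * g y"
      using ord_at_any[OF c f] by (rule c.has_orderE) (rule that)
    have "\<not> zero_on Y f" by (rule ord_at_nonzero[OF Y y f])
    hence "\<not> zero_on V (\<lambda>y. f (r y))" unfolding zero_on_image[OF surj] .
    then obtain a where a: "ord_at V x (d * k) (\<lambda>y. f (r y)) a"
      using ord_at_exists[OF V x comp[OF 1(1)]] by blast
    \<comment> \<open>The local identity that defines the order \<open>n\<close> of \<open>f\<close>
      is pulled back along \<open>r\<close>; units stay units, and comparing the orders of its two
      sides gives \<open>n * e\<close>.\<close>
    have l: "ord_at V x (d * k + l * k + n * (1 * k)) (\<lambda>y. f (r y) * h (r y) * t0 (r y) ^ n) (a + 0 + n * 0)"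
      by (intro ord_at_mult[OF V x] ord_at_power[OF V x] a ord_at_0[OF V x] comp 1 c.t0_form c.t0_x)
    have "ord_at V x (n * (1 * k) + (d + l) * k) (\<lambda>y. t (r y) ^ n * g (r y)) (n * e + 0)"
      by (intro ord_at_mult[OF V x] ord_at_power[OF V x] e ord_at_0[OF V x] comp 1)
    moreover have "n * (1 * k) + (d + l) * k = d * k + l * k + n * (1 * k)" by (simp add: algebra_simps)
    ultimately have "ord_at V x (d * k + l * k + n * (1 * k)) (\<lambda>y. t (r y) ^ n * g (r y)) (n * e + 0)" by metis
    hence "ord_at V x (d * k + l * k + n * (1 * k)) (\<lambda>y. f (r y) * h (r y) * t0 (r y) ^ n) (n * e + 0)"
      by (rule ord_at_cong[OF V x _ ord_at_form[OF l]]) (rule 1(6), simp only: surj, rule imageI)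
    hence "n * e + 0 = a + 0 + n * 0" using l by (rule ord_at_unique)
    thus ?thesis using a by simp
  qed
  have mp: "map_point V r (hpoint x) = hpoint (r x)" by (rule map_point_hpoint(1)[OF V.irreducible_set_axioms r x rx])
  have ord: "ordv V (hpoint x) (pullback_fun UNIV V r U) = int e"
    if U: "U \<in> nonzero_functions Y" "ordv Y (hpoint (r x)) U = 1" for U
  proof -
    obtain f g where fg: "(f, g) \<in> fracs UNIV Y" "U = ratio UNIV Y f g"
      using U(1) unfolding nonzero_functions_def Y.carrier_FF by blast
    then obtain d where d: "is_form UNIV d f" "is_form UNIV d g" unfolding Y.fracs_iff by blast
    have nz: "\<not> zero_on Y f" "\<not> zero_on Y g"
      using U(1) Y.nonzero_functions_ratio[OF fg(1)] fg by (auto simp: Y.fracs_iff)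
    obtain a where a: "ord_at Y (r x) d f a" using ord_at_exists[OF Y y d(1) nz(1)] .
    obtain b where b: "ord_at Y (r x) d g b" using ord_at_exists[OF Y y d(2) nz(2)] .
    note ab = a b
    have 1: "int a - int b = 1" using U(2) ordv_ratio_ord_at[OF Y y ab] fg(2) by simp
    have "ordv V (hpoint x) (pullback_fun UNIV V r U) = int (a * e) - int (b * e)"
      unfolding fg(2) pullback_fun_ratio(2)[OF V.irreducible_set_axioms Y.irreducible_set_axioms coeff_ring_UNIV r surj fg(1)]
      using ordv_ratio_ord_at[OF V x pull[OF ab(1)] pull[OF ab(2)]] by (simp add: o_def)
    also have "\<dots> = (int a - int b) * int e" by (simp add: left_diff_distrib)
    finally show ?thesis using 1 by simp
  qed
  let ?U = "ratio UNIV Y t t0"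
  have frt: "(t, t0) \<in> fracs UNIV Y" using c.fracs_atI[OF c.t_form c.t0_form c.t0_x] .
  have U1: "?U \<in> nonzero_functions Y" using Y.nonzero_functions_ratio[OF frt] c.t_nz by simp
  have U2: "ordv Y (hpoint (r x)) ?U = 1"
    using ordv_ratio_ord_at[OF Y y t1 ord_at_0[OF Y y c.t0_form c.t0_x]] by simp
  have "ram_index V Y r (hpoint x) = int e"
    unfolding ram_index_def mp
  proof (rule the_equality)
    show "\<forall>t\<in>nonzero_functions Y. ordv Y (hpoint (r x)) t = 1 \<longrightarrow> ordv V (hpoint x) (pullback_fun UNIV V r t) = int e"
      using ord by blast
    fix e' assume "\<forall>t\<in>nonzero_functions Y. ordv Y (hpoint (r x)) t = 1 \<longrightarrow> ordv V (hpoint x) (pullback_fun UNIV V r t) = e'"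
    thus "e' = int e" using U1 U2 ord by metis
  qed
  thus ?thesis using pull by blast
qed

text \<open>The form \<open>l\<close> has order 1 at \<open>p0\<close>, so its pullback through
  \<open>m\<close> and \<open>r\<close> has as order the product of the two ramification indices,
  which is the multiplicity in the iterated pullback. The same pullback is \<open>h * h'\<close>
  with \<open>h'\<close> a unit wherever \<open>h\<close> vanishes, so this is also the order of
  \<open>h\<close>.\<close>

lemma hyperplane_divisor_eq_pullback:
  fixes r :: "'a::field_char_0^'m \<Rightarrow> 'a^'n" and m :: "'a^'n \<Rightarrow> 'a^'k"
  assumes D: "smooth_curve D" and C: "smooth_curve C" and G: "smooth_curve G"
    and r: "forms_over UNIV k r" "\<Union>C = r ` \<Union>D" and m: "forms_over UNIV 1 m" "\<Union>G = m ` \<Union>C"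
    and h: "is_form UNIV 1 h" "\<not> zero_on D h" and h': "is_form UNIV d' h'"
    and l: "ord_at G p0 1 l 1"
    and eq: "\<And>w. w \<in> \<Union>D \<Longrightarrow> l (m (r w)) = h w * h' w"
    and nv: "\<And>w. w \<in> \<Union>D \<Longrightarrow> h w = 0 \<Longrightarrow> h' w \<noteq> 0"
    and pt: "\<And>w. w \<in> \<Union>D \<Longrightarrow> h w = 0 \<longleftrightarrow> hpoint (m (r w)) = hpoint p0"
    and deg: "1 + d' = k"
  shows "hyperplane_divisor D h = pullback_divisor D C r (pullback_divisor C G m (point_divisor (hpoint p0)))"
proof
  fix P
  interpret D: irreducible_set D by (rule smooth_curve_irreducible[OF D])
  interpret C: irreducible_set C by (rule smooth_curve_irreducible[OF C])
  interpret G: irreducible_set G by (rule smooth_curve_irreducible[OF G])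
  show "hyperplane_divisor D h P = pullback_divisor D C r (pullback_divisor C G m (point_divisor (hpoint p0))) P"
  proof (cases "P \<in> D")
    case True
    then obtain w where w: "w \<in> \<Union>D" and P: "P = hpoint w" by (rule D.point_rep)
    have rw: "r w \<in> \<Union>C" unfolding r(2) using w by (rule imageI)
    have mrw: "m (r w) \<in> \<Union>G" unfolding m(2) using rw by (rule imageI)
    have mp: "map_point D r (hpoint w) = hpoint (r w)" "map_point C m (hpoint (r w)) = hpoint (m (r w))"
      using map_point_hpoint(1)[OF D.irreducible_set_axioms r(1) w C.point_nonzero[OF rw]]
        map_point_hpoint(1)[OF C.irreducible_set_axioms m(1) rw G.point_nonzero[OF mrw]] by auto
    obtain e where e: "ram_index D C r (hpoint w) = int e"
      "\<And>d f n. ord_at C (r w) d f n \<Longrightarrow> ord_at D w (d * k) (\<lambda>y. f (r y)) (n * e)"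
      using ramification_exists[OF D C r w] by blast
    obtain e' where e': "ram_index C G m (hpoint (r w)) = int e'"
      "\<And>d f n. ord_at G (m (r w)) d f n \<Longrightarrow> ord_at C (r w) (d * 1) (\<lambda>y. f (m y)) (n * e')"
      using ramification_exists[OF C G m rw] by blast
    obtain n where n: "ord_at D w 1 h n" using ord_at_exists[OF D w h] by blast
    have "int n = (if hpoint (m (r w)) = hpoint p0 then int e * int e' else 0)"
    proof (cases "h w = 0")
      case False
      have "n = 0" using ord_at_unique[OF n ord_at_0[OF D w h(1) False]] .
      thus ?thesis using False pt[OF w] by simp
    next
      case True
      have hp: "hpoint (m (r w)) = hpoint p0" using True pt[OF w] by simp
      have lf: "is_form UNIV 1 l" by (rule ord_at_form[OF l])
      have "p0 \<in> hpoint (m (r w))" using hp hpoint_self[of p0] by simp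
      hence p0: "p0 \<in> \<Union>G" using G.hpoint_mem[OF mrw] by blast
      have "\<not> zero_on G l" by (rule ord_at_nonzero[OF G p0 l])
      then obtain a where a: "ord_at G (m (r w)) 1 l a" using ord_at_exists[OF G mrw lf] by blast
      have "a = 1" using ord_at_unique_hpoint[OF a l hp] .
      hence 1: "ord_at D w (1 * 1 * k) (\<lambda>y. l (m (r y))) (1 * e' * e)" using e(2)[OF e'(2)[OF a]] by simp
      have "ord_at D w (1 + d') (\<lambda>y. h y * h' y) (n + 0)"
        by (rule ord_at_mult[OF D w n ord_at_0[OF D w h' nv[OF w True]]])
      hence 2: "ord_at D w (1 * 1 * k) (\<lambda>y. h y * h' y) (n + 0)" using deg by simp
      have "ord_at D w (1 * 1 * k) (\<lambda>y. l (m (r y))) (n + 0)"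
        by (rule ord_at_cong[OF D w 2 ord_at_form[OF 1]]) (rule eq)
      hence "n + 0 = 1 * e' * e" using 1 by (rule ord_at_unique)
      thus ?thesis using hp by simp
    qed
    thus ?thesis
      unfolding P hyperplane_divisor_ord_at[OF D w n] pullback_divisor_def point_divisor_def mp e(1) e'(1)
      using True P C.hpoint_mem[OF rw] by (simp add: mp e(1) e'(1))
  qed (simp add: hyperplane_divisor_def pullback_divisor_def)
qed

section \<open>The curves \<open>\<theta>\<^sup>2 = a(c, d)\<close>, \<open>\<psi>\<^sup>2 = b(c, d)\<close>\<close>

text \<open>Sums of forms of different degrees are no forms, but they are still polynomial on every
  line. This class is closed under sums, differences and products and keeps degrees out of the
  cancellation arguments.\<close>

definition polyfun :: "('a::field_char_0^'n \<Rightarrow> 'a) \<Rightarrow> bool" where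
  "polyfun f \<longleftrightarrow> (\<forall>x y. \<exists>p. \<forall>t. poly p t = f (x + t *s y))"

lemma polyfun_form: "is_form S d f \<Longrightarrow> polyfun f"
  unfolding polyfun_def using is_form_on_line by blast

lemma polyfun_add: "polyfun f \<Longrightarrow> polyfun g \<Longrightarrow> polyfun (\<lambda>x. f x + g x)"
  unfolding polyfun_def by (metis poly_add)

lemma polyfun_diff: "polyfun f \<Longrightarrow> polyfun g \<Longrightarrow> polyfun (\<lambda>x. f x - g x)"
  unfolding polyfun_def by (metis poly_diff)

lemma polyfun_mult: "polyfun f \<Longrightarrow> polyfun g \<Longrightarrow> polyfun (\<lambda>x. f x * g x)"
  unfolding polyfun_def by (metis poly_mult)

lemma polyfun_const: "polyfun (\<lambda>_. k)"
  unfolding polyfun_def by (metis poly_pCons poly_0 mult_zero_right add_0_right)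

lemma polyfun_power: "polyfun f \<Longrightarrow> polyfun (\<lambda>x. f x ^ n)"
  by (induction n) (simp_all add: polyfun_const polyfun_mult)

lemmas polyfun_intros = polyfun_add polyfun_diff polyfun_mult polyfun_const polyfun_power

text \<open>On the line joining a point where \<open>f\<close> is nonzero with one where
  \<open>g\<close> is nonzero, both factors would be nonzero polynomials with product 0.\<close>

lemma polyfun_mult_eq_0:
  assumes "polyfun f" "polyfun g" "\<And>x. f x * g x = 0"
  shows "(\<forall>x. f x = 0) \<or> (\<forall>x. g x = 0)"
proof (rule ccontr)
  assume "\<not> ?thesis"
  then obtain x y where x: "f x \<noteq> 0" and y: "g y \<noteq> 0" by auto
  obtain p where p: "\<forall>t. poly p t = f (x + t *s (y - x))" using assms(1) unfolding polyfun_def by blast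
  obtain q where q: "\<forall>t. poly q t = g (x + t *s (y - x))" using assms(2) unfolding polyfun_def by blast
  have "poly (p * q) t = 0" for t using p q assms(3) by (simp only: poly_mult)
  hence "p * q = 0" using poly_all_0_iff_0 by blast
  hence "p = 0 \<or> q = 0" by simp
  moreover have "poly p 0 \<noteq> 0" "poly q 1 \<noteq> 0" using p q x y by auto
  ultimately show False by auto
qed

lemma polyfun_cancel:
  assumes "polyfun f" "f u \<noteq> 0" "polyfun g" "\<And>x. f x * g x = 0"
  shows "g x = 0"
  using polyfun_mult_eq_0[OF assms(1,3,4)] assms(2) by blast

lemma polyfun_zero:
  fixes f :: "'a::field_char_0^'n \<Rightarrow> 'a"
  assumes f: "polyfun f" and z: "\<And>x. x \<noteq> 0 \<Longrightarrow> f x = 0"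
  shows "f x = 0"
proof (cases "x = 0")
  case True
  define e :: "'a^'n" where "e = (\<chi> i. 1)"
  have e: "t *s e \<noteq> 0" if "t \<noteq> 0" for t using that by (simp add: e_def vec_eq_iff)
  obtain p where p: "\<forall>t. poly p t = f (0 + t *s e)" using f unfolding polyfun_def by blast
  \<comment> \<open>Nothing is known at \<open>t = 0\<close>; the factor \<open>[:0, 1:]\<close>
    fills that gap and is then divided out.\<close>
  have "poly (p * [:0, 1:]) t = 0" for t using p z[OF e] by (cases "t = 0") simp_all
  hence "p * [:0, 1:] = 0" using poly_all_0_iff_0 by blast
  hence "p = 0" by simp
  thus ?thesis using p[rule_format, of 0] True by simp
qed (rule z)

section \<open>Binary forms\<close>

lemma linear2:
  fixes l :: "'a::field^2 \<Rightarrow> 'a"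
  assumes "is_form S 1 l" obtains p q where "\<And>z. l z = p * z $ 1 + q * z $ 2"
proof -
  obtain a where "l = (\<lambda>x. \<Sum>i\<in>UNIV. a i * x $ i)"
    using linear_form_expand[OF coeff_ring_UNIV is_form_UNIV[OF assms]] by blast
  thus ?thesis using that[of "a 1" "a 2"] by (simp add: sum_2)
qed

lemma linear2_kernel:
  fixes l :: "'a::field^2 \<Rightarrow> 'a"
  assumes "is_form S 1 l" shows "\<exists>k. k \<noteq> 0 \<and> l k = 0"
proof -
  obtain p q where l: "\<And>z. l z = p * z $ 1 + q * z $ 2" by (rule linear2[OF assms]) (rule that)
  show ?thesis
  proof (cases "p = 0 \<and> q = 0")
    case True thus ?thesis using l by (intro exI[of _ "vector [1, 0]"]) (auto simp: vec_eq_iff forall_2)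
  next
    case False thus ?thesis using l by (intro exI[of _ "vector [q, - p]"]) (auto simp: vec_eq_iff forall_2)
  qed
qed

lemma linear2_proportional:
  fixes l m :: "'a::field^2 \<Rightarrow> 'a"
  assumes l: "is_form UNIV 1 l" and m: "is_form UNIV 1 m" and k: "k \<noteq> 0" "l k = 0" "m k = 0"
  shows "m z * l u = m u * l z"
proof -
  obtain p q where lz: "\<And>z. l z = p * z $ 1 + q * z $ 2" by (rule linear2[OF l]) (rule that)
  obtain p' q' where mz: "\<And>z. m z = p' * z $ 1 + q' * z $ 2" by (rule linear2[OF m]) (rule that)
  have e: "p * k $ 1 + q * k $ 2 = 0" "p' * k $ 1 + q' * k $ 2 = 0" using k(2,3) lz mz by auto
  have "(p * q' - p' * q) * k $ 1 = q' * (p * k $ 1 + q * k $ 2) - q * (p' * k $ 1 + q' * k $ 2)"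
    "(p * q' - p' * q) * k $ 2 = p * (p' * k $ 1 + q' * k $ 2) - p' * (p * k $ 1 + q * k $ 2)"
    by (simp_all add: algebra_simps)
  hence "(p * q' - p' * q) * k $ 1 = 0" "(p * q' - p' * q) * k $ 2 = 0" unfolding e by simp_all
  hence d: "p * q' - p' * q = 0" using k(1) by (auto simp: vec_eq_iff forall_2)
  have "m z * l u - m u * l z = (p * q' - p' * q) * (z $ 2 * u $ 1 - z $ 1 * u $ 2)"
    unfolding lz mz by (simp add: algebra_simps)
  thus ?thesis unfolding d by simp
qed

text \<open>In two variables every linear form that vanishes at \<open>k\<close> is a multiple of
  \<open>l\<close>; expanding \<open>f\<close> at \<open>k\<close> therefore exhibits the factor
  \<open>l\<close>.\<close>

lemma binary_divide:
  fixes f l :: "'a::field^2 \<Rightarrow> 'a"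
  assumes f: "is_form UNIV d f" "f k = 0" "f v \<noteq> 0" and l: "is_form UNIV 1 l" "l k = 0" "l u \<noteq> 0" and k: "k \<noteq> 0"
  shows "\<exists>d' g. d = Suc d' \<and> is_form UNIV d' g \<and> (\<forall>z. f z = l z * g z)"
proof -
  have "d \<noteq> 0"
  proof
    assume "d = 0"
    hence "\<exists>c\<in>UNIV. f = (\<lambda>_. c)" using f(1) is_form_0D[OF coeff_ring_UNIV] by blast
    thus False using f(2,3) by auto
  qed
  then obtain d' where d: "d = Suc d'" by (cases d) auto
  obtain i where i: "k $ i \<noteq> 0" using k by (auto simp: vec_eq_iff)
  define mu where "mu = (\<lambda>z :: 'a^2. (1 / k $ i) * z $ i)"
  have mu: "is_form UNIV 1 mu" unfolding mu_def by (intro is_form_smult is_form_component) auto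
  have muk: "mu k = 1" using i by (simp add: mu_def)
  obtain g where g: "\<forall>i. is_form UNIV (d - 1) (g i)"
    "\<forall>x. f x = f k * mu x ^ d + (\<Sum>i\<in>UNIV. (x $ i - k $ i * mu x) * g i x)"
    using form_decompose_at[OF f(1) mu, of k] by (elim exE conjE) (rule that)
  have c: "z $ j - k $ j * mu z = (u $ j - k $ j * mu u) / l u * l z" for z j
  proof -
    have "is_form UNIV 1 (\<lambda>z. z $ j - k $ j * mu z)"
      by (intro is_form_diff is_form_smult is_form_component mu) auto
    from linear2_proportional[OF l(1) this k l(2), of z u]
    show ?thesis using l(3) muk by (simp add: field_simps)
  qed
  define G where "G = (\<lambda>z. \<Sum>j\<in>UNIV. (u $ j - k $ j * mu u) / l u * g j z)"
  have "is_form UNIV d' G" unfolding G_def using g(1) d by (intro is_form_sum is_form_smult) auto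
  moreover have "f z = l z * G z" for z
  proof -
    have "f z = (\<Sum>j\<in>UNIV. ((u $ j - k $ j * mu u) / l u * l z) * g j z)"
      using g(2)[rule_format, of z] f(2) unfolding c[of z] by simp
    thus ?thesis unfolding G_def sum_distrib_left by (simp add: mult_ac)
  qed
  ultimately show ?thesis using d by blast
qed

text \<open>A product with a simple zero at \<open>k\<close> is no square among rational functions
  on the line. Infinite descent: \<open>l\<close> divides \<open>X'\<close>, hence \<open>Y\<close>,
  and the quotients satisfy the same equation with smaller degree.\<close>

lemma square_simple_root:
  fixes X' Y :: "'a::field_char_0^2 \<Rightarrow> 'a"
  assumes l: "is_form UNIV 1 l" "l k = 0" "l u \<noteq> 0" and k: "k \<noteq> 0" and E: "polyfun E" "E k \<noteq> 0"
  shows "is_form UNIV m X' \<Longrightarrow> is_form UNIV n Y \<Longrightarrow> (\<And>z. X' z ^ 2 = l z * E z * Y z ^ 2) \<Longrightarrow>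
    (\<forall>z. X' z = 0) \<and> (\<forall>z. Y z = 0)"
proof (induction m arbitrary: X' Y n rule: less_induct)
  case (less m)
  have lp: "polyfun l" by (rule polyfun_form[OF l(1)])
  have Yp: "polyfun Y" by (rule polyfun_form[OF less.prems(2)])
  show ?case
  proof (cases "\<forall>z. X' z = 0")
    case True
    have "l z * (E z * Y z ^ 2) = 0" for z using less.prems(3)[of z] True by (simp add: mult.assoc)
    hence "E z * Y z ^ 2 = 0" for z
      using polyfun_cancel[OF lp l(3) polyfun_mult[OF E(1) polyfun_power[OF Yp]]] by blast
    hence "Y z ^ 2 = 0" for z using polyfun_cancel[OF E polyfun_power[OF Yp]] by blast
    thus ?thesis using True by simp
  next
    case False
    then obtain v where v: "X' v \<noteq> 0" by blast
    have "X' k ^ 2 = 0" using less.prems(3)[of k] l(2) by simp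
    hence "X' k = 0" by simp
    then obtain m' X1 where m': "m = Suc m'" "is_form UNIV m' X1" "\<forall>z. X' z = l z * X1 z"
      using binary_divide[OF less.prems(1) _ v l k] by blast
    have X1p: "polyfun X1" by (rule polyfun_form[OF m'(2)])
    have "l z * (l z * X1 z ^ 2 - E z * Y z ^ 2) = 0" for z
      using less.prems(3)[of z] m'(3) by (simp add: algebra_simps power2_eq_square)
    moreover have "polyfun (\<lambda>z. l z * X1 z ^ 2 - E z * Y z ^ 2)"
      by (intro polyfun_intros lp X1p E(1) Yp)
    ultimately have "l z * X1 z ^ 2 - E z * Y z ^ 2 = 0" for z using polyfun_cancel[OF lp l(3)] by blast
    hence e1: "l z * X1 z ^ 2 = E z * Y z ^ 2" for z by simp
    have Yk: "Y k = 0" using e1[of k] l(2) E(2) by simp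
    have "\<exists>v. Y v \<noteq> 0"
    proof (rule ccontr)
      assume "\<not> ?thesis" hence "X' v ^ 2 = 0" using less.prems(3)[of v] by simp
      thus False using v by simp
    qed
    then obtain v' where v': "Y v' \<noteq> 0" by blast
    obtain n' Y1 where n': "n = Suc n'" "is_form UNIV n' Y1" "\<forall>z. Y z = l z * Y1 z"
      using binary_divide[OF less.prems(2) Yk v' l k] by blast
    have Y1p: "polyfun Y1" by (rule polyfun_form[OF n'(2)])
    have "l z * (X1 z ^ 2 - l z * E z * Y1 z ^ 2) = 0" for z
      using e1[of z] n'(3) by (simp add: algebra_simps power2_eq_square)
    moreover have "polyfun (\<lambda>z. X1 z ^ 2 - l z * E z * Y1 z ^ 2)"
      by (intro polyfun_intros lp X1p E(1) Y1p)
    ultimately have "X1 z ^ 2 - l z * E z * Y1 z ^ 2 = 0" for z using polyfun_cancel[OF lp l(3)] by blast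
    hence "X1 z ^ 2 = l z * E z * Y1 z ^ 2" for z by simp
    hence "\<forall>z. X1 z = 0" using less.IH[OF _ m'(2) n'(2)] m'(1) by blast
    thus ?thesis using m'(3) v by simp
  qed
qed

lemma binary_root_multiplicity:
  fixes f l :: "'a::field^2 \<Rightarrow> 'a"
  assumes l: "is_form UNIV 1 l" "l k = 0" "l u \<noteq> 0" and k: "k \<noteq> 0"
  shows "is_form UNIV d f \<Longrightarrow> f v \<noteq> 0 \<Longrightarrow>
    \<exists>j n g. d = j + n \<and> is_form UNIV n g \<and> g k \<noteq> 0 \<and> (\<forall>z. f z = l z ^ j * g z)"
proof (induction d arbitrary: f v)
  case (0 f v)
  obtain c where "f = (\<lambda>_. c)" using is_form_0D[OF coeff_ring_UNIV 0(1)] by blast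
  thus ?case using 0 by (intro exI[of _ 0] exI[of _ 0] exI[of _ f]) simp
next
  case (Suc d f v)
  show ?case
  proof (cases "f k = 0")
    case True
    obtain d' g where g: "Suc d = Suc d'" "is_form UNIV d' g" "\<forall>z. f z = l z * g z"
      using binary_divide[OF Suc.prems(1) True Suc.prems(2) l k] by blast
    have "g v \<noteq> 0" using Suc.prems(2) g(3) by auto
    then obtain j n h where "d = j + n" "is_form UNIV n h" "h k \<noteq> 0" "\<forall>z. g z = l z ^ j * h z"
      using Suc.IH[of g v] g(1,2) by auto
    thus ?thesis using g(3) by (intro exI[of _ "Suc j"] exI[of _ n] exI[of _ h]) simp
  next
    case False
    thus ?thesis using Suc.prems by (intro exI[of _ 0] exI[of _ "Suc d"] exI[of _ f]) simp
  qed
qed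

section \<open>Adjoining two square roots to the line\<close>

lemma vector_4:
  "(vector [x, y, z, w] :: 'a::zero^4) $ 1 = x" "(vector [x, y, z, w] :: 'a^4) $ 2 = y"
  "(vector [x, y, z, w] :: 'a^4) $ 3 = z" "(vector [x, y, z, w] :: 'a^4) $ 4 = w"
  by (simp_all add: vector_def)

definition pr :: "'a::field^4 \<Rightarrow> 'a^2" where
  "pr w = vector [w $ 1, w $ 2]"

lemma pr_nth [simp]: "pr w $ 1 = w $ 1" "pr w $ 2 = w $ 2"
  by (simp_all add: pr_def)

lemma pr_form: "forms_over UNIV 1 pr"
  unfolding forms_over_def forall_2 by (simp del: One_nat_def) (intro conjI is_form_component coeff_ring_UNIV)

lemma pr_scale: "pr (c *s w) = c *s pr w"
  by (simp add: vec_eq_iff forall_2)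

lemma form_pr: "is_form UNIV d f \<Longrightarrow> is_form UNIV d (\<lambda>w. f (pr w))"
  by (rule is_form_comp_linear[OF coeff_ring_UNIV _ pr_form])

text \<open>\<open>bform n j g\<close>: \<open>g\<close> is a form of degree \<open>n - j\<close>, where a negative degree forces \<open>g = 0\<close>.\<close>

definition bform :: "nat \<Rightarrow> nat \<Rightarrow> ('a::field^'n \<Rightarrow> 'a) \<Rightarrow> bool" where
  "bform n j g \<longleftrightarrow> (j \<le> n \<and> is_form UNIV (n - j) g) \<or> g = (\<lambda>_. 0)"

lemma bform_form: "bform n j g \<Longrightarrow> \<exists>d. is_form UNIV d g"
  unfolding bform_def using is_form_zero[OF coeff_ring_UNIV] by blast

lemma bform_0: "bform n 0 g \<longleftrightarrow> is_form UNIV n g"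
  unfolding bform_def by (auto simp: is_form_zero)

lemma bform_add: "bform n j f \<Longrightarrow> bform n j g \<Longrightarrow> bform n j (\<lambda>x. f x + g x)"
  unfolding bform_def by (auto simp: is_form_add)

lemma bform_diff: "bform n j f \<Longrightarrow> bform n j g \<Longrightarrow> bform n j (\<lambda>x. f x - g x)"
  unfolding bform_def by (auto simp: is_form_diff is_form_uminus)

lemma bform_smult: "bform n j f \<Longrightarrow> bform n j (\<lambda>x. k * f x)"
  unfolding bform_def by (auto simp: is_form_smult)

lemma bform_mult:
  assumes "bform n j f" "bform n' j' g" shows "bform (n + n') (j + j') (\<lambda>x. f x * g x)"
proof (cases "f = (\<lambda>_. 0) \<or> g = (\<lambda>_. 0)")
  case True thus ?thesis unfolding bform_def by auto
next
  case False
  hence 1: "j \<le> n" "j' \<le> n'" "is_form UNIV (n - j) f" "is_form UNIV (n' - j') g"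
    using assms unfolding bform_def by auto
  have "n + n' - (j + j') = (n - j) + (n' - j')" using 1(1,2) by simp
  thus ?thesis unfolding bform_def using 1 is_form_mult[OF coeff_ring_UNIV 1(3,4)] by simp
qed

lemma bform_raise:
  assumes "bform n (j + k) g" "is_form UNIV k q" shows "bform n j (\<lambda>x. q x * g x)"
proof (cases "g = (\<lambda>_. 0)")
  case True thus ?thesis unfolding bform_def by auto
next
  case False
  hence 1: "j + k \<le> n" "is_form UNIV (n - (j + k)) g" using assms unfolding bform_def by auto
  have "n - j = k + (n - (j + k))" using 1(1) by simp
  thus ?thesis unfolding bform_def using 1 is_form_mult[OF coeff_ring_UNIV assms(2) 1(2)] by simp
qed

lemma bform_Suc: "bform n j g \<Longrightarrow> bform (Suc n) (Suc j) g"
  unfolding bform_def by auto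

lemma bform_linear: "bform n j g \<Longrightarrow> is_form UNIV 1 q \<Longrightarrow> bform (Suc n) j (\<lambda>x. q x * g x)"
  using bform_raise[of "Suc n" j 1 g q] bform_Suc[of n j g] by simp

lemma bform_lift:
  assumes "bform n j g" "is_form UNIV j q" shows "is_form UNIV n (\<lambda>w. g (pr w) * q w)"
proof (cases "g = (\<lambda>_. 0)")
  case True thus ?thesis by (simp add: is_form_zero)
next
  case False
  hence 1: "j \<le> n" "is_form UNIV (n - j) g" using assms unfolding bform_def by auto
  show ?thesis using is_form_mult[OF coeff_ring_UNIV form_pr[OF 1(2)] assms(2)] 1(1) by simp
qed

text \<open>The norm from the biquadratic extension taken in two stages: conjugating
  \<open>s\<close> leaves \<open>u + v * t\<close>, and conjugating \<open>t\<close> then leaves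
  \<open>u^2 - b * v^2\<close>. The second factor on the left is the product of the other
  conjugates.\<close>

lemma sum_squares_cofactor:
  fixes p0 p1 q0 q1 s t a b :: "'a::comm_ring_1"
  assumes "s ^ 2 = a" "t ^ 2 = b"
  defines "u \<equiv> p0^2 + b * p1^2 - a * (q0^2 + b * q1^2)" and "v \<equiv> 2 * (p0 * p1 - a * (q0 * q1))"
  shows "(p0 + p1 * t + q0 * s + q1 * (s * t)) * ((p0 + p1 * t - (q0 * s + q1 * (s * t))) * (u - v * t)) = u^2 - b * v^2"
proof -
  have "(p0 + p1 * t + q0 * s + q1 * (s * t)) * (p0 + p1 * t - (q0 * s + q1 * (s * t))) = u + v * t"
    unfolding u_def v_def assms(1,2)[symmetric] by (simp add: algebra_simps power2_eq_square)
  hence "(p0 + p1 * t + q0 * s + q1 * (s * t)) * ((p0 + p1 * t - (q0 * s + q1 * (s * t))) * (u - v * t)) = (u + v * t) * (u - v * t)"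
    by (metis mult.assoc)
  also have "\<dots> = u^2 - b * v^2" unfolding assms(2)[symmetric] by (simp add: algebra_simps power2_eq_square)
  finally show ?thesis .
qed

text \<open>The zeros of the four linear forms are pairwise distinct points of the line, so
  \<open>l1 * l2\<close>, \<open>l3 * l4\<close> and the product of all four have only simple zeros.
  This gives both irreducibility and smoothness of the curve.\<close>

locale nf_curve =
  fixes l1 l2 l3 l4 :: "'a::{alg_closed_field, field_char_0}^2 \<Rightarrow> 'a"
  assumes lin: "is_form UNIV 1 l1" "is_form UNIV 1 l2" "is_form UNIV 1 l3" "is_form UNIV 1 l4"
    and indep: "\<And>z. l1 z = 0 \<Longrightarrow> l2 z = 0 \<Longrightarrow> z = 0" "\<And>z. l1 z = 0 \<Longrightarrow> l3 z = 0 \<Longrightarrow> z = 0"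
      "\<And>z. l1 z = 0 \<Longrightarrow> l4 z = 0 \<Longrightarrow> z = 0" "\<And>z. l2 z = 0 \<Longrightarrow> l3 z = 0 \<Longrightarrow> z = 0"
      "\<And>z. l2 z = 0 \<Longrightarrow> l4 z = 0 \<Longrightarrow> z = 0" "\<And>z. l3 z = 0 \<Longrightarrow> l4 z = 0 \<Longrightarrow> z = 0"
begin

definition a where "a z = l1 z * l2 z"
definition b where "b z = l3 z * l4 z"

definition nfset :: "('a^4) set" where
  "nfset = {w. w \<noteq> 0 \<and> (w $ 3)^2 = a (pr w) \<and> (w $ 4)^2 = b (pr w)}"

definition nfV :: "('a^4) set set" where "nfV = hpoint ` nfset"

lemma a_form: "is_form UNIV 2 a" and b_form: "is_form UNIV 2 b"
proof -
  have "is_form UNIV (1 + 1) (\<lambda>z. l1 z * l2 z)" "is_form UNIV (1 + 1) (\<lambda>z. l3 z * l4 z)"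
    by (intro is_form_mult lin coeff_ring_UNIV)+
  thus "is_form UNIV 2 a" "is_form UNIV 2 b" by (simp_all add: a_def[abs_def] b_def[abs_def] numeral_2_eq_2)
qed

lemmas a_poly = polyfun_form[OF a_form] and b_poly = polyfun_form[OF b_form]

lemma nonzero: "\<exists>u. l1 u \<noteq> 0" "\<exists>u. l3 u \<noteq> 0" "\<exists>u. a u \<noteq> 0" "\<exists>u. b u \<noteq> 0"
proof -
  obtain k1 where k1: "k1 \<noteq> 0" "l1 k1 = 0" using linear2_kernel[OF lin(1)] by blast
  obtain k3 where k3: "k3 \<noteq> 0" "l3 k3 = 0" using linear2_kernel[OF lin(3)] by blast
  have "l1 k3 \<noteq> 0" "l2 k3 \<noteq> 0" "l3 k1 \<noteq> 0" "l4 k1 \<noteq> 0" using k1 k3 indep by blast+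
  thus "\<exists>u. l1 u \<noteq> 0" "\<exists>u. l3 u \<noteq> 0" "\<exists>u. a u \<noteq> 0" "\<exists>u. b u \<noteq> 0" unfolding a_def b_def by auto
qed

lemma ab_not_both: "a z = 0 \<Longrightarrow> b z = 0 \<Longrightarrow> z = 0"
  unfolding a_def b_def using indep by auto

lemma nfset_pr_nonzero: "w \<in> nfset \<Longrightarrow> pr w \<noteq> 0"
proof
  assume w: "w \<in> nfset" and 0: "pr w = 0"
  have "a 0 = 0" "b 0 = 0" using is_form_at_0[OF a_form] is_form_at_0[OF b_form] by auto
  hence "w $ 3 = 0" "w $ 4 = 0" using w 0 by (auto simp: nfset_def)
  moreover have "w $ 1 = 0" "w $ 2 = 0" using 0 pr_nth[of w] by (metis zero_index)+
  ultimately have "w = 0" by (simp add: vec_eq_iff forall_4)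
  thus False using w by (simp add: nfset_def)
qed

lemma nfset_scale: "w \<in> nfset \<Longrightarrow> c \<noteq> 0 \<Longrightarrow> c *s w \<in> nfset"
  unfolding nfset_def pr_scale
  by (simp add: pr_scale is_form_homogeneous[OF a_form] is_form_homogeneous[OF b_form] power_mult_distrib)

lemma Union_nfV: "\<Union>nfV = nfset"
  unfolding nfV_def using nfset_scale by (auto simp: mem_hpoint_iff)

lemma nfset_above:
  assumes z: "z \<noteq> 0"
  obtains s t where "s^2 = a z" "t^2 = b z" "vector [z $ 1, z $ 2, s, t] \<in> nfset" "vector [z $ 1, z $ 2, - s, t] \<in> nfset"
    "vector [z $ 1, z $ 2, s, - t] \<in> nfset" "vector [z $ 1, z $ 2, - s, - t] \<in> nfset"
proof -
  obtain s where s: "s ^ 2 = a z" using nth_root_exists[of 2 "a z"] by auto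
  obtain t where t: "t ^ 2 = b z" using nth_root_exists[of 2 "b z"] by auto
  have "pr (vector [z $ 1, z $ 2, x, y]) = z" for x y by (simp add: vec_eq_iff forall_2 vector_4)
  moreover have "vector [z $ 1, z $ 2, x, y] \<noteq> (0 :: 'a^4)" for x y
    using z by (auto simp: vec_eq_iff forall_2 forall_4 vector_4)
  ultimately show ?thesis using s t by (intro that[of s t]) (simp_all add: nfset_def vector_4)
qed

text \<open>Squares of the last two coordinates are replaced by \<open>a\<close> and
  \<open>b\<close>. Each component loses as many degrees as the monomial beside it has, which may
  exceed \<open>n\<close>; hence \<open>bform\<close> instead of \<open>is_form\<close>.\<close>

lemma reduce:
  assumes "is_form UNIV n f"
  shows "\<exists>p0 p1 q0 q1. bform n 0 p0 \<and> bform n 1 p1 \<and> bform n 1 q0 \<and> bform n 2 q1 \<and>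
    (\<forall>w. (w $ 3)^2 = a (pr w) \<longrightarrow> (w $ 4)^2 = b (pr w) \<longrightarrow>
      f w = p0 (pr w) + p1 (pr w) * w $ 4 + q0 (pr w) * w $ 3 + q1 (pr w) * (w $ 3 * w $ 4))"
  using coeff_ring_UNIV assms
proof (induction rule: is_form_induct)
  case (const k)
  show ?case
    by (intro exI[of _ "\<lambda>_. k"] exI[of _ "\<lambda>_. 0"]) (simp add: bform_0 is_form_const, simp add: bform_def)
next
  case (add n f g)
  obtain p0 p1 q0 q1 where 1: "bform n 0 p0" "bform n 1 p1" "bform n 1 q0" "bform n 2 q1"
    "\<forall>w. (w $ 3)^2 = a (pr w) \<longrightarrow> (w $ 4)^2 = b (pr w) \<longrightarrow>
      f w = p0 (pr w) + p1 (pr w) * w $ 4 + q0 (pr w) * w $ 3 + q1 (pr w) * (w $ 3 * w $ 4)"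
    using add(3) by (elim exE conjE) (rule that)
  obtain p0' p1' q0' q1' where 2: "bform n 0 p0'" "bform n 1 p1'" "bform n 1 q0'" "bform n 2 q1'"
    "\<forall>w. (w $ 3)^2 = a (pr w) \<longrightarrow> (w $ 4)^2 = b (pr w) \<longrightarrow>
      g w = p0' (pr w) + p1' (pr w) * w $ 4 + q0' (pr w) * w $ 3 + q1' (pr w) * (w $ 3 * w $ 4)"
    using add(4) by (elim exE conjE) (rule that)
  show ?case
    by (intro exI[of _ "\<lambda>z. p0 z + p0' z"] exI[of _ "\<lambda>z. p1 z + p1' z"] exI[of _ "\<lambda>z. q0 z + q0' z"]
        exI[of _ "\<lambda>z. q1 z + q1' z"] conjI bform_add 1 2)
       (simp add: 1(5) 2(5) algebra_simps)
next
  case (mult n f i)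
  obtain p0 p1 q0 q1 where 1: "bform n 0 p0" "bform n 1 p1" "bform n 1 q0" "bform n 2 q1"
    "\<And>w. (w $ 3)^2 = a (pr w) \<Longrightarrow> (w $ 4)^2 = b (pr w) \<Longrightarrow>
      f w = p0 (pr w) + p1 (pr w) * w $ 4 + q0 (pr w) * w $ 3 + q1 (pr w) * (w $ 3 * w $ 4)"
    using mult(2) by (elim exE conjE) (rule that, auto)
  note F = 1(5) and B = 1(1-4)
  have c: "is_form UNIV 1 (\<lambda>z :: 'a^2. z $ j)" for j by (rule is_form_component) simp
  have s: "bform (Suc n) 1 p0" "bform (Suc n) 2 p1" "bform (Suc n) 2 q0" "bform (Suc n) 3 q1"
    using bform_Suc[OF 1(1)] bform_Suc[OF 1(2)] bform_Suc[OF 1(3)] bform_Suc[OF 1(4)]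
    by (simp_all add: numeral_2_eq_2 numeral_3_eq_3)
  have s': "bform (Suc n) 0 (\<lambda>z. a z * q0 z)" "bform (Suc n) 1 (\<lambda>z. a z * q1 z)"
    "bform (Suc n) 0 (\<lambda>z. b z * p1 z)" "bform (Suc n) 1 (\<lambda>z. b z * q1 z)"
    using bform_raise[OF _ a_form, of "Suc n" 0 q0] bform_raise[OF _ a_form, of "Suc n" 1 q1]
      bform_raise[OF _ b_form, of "Suc n" 0 p1] bform_raise[OF _ b_form, of "Suc n" 1 q1] s(2-4)
    by (simp_all del: One_nat_def add_2_eq_Suc add_2_eq_Suc')
  consider "i = 1" | "i = 2" | "i = 3" | "i = 4" using exhaust_4 by blast
  thus ?case
  proof cases
    case 1
    show ?thesis unfolding 1
      by (intro exI[of _ "\<lambda>z. z $ 1 * p0 z"] exI[of _ "\<lambda>z. z $ 1 * p1 z"] exI[of _ "\<lambda>z. z $ 1 * q0 z"]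
          exI[of _ "\<lambda>z. z $ 1 * q1 z"] conjI bform_linear B c)
         (simp add: F algebra_simps)
  next
    case 2
    show ?thesis unfolding 2
      by (intro exI[of _ "\<lambda>z. z $ 2 * p0 z"] exI[of _ "\<lambda>z. z $ 2 * p1 z"] exI[of _ "\<lambda>z. z $ 2 * q0 z"]
          exI[of _ "\<lambda>z. z $ 2 * q1 z"] conjI bform_linear B c)
         (simp add: F algebra_simps)
  next
    case 3
    have eq: "w $ 3 * f w = a (pr w) * q0 (pr w) + a (pr w) * q1 (pr w) * w $ 4 + p0 (pr w) * w $ 3 + p1 (pr w) * (w $ 3 * w $ 4)"
      if h: "(w $ 3)^2 = a (pr w)" "(w $ 4)^2 = b (pr w)" for w
      unfolding F[OF h] h(1)[symmetric] by (simp add: algebra_simps power2_eq_square)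
    show ?thesis unfolding 3
      by (intro exI[of _ "\<lambda>z. a z * q0 z"] exI[of _ "\<lambda>z. a z * q1 z"] exI[of _ p0] exI[of _ p1] conjI s s' allI impI)
         (rule eq)
  next
    case 4
    have eq: "w $ 4 * f w = b (pr w) * p1 (pr w) + p0 (pr w) * w $ 4 + b (pr w) * q1 (pr w) * w $ 3 + q0 (pr w) * (w $ 3 * w $ 4)"
      if h: "(w $ 3)^2 = a (pr w)" "(w $ 4)^2 = b (pr w)" for w
      unfolding F[OF h] h(2)[symmetric] by (simp add: algebra_simps power2_eq_square)
    show ?thesis unfolding 4
      by (intro exI[of _ "\<lambda>z. b z * p1 z"] exI[of _ p0] exI[of _ "\<lambda>z. b z * q1 z"] exI[of _ q0] conjI s s' allI impI)
         (rule eq)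
  qed
qed

end

lemma four_signs:
  fixes s t u v :: "'a::field_char_0"
  assumes "s + t + u + v = 0" "s + t - u - v = 0" "s - t + u - v = 0" "s - t - u + v = 0"
  shows "s = 0 \<and> t = 0 \<and> u = 0 \<and> v = 0"
proof -
  have "4 * s = (s + t + u + v) + (s + t - u - v) + (s - t + u - v) + (s - t - u + v)"
    "4 * t = (s + t + u + v) + (s + t - u - v) - (s - t + u - v) - (s - t - u + v)"
    "4 * u = (s + t + u + v) - (s + t - u - v) + (s - t + u - v) - (s - t - u + v)"
    "4 * v = (s + t + u + v) - (s + t - u - v) - (s - t + u - v) + (s - t - u + v)"
    by simp_all
  thus ?thesis unfolding assms by simp
qed

context nf_curve
begin

text \<open>Above each point of the line lie the points with all choices of signs of the two roots;
  the four resulting equations separate the components.\<close>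

lemma components_zero:
  assumes p: "polyfun p0" "polyfun p1" "polyfun q0" "polyfun q1"
    and z: "\<And>w. w \<in> nfset \<Longrightarrow> p0 (pr w) + p1 (pr w) * w $ 4 + q0 (pr w) * w $ 3 + q1 (pr w) * (w $ 3 * w $ 4) = 0"
  shows "p0 z = 0" "p1 z = 0" "q0 z = 0" "q1 z = 0"
proof -
  \<comment> \<open>At branch points a root is 0 and hides its component, so only products with
    \<open>a\<close> and \<open>b\<close> are known to vanish pointwise; these factors are cancelled
    as polynomial functions afterwards.\<close>
  have e: "p0 z = 0 \<and> b z * p1 z = 0 \<and> a z * q0 z = 0 \<and> a z * (b z * q1 z) = 0" if z0: "z \<noteq> 0" for z
  proof -
    obtain s t where st: "s^2 = a z" "t^2 = b z" and w: "vector [z $ 1, z $ 2, s, t] \<in> nfset" "vector [z $ 1, z $ 2, - s, t] \<in> nfset"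
      "vector [z $ 1, z $ 2, s, - t] \<in> nfset" "vector [z $ 1, z $ 2, - s, - t] \<in> nfset"
      by (rule nfset_above[OF z0]) (rule that)
    have "pr (vector [z $ 1, z $ 2, x, y]) = z" for x y by (simp add: vec_eq_iff forall_2 vector_4)
    hence eqs: "p0 z + p1 z * t + q0 z * s + q1 z * (s * t) = 0" "p0 z + p1 z * t - q0 z * s - q1 z * (s * t) = 0"
      "p0 z - p1 z * t + q0 z * s - q1 z * (s * t) = 0" "p0 z - p1 z * t - q0 z * s + q1 z * (s * t) = 0"
      using z[OF w(1)] z[OF w(2)] z[OF w(3)] z[OF w(4)] by (simp_all add: vector_4)
    have 0: "p0 z = 0" "p1 z * t = 0" "q0 z * s = 0" "q1 z * (s * t) = 0"
      using four_signs[OF eqs] by blast+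
    hence "p1 z = 0 \<or> t = 0" "q0 z = 0 \<or> s = 0" "q1 z = 0 \<or> s = 0 \<or> t = 0" by simp_all
    thus ?thesis unfolding st[symmetric] using 0(1) by auto
  qed
  obtain u u' where u: "a u \<noteq> 0" "b u' \<noteq> 0" using nonzero(3,4) by blast
  show "p0 z = 0" by (rule polyfun_zero[OF p(1)]) (use e in blast)
  have "b z * p1 z = 0" for z
    by (rule polyfun_zero[OF polyfun_mult[OF b_poly p(2)]]) (use e in blast)
  thus "p1 z = 0" using polyfun_cancel[OF b_poly u(2) p(2)] by blast
  have "a z * q0 z = 0" for z
    by (rule polyfun_zero[OF polyfun_mult[OF a_poly p(3)]]) (use e in blast)
  thus "q0 z = 0" using polyfun_cancel[OF a_poly u(1) p(3)] by blast
  have "a z * (b z * q1 z) = 0" for z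
    by (rule polyfun_zero[OF polyfun_mult[OF a_poly polyfun_mult[OF b_poly p(4)]]]) (use e in blast)
  hence "b z * q1 z = 0" for z using polyfun_cancel[OF a_poly u(1) polyfun_mult[OF b_poly p(4)]] by blast
  thus "q1 z = 0" using polyfun_cancel[OF b_poly u(2) p(4)] by blast
qed

lemma linear_form_zero_on:
  assumes f: "is_form UNIV 1 f" and z: "\<And>w. w \<in> nfset \<Longrightarrow> f w = 0"
  shows "f w = 0"
proof -
  obtain c where c: "f = (\<lambda>x. \<Sum>i\<in>UNIV. c i * x $ i)"
    using linear_form_expand[OF coeff_ring_UNIV f] by blast
  have f': "f w = c 1 * w $ 1 + c 2 * w $ 2 + c 3 * w $ 3 + c 4 * w $ 4" for w
    unfolding c by (simp add: sum_4)
  define p0 where "p0 = (\<lambda>z :: 'a^2. c 1 * z $ 1 + c 2 * z $ 2)"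
  have p0: "is_form UNIV 1 p0" unfolding p0_def by (intro is_form_add is_form_smult is_form_component) auto
  have "p0 (pr w) + c 4 * w $ 4 + c 3 * w $ 3 + 0 * (w $ 3 * w $ 4) = 0" if "w \<in> nfset" for w
    using z[OF that] unfolding f' p0_def by (simp add: algebra_simps)
  from components_zero[OF polyfun_form[OF p0] polyfun_const polyfun_const polyfun_const this]
  have "\<And>z. p0 z = 0" "c 4 = 0" "c 3 = 0" by auto
  hence "f w = p0 (pr w)" unfolding f' p0_def by simp
  thus ?thesis using \<open>\<And>z. p0 z = 0\<close> by simp
qed

text \<open>An element of norm 0 vanishes because \<open>a\<close>, \<open>b\<close> and
  \<open>a * b\<close> are no squares. First \<open>u^2 = b * v^2\<close> forces \<open>u\<close>
  and \<open>v\<close> to be 0, and what remains splits into two cases, each again an equation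
  between squares.\<close>

lemma norm_zero:
  assumes p: "is_form UNIV d0 p0" "is_form UNIV d1 p1" "is_form UNIV e0 q0" "is_form UNIV e1 q1"
    and u: "is_form UNIV du u" "is_form UNIV dv v"
    and u_eq: "\<And>z. u z = p0 z^2 + b z * p1 z^2 - a z * (q0 z^2 + b z * q1 z^2)"
    and v_eq: "\<And>z. v z = 2 * (p0 z * p1 z - a z * (q0 z * q1 z))"
    and N: "\<And>z. u z^2 - b z * v z^2 = 0"
  shows "p0 z = 0 \<and> p1 z = 0 \<and> q0 z = 0 \<and> q1 z = 0"
proof -
  note pp = polyfun_form[OF p(1)] polyfun_form[OF p(2)] polyfun_form[OF p(3)] polyfun_form[OF p(4)]
  obtain k1 where k1: "k1 \<noteq> 0" "l1 k1 = 0" using linear2_kernel[OF lin(1)] by blast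
  obtain k3 where k3: "k3 \<noteq> 0" "l3 k3 = 0" using linear2_kernel[OF lin(3)] by blast
  have k13: "l2 k1 \<noteq> 0" "l3 k1 \<noteq> 0" "l4 k1 \<noteq> 0" "l4 k3 \<noteq> 0" using k1 k3 indep by blast+
  obtain u1 u3 where u13: "l1 u1 \<noteq> 0" "l3 u3 \<noteq> 0" using nonzero(1,2) by blast
  note root_a = square_simple_root[OF lin(1) k1(2) u13(1) k1(1) polyfun_form[OF lin(2)] k13(1)]
  have l2b: "polyfun (\<lambda>z. l2 z * b z)" by (intro polyfun_mult polyfun_form[OF lin(2)] b_poly)
  have "l2 k1 * b k1 \<noteq> 0" using k13 by (simp add: b_def)
  note root_ab = square_simple_root[OF lin(1) k1(2) u13(1) k1(1) l2b this]
  obtain ua ub where uab: "a ua \<noteq> 0" "b ub \<noteq> 0" using nonzero(3,4) by blast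
  have "u z ^ 2 = l3 z * l4 z * v z ^ 2" for z using N[of z] by (simp add: b_def)
  from square_simple_root[OF lin(3) k3(2) u13(2) k3(1) polyfun_form[OF lin(4)] k13(4) u this]
  have uv: "u z = 0" "v z = 0" for z by auto
  have e1: "p0 z^2 + b z * p1 z^2 = a z * (q0 z^2 + b z * q1 z^2)" for z using uv(1)[of z] u_eq[of z] by simp
  have e2: "p0 z * p1 z = a z * (q0 z * q1 z)" for z using uv(2)[of z] v_eq[of z] by simp
  \<comment> \<open>By \<open>(x + y)^2 - 4 * x * y = (x - y)^2\<close>, the equations for the sum
    and the product of \<open>p0\<close> and \<open>p1\<close> terms give \<open>A^2 = B^2\<close>.
    The sign \<open>A = B\<close> leads to \<open>p0^2 = a * q0^2\<close>, the other sign to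
    \<open>p0^2 = a * b * q1^2\<close>.\<close>
  define A where "A = (\<lambda>z. p0 z^2 - b z * p1 z^2)"
  define B where "B = (\<lambda>z. a z * (q0 z^2 - b z * q1 z^2))"
  have AB: "(A z - B z) * (A z + B z) = 0" for z
  proof -
    have "(A z - B z) * (A z + B z) = (p0 z^2 + b z * p1 z^2)^2 - (a z * (q0 z^2 + b z * q1 z^2))^2
        - 4 * b z * ((p0 z * p1 z)^2 - (a z * (q0 z * q1 z))^2)"
      unfolding A_def B_def by (simp add: algebra_simps power2_eq_square)
    thus ?thesis unfolding e1 e2 by simp
  qed
  have AP: "polyfun A" unfolding A_def by (intro polyfun_diff polyfun_mult polyfun_power pp b_poly)
  have BP: "polyfun B" unfolding B_def by (intro polyfun_diff polyfun_mult polyfun_power pp a_poly b_poly)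
  consider "\<forall>z. A z - B z = 0" | "\<forall>z. A z + B z = 0"
    using polyfun_mult_eq_0[OF polyfun_diff[OF AP BP] polyfun_add[OF AP BP] AB] by blast
  thus ?thesis
  proof cases
    case 1
    have E: "2 * (p0 z^2 - l1 z * l2 z * q0 z^2) = (A z - B z) + ((p0 z^2 + b z * p1 z^2) - a z * (q0 z^2 + b z * q1 z^2))" for z
      unfolding A_def B_def a_def by (simp add: algebra_simps)
    have "2 * (p0 z^2 - l1 z * l2 z * q0 z^2) = 0" for z unfolding E e1 using 1 by simp
    hence "p0 z^2 = l1 z * l2 z * q0 z^2" for z by simp
    from root_a[OF p(1,3) this] have pq0: "\<forall>z. p0 z = 0" "\<forall>z. q0 z = 0" by auto
    have "b z * (p1 z^2 - l1 z * l2 z * q1 z^2) = 0" for z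
      using e1[of z] pq0 by (simp add: a_def algebra_simps)
    moreover have "polyfun (\<lambda>z. p1 z^2 - l1 z * l2 z * q1 z^2)"
      by (intro polyfun_diff polyfun_mult polyfun_power pp polyfun_form[OF lin(1)] polyfun_form[OF lin(2)])
    ultimately have "p1 z^2 - l1 z * l2 z * q1 z^2 = 0" for z using polyfun_cancel[OF b_poly uab(2)] by blast
    hence "p1 z^2 = l1 z * l2 z * q1 z^2" for z by simp
    from root_a[OF p(2,4) this] show ?thesis using pq0 by simp
  next
    case 2
    have E: "2 * (p0 z^2 - l1 z * (l2 z * b z) * q1 z^2) = (A z + B z) + ((p0 z^2 + b z * p1 z^2) - a z * (q0 z^2 + b z * q1 z^2))" for z
      unfolding A_def B_def a_def by (simp add: algebra_simps)
    have "2 * (p0 z^2 - l1 z * (l2 z * b z) * q1 z^2) = 0" for z unfolding E e1 using 2 by simp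
    hence "p0 z^2 = l1 z * (l2 z * b z) * q1 z^2" for z by simp
    from root_ab[OF p(1,4) this] have pq: "\<forall>z. p0 z = 0" "\<forall>z. q1 z = 0" by auto
    have "is_form UNIV (2 + d1) (\<lambda>z. b z * p1 z)" by (intro is_form_mult b_form p coeff_ring_UNIV)
    moreover have "(b z * p1 z)^2 = l1 z * (l2 z * b z) * q0 z^2" for z
    proof -
      have "b z * p1 z^2 = a z * q0 z^2" using e1[of z] pq by simp
      hence "b z * (b z * p1 z^2) = b z * (a z * q0 z^2)" by simp
      thus ?thesis by (simp add: a_def power2_eq_square mult_ac)
    qed
    ultimately have "(\<forall>z. b z * p1 z = 0) \<and> (\<forall>z. q0 z = 0)" by (rule root_ab[OF _ p(3)])
    thus ?thesis using pq polyfun_cancel[OF b_poly uab(2) pp(2)] by blast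
  qed
qed

text \<open>\<open>N\<close> is the norm of \<open>f\<close> and \<open>f'\<close> the product of
  its other three conjugates, which explains the degrees \<open>4 * n\<close> and
  \<open>3 * n\<close>. The norm transports questions about the curve to binary forms.\<close>

lemma cofactor_exists:
  assumes f: "is_form UNIV n f"
  shows "\<exists>f' N. is_form UNIV (3 * n) f' \<and> is_form UNIV (4 * n) N \<and> (\<forall>w\<in>nfset. f w * f' w = N (pr w)) \<and>
    ((\<forall>z. N z = 0) \<longrightarrow> (\<forall>w\<in>nfset. f w = 0))"
proof -
  obtain p0 p1 q0 q1 where p: "bform n 0 p0" "bform n 1 p1" "bform n 1 q0" "bform n 2 q1"
    and f_eq: "\<And>w. (w $ 3)^2 = a (pr w) \<Longrightarrow> (w $ 4)^2 = b (pr w) \<Longrightarrow>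
      f w = p0 (pr w) + p1 (pr w) * w $ 4 + q0 (pr w) * w $ 3 + q1 (pr w) * (w $ 3 * w $ 4)"
    using reduce[OF f] by (elim exE conjE) (rule that, auto)
  define u where "u = (\<lambda>z. p0 z^2 + b z * p1 z^2 - a z * (q0 z^2 + b z * q1 z^2))"
  define v where "v = (\<lambda>z. 2 * (p0 z * p1 z - a z * (q0 z * q1 z)))"
  define N where "N = (\<lambda>z. u z^2 - b z * v z^2)"
  define f' where "f' = (\<lambda>w. (p0 (pr w) + p1 (pr w) * w $ 4 - (q0 (pr w) * w $ 3 + q1 (pr w) * (w $ 3 * w $ 4))) *
    (u (pr w) - v (pr w) * w $ 4))"
  have ab: "is_form UNIV 4 (\<lambda>z. a z * b z)" using is_form_mult[OF coeff_ring_UNIV a_form b_form] by simp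
  have "bform (n + n) 0 (\<lambda>z. p0 z * p0 z)" using bform_mult[OF p(1) p(1)] by simp
  moreover have "bform (n + n) 0 (\<lambda>z. b z * (p1 z * p1 z))"
    by (rule bform_raise[where k = 2]) (use bform_mult[OF p(2) p(2)] b_form in \<open>simp_all add: numeral_2_eq_2\<close>)
  moreover have "bform (n + n) 0 (\<lambda>z. a z * (q0 z * q0 z))"
    by (rule bform_raise[where k = 2]) (use bform_mult[OF p(3) p(3)] a_form in \<open>simp_all add: numeral_2_eq_2\<close>)
  moreover have "bform (n + n) 0 (\<lambda>z. (a z * b z) * (q1 z * q1 z))"
    by (rule bform_raise[where k = 4]) (use bform_mult[OF p(4) p(4)] ab in simp_all)
  ultimately have "bform (n + n) 0 (\<lambda>z. p0 z * p0 z + b z * (p1 z * p1 z) -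
      (a z * (q0 z * q0 z) + (a z * b z) * (q1 z * q1 z)))"
    by (intro bform_add bform_diff)
  hence ub: "bform (n + n) 0 u" unfolding u_def by (simp add: power2_eq_square algebra_simps)
  have "bform (n + n) 1 (\<lambda>z. p0 z * p1 z)" using bform_mult[OF p(1) p(2)] by simp
  moreover have "bform (n + n) 1 (\<lambda>z. a z * (q0 z * q1 z))"
    by (rule bform_raise[where k = 2]) (use bform_mult[OF p(3) p(4)] a_form in simp_all)
  ultimately have vb: "bform (n + n) 1 v" unfolding v_def by (intro bform_smult bform_diff)
  have "bform (n + n + (n + n)) 0 (\<lambda>z. u z * u z)" using bform_mult[OF ub ub] by simp
  moreover have "bform (n + n + (n + n)) 0 (\<lambda>z. b z * (v z * v z))"
    by (rule bform_raise[where k = 2]) (use bform_mult[OF vb vb] b_form in \<open>simp_all add: numeral_2_eq_2\<close>)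
  ultimately have "bform (n + n + (n + n)) 0 (\<lambda>z. u z * u z - b z * (v z * v z))" by (rule bform_diff)
  hence "is_form UNIV (n + n + (n + n)) N" unfolding bform_0 N_def power2_eq_square .
  moreover have "n + n + (n + n) = 4 * n" by simp
  ultimately have NF: "is_form UNIV (4 * n) N" by (simp only:)
  have c: "is_form UNIV 1 (\<lambda>w :: 'a^4. w $ i)" for i by (rule is_form_component) simp
  have one: "is_form UNIV 0 (\<lambda>w :: 'a^4. 1)" by (rule is_form_const) auto
  have c34: "is_form UNIV 2 (\<lambda>w :: 'a^4. w $ 3 * w $ 4)"
    using is_form_mult[OF coeff_ring_UNIV c[of 3] c[of 4]] by (simp add: numeral_2_eq_2)
  have f1: "is_form UNIV n (\<lambda>w. p0 (pr w) * 1 + p1 (pr w) * w $ 4 - (q0 (pr w) * w $ 3 + q1 (pr w) * (w $ 3 * w $ 4)))"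
    by (intro is_form_add is_form_diff coeff_ring_UNIV bform_lift[OF p(1) one] bform_lift[OF p(2) c]
        bform_lift[OF p(3) c] bform_lift[OF p(4) c34])
  have f2: "is_form UNIV (n + n) (\<lambda>w. u (pr w) * 1 - v (pr w) * w $ 4)"
    by (intro is_form_diff coeff_ring_UNIV bform_lift[OF ub one] bform_lift[OF vb c])
  have "is_form UNIV (n + (n + n)) f'"
    using is_form_mult[OF coeff_ring_UNIV f1 f2] unfolding f'_def by simp
  moreover have "n + (n + n) = 3 * n" by simp
  ultimately have f'F: "is_form UNIV (3 * n) f'" by (simp only:)
  have prod: "f w * f' w = N (pr w)" if w: "w \<in> nfset" for w
  proof -
    have h: "(w $ 3)^2 = a (pr w)" "(w $ 4)^2 = b (pr w)" using w by (auto simp: nfset_def)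
    show ?thesis unfolding f_eq[OF h] f'_def N_def u_def v_def by (rule sum_squares_cofactor[OF h])
  qed
  have "\<forall>w\<in>nfset. f w = 0" if N0: "\<forall>z. N z = 0"
  proof
    fix w assume w: "w \<in> nfset"
    have h: "(w $ 3)^2 = a (pr w)" "(w $ 4)^2 = b (pr w)" using w by (auto simp: nfset_def)
    obtain d0 d1 e0 e1 du dv where d: "is_form UNIV d0 p0" "is_form UNIV d1 p1" "is_form UNIV e0 q0" "is_form UNIV e1 q1"
      "is_form UNIV du u" "is_form UNIV dv v"
      using bform_form[OF p(1)] bform_form[OF p(2)] bform_form[OF p(3)] bform_form[OF p(4)] bform_form[OF ub] bform_form[OF vb]
      by blast
    have "p0 z = 0 \<and> p1 z = 0 \<and> q0 z = 0 \<and> q1 z = 0" for z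
      by (rule norm_zero[OF d]) (use N0 in \<open>simp_all add: u_def v_def N_def\<close>)
    thus "f w = 0" unfolding f_eq[OF h] by simp
  qed
  thus ?thesis using NF f'F prod by (intro exI[of _ f'] exI[of _ N]) simp
qed

lemma nfset_above_nonempty: "z \<noteq> 0 \<Longrightarrow> \<exists>w\<in>nfset. pr w = z"
  by (rule nfset_above, assumption) (rule bexI, auto simp: vec_eq_iff forall_2 vector_4)

text \<open>If a product vanishes on the curve, the product of the norms vanishes on the line; one
  norm is then 0, and a form of norm 0 vanishes on the curve.\<close>

lemma irreducible_nfV: "irreducible_set nfV"
proof (unfold_locales)
  show "nfV \<subseteq> {hpoint x |x. x \<noteq> 0}" unfolding nfV_def nfset_def by blast
  have "vector [1, 1] \<noteq> (0 :: 'a^2)" by (simp add: vec_eq_iff forall_2)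
  thus "nfV \<noteq> {}" using nfset_above_nonempty unfolding nfV_def by blast
next
  fix d e and f g :: "'a^4 \<Rightarrow> 'a"
  assume f: "is_form UNIV d f" and g: "is_form UNIV e g" and fg: "zero_on nfV (\<lambda>x. f x * g x)"
  obtain f' Nf where 1: "\<forall>w\<in>nfset. f w * f' w = Nf (pr w)" "(\<forall>z. Nf z = 0) \<longrightarrow> (\<forall>w\<in>nfset. f w = 0)"
    and 11: "is_form UNIV (4 * d) Nf"
    using cofactor_exists[OF f] by (elim exE conjE) (rule that)
  obtain g' Ng where 2: "\<forall>w\<in>nfset. g w * g' w = Ng (pr w)" "(\<forall>z. Ng z = 0) \<longrightarrow> (\<forall>w\<in>nfset. g w = 0)"
    and 21: "is_form UNIV (4 * e) Ng"
    using cofactor_exists[OF g] by (elim exE conjE) (rule that)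
  have p: "polyfun Nf" "polyfun Ng" using polyfun_form 11 21 by blast+
  have "Nf z * Ng z = 0" for z
  proof (rule polyfun_zero[OF polyfun_mult[OF p]])
    fix z :: "'a^2" assume "z \<noteq> 0"
    then obtain w where w: "w \<in> nfset" "pr w = z" using nfset_above_nonempty by blast
    have "f w * g w = 0" using fg w(1) unfolding zero_on_def Union_nfV by blast
    thus "Nf z * Ng z = 0" using 1(1) 2(1) w by fastforce
  qed
  hence "(\<forall>z. Nf z = 0) \<or> (\<forall>z. Ng z = 0)" by (rule polyfun_mult_eq_0[OF p])
  thus "zero_on nfV f \<or> zero_on nfV g" unfolding zero_on_def Union_nfV using 1(2) 2(2) by blast
qed

section \<open>Local parameters on the normal form\<close>

lemma quadratic_split_at:
  fixes m1 m2 l :: "'a^2 \<Rightarrow> 'a"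
  assumes q: "is_form UNIV 1 m1" "is_form UNIV 1 m2" and k: "k \<noteq> 0" "m1 k * m2 k = 0"
    and ind: "\<And>z. m1 z = 0 \<Longrightarrow> m2 z = 0 \<Longrightarrow> z = 0"
    and l: "is_form UNIV 1 l" "l k = 0" "l u \<noteq> 0"
  shows "\<exists>l'. is_form UNIV 1 l' \<and> l' k \<noteq> 0 \<and> (\<forall>z. m1 z * m2 z = l z * l' z)"
proof -
  have main: "\<exists>l'. is_form UNIV 1 l' \<and> l' k \<noteq> 0 \<and> (\<forall>z. m1 z * m2 z = l z * l' z)"
    if q: "is_form UNIV 1 m1" "is_form UNIV 1 m2" and k0: "m1 k = 0" and ind: "\<And>z. m1 z = 0 \<Longrightarrow> m2 z = 0 \<Longrightarrow> z = 0" for m1 m2 :: "'a^2 \<Rightarrow> 'a"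
  proof -
    define c where "c = m1 u / l u"
    have m1: "m1 z = c * l z" for z
      using linear2_proportional[OF l(1) q(1) k(1) l(2) k0, of z u] l(3) by (simp add: c_def field_simps)
    have "c \<noteq> 0"
    proof
      assume "c = 0"
      obtain k2 where "k2 \<noteq> 0" "m2 k2 = 0" using linear2_kernel[OF q(2)] by blast
      thus False using ind[of k2] m1[of k2] \<open>c = 0\<close> by simp
    qed
    moreover have "m2 k \<noteq> 0" using ind k0 k(1) by blast
    ultimately show ?thesis
      using m1 q(2) by (intro exI[of _ "\<lambda>z. c * m2 z"]) (simp add: is_form_smult mult_ac)
  qed
  consider "m1 k = 0" | "m2 k = 0" using k(2) by auto
  thus ?thesis
  proof cases
    case 1 thus ?thesis using main[OF q _ ind] by blast
  next
    case 2
    from main[OF q(2,1) 2] ind obtain l' where "is_form UNIV 1 l'" "l' k \<noteq> 0" "\<forall>z. m2 z * m1 z = l z * l' z" by blast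
    thus ?thesis by (intro exI[of _ l']) (simp add: mult.commute)
  qed
qed

lemma curve_point_nfV:
  assumes x: "x \<in> nfset"
  shows "\<exists>t t0. curve_point nfV x t t0"
proof -
  interpret irreducible_set nfV by (rule irreducible_nfV)
  define k where "k = pr x"
  have k: "k \<noteq> 0" unfolding k_def by (rule nfset_pr_nonzero[OF x])
  have hx: "(x $ 3)^2 = a k" "(x $ 4)^2 = b k" using x by (auto simp: nfset_def k_def)
  have x12: "x $ 1 = k $ 1" "x $ 2 = k $ 2" by (simp_all add: k_def)
  define l where "l = (\<lambda>z :: 'a^2. k $ 2 * z $ 1 - k $ 1 * z $ 2)"
  have l: "is_form UNIV 1 l" unfolding l_def by (intro is_form_diff is_form_smult is_form_component) auto
  have lk: "l k = 0" by (simp add: l_def mult.commute)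
  have "\<exists>u. l u \<noteq> 0"
  proof (rule ccontr)
    assume n: "\<not> ?thesis"
    hence "l (vector [1, 0]) = 0" "l (vector [0, 1]) = 0" by blast+
    thus False using k by (simp add: l_def vec_eq_iff forall_2)
  qed
  then obtain u where lu: "l u \<noteq> 0" by blast
  obtain i where i: "k $ i \<noteq> 0" using k by (auto simp: vec_eq_iff)
  define mu where "mu = (\<lambda>z :: 'a^2. (1 / k $ i) * z $ i)"
  have mu: "is_form UNIV 1 mu" unfolding mu_def by (intro is_form_smult is_form_component) auto
  have muk: "mu k = 1" using i by (simp add: mu_def)
  let ?l = "\<lambda>w. l (pr w)" and ?m = "\<lambda>w. mu (pr w)"
  have lF: "is_form UNIV 1 ?l" and mF: "is_form UNIV 1 ?m" by (rule form_pr[OF l], rule form_pr[OF mu])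
  have c: "is_form UNIV 1 (\<lambda>w :: 'a^4. w $ j)" for j by (rule is_form_component) simp
  have nz: "\<not> zero_on nfV f" if "is_form UNIV 1 f" "f w \<noteq> 0" for f w
    using linear_form_zero_on[OF that(1), of w] that(2) unfolding zero_on_def Union_nfV by blast
  have germ: "curve_germ nfV x t ?m" if t: "is_form UNIV 1 t" "t x = 0" "t w \<noteq> 0" for t w
    by unfold_locales (use x t mF muk nz[OF t(1,3)] in \<open>auto simp: Union_nfV k_def\<close>)
  \<comment> \<open>At a branch point the vanishing root itself is the uniformiser; elsewhere the
    projection to the line is unramified and its local coordinate \<open>l\<close> serves. At most
    one of \<open>a\<close>, \<open>b\<close> vanishes at \<open>k\<close>.\<close>
  define t where "t = (if a k = 0 then (\<lambda>w. w $ 3) else if b k = 0 then (\<lambda>w. w $ 4) else ?l)"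
  have "\<exists>w. ?l w \<noteq> 0" using lu by (intro exI[of _ "vector [u $ 1, u $ 2, 0, 0]"]) (simp add: l_def vector_4)
  moreover have "\<exists>w :: 'a^4. w $ 3 \<noteq> 0" "\<exists>w :: 'a^4. w $ 4 \<noteq> 0"
    by (rule exI[of _ "vector [0, 0, 1, 0]"], simp add: vector_4) (rule exI[of _ "vector [0, 0, 0, 1]"], simp add: vector_4)
  ultimately have "\<exists>w. t w \<noteq> 0" unfolding t_def by auto
  then obtain w0 where w0: "t w0 \<noteq> 0" by blast
  have tF: "is_form UNIV 1 t" unfolding t_def using lF c by auto
  have tx: "t x = 0" unfolding t_def using hx lk by (auto simp: k_def)
  interpret G: curve_germ nfV x t ?m by (rule germ[OF tF tx w0])
  have t34: "x $ 3 = 0 \<Longrightarrow> t = (\<lambda>w. w $ 3)" "x $ 4 = 0 \<Longrightarrow> t = (\<lambda>w. w $ 4)"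
    using hx ab_not_both[of k] k unfolding t_def by auto
  \<comment> \<open>\<open>J\<close> is the ramification index of the projection to the line. At a
    branch point the simple zero of \<open>a\<close> or \<open>b\<close> gives
    \<open>l * l' = t^2\<close> with \<open>l'\<close> nonzero at \<open>k\<close>, hence
    \<open>J = 2\<close>.\<close>
  obtain J where J: "J \<ge> 1" "G.has_order 1 ?l J"
  proof (cases "a k = 0 \<or> b k = 0")
    case False
    hence "t = ?l" by (simp add: t_def)
    thus ?thesis using G.has_order_t that[of 1] by simp
  next
    case True
    have "\<exists>l'. is_form UNIV 1 l' \<and> l' k \<noteq> 0 \<and> (\<forall>w\<in>nfset. ?l w * l' (pr w) = t w ^ 2)"
    proof (cases "a k = 0")
      case True
      obtain l' where "is_form UNIV 1 l'" "l' k \<noteq> 0" "\<forall>z. l1 z * l2 z = l z * l' z"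
        using quadratic_split_at[OF lin(1,2) k _ indep(1) l lk lu] True unfolding a_def by blast
      thus ?thesis using True by (intro exI[of _ l']) (auto simp: t_def nfset_def a_def)
    next
      case False
      hence b0: "b k = 0" using True by simp
      obtain l' where "is_form UNIV 1 l'" "l' k \<noteq> 0" "\<forall>z. l3 z * l4 z = l z * l' z"
        using quadratic_split_at[OF lin(3,4) k _ indep(6) l lk lu] b0 unfolding b_def by blast
      thus ?thesis using False b0 by (intro exI[of _ l']) (auto simp: t_def nfset_def b_def)
    qed
    then obtain l' where l': "is_form UNIV 1 l'" "l' k \<noteq> 0" "\<forall>w\<in>nfset. ?l w * l' (pr w) = t w ^ 2" by blast
    have "G.has_order 1 ?l 2"
    proof (rule G.has_orderI[OF lF form_pr[OF l'(1)] _ _ _])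
      show "is_form UNIV (1 + 1) (\<lambda>w. ?m w ^ 2)" using is_form_power[OF coeff_ring_UNIV mF, of 2] by (simp add: numeral_2_eq_2)
      fix y assume y: "y \<in> \<Union>nfV"
      show "?l y * l' (pr y) * ?m y ^ 2 = t y ^ 2 * ?m y ^ 2" using l'(3) y unfolding Union_nfV by simp
    qed (use l'(2) muk in \<open>simp_all add: k_def\<close>)
    thus ?thesis using that[of 2] by simp
  qed
  have dl: "G.dv 1 1 ?l" using G.divs_iff_order[OF J(2)] J(1) by blast
  have d12: "G.dv 1 1 (\<lambda>w. w $ j - x $ j * ?m w)" if j: "j = 1 \<or> j = 2" for j :: 4
  proof -
    define j2 where "j2 = (if j = 1 then 1 else 2 :: 2)"
    have j2: "w $ j = pr w $ j2" for w :: "'a^4" using j by (auto simp: j2_def)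
    define r where "r = (\<lambda>z :: 'a^2. z $ j2 - k $ j2 * mu z)"
    have r: "is_form UNIV 1 r" unfolding r_def by (intro is_form_diff is_form_smult is_form_component mu) auto
    have rk: "r k = 0" by (simp add: r_def muk)
    have "r z = (r u / l u) * l z" for z
      using linear2_proportional[OF l r k lk rk, of z u] lu by (simp add: field_simps)
    hence "(\<lambda>w. w $ j - x $ j * ?m w) = (\<lambda>w. (r u / l u) * ?l w)"
      unfolding j2 r_def k_def by (rule ext)
    moreover have "G.dv (0 + 1) (0 + 1) (\<lambda>w. (r u / l u) * ?l w)"
      by (rule G.divs_mult[OF G.divs_0 dl]) (auto intro: is_form_const)
    ultimately show ?thesis by simp
  qed
  have d34: "G.dv 1 1 (\<lambda>w. w $ j - x $ j * ?m w)"
    if j: "x $ j = 0 \<Longrightarrow> t = (\<lambda>w. w $ j)" "\<And>w. w \<in> nfset \<Longrightarrow> (w $ j)^2 = q (pr w)" "is_form UNIV 2 q" "(x $ j)^2 = q k"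
    for j :: 4 and q
  proof (cases "x $ j = 0")
    case True
    hence "(\<lambda>w. w $ j - x $ j * ?m w) = t" using j(1) by simp
    thus ?thesis using G.has_order_divs[OF G.has_order_t] by simp
  next
    case False
    \<comment> \<open>The product of \<open>w $ j - x $ j * ?m w\<close> and
      \<open>w $ j + x $ j * ?m w\<close> is \<open>e\<close> at the projected point. It vanishes at
      \<open>k\<close> and so is divisible by \<open>l\<close>, while the second factor is a unit at
      \<open>x\<close> because \<open>x $ j\<close> is nonzero.\<close>
    define e where "e = (\<lambda>z. q z - q k * mu z ^ 2)"
    have mu2: "is_form UNIV 2 (\<lambda>z. mu z ^ 2)" using is_form_power[OF coeff_ring_UNIV mu, of 2] by simp
    have eF: "is_form UNIV 2 e" unfolding e_def by (intro is_form_diff is_form_smult j(3) mu2) auto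
    have ek: "e k = 0" by (simp add: e_def muk)
    have f1: "is_form UNIV 1 (\<lambda>w. w $ j - x $ j * ?m w)" "is_form UNIV 1 (\<lambda>w. w $ j + x $ j * ?m w)"
      by (intro is_form_diff is_form_add is_form_smult c mF; simp)+
    have "\<exists>g. is_form UNIV 1 g \<and> (\<forall>z. e z = l z * g z)"
    proof (cases "\<exists>v. e v \<noteq> 0")
      case True
      then obtain v where v: "e v \<noteq> 0" by blast
      from binary_divide[OF eF ek v l lk lu k] show ?thesis by auto
    next
      case False thus ?thesis by (intro exI[of _ "\<lambda>_. 0"]) (auto intro: is_form_zero)
    qed
    then obtain g where g: "is_form UNIV 1 g" "\<forall>z. e z = l z * g z" by blast
    have dlg: "G.dv (1 + 1) (1 + 0) (\<lambda>w. ?l w * g (pr w))"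
      by (rule G.divs_mult[OF dl G.divs_0[OF form_pr[OF g(1)]]])
    have "G.dv 1 (1 + 0) (\<lambda>w. w $ j - x $ j * ?m w)"
    proof (rule G.divs_cong[OF dlg f1(1) f1(2)])
      show "x $ j + x $ j * ?m x \<noteq> 0" using False muk by (simp add: k_def)
      show "is_form UNIV 0 (\<lambda>w :: 'a^4. 1)" by (rule is_form_const) auto
      fix y assume y: "y \<in> \<Union>nfV"
      have "(y $ j - x $ j * ?m y) * (y $ j + x $ j * ?m y) = (y $ j)^2 - (x $ j)^2 * ?m y ^ 2"
        by (simp add: algebra_simps power2_eq_square)
      also have "\<dots> = e (pr y)" using j(2,4) y unfolding Union_nfV e_def by simp
      finally show "(y $ j - x $ j * ?m y) * (y $ j + x $ j * ?m y) = ?l y * g (pr y) * 1" using g(2) by simp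
    qed simp
    thus ?thesis by simp
  qed
  have d3: "G.dv 1 1 (\<lambda>w. w $ 3 - x $ 3 * ?m w)"
    by (rule d34[OF t34(1) _ a_form hx(1)]) (auto simp: nfset_def)
  have d4: "G.dv 1 1 (\<lambda>w. w $ 4 - x $ 4 * ?m w)"
    by (rule d34[OF t34(2) _ b_form hx(2)]) (auto simp: nfset_def)
  have dj: "G.dv 1 1 (\<lambda>w. w $ j - x $ j * ?m w)" for j
    using exhaust_4[of j] d12[of 1] d12[of 2] d3 d4 by auto
  have "curve_point nfV x t ?m"
  proof unfold_locales
    fix d and f :: "'a^4 \<Rightarrow> 'a" assume f: "is_form UNIV d f" and fx: "f x = 0"
    show "divs nfV x t ?m d 1 f"
    proof (cases d)
      case 0
      obtain c0 where "f = (\<lambda>_. c0)" using is_form_0D[OF coeff_ring_UNIV] f 0 by blast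
      hence "f = (\<lambda>_. 0)" using fx by auto
      thus ?thesis
        by (intro divsI[where e = 0 and h = "\<lambda>_. 1" and g = "\<lambda>_. 0"]) (auto intro: is_form_const is_form_zero)
    next
      case (Suc d')
      obtain g where g: "\<forall>i. is_form UNIV (d - 1) (g i)"
        "\<forall>y. f y = f x * ?m y ^ d + (\<Sum>i\<in>UNIV. (y $ i - x $ i * ?m y) * g i y)"
        using form_decompose_at[OF f mF, of x] by (elim exE conjE) (rule that)
      have t: "G.dv (1 + d') (1 + 0) (\<lambda>y. (y $ i - x $ i * ?m y) * g i y)" for i
        by (rule G.divs_mult[OF dj G.divs_0]) (use g(1) Suc in simp)
      have "f = (\<lambda>y. (y $ 1 - x $ 1 * ?m y) * g 1 y + (y $ 2 - x $ 2 * ?m y) * g 2 y +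
          (y $ 3 - x $ 3 * ?m y) * g 3 y + (y $ 4 - x $ 4 * ?m y) * g 4 y)"
      proof
        fix y
        show "f y = (y $ 1 - x $ 1 * ?m y) * g 1 y + (y $ 2 - x $ 2 * ?m y) * g 2 y +
          (y $ 3 - x $ 3 * ?m y) * g 3 y + (y $ 4 - x $ 4 * ?m y) * g 4 y"
          using g(2)[rule_format, of y] fx unfolding sum_4 by simp
      qed
      moreover have "G.dv (1 + d') (1 + 0) (\<lambda>y. (y $ 1 - x $ 1 * ?m y) * g 1 y + (y $ 2 - x $ 2 * ?m y) * g 2 y +
          (y $ 3 - x $ 3 * ?m y) * g 3 y + (y $ 4 - x $ 4 * ?m y) * g 4 y)"
        by (intro G.divs_add t)
      ultimately show ?thesis using Suc by simp
    qed
  next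
    fix d and f :: "'a^4 \<Rightarrow> 'a" assume f: "is_form UNIV d f" and fz: "\<not> zero_on nfV f"
    obtain f' N where 1: "is_form UNIV (3 * d) f'" "is_form UNIV (4 * d) N" "\<forall>w\<in>nfset. f w * f' w = N (pr w)"
      "(\<forall>z. N z = 0) \<longrightarrow> (\<forall>w\<in>nfset. f w = 0)" using cofactor_exists[OF f] by (elim exE conjE) (rule that)
    have "\<exists>v. N v \<noteq> 0" using fz 1(4) unfolding zero_on_def Union_nfV by blast
    then obtain v where v: "N v \<noteq> 0" by blast
    \<comment> \<open>The norm is a power of \<open>l\<close> times a form nonzero at
      \<open>k\<close>, so its order at \<open>x\<close> is \<open>j * J\<close>; since
      \<open>f\<close> divides its norm, this bounds the order of \<open>f\<close>.\<close>
    obtain j n N1 where 2: "4 * d = j + n" "is_form UNIV n N1" "N1 k \<noteq> 0" "\<forall>z. N z = l z ^ j * N1 z"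
      using binary_root_multiplicity[OF l lk lu k 1(2) v] by (elim exE conjE) (rule that)
    have "G.has_order (j * 1 + n) (\<lambda>y. ?l y ^ j * N1 (pr y)) (j * J + 0)"
      by (rule G.has_order_mult[OF G.has_order_power[OF J(2)] G.has_order_0[OF form_pr[OF 2(2)]]])
         (use 2(3) in \<open>simp add: k_def\<close>)
    hence NO: "G.has_order (4 * d) (\<lambda>y. N (pr y)) (j * J)" using 2(1,4) by simp
    have "m \<le> j * J" if m: "divs nfV x t ?m d m f" for m
    proof -
      have "G.dv (d + 3 * d) (m + 0) (\<lambda>y. f y * f' y)" by (rule G.divs_mult[OF m G.divs_0[OF 1(1)]])
      hence h: "G.dv (4 * d) m (\<lambda>y. f y * f' y)" by simp
      have c1: "is_form UNIV 0 (\<lambda>_ :: 'a^4. 1)" by (rule is_form_const) auto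
      have "G.dv (4 * d) m (\<lambda>y. N (pr y))"
        by (rule G.divs_cong[OF h form_pr[OF 1(2)] c1 _ c1]) (use 1(3) in \<open>auto simp: Union_nfV\<close>)
      thus ?thesis by (rule G.has_order_bound[OF NO])
    qed
    thus "\<exists>N. \<forall>m. divs nfV x t ?m d m f \<longrightarrow> m \<le> N" by blast
  qed
  thus ?thesis by blast
qed

theorem smooth_nfV: "smooth_curve nfV"
  unfolding smooth_curve_def Union_nfV using irreducible_nfV curve_point_nfV by blast

end

section \<open>Linear changes of coordinates\<close>

lemma (in irreducible_set) scale_mem: "x \<in> \<Union>V \<Longrightarrow> c \<noteq> 0 \<Longrightarrow> c *s x \<in> \<Union>V"
  using hpoint_mem hpoint_eqI hpoint_self by (metis UnionI)

lemma divs_pullback: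
  assumes S: "forms_over UNIV 1 S" and V: "\<And>y. y \<in> \<Union>V1 \<Longrightarrow> S y \<in> \<Union>V2" and d: "divs V2 (S x) t t0 d m f"
  shows "divs V1 x (\<lambda>y. t (S y)) (\<lambda>y. t0 (S y)) d m (\<lambda>y. f (S y))"
proof -
  obtain e h g where 1: "is_form UNIV d f" "is_form UNIV e h" "h (S x) \<noteq> 0" "is_form UNIV (d + e) g"
    "\<And>y. y \<in> \<Union>V2 \<Longrightarrow> f y * h y * t0 y ^ m = t y ^ m * g y" using d by (rule divsE) (rule that)
  show ?thesis
    by (rule divsI[where h = "\<lambda>y. h (S y)" and e = e and g = "\<lambda>y. g (S y)"])
       (use 1(3) in \<open>auto intro: is_form_comp_linear[OF coeff_ring_UNIV _ S] 1 V\<close>)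
qed

lemma smooth_curve_transport:
  fixes V V' :: "('a::field_char_0^'n) set set"
  assumes V: "smooth_curve V" and T: "forms_over UNIV 1 T" and T': "forms_over UNIV 1 T'"
    and inv: "\<And>x. T (T' x) = x" "\<And>x. T' (T x) = x" and V': "V' = hpoint ` {x. T x \<in> \<Union>V}"
  shows "smooth_curve V'" "\<Union>V' = {x. T x \<in> \<Union>V}"
proof -
  interpret V: irreducible_set V by (rule smooth_curve_irreducible[OF V])
  show U: "\<Union>V' = {x. T x \<in> \<Union>V}"
  proof
    show "{x. T x \<in> \<Union>V} \<subseteq> \<Union>V'" unfolding V' by auto
    show "\<Union>V' \<subseteq> {x. T x \<in> \<Union>V}"
    proof
      fix y assume "y \<in> \<Union>V'"
      then obtain x where x: "T x \<in> \<Union>V" "y \<in> hpoint x" unfolding V' by blast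
      then obtain c where "c \<noteq> 0" "y = c *s x" using mem_hpoint_iff by blast
      thus "y \<in> {x. T x \<in> \<Union>V}" using x(1) V.scale_mem by (simp add: forms1_scale[OF T])
    qed
  qed
  have comp: "is_form UNIV d f \<Longrightarrow> is_form UNIV d (\<lambda>y. f (T' y))" "is_form UNIV d f \<Longrightarrow> is_form UNIV d (\<lambda>y. f (T y))" for d f
    by (rule is_form_comp_linear[OF coeff_ring_UNIV _ T'], assumption) (rule is_form_comp_linear[OF coeff_ring_UNIV _ T])
  have zero: "zero_on V (\<lambda>y. f (T' y)) \<longleftrightarrow> zero_on V' f" for f :: "'a^'n \<Rightarrow> 'a"
    unfolding zero_on_def U using inv by (metis mem_Collect_eq)
  have I: "irreducible_set V'"
  proof unfold_locales
    show "V' \<subseteq> {hpoint x |x. x \<noteq> 0}"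
      unfolding V' using V.point_nonzero forms1_zero[OF T] by fastforce
    obtain y where "y \<in> \<Union>V" using V.point_exists by blast
    hence "T (T' y) \<in> \<Union>V" using inv(1) by simp
    thus "V' \<noteq> {}" unfolding V' by blast
    fix d e and f g :: "'a^'n \<Rightarrow> 'a" assume "is_form UNIV d f" "is_form UNIV e g" "zero_on V' (\<lambda>x. f x * g x)"
    thus "zero_on V' f \<or> zero_on V' g"
      using V.prime[OF comp(1) comp(1), of d f e g] zero[of f] zero[of g] zero[of "\<lambda>x. f x * g x"] by blast
  qed
  have "\<exists>t t0. curve_point V' x t t0" if x: "x \<in> \<Union>V'" for x
  proof -
    have Tx: "T x \<in> \<Union>V" using x unfolding U by simp
    obtain t t0 where c: "curve_point V (T x) t t0" using smooth_curve_point[OF V Tx] by blast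
    interpret c: curve_point V "T x" t t0 by (rule c)
    interpret I: irreducible_set V' by (rule I)
    have "curve_point V' x (\<lambda>y. t (T y)) (\<lambda>y. t0 (T y))"
    proof unfold_locales
      show "\<not> zero_on V' (\<lambda>y. t (T y))" using c.t_nz zero[of "\<lambda>y. t (T y)"] inv(1) by simp
      fix d and f :: "'a^'n \<Rightarrow> 'a" assume f: "is_form UNIV d f"
      show "divs V' x (\<lambda>y. t (T y)) (\<lambda>y. t0 (T y)) d 1 f" if "f x = 0"
      proof -
        have "divs V (T x) t t0 d 1 (\<lambda>y. f (T' y))"
          by (rule c.vanishing_divs[OF comp(1)[OF f]]) (simp add: inv that)
        from divs_pullback[OF T _ this, of V'] show ?thesis using U by (simp add: inv)
      qed
      assume "\<not> zero_on V' f"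
      hence "\<not> zero_on V (\<lambda>y. f (T' y))" using zero by simp
      then obtain N where N: "\<forall>m. divs V (T x) t t0 d m (\<lambda>y. f (T' y)) \<longrightarrow> m \<le> N"
        using c.divs_bounded[OF comp(1)[OF f]] by blast
      have "m \<le> N" if m: "divs V' x (\<lambda>y. t (T y)) (\<lambda>y. t0 (T y)) d m f" for m
      proof -
        have m': "divs V' (T' (T x)) (\<lambda>y. t (T y)) (\<lambda>y. t0 (T y)) d m f" using m by (simp add: inv)
        have "divs V (T x) (\<lambda>y. t (T (T' y))) (\<lambda>y. t0 (T (T' y))) d m (\<lambda>y. f (T' y))"
          by (rule divs_pullback[OF T' _ m']) (simp add: U inv)
        thus ?thesis using N by (simp add: inv)
      qed
      thus "\<exists>N. \<forall>m. divs V' x (\<lambda>y. t (T y)) (\<lambda>y. t0 (T y)) d m f \<longrightarrow> m \<le> N" by blast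
    qed (use x c.t_x c.t0_x comp(2)[OF c.t_form] comp(2)[OF c.t0_form] in auto)
    thus ?thesis by blast
  qed
  thus "smooth_curve V'" unfolding smooth_curve_def using I by blast
qed

section \<open>Forms of even degree\<close>

definition sq2 :: "'a::field^2 \<Rightarrow> 'a^3" where
  "sq2 z = vector [(z $ 1)^2, z $ 1 * z $ 2, (z $ 2)^2]"

definition pr' :: "'a::field^4 \<Rightarrow> 'a^2" where
  "pr' w = vector [w $ 3, w $ 4]"

lemma pr'_nth [simp]: "pr' w $ 1 = w $ 3" "pr' w $ 2 = w $ 4"
  by (simp_all add: pr'_def)

text \<open>The monomials of degree 2 with both factors in the same half of the coordinates; they
  are invariant under \<open>flip4\<close>. The parametrisations of the two conics, applied to the
  two halves, are linear in them.\<close>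

definition sq4 :: "'a::field^4 \<Rightarrow> 'a^(3+3)" where
  "sq4 w = join (sq2 (pr w)) (sq2 (pr' w))"

definition flip4 :: "'a::field^4 \<Rightarrow> 'a^4" where
  "flip4 w = vector [w $ 1, w $ 2, - w $ 3, - w $ 4]"

lemma flip4_nth: "flip4 w $ 1 = w $ 1" "flip4 w $ 2 = w $ 2" "flip4 w $ 3 = - w $ 3" "flip4 w $ 4 = - w $ 4"
  by (simp_all add: flip4_def vector_4)

lemma join_nth [simp]: "join x y $ Inl i = x $ i" "join x y $ Inr j = y $ j"
  by (simp_all add: join_def)

lemma sq2_nth: "sq2 z $ 1 = (z $ 1)^2" "sq2 z $ 2 = z $ 1 * z $ 2" "sq2 z $ 3 = (z $ 2)^2"
  by (simp_all add: sq2_def)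

lemma sq4_flip4: "sq4 (flip4 w) = sq4 w"
proof -
  have "pr (flip4 w) = pr w" by (simp add: vec_eq_iff forall_2 flip4_nth)
  moreover have "sq2 (pr' (flip4 w)) = sq2 (pr' w)" by (simp add: vec_eq_iff forall_3 sq2_nth flip4_nth)
  ultimately show ?thesis by (simp add: sq4_def)
qed

definition blk :: "4 \<Rightarrow> bool" where "blk i \<longleftrightarrow> i = 1 \<or> i = 2"

lemma blk_simps [simp]: "blk 1" "blk 2" "\<not> blk 3" "\<not> blk 4"
  by (simp_all add: blk_def)

lemma same_block_product:
  fixes S :: "'a::field set"
  assumes S: "coeff_ring S" and b: "blk i = blk j"
  shows "\<exists>l. is_form S 1 l \<and> (\<forall>w. w $ i * w $ j = l (sq4 w))"
proof -
  have c: "is_form S 1 (\<lambda>y :: 'a^(3+3). y $ k)" for k by (rule is_form_component[OF S])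
  have "\<exists>k. \<forall>w :: 'a^4. w $ i * w $ j = sq4 w $ k"
  proof -
    consider "i = 1 \<and> j = 1" | "(i = 1 \<and> j = 2) \<or> (i = 2 \<and> j = 1)" | "i = 2 \<and> j = 2" | "i = 3 \<and> j = 3"
      | "(i = 3 \<and> j = 4) \<or> (i = 4 \<and> j = 3)" | "i = 4 \<and> j = 4"
      using b exhaust_4[of i] exhaust_4[of j] by auto
    thus ?thesis
    proof cases
      case 1 thus ?thesis by (intro exI[of _ "Inl 1"]) (simp add: sq4_def sq2_nth power2_eq_square)
    next
      case 2 thus ?thesis by (intro exI[of _ "Inl 2"]) (auto simp: sq4_def sq2_nth)
    next
      case 3 thus ?thesis by (intro exI[of _ "Inl 3"]) (simp add: sq4_def sq2_nth power2_eq_square)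
    next
      case 4 thus ?thesis by (intro exI[of _ "Inr 1"]) (simp add: sq4_def sq2_nth power2_eq_square)
    next
      case 5 thus ?thesis by (intro exI[of _ "Inr 2"]) (auto simp: sq4_def sq2_nth)
    next
      case 6 thus ?thesis by (intro exI[of _ "Inr 3"]) (simp add: sq4_def sq2_nth power2_eq_square)
    qed
  qed
  then obtain k where "\<forall>w :: 'a^4. w $ i * w $ j = sq4 w $ k" by blast
  thus ?thesis using c[of k] by (intro exI[of _ "\<lambda>y. y $ k"]) simp
qed

definition odd_part :: "'a::field set \<Rightarrow> nat \<Rightarrow> ('a^4 \<Rightarrow> 'a) \<Rightarrow> bool" where
  "odd_part S d f \<longleftrightarrow> (\<exists>h. (\<forall>i. is_form S d (h i)) \<and> (\<forall>w. f w = (\<Sum>i\<in>UNIV. w $ i * h i (sq4 w))))"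

lemma odd_part_single:
  assumes S: "coeff_ring S" and h: "is_form S d h"
  shows "odd_part S d (\<lambda>w. w $ j * h (sq4 w))"
  unfolding odd_part_def
proof (intro exI[of _ "\<lambda>i. if i = j then h else (\<lambda>_. 0)"] conjI allI)
  fix w :: "'a^4"
  have "(\<Sum>i\<in>UNIV. w $ i * (if i = j then h else (\<lambda>_. 0)) (sq4 w)) = (\<Sum>i\<in>UNIV. if i = j then w $ i * h (sq4 w) else 0)"
    by (rule sum.cong) auto
  thus "w $ j * h (sq4 w) = (\<Sum>i\<in>UNIV. w $ i * (if i = j then h else (\<lambda>_. 0)) (sq4 w))" by simp
qed (use h S in \<open>auto intro: is_form_zero\<close>)

lemma odd_part_add:
  assumes S: "coeff_ring S" and f: "odd_part S d f" and g: "odd_part S d g"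
  shows "odd_part S d (\<lambda>w. f w + g w)"
proof -
  obtain h where h: "\<forall>i. is_form S d (h i)" "\<forall>w. f w = (\<Sum>i\<in>UNIV. w $ i * h i (sq4 w))"
    using f unfolding odd_part_def by (elim exE conjE) (rule that)
  obtain h' where h': "\<forall>i. is_form S d (h' i)" "\<forall>w. g w = (\<Sum>i\<in>UNIV. w $ i * h' i (sq4 w))"
    using g unfolding odd_part_def by (elim exE conjE) (rule that)
  show ?thesis
    unfolding odd_part_def using h h'
    by (intro exI[of _ "\<lambda>i y. h i y + h' i y"]) (simp add: is_form_add S distrib_left sum.distrib)
qed

lemma odd_part_sum:
  assumes S: "coeff_ring S" and "finite I" and "\<And>i. i \<in> I \<Longrightarrow> odd_part S d (f i)"
  shows "odd_part S d (\<lambda>w. \<Sum>i\<in>I. f i w)"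
  using assms(2,3)
proof (induction I)
  case empty
  show ?case unfolding odd_part_def by (intro exI[of _ "\<lambda>_ _. 0"]) (simp add: is_form_zero S)
next
  case (insert i I)
  thus ?case using odd_part_add[OF S, of d "f i" "\<lambda>w. \<Sum>i\<in>I. f i w"] by simp
qed

text \<open>Of three coordinates two lie in the same half, and the product of those two is linear in
  \<open>sq4\<close>.\<close>

lemma odd_part_triple:
  assumes S: "coeff_ring S" and h: "is_form S d h"
  shows "odd_part S (Suc d) (\<lambda>w. w $ i * (w $ j * (w $ k * h (sq4 w))))"
proof -
  have main: "odd_part S (Suc d) (\<lambda>w. w $ a * ((w $ b * w $ c) * h (sq4 w)))" if bc: "blk b = blk c" for a b c
  proof -
    obtain l where l: "is_form S 1 l" "\<forall>w. w $ b * w $ c = l (sq4 w)" using same_block_product[OF S bc] by blast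
    have "is_form S (1 + d) (\<lambda>y. l y * h y)" by (rule is_form_mult[OF S l(1) h])
    from odd_part_single[OF S this, of a] show ?thesis using l(2) by simp
  qed
  consider "blk j = blk k" | "blk i = blk k" | "blk i = blk j" by blast
  thus ?thesis
  proof cases
    case 1 thus ?thesis using main[of j k i] by (simp add: mult_ac)
  next
    case 2 thus ?thesis using main[of i k j] by (simp add: mult_ac)
  next
    case 3 thus ?thesis using main[of i j k] by (simp add: mult_ac)
  qed
qed

lemma odd_degree_form:
  fixes f :: "'a::field^4 \<Rightarrow> 'a"
  assumes S: "coeff_ring S"
  shows "is_form S (2 * d + 1) f \<Longrightarrow> odd_part S d f"
proof (induction d arbitrary: f)
  case 0
  hence "is_form S 1 f" by simp
  then obtain a where a: "\<forall>i. a i \<in> S" "f = (\<lambda>x. \<Sum>i\<in>UNIV. a i * x $ i)"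
    using linear_form_expand[OF S] by blast
  show ?case unfolding odd_part_def a(2)
    using a(1) by (intro exI[of _ "\<lambda>i _. a i"]) (simp add: is_form_const S mult.commute)
next
  case (Suc d)
  have "is_form S (Suc (Suc (2 * d + 1))) f" using Suc.prems by simp
  then obtain g where g: "\<forall>i. is_form S (Suc (2 * d + 1)) (g i)" "f = (\<lambda>x. \<Sum>i\<in>UNIV. x $ i * g i x)"
    using is_form_SucD[OF S] by blast
  have "odd_part S (Suc d) (\<lambda>x. x $ i * g i x)" for i
  proof -
    obtain g' where g': "\<forall>j. is_form S (2 * d + 1) (g' j)" "g i = (\<lambda>x. \<Sum>j\<in>UNIV. x $ j * g' j x)"
      using is_form_SucD[OF S g(1)[rule_format, of i]] by blast
    have "odd_part S (Suc d) (\<lambda>x. x $ i * (x $ j * g' j x))" for j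
    proof -
      obtain h where h: "\<forall>k. is_form S d (h k)" "\<forall>w. g' j w = (\<Sum>k\<in>UNIV. w $ k * h k (sq4 w))"
        using Suc.IH[OF g'(1)[rule_format, of j]] unfolding odd_part_def by (elim exE conjE) (rule that)
      have "odd_part S (Suc d) (\<lambda>x. \<Sum>k\<in>UNIV. x $ i * (x $ j * (x $ k * h k (sq4 x))))"
        by (rule odd_part_sum[OF S]) (use h(1) odd_part_triple[OF S] in auto)
      thus ?thesis using h(2) by (simp add: sum_distrib_left)
    qed
    hence "odd_part S (Suc d) (\<lambda>x. \<Sum>j\<in>UNIV. x $ i * (x $ j * g' j x))" by (intro odd_part_sum[OF S]) auto
    thus ?thesis unfolding g'(2) by (simp add: sum_distrib_left)
  qed
  thus ?case unfolding g(2) by (intro odd_part_sum[OF S]) auto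
qed

text \<open>Taking out one coordinate leaves a form of odd degree, so \<open>f\<close> is a
  combination of products of two coordinates with coefficients in \<open>sq4\<close>. Products
  across the two halves change sign under \<open>flip4\<close>; invariance makes their total vanish,
  and the others are linear in \<open>sq4\<close>.\<close>

lemma even_invariant_form:
  fixes f :: "'a::field_char_0^4 \<Rightarrow> 'a"
  assumes S: "coeff_ring S" and f: "is_form S (2 * d) f" and inv: "\<And>w. f (flip4 w) = f w"
  shows "\<exists>h. is_form S d h \<and> (\<forall>w. f w = h (sq4 w))"
proof (cases d)
  case 0
  then obtain c where "c \<in> S" "f = (\<lambda>_. c)" using is_form_0D[OF S] f by auto
  thus ?thesis using 0 by (intro exI[of _ "\<lambda>_. c"]) (simp add: is_form_const S)
next
  case (Suc e)
  have "is_form S (Suc (2 * e + 1)) f" using f Suc by simp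
  then obtain g where g: "\<forall>i. is_form S (2 * e + 1) (g i)" "f = (\<lambda>x. \<Sum>i\<in>UNIV. x $ i * g i x)"
    using is_form_SucD[OF S] by blast
  have "\<forall>i. \<exists>h. (\<forall>j. is_form S e (h j)) \<and> (\<forall>w. g i w = (\<Sum>j\<in>UNIV. w $ j * h j (sq4 w)))"
    using odd_degree_form[OF S] g(1) unfolding odd_part_def by simp
  from choice[OF this] obtain h where h: "\<And>i j. is_form S e (h i j)" "\<And>i w. g i w = (\<Sum>j\<in>UNIV. w $ j * h i j (sq4 w))"
    by blast
  define E where "E = (\<lambda>w. \<Sum>i\<in>UNIV. \<Sum>j\<in>UNIV. if blk i = blk j then w $ i * w $ j * h i j (sq4 w) else 0)"
  define D where "D = (\<lambda>w. \<Sum>i\<in>UNIV. \<Sum>j\<in>UNIV. if blk i = blk j then 0 else w $ i * w $ j * h i j (sq4 w))"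
  have fED: "f w = E w + D w" for w
    unfolding g(2) h(2) E_def D_def sum.distrib[symmetric] sum_distrib_left
    by (intro sum.cong) (auto simp: mult.assoc)
  have fl: "flip4 w $ i = (if blk i then w $ i else - w $ i)" for w :: "'a^4" and i
    using exhaust_4[of i] by (auto simp: flip4_nth)
  have "E (flip4 w) = E w" for w
    unfolding E_def sq4_flip4 by (intro sum.cong) (auto simp: fl)
  moreover have "D (flip4 w) = - D w" for w
    unfolding D_def sq4_flip4 sum_negf[symmetric] by (intro sum.cong) (auto simp: fl)
  ultimately have "2 * D w = 0" for w using inv[of w] unfolding fED by simp
  hence fE: "f w = E w" for w using fED[of w] by simp
  have "\<forall>i j. \<exists>l. is_form S 1 l \<and> (blk i = blk j \<longrightarrow> (\<forall>w. w $ i * w $ j = l (sq4 w)))"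
    using same_block_product[OF S] is_form_zero[OF S] by metis
  then obtain l where l: "\<And>i j. is_form S 1 (l i j)" "\<And>i j w. blk i = blk j \<Longrightarrow> w $ i * w $ j = l i j (sq4 w)"
    by metis
  have lh: "is_form S d (\<lambda>y. l i j y * h i j y)" for i j
    using is_form_mult[OF S l(1)[of i j] h(1)[of i j]] Suc by simp
  have "is_form S d (\<lambda>y. if blk i = blk j then l i j y * h i j y else 0)" for i j
    by (cases "blk i = blk j") (simp_all add: lh is_form_zero S)
  hence "is_form S d (\<lambda>y. \<Sum>i\<in>UNIV. \<Sum>j\<in>UNIV. if blk i = blk j then l i j y * h i j y else 0)"
    by (intro is_form_sum S)
  moreover have "f w = (\<Sum>i\<in>UNIV. \<Sum>j\<in>UNIV. if blk i = blk j then l i j (sq4 w) * h i j (sq4 w) else 0)" for w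
    unfolding fE E_def by (intro sum.cong refl if_cong) (simp add: l(2))
  ultimately show ?thesis by (intro exI conjI allI)
qed

lemma even_binary_form:
  fixes f :: "'a::field_char_0^2 \<Rightarrow> 'a"
  assumes f: "is_form UNIV (2 * d) f"
  shows "\<exists>h. is_form UNIV d h \<and> (\<forall>z. f z = h (sq2 z))"
proof -
  have "pr (flip4 w) = pr w" for w :: "'a^4" by (simp add: vec_eq_iff forall_2 flip4_nth)
  hence "f (pr (flip4 w)) = f (pr w)" for w by simp
  from even_invariant_form[OF coeff_ring_UNIV form_pr[OF f] this]
  obtain h where h: "is_form UNIV d h" "\<forall>w. f (pr w) = h (sq4 w)" by blast
  have J: "forms_over UNIV 1 (\<lambda>y :: 'a^3. join y (0 :: 'a^3))"
    by (rule forms_over1I) (simp_all add: vec_eq_iff join_def split: sum.split)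
  have "f z = h (join (sq2 z) 0)" for z
  proof -
    have "pr (vector [z $ 1, z $ 2, 0, 0]) = z" "sq2 (pr' (vector [z $ 1, z $ 2, 0, 0])) = 0"
      by (simp_all add: vec_eq_iff forall_2 forall_3 sq2_nth vector_4)
    thus ?thesis using h(2)[rule_format, of "vector [z $ 1, z $ 2, 0, 0]"] by (simp add: sq4_def)
  qed
  thus ?thesis using is_form_comp_linear[OF coeff_ring_UNIV h(1) J]
    by (intro exI[of _ "\<lambda>y. h (join y 0)"]) simp
qed

section \<open>Parametrised conics\<close>

text \<open>\<open>N\<close> inverts the parametrisation up to the Veronese map \<open>sq2\<close>,
  so that binary forms of even degree are exactly the pullbacks of forms in the plane.\<close>

locale parametrised_conic =
  fixes G :: "('a::field_char_0^3) set set" and Q :: "'a^2 \<Rightarrow> 'a^3" and N :: "'a^3 \<Rightarrow> 'a^3"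
  assumes G_points: "G \<subseteq> {hpoint x |x. x \<noteq> 0}" and G_Union: "\<Union>G = Q ` {z. z \<noteq> 0}"
    and Q_form: "forms_over UNIV 2 Q" and N_form: "forms_over UNIV 1 N" and N_Q: "\<And>z. N (Q z) = sq2 z"
begin

lemma even_pullback:
  assumes "is_form UNIV (2 * d) f" shows "\<exists>h. is_form UNIV d h \<and> (\<forall>z. f z = h (Q z))"
proof -
  obtain h where "is_form UNIV d h" "\<forall>z. f z = h (sq2 z)" using even_binary_form[OF assms] by blast
  thus ?thesis using is_form_comp_linear[OF coeff_ring_UNIV _ N_form]
    by (intro exI[of _ "\<lambda>y. h (N y)"]) (simp add: N_Q)
qed

lemma comp_Q: "is_form UNIV d f \<Longrightarrow> is_form UNIV (d * 2) (\<lambda>z. f (Q z))"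
  by (rule is_form_comp[OF coeff_ring_UNIV _ Q_form])

lemma zero_on_G: "is_form UNIV d f \<Longrightarrow> zero_on G f \<longleftrightarrow> (\<forall>z. f (Q z) = 0)"
  unfolding zero_on_def G_Union using polyfun_zero[OF polyfun_form[OF comp_Q]] by blast

lemma irreducible: "irreducible_set G"
proof unfold_locales
  have "(\<chi> i. 1) \<noteq> (0 :: 'a^2)" by (simp add: vec_eq_iff)
  thus "G \<noteq> {}" using G_Union by auto
  fix d e and f g :: "'a^3 \<Rightarrow> 'a" assume f: "is_form UNIV d f" and g: "is_form UNIV e g" and fg: "zero_on G (\<lambda>x. f x * g x)"
  have "\<forall>z. f (Q z) * g (Q z) = 0" using fg zero_on_G[OF is_form_mult[OF _ f g]] by simp
  thus "zero_on G f \<or> zero_on G g"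
    unfolding zero_on_G[OF f] zero_on_G[OF g]
    using polyfun_mult_eq_0[OF polyfun_form[OF comp_Q[OF f]] polyfun_form[OF comp_Q[OF g]]] by blast
qed (rule G_points)

text \<open>The pair is chosen so that \<open>t / t0\<close> pulls back to the local coordinate
  \<open>l / mu\<close> of the parameter line; numerator and denominator need even degree to be
  pullbacks, hence the additional factor \<open>mu\<close>.\<close>

lemma uniformizer:
  assumes z0: "z0 \<noteq> 0" and l: "is_form UNIV 1 l" "l z0 = 0" "l u \<noteq> 0" and mu: "is_form UNIV 1 mu" "mu z0 = 1"
  shows "\<exists>t t0. curve_point G (Q z0) t t0 \<and> (\<forall>z. t (Q z) = l z * mu z) \<and> (\<forall>z. t0 (Q z) = mu z ^ 2)"
proof -
  interpret irreducible_set G by (rule irreducible)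
  have "is_form UNIV (2 * 1) (\<lambda>z. l z * mu z)" using is_form_mult[OF _ l(1) mu(1)] by (simp add: numeral_2_eq_2)
  then obtain t where t: "is_form UNIV 1 t" "\<forall>z. l z * mu z = t (Q z)" using even_pullback by blast
  have "is_form UNIV (2 * 1) (\<lambda>z. mu z ^ 2)" using is_form_power[OF _ mu(1), of 2] by simp
  then obtain t0 where t0: "is_form UNIV 1 t0" "\<forall>z. mu z ^ 2 = t0 (Q z)" using even_pullback by blast
  have lm: "\<exists>z. l z * mu z \<noteq> 0"
    using polyfun_mult_eq_0[OF polyfun_form[OF l(1)] polyfun_form[OF mu(1)]] l(3) mu(2) by (metis zero_neq_one)
  have "curve_germ G (Q z0) t t0"
  proof unfold_locales
    show "Q z0 \<in> \<Union>G" using z0 unfolding G_Union by blast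
    show "t (Q z0) = 0" using t(2) l(2) by (metis mult_zero_left)
    show "t0 (Q z0) \<noteq> 0" using t0(2) mu(2) by (metis power_one zero_neq_one)
    show "\<not> zero_on G t" using zero_on_G[OF t(1)] t(2) lm by simp
  qed (rule t, rule t0)
  then interpret g: curve_germ G "Q z0" t t0 .
  have "curve_point G (Q z0) t t0"
  proof unfold_locales
    fix d and f :: "'a^3 \<Rightarrow> 'a" assume f: "is_form UNIV d f"
    have one: "is_form UNIV 0 (\<lambda>_ :: 'a^3. 1)" by (rule is_form_const) auto
    show "divs G (Q z0) t t0 d 1 f" if f0: "f (Q z0) = 0"
    proof (cases "\<exists>v. f (Q v) \<noteq> 0")
      case False
      thus ?thesis using f one
        by (intro divsI[where e = 0 and h = "\<lambda>_. 1" and g = "\<lambda>_. 0"]) (auto simp: G_Union is_form_zero)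
    next
      case True
      then obtain v where v: "f (Q v) \<noteq> 0" by blast
      obtain d' g where g: "d * 2 = Suc d'" "is_form UNIV d' g" "\<forall>z. f (Q z) = l z * g z"
        using binary_divide[OF comp_Q[OF f] f0 v l z0] by blast
      \<comment> \<open>The quotient by \<open>l\<close> has odd degree; multiplication with
        \<open>mu\<close>, a unit at \<open>z0\<close>, makes the degree even and the form a
        pullback.\<close>
      have "is_form UNIV (d' + 1) (\<lambda>z. g z * mu z)" by (rule is_form_mult[OF _ g(2) mu(1)]) simp
      moreover have "d' + 1 = 2 * d" using g(1) by simp
      ultimately have F: "is_form UNIV (2 * d) (\<lambda>z. g z * mu z)" by (simp only:)
      obtain h where h: "is_form UNIV d h" "\<forall>z. g z * mu z = h (Q z)" using even_pullback[OF F] by blast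
      show ?thesis
      proof (rule divsI[OF f one, where g = h])
        fix y assume "y \<in> \<Union>G"
        then obtain z where y: "y = Q z" unfolding G_Union by blast
        show "f y * 1 * t0 y ^ 1 = t y ^ 1 * h y"
          using g(3) t(2)[rule_format, of z, symmetric] t0(2)[rule_format, of z, symmetric] h(2)[rule_format, of z, symmetric]
          unfolding y by (simp add: power2_eq_square mult_ac)
      qed (use h in auto)
    qed
    assume "\<not> zero_on G f"
    then obtain v where v: "f (Q v) \<noteq> 0" using zero_on_G[OF f] by blast
    obtain j n N1 where 2: "d * 2 = j + n" "is_form UNIV n N1" "N1 z0 \<noteq> 0" "\<forall>z. f (Q z) = l z ^ j * N1 z"
      using binary_root_multiplicity[OF l z0 comp_Q[OF f] v] by (elim exE conjE) (rule that)
    have muj: "is_form UNIV j (\<lambda>z. mu z ^ j)" using is_form_power[OF _ mu(1), of j] by simp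
    have "is_form UNIV (n + j) (\<lambda>z. N1 z * mu z ^ j)" by (rule is_form_mult[OF _ 2(2) muj]) simp
    moreover have "n + j = 2 * d" using 2(1) by simp
    ultimately have F: "is_form UNIV (2 * d) (\<lambda>z. N1 z * mu z ^ j)" by (simp only:)
    obtain h where h: "is_form UNIV d h" "\<forall>z. N1 z * mu z ^ j = h (Q z)" using even_pullback[OF F] by blast
    have "g.has_order d f j"
    proof (rule g.has_orderI[OF f one, where g = h])
      show "h (Q z0) \<noteq> 0" using h(2) 2(3) mu(2) by (metis mult.right_neutral power_one)
      fix y assume "y \<in> \<Union>G"
      then obtain z where y: "y = Q z" unfolding G_Union by blast
      show "f y * 1 * t0 y ^ j = t y ^ j * h y"
        using 2(4) t(2)[rule_format, of z, symmetric] t0(2)[rule_format, of z, symmetric] h(2)[rule_format, of z, symmetric]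
        unfolding y by (simp add: power_mult_distrib power2_eq_square mult_ac)
    qed (use h in auto)
    thus "\<exists>N. \<forall>m. divs G (Q z0) t t0 d m f \<longrightarrow> m \<le> N" using g.has_order_bound by blast
  qed
  thus ?thesis using t(2) t0(2) by (intro exI[of _ t] exI[of _ t0]) simp
qed

lemma linear_pair:
  fixes z0 :: "'a^2"
  assumes z0: "z0 \<noteq> 0"
  obtains l u mu where "is_form UNIV 1 l" "l z0 = 0" "l u \<noteq> 0" "is_form UNIV 1 mu" "mu z0 = 1"
proof -
  define l where "l = (\<lambda>z :: 'a^2. z0 $ 2 * z $ 1 - z0 $ 1 * z $ 2)"
  have l: "is_form UNIV 1 l" unfolding l_def by (intro is_form_diff is_form_smult is_form_component) auto
  have lk: "l z0 = 0" by (simp add: l_def mult.commute)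
  have "\<exists>u. l u \<noteq> 0"
  proof (rule ccontr)
    assume n: "\<not> ?thesis"
    hence "l (vector [1, 0]) = 0" "l (vector [0, 1]) = 0" by blast+
    thus False using z0 by (simp add: l_def vec_eq_iff forall_2)
  qed
  then obtain u where lu: "l u \<noteq> 0" by blast
  obtain i where i: "z0 $ i \<noteq> 0" using z0 by (auto simp: vec_eq_iff)
  define mu where "mu = (\<lambda>z :: 'a^2. (1 / z0 $ i) * z $ i)"
  have "is_form UNIV 1 mu" unfolding mu_def by (intro is_form_smult is_form_component) auto
  moreover have "mu z0 = 1" using i by (simp add: mu_def)
  ultimately show ?thesis using that l lk lu by blast
qed

theorem smooth: "smooth_curve G"
proof -
  have "\<exists>t t0. curve_point G x t t0" if x: "x \<in> \<Union>G" for x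
  proof -
    obtain z0 where z0: "z0 \<noteq> 0" "x = Q z0" using x unfolding G_Union by blast
    obtain l u mu where lm: "is_form UNIV 1 l" "l z0 = 0" "l u \<noteq> 0" "is_form UNIV 1 mu" "mu z0 = 1"
      by (rule linear_pair[OF z0(1)]) (rule that)
    show ?thesis using uniformizer[OF z0(1) lm] z0(2) by blast
  qed
  thus ?thesis unfolding smooth_curve_def using irreducible by blast
qed

end

section \<open>A cone in the pencil and its conic\<close>

lemma quadratic_root:
  fixes a b c :: "'a::alg_closed_field"
  assumes "a \<noteq> 0" shows "\<exists>t. c + t * b + t^2 * a = 0"
proof -
  have "Polynomial.degree [:c, b, a:] > 0" using assms by simp
  then obtain t where "poly [:c, b, a:] t = 0" using alg_closed_imp_poly_has_root by blast
  thus ?thesis by (intro exI[of _ t]) (simp add: algebra_simps power2_eq_square)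
qed

lemma linear_kernel_pair:
  fixes f :: "'a::field^4 \<Rightarrow> 'a"
  assumes "is_form S 1 f"
  shows "\<exists>u v. f u = 0 \<and> f v = 0 \<and> (\<forall>s t. s *s u + t *s v = 0 \<longrightarrow> s = 0 \<and> t = 0)"
proof -
  obtain c where "f = (\<lambda>x. \<Sum>i\<in>UNIV. c i * x $ i)"
    using linear_form_expand[OF coeff_ring_UNIV is_form_UNIV[OF assms]] by blast
  hence f: "f x = c 1 * x $ 1 + c 2 * x $ 2 + c 3 * x $ 3 + c 4 * x $ 4" for x by (simp add: sum_4)
  show ?thesis
  proof (cases "c 1 = 0 \<and> c 2 = 0")
    case True
    thus ?thesis by (intro exI[of _ "vector [1, 0, 0, 0]"] exI[of _ "vector [0, 1, 0, 0]"])
        (simp add: f vector_4 vec_eq_iff forall_4)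
  next
    case A: False
    show ?thesis
    proof (cases "c 3 = 0 \<and> c 4 = 0")
      case True
      thus ?thesis by (intro exI[of _ "vector [0, 0, 1, 0]"] exI[of _ "vector [0, 0, 0, 1]"])
          (simp add: f vector_4 vec_eq_iff forall_4)
    next
      case False
      thus ?thesis using A by (intro exI[of _ "vector [c 2, - c 1, 0, 0]"] exI[of _ "vector [0, 0, c 4, - c 3]"])
          (auto simp: f vector_4 vec_eq_iff forall_4)
    qed
  qed
qed

lemma quadratic_zero_on_plane:
  fixes W :: "'a::alg_closed_field^'n \<Rightarrow> 'a"
  assumes W: "is_form S 2 W"
  shows "\<exists>s t. (s, t) \<noteq> (0, 0) \<and> W (s *s u + t *s v) = 0"
proof (cases "W v = 0")
  case True thus ?thesis by (intro exI[of _ 0] exI[of _ 1]) simp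
next
  case False
  obtain t where "W u + t * polar W u v + t^2 * W v = 0" using quadratic_root[OF False] by blast
  thus ?thesis using quadratic_form_comb[OF W, of 1 u t v] by (intro exI[of _ 1] exI[of _ t]) simp
qed

lemma polar_self:
  fixes x :: "'a::field^'n"
  assumes "is_form S 2 f" shows "polar f x x = 2 * f x"
proof -
  have "x + x = 2 *s x" by (simp add: vec_eq_iff)
  hence "f (x + x) = 4 * f x" using is_form_homogeneous[OF assms, of 2 x] by simp
  thus ?thesis by (simp add: polar_def)
qed

lemma three_values:
  fixes s t u v :: "'a::field_char_0"
  assumes "s + t + u + v = 0" "s - t + u - v = 0" "4 * s + 8 * t + 4 * u + 2 * v = 0"
  shows "u = - s" "t = 0" "v = 0"
proof -
  have "2 * (u + s) = (s + t + u + v) + (s - t + u - v)" "2 * (t + v) = (s + t + u + v) - (s - t + u - v)"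
    by simp_all
  hence "2 * (u + s) = 0" "2 * (t + v) = 0" unfolding assms by (simp_all only: add_0 diff_self)
  hence us: "u + s = 0" and tv: "t + v = 0" by (metis mult_eq_0_iff zero_neq_numeral)+
  have "6 * t = (4 * s + 8 * t + 4 * u + 2 * v) - 4 * (u + s) - 2 * (t + v)" by simp
  hence "t = 0" unfolding assms us tv by simp
  thus "u = - s" "t = 0" "v = 0" using us tv by (auto simp: add_eq_0_iff2)
qed

text \<open>A version of \<open>parametrises\<close> for the closed field: points of the conic are
  hit as vectors and not only up to scaling, which is possible since scalars have square
  roots.\<close>

definition parametrisation :: "('a::field^3 \<Rightarrow> 'a) \<Rightarrow> ('a^2 \<Rightarrow> 'a^3) \<Rightarrow> bool" where
  "parametrisation q Q \<longleftrightarrow> forms_over UNIV 2 Q \<and> (\<forall>z. z \<noteq> 0 \<longrightarrow> Q z \<noteq> 0 \<and> q (Q z) = 0) \<and>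
     (\<forall>y. y \<noteq> 0 \<longrightarrow> q y = 0 \<longrightarrow> (\<exists>z. Q z = y))"

lemma vec2_expand: "(z :: 'a::field^2) = z $ 1 *s vector [1, 0] + z $ 2 *s vector [0, 1]"
  by (simp add: vec_eq_iff forall_2)

lemma vec3_expand: "(z :: 'a::field^3) = z $ 1 *s vector [1, 0, 0] + z $ 2 *s vector [0, 1, 0] + z $ 3 *s vector [0, 0, 1]"
  by (simp add: vec_eq_iff forall_3)

lemma quadratic_map_expand:
  fixes Q :: "'a::field^2 \<Rightarrow> 'a^3"
  assumes Q: "forms_over UNIV 2 Q"
  shows "Q z = (z $ 1)^2 *s Q (vector [1, 0]) + (z $ 1 * z $ 2) *s (Q (vector [1, 1]) - Q (vector [1, 0]) - Q (vector [0, 1]))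
    + (z $ 2)^2 *s Q (vector [0, 1])"
proof -
  have e: "vector [1, 0] + vector [0, 1] = (vector [1, 1] :: 'a^2)" by (simp add: vec_eq_iff forall_2)
  have eq: "Q (z $ 1 *s vector [1, 0] + z $ 2 *s vector [0, 1]) $ i = (z $ 1)^2 * Q (vector [1, 0]) $ i
    + z $ 1 * z $ 2 * (Q (vector [1, 1]) $ i - Q (vector [1, 0]) $ i - Q (vector [0, 1]) $ i) + (z $ 2)^2 * Q (vector [0, 1]) $ i" for i
  proof -
    have "is_form UNIV 2 (\<lambda>x. Q x $ i)" using Q by (simp add: forms_over_def)
    from quadratic_form_comb[OF this, of "z $ 1" "vector [1, 0]" "z $ 2" "vector [0, 1]"]
    show ?thesis by (simp add: polar_def e)
  qed
  show ?thesis
    unfolding vec_eq_iff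
  proof
    fix i
    have "Q z $ i = Q (z $ 1 *s vector [1, 0] + z $ 2 *s vector [0, 1]) $ i"
      by (rule arg_cong[OF vec2_expand])
    thus "Q z $ i = ((z $ 1)^2 *s Q (vector [1, 0]) + (z $ 1 * z $ 2) *s (Q (vector [1, 1]) - Q (vector [1, 0]) - Q (vector [0, 1]))
      + (z $ 2)^2 *s Q (vector [0, 1])) $ i"
      unfolding eq by (simp only: vector_add_component vector_smult_component vector_minus_component)
  qed
qed

text \<open>A cone \<open>W\<close> together with a second quadric \<open>W'\<close>. Nondegeneracy
  of the conic and uniqueness of the vertex are consequences: they follow because no point of the
  intersection lies in the radical of \<open>W\<close>.\<close>

locale pencil_cone =
  fixes q :: "'a::{alg_closed_field, field_char_0}^3 \<Rightarrow> 'a" and m :: "'a^4 \<Rightarrow> 'a^3" and W W' :: "'a^4 \<Rightarrow> 'a" and v :: "'a^4"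
  assumes q_form: "is_form UNIV 2 q" and m_form: "forms_over UNIV 1 m" and m_surj: "surj m"
    and W'_form: "is_form UNIV 2 W'" and W_eq: "\<And>x. W x = q (m x)"
    and nonsing: "\<And>x. x \<noteq> 0 \<Longrightarrow> W x = 0 \<Longrightarrow> W' x = 0 \<Longrightarrow> \<exists>y. polar W x y \<noteq> 0"
    and v_nonzero: "v \<noteq> 0" and v_radical: "\<And>y. polar W v y = 0"
    and param_exists: "\<exists>Q. parametrisation q Q"
begin

lemma W_form: "is_form UNIV 2 W"
proof -
  have "W = (\<lambda>x. q (m x))" using W_eq by blast
  thus ?thesis using is_form_comp_linear[OF coeff_ring_UNIV q_form m_form] by simp
qed

lemma polar_W: "polar W x y = polar q (m x) (m y)"
  by (simp add: polar_def W_eq forms1_add[OF m_form])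

lemma radical_W: "(\<And>y. polar W x y = 0) \<Longrightarrow> W x = 0"
  using polar_self[OF W_form, of x] by (metis mult_eq_0_iff zero_neq_numeral)

lemma radical_not_in_C: "x \<noteq> 0 \<Longrightarrow> (\<And>y. polar W x y = 0) \<Longrightarrow> W' x \<noteq> 0"
  using nonsing radical_W by blast

text \<open>If the conic lay on a line, \<open>q\<close> would be a multiple of the square of the
  equation of that line, and \<open>W\<close> would be singular along a hyperplane of the space, on
  which \<open>W'\<close> has a zero: a singular point of the intersection.\<close>

lemma param_span:
  assumes Q: "parametrisation q Q" and rho: "is_form UNIV 1 \<rho>" "\<And>z. \<rho> (Q z) = 0"
  shows "\<rho> y = 0"
proof (rule ccontr)
  assume "\<rho> y \<noteq> 0"
  define y0 where "y0 = (1 / \<rho> y) *s y"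
  have y0: "\<rho> y0 = 1" using \<open>\<rho> y \<noteq> 0\<close> by (simp add: y0_def linear_form_scale[OF rho(1)])
  have q_zero: "\<rho> u = 0" if "q u = 0" for u
    using Q that rho(2) linear_form_zero[OF rho(1)] unfolding parametrisation_def by metis
  hence qy0: "q y0 \<noteq> 0" using y0 by force
  \<comment> \<open>All zeros of \<open>q\<close> lie on the line, so the quadratic polynomial
    \<open>q (u + t *s y0)\<close> in \<open>t\<close> has no root except 0; both lower coefficients
    vanish.\<close>
  have ker: "q u = 0 \<and> polar q u y0 = 0" if u: "\<rho> u = 0" for u
  proof -
    have root: "t = 0" if "q u + t * polar q u y0 + t^2 * q y0 = 0" for t
    proof -
      have "q (u + t *s y0) = 0" using that quadratic_form_add[OF q_form] by simp
      hence "\<rho> (u + t *s y0) = 0" by (rule q_zero)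
      thus ?thesis using u y0 by (simp add: linear_form_add[OF rho(1)] linear_form_scale[OF rho(1)])
    qed
    obtain t where t: "q u + t * polar q u y0 + t^2 * q y0 = 0" using quadratic_root[OF qy0] by blast
    have "q u = 0" using t root[OF t] by simp
    moreover have "polar q u y0 = 0"
    proof -
      have "q u + (- polar q u y0 / q y0) * polar q u y0 + (- polar q u y0 / q y0)^2 * q y0 = 0"
        using qy0 \<open>q u = 0\<close> by (simp add: field_simps power2_eq_square)
      from root[OF this] show ?thesis using qy0 by simp
    qed
    ultimately show ?thesis by simp
  qed
  have q_eq: "q u = \<rho> u ^ 2 * q y0" for u
  proof -
    have 0: "\<rho> (u - \<rho> u *s y0) = 0"
      using y0 by (simp add: linear_form_diff[OF rho(1)] linear_form_scale[OF rho(1)])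
    have "q u = q ((u - \<rho> u *s y0) + \<rho> u *s y0)" by simp
    also have "\<dots> = \<rho> u ^ 2 * q y0" unfolding quadratic_form_add[OF q_form] using ker[OF 0] by simp
    finally show ?thesis .
  qed
  have rm: "is_form UNIV 1 (\<lambda>x. \<rho> (m x))" by (rule is_form_comp_linear[OF coeff_ring_UNIV rho(1) m_form])
  obtain u u' where u: "\<rho> (m u) = 0" "\<rho> (m u') = 0" "\<And>s t. s *s u + t *s u' = 0 \<Longrightarrow> s = 0 \<and> t = 0"
    using linear_kernel_pair[OF rm] by blast
  obtain s t where st: "(s, t) \<noteq> (0, 0)" "W' (s *s u + t *s u') = 0" using quadratic_zero_on_plane[OF W'_form] by blast
  define x where "x = s *s u + t *s u'"
  have x0: "x \<noteq> 0" unfolding x_def using u(3) st(1) by auto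
  have rx: "\<rho> (m x) = 0"
    unfolding x_def using u(1,2) linear_form_add[OF rm] linear_form_scale[OF rm] by simp
  define k where "k = q y0"
  note q_eq' = q_eq[folded k_def]
  have "polar W x y = 0" for y
    unfolding polar_def W_eq q_eq' using rx linear_form_add[OF rm, of x y] by (simp add: algebra_simps)
  thus False using radical_not_in_C[OF x0] st(2) unfolding x_def by blast
qed

text \<open>\<open>L\<close> is the linear map through which \<open>Q\<close> factors over the
  Veronese map; it is invertible because the image of \<open>Q\<close> spans. In the coordinates
  \<open>N\<close> the conic contains the standard conic, and a quadratic form vanishing there is a
  multiple of the standard one.\<close>

lemma param_coordinates:
  assumes Q: "parametrisation q Q"
  shows "\<exists>N L \<kappa>. forms_over UNIV 1 N \<and> forms_over UNIV 1 L \<and> (\<forall>y. L (N y) = y) \<and> (\<forall>u. N (L u) = u) \<and>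
    (\<forall>z. N (Q z) = sq2 z) \<and> \<kappa> \<noteq> 0 \<and> (\<forall>y. q y = \<kappa> * ((N y $ 2)^2 - N y $ 1 * N y $ 3))"
proof -
  have QF: "forms_over UNIV 2 Q" using Q by (simp add: parametrisation_def)
  define a b c where "a = Q (vector [1, 0])" and "b = Q (vector [1, 1]) - Q (vector [1, 0]) - Q (vector [0, 1])"
    and "c = Q (vector [0, 1])"
  define L where "L = (\<lambda>u :: 'a^3. u $ 1 *s a + u $ 2 *s b + u $ 3 *s c)"
  have L: "forms_over UNIV 1 L"
    by (rule forms_over1I) (simp_all add: L_def vec_eq_iff algebra_simps)
  have LQ: "L (sq2 z) = Q z" for z
    unfolding L_def sq2_nth a_def b_def c_def by (rule quadratic_map_expand[OF QF, symmetric])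
  obtain M where M: "L = (\<lambda>u. M *v u)" using matrix_of_forms1[OF coeff_ring_UNIV L] by blast
  \<comment> \<open>A vector in the kernel of the transpose is a linear form that vanishes on the
    image of \<open>Q\<close>.\<close>
  have "\<forall>x. transpose M *v x = 0 \<longrightarrow> x = 0"
  proof (intro allI impI)
    fix x assume x: "transpose M *v x = 0"
    define \<rho> where "\<rho> = (\<lambda>y :: 'a^3. \<Sum>i\<in>UNIV. x $ i * y $ i)"
    have rho: "is_form UNIV 1 \<rho>" unfolding \<rho>_def by (intro is_form_sum is_form_smult is_form_component) auto
    have "\<rho> (M *v u) = 0" for u
    proof -
      have "\<rho> (M *v u) = (\<Sum>i\<in>UNIV. \<Sum>j\<in>UNIV. x $ i * (M $ i $ j * u $ j))"
        by (simp add: \<rho>_def matrix_vector_mult_def sum_distrib_left)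
      also have "\<dots> = (\<Sum>j\<in>UNIV. \<Sum>i\<in>UNIV. x $ i * (M $ i $ j * u $ j))" by (rule sum.swap)
      also have "\<dots> = (\<Sum>j\<in>UNIV. (transpose M *v x) $ j * u $ j)"
        by (auto simp: matrix_vector_mult_def transpose_def sum_distrib_right intro!: sum.cong)
      finally show ?thesis using x by simp
    qed
    hence "\<rho> (Q z) = 0" for z using LQ M by metis
    from param_span[OF Q rho this] have "\<rho> y = 0" for y .
    moreover have "\<rho> (axis i 1) = x $ i" for i
    proof -
      have "\<rho> (axis i 1) = (\<Sum>j\<in>UNIV. if j = i then x $ j else 0)"
        unfolding \<rho>_def by (rule sum.cong) (auto simp: axis_def)
      thus ?thesis by simp
    qed
    ultimately show "x = 0" by (metis vec_eq_iff zero_index)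
  qed
  hence "\<exists>B. B ** transpose M = mat 1" unfolding matrix_left_invertible_ker .
  then obtain B where "B ** transpose M = mat 1" by blast
  hence "transpose (B ** transpose M) = mat 1" by (simp add: transpose_mat)
  hence MB: "M ** transpose B = mat 1" by (simp add: matrix_transpose_mul transpose_transpose)
  hence BM: "transpose B ** M = mat 1" using matrix_left_right_inverse by blast
  define N where "N = (\<lambda>y. transpose B *v y)"
  have N: "forms_over UNIV 1 N" unfolding N_def by (rule forms_over_matrix) auto
  have LN: "L (N y) = y" for y unfolding M N_def by (simp only: matrix_vector_mul_assoc MB matrix_vector_mul_lid)
  have NL: "N (L u) = u" for u unfolding M N_def by (simp only: matrix_vector_mul_assoc BM matrix_vector_mul_lid)
  have NQ: "N (Q z) = sq2 z" for z using NL[of "sq2 z"] LQ[of z] by simp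
  have qQ: "q (Q z) = 0" for z
    using Q is_form_at_0[OF q_form] by (cases "z = 0") (auto simp: parametrisation_def LQ[symmetric] sq2_def L_def vec_eq_iff forall_3)
  have qL: "q (L u) = (u $ 1)^2 * q a + (u $ 2)^2 * q b + (u $ 3)^2 * q c + u $ 1 * u $ 2 * polar q a b
      + u $ 1 * u $ 3 * polar q a c + u $ 2 * u $ 3 * polar q b c" for u
  proof -
    have "L u = 1 *s (u $ 1 *s a + u $ 2 *s b) + u $ 3 *s c" by (simp add: L_def)
    hence "q (L u) = q (u $ 1 *s a + u $ 2 *s b) + u $ 3 * polar q (u $ 1 *s a + u $ 2 *s b) c + (u $ 3)^2 * q c"
      by (simp only: quadratic_form_comb[OF q_form]) simp
    thus ?thesis unfolding quadratic_form_comb[OF q_form] by (simp add: polar_simps[OF q_form] algebra_simps)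
  qed
  have qac: "q a = 0" "q c = 0" unfolding a_def c_def by (rule qQ)+
  \<comment> \<open>A quartic in the parameters. Its values at \<open>(1, 1)\<close>,
    \<open>(1, -1)\<close> and \<open>(2, 1)\<close> leave only the equation of the standard
    conic.\<close>
  have E: "s^2 * t^2 * q b + s^2 * (s * t) * polar q a b + s^2 * t^2 * polar q a c + s * t * t^2 * polar q b c = 0" for s t
    using qQ[of "vector [s, t]"] unfolding LQ[symmetric] qL qac by (simp add: sq2_nth power_mult_distrib)
  have "q b + polar q a b + polar q a c + polar q b c = 0" "q b - polar q a b + polar q a c - polar q b c = 0"
    "4 * q b + 8 * polar q a b + 4 * polar q a c + 2 * polar q b c = 0"
    using E[of 1 1] E[of 1 "-1"] E[of 2 1] by simp_all
  note e = three_values[OF this]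
  have q_eq: "q y = q b * ((N y $ 2)^2 - N y $ 1 * N y $ 3)" for y
    using qL[of "N y"] unfolding LN qac e by (simp add: algebra_simps)
  have "q b \<noteq> 0"
  proof
    \<comment> \<open>Then \<open>q\<close> would vanish identically and \<open>b\<close> would be
      hit by \<open>Q\<close>, but \<open>(0, 1, 0)\<close> is no value of the Veronese map.\<close>
    assume qb: "q b = 0"
    have b: "b = L (vector [0, 1, 0])" by (simp add: L_def)
    hence Nb: "N b = vector [0, 1, 0]" using NL by simp
    have "b \<noteq> 0"
    proof
      assume "b = 0"
      hence "N b = 0" using forms1_zero[OF N] by simp
      hence "N b $ 2 = 0" by simp
      thus False using Nb by simp
    qed
    then obtain z where "Q z = b" using Q qb unfolding parametrisation_def by blast
    hence "sq2 z = vector [0, 1, 0]" using Nb NQ by metis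
    thus False by (auto simp: vec_eq_iff forall_3 sq2_nth)
  qed
  thus ?thesis using N L LN NL NQ q_eq by blast
qed

text \<open>A binary quadratic form splits into linear factors. In the plane: a point off the
  standard conic is the intersection of two tangents, and it is obtained by polarising
  \<open>sq2\<close> at their points of contact.\<close>

lemma sq2_polar_factor:
  fixes p1 p2 p3 :: 'a
  shows "\<exists>s1 t1 s2 t2. 2 * (s1 * s2) = p1 \<and> s1 * t2 + s2 * t1 = p2 \<and> 2 * (t1 * t2) = p3"
proof (cases "p1 = 0")
  case True
  thus ?thesis by (intro exI[of _ 0] exI[of _ 1] exI[of _ p2] exI[of _ "p3 / 2"]) simp
next
  case False
  obtain r where r: "p3 + r * (- 2 * p2) + r^2 * p1 = 0" using quadratic_root[OF False] by blast
  define k where "k = 2 * p2 / p1"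
  have k: "p1 * k = 2 * p2" using False by (simp add: k_def)
  have "p1 * r * (k - r) = r * (p1 * k) - r^2 * p1" by (simp add: algebra_simps power2_eq_square)
  hence "p1 * r * (2 * p2 / p1 - r) = 2 * p2 * r - r^2 * p1" unfolding k unfolding k_def by (simp add: mult_ac)
  moreover have "p3 = 2 * p2 * r - r^2 * p1" using r by (simp add: algebra_simps)
  ultimately have "p1 * r * (2 * p2 / p1 - r) = p3" by (simp only:)
  moreover have "p1 / 2 * (2 * p2 / p1 - r) + 1 * (p1 / 2 * r) = p2" using False by (simp add: field_simps)
  ultimately show ?thesis
    by (intro exI[of _ "p1 / 2"] exI[of _ "p1 / 2 * r"] exI[of _ 1] exI[of _ "2 * p2 / p1 - r"]) simp
qed

text \<open>The points of contact of the two tangents from \<open>y0\<close> become the parameters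
  \<open>(1, 0)\<close> and \<open>(0, 1)\<close>. They are distinct because \<open>y0\<close> is
  off the conic, which is what \<open>\<Delta> \<noteq> 0\<close> expresses. Polarising the
  parametrisation at these two points returns \<open>y0\<close>, which is why it gets the
  coordinates \<open>(0, 1, 0)\<close>.\<close>

lemma param_normalise:
  assumes Q: "parametrisation q Q" and y0: "q y0 \<noteq> 0"
  shows "\<exists>S S' N L \<kappa>. forms_over UNIV 1 S \<and> forms_over UNIV 1 S' \<and> (\<forall>p. S' (S p) = p) \<and> (\<forall>z. S (S' z) = z) \<and>
    forms_over UNIV 1 N \<and> forms_over UNIV 1 L \<and> (\<forall>y. L (N y) = y) \<and> (\<forall>u. N (L u) = u) \<and>
    (\<forall>p. N (Q (S p)) = sq2 p) \<and> \<kappa> \<noteq> 0 \<and> (\<forall>y. q y = \<kappa> * ((N y $ 2)^2 - N y $ 1 * N y $ 3)) \<and> N y0 = vector [0, 1, 0]"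
proof -
  obtain N L \<kappa> where N: "forms_over UNIV 1 N" "forms_over UNIV 1 L" "\<forall>y. L (N y) = y" "\<forall>u. N (L u) = u"
    "\<forall>z. N (Q z) = sq2 z" "\<kappa> \<noteq> 0" "\<forall>y. q y = \<kappa> * ((N y $ 2)^2 - N y $ 1 * N y $ 3)"
    using param_coordinates[OF Q] by (elim exE conjE) (rule that)
  obtain s1 t1 s2 t2 where st: "2 * (s1 * s2) = N y0 $ 1" "s1 * t2 + s2 * t1 = N y0 $ 2" "2 * (t1 * t2) = N y0 $ 3"
    using sq2_polar_factor by blast
  define \<Delta> where "\<Delta> = s1 * t2 - s2 * t1"
  have "\<Delta>^2 = (N y0 $ 2)^2 - N y0 $ 1 * N y0 $ 3"
    unfolding \<Delta>_def st[symmetric] by (simp add: algebra_simps power2_eq_square)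
  hence D0: "\<Delta> \<noteq> 0" using y0 N(7) by auto
  define S where "S = (\<lambda>p :: 'a^2. vector [s1 * p $ 1 + s2 * p $ 2, t1 * p $ 1 + t2 * p $ 2] :: 'a^2)"
  define S' where "S' = (\<lambda>z :: 'a^2. vector [(t2 * z $ 1 - s2 * z $ 2) / \<Delta>, (s1 * z $ 2 - t1 * z $ 1) / \<Delta>] :: 'a^2)"
  have S: "forms_over UNIV 1 S" by (rule forms_over1I) (simp_all add: S_def vec_eq_iff forall_2 algebra_simps)
  have S'F: "forms_over UNIV 1 S'"
    by (rule forms_over1I) (simp_all add: S'_def vec_eq_iff forall_2 field_simps add_divide_distrib diff_divide_distrib)
  have SS: "S' (S p) = p" for p
  proof -
    have "t2 * (s1 * p $ 1 + s2 * p $ 2) - s2 * (t1 * p $ 1 + t2 * p $ 2) = \<Delta> * p $ 1"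
      "s1 * (t1 * p $ 1 + t2 * p $ 2) - t1 * (s1 * p $ 1 + s2 * p $ 2) = \<Delta> * p $ 2"
      by (simp_all add: \<Delta>_def algebra_simps)
    thus ?thesis using D0 by (simp add: S_def S'_def vec_eq_iff forall_2)
  qed
  have SS': "S (S' z) = z" for z
  proof -
    have "s1 * ((t2 * z $ 1 - s2 * z $ 2) / \<Delta>) + s2 * ((s1 * z $ 2 - t1 * z $ 1) / \<Delta>) = (\<Delta> * z $ 1) / \<Delta>"
      "t1 * ((t2 * z $ 1 - s2 * z $ 2) / \<Delta>) + t2 * ((s1 * z $ 2 - t1 * z $ 1) / \<Delta>) = (\<Delta> * z $ 2) / \<Delta>"
      by (simp_all add: \<Delta>_def algebra_simps add_divide_distrib[symmetric] diff_divide_distrib[symmetric])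
    thus ?thesis using D0 by (simp add: S_def S'_def vec_eq_iff forall_2)
  qed
  have S0: "S p = 0 \<longleftrightarrow> p = 0" for p using SS[of p] forms1_zero[OF S] forms1_zero[OF S'F] by metis
  have QS: "parametrisation q (\<lambda>p. Q (S p))"
    unfolding parametrisation_def
  proof (intro conjI allI impI)
    have "forms_over UNIV (2 * 1) (\<lambda>p. Q (S p))"
      using Q by (intro forms_over_comp[OF _ _ S]) (auto simp: parametrisation_def)
    thus "forms_over UNIV 2 (\<lambda>p. Q (S p))" by simp
    fix p :: "'a^2" assume "p \<noteq> 0"
    thus "Q (S p) \<noteq> 0" "q (Q (S p)) = 0" using Q S0 unfolding parametrisation_def by blast+
  next
    fix y assume "y \<noteq> 0" "q y = 0"
    then obtain z where "Q z = y" using Q unfolding parametrisation_def by blast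
    thus "\<exists>p. Q (S p) = y" using SS' by metis
  qed
  obtain N' L' \<kappa>' where N': "forms_over UNIV 1 N'" "forms_over UNIV 1 L'" "\<forall>y. L' (N' y) = y" "\<forall>u. N' (L' u) = u"
    "\<forall>z. N' (Q (S z)) = sq2 z" "\<kappa>' \<noteq> 0" "\<forall>y. q y = \<kappa>' * ((N' y $ 2)^2 - N' y $ 1 * N' y $ 3)"
    using param_coordinates[OF QS] by (elim exE conjE) (rule that)
  let ?b = "Q (S (vector [1, 1])) - Q (S (vector [1, 0])) - Q (S (vector [0, 1]))"
  have "N ?b = sq2 (S (vector [1, 1])) - sq2 (S (vector [1, 0])) - sq2 (S (vector [0, 1]))"
    using N(5) by (simp add: forms1_diff[OF N(1)])
  also have "\<dots> = N y0"
    unfolding vec_eq_iff forall_3 using st by (simp add: sq2_nth S_def algebra_simps power2_eq_square)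
  finally have "L (N ?b) = L (N y0)" by simp
  hence b: "?b = y0" using N(3) by simp
  have "N' ?b = sq2 (vector [1, 1]) - sq2 (vector [1, 0]) - sq2 (vector [0, 1])"
    using N'(5) by (simp add: forms1_diff[OF N'(1)])
  also have "\<dots> = vector [0, 1, 0]" by (simp add: vec_eq_iff forall_3 sq2_nth)
  finally have "N' y0 = vector [0, 1, 0]" unfolding b .
  thus ?thesis using S S'F SS SS' N'
    by (intro exI[of _ S] exI[of _ S'] exI[of _ N'] exI[of _ L'] exI[of _ \<kappa>'] conjI) auto
qed

text \<open>Otherwise \<open>m v\<close> would be a point of the conic that is polar to every point.
  The standard conic has no such point: at the sum of two of its points its equation is minus the
  square of the determinant of their parameters.\<close>

lemma m_v: "m v = 0"
proof (rule ccontr)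
  assume nz: "m v \<noteq> 0"
  obtain Q where Q: "parametrisation q Q" using param_exists by blast
  obtain N L \<kappa> where N: "forms_over UNIV 1 N" "forms_over UNIV 1 L" "\<forall>y. L (N y) = y" "\<forall>u. N (L u) = u"
    "\<forall>z. N (Q z) = sq2 z" "\<kappa> \<noteq> 0" "\<forall>y. q y = \<kappa> * ((N y $ 2)^2 - N y $ 1 * N y $ 3)"
    using param_coordinates[OF Q] by (elim exE conjE) (rule that)
  have "q (m v) = 0" using radical_W[OF v_radical] by (simp add: W_eq)
  then obtain z where z: "Q z = m v" using Q nz unfolding parametrisation_def by blast
  have "z \<noteq> 0"
  proof
    assume "z = 0"
    hence "N (m v) = sq2 0" using N(5) z by metis
    hence "N (m v) = 0" by (simp add: vec_eq_iff forall_3 sq2_nth)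
    hence "L (N (m v)) = 0" using forms1_zero[OF N(2)] by simp
    thus False using N(3) nz by simp
  qed
  define z' :: "'a^2" where "z' = (if z $ 1 = 0 then vector [1, 0] else vector [0, 1])"
  have z'0: "z' \<noteq> 0" by (simp add: z'_def vec_eq_iff forall_2)
  have ind: "z $ 1 * z' $ 2 - z $ 2 * z' $ 1 \<noteq> 0" using \<open>z \<noteq> 0\<close> by (auto simp: z'_def vec_eq_iff forall_2)
  obtain x' where x': "m x' = Q z'" using m_surj by (metis surjD)
  have "polar q (m v) (Q z') = 0" using v_radical[of x'] unfolding polar_W x' .
  hence "q (m v + Q z') = 0" using \<open>q (m v) = 0\<close> Q z'0 unfolding polar_def parametrisation_def by simp
  hence "(N (m v + Q z') $ 2)^2 - N (m v + Q z') $ 1 * N (m v + Q z') $ 3 = 0" using N(6,7) by simp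
  moreover have "N (m v + Q z') = sq2 z + sq2 z'" unfolding z[symmetric] forms1_add[OF N(1)] using N(5) by simp
  ultimately have "(z $ 1 * z $ 2 + z' $ 1 * z' $ 2)^2 - ((z $ 1)^2 + (z' $ 1)^2) * ((z $ 2)^2 + (z' $ 2)^2) = 0"
    by (simp add: sq2_nth)
  hence "- ((z $ 1 * z' $ 2 - z $ 2 * z' $ 1)^2) = 0" by (simp add: algebra_simps power2_eq_square)
  thus False using ind by simp
qed

lemma W'_v: "W' v \<noteq> 0"
  using radical_not_in_C[OF v_nonzero v_radical] .

text \<open>The kernel of \<open>m\<close> lies in the radical of \<open>W\<close>. The line through
  \<open>x\<close> in direction \<open>v\<close> stays in the kernel and meets \<open>W'\<close>;
  unless it does so at 0, this is a singular point of the intersection.\<close>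

lemma kernel_m:
  assumes "m x = 0" shows "\<exists>c. x = c *s v"
proof -
  obtain t where t: "W' x + t * polar W' x v + t^2 * W' v = 0" using quadratic_root[OF W'_v] by blast
  have 0: "W' (x + t *s v) = 0" using t quadratic_form_add[OF W'_form] by simp
  have "m (x + t *s v) = 0" using assms m_v by (simp add: forms1_add[OF m_form] forms1_scale[OF m_form])
  hence "polar W (x + t *s v) y = 0" for y unfolding polar_W by (simp add: polar_simps[OF q_form])
  hence "x + t *s v = 0" using radical_not_in_C 0 by blast
  hence "x = (- t) *s v" by (simp add: add_eq_0_iff2 vector_smult_lneg)
  thus ?thesis by blast
qed

text \<open>The fibre of the cone is a line through the vertex, which is off \<open>W'\<close>, so
  \<open>W'\<close> restricts to a polynomial of degree exactly 2 on it.\<close>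

lemma lift_to_curve:
  assumes y: "y \<noteq> 0" "q y = 0" shows "\<exists>x. x \<noteq> 0 \<and> m x = y \<and> W x = 0 \<and> W' x = 0"
proof -
  obtain x0 where x0: "m x0 = y" using m_surj by (metis surjD)
  obtain t where t: "W' x0 + t * polar W' x0 v + t^2 * W' v = 0" using quadratic_root[OF W'_v] by blast
  have "m (x0 + t *s v) = y" using x0 m_v by (simp add: forms1_add[OF m_form] forms1_scale[OF m_form])
  moreover have "W' (x0 + t *s v) = 0" using t quadratic_form_add[OF W'_form] by simp
  ultimately show ?thesis using y forms1_zero[OF m_form] W_eq by metis
qed

lemma m_nonzero: "x \<noteq> 0 \<Longrightarrow> W x = 0 \<Longrightarrow> W' x = 0 \<Longrightarrow> m x \<noteq> 0"
  using nonsing polar_W polar_simps(6)[OF q_form] by metis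

lemma conic_zeros: "\<Union>(zeros {q}) = {y. y \<noteq> 0 \<and> q y = 0}"
proof -
  have "y \<in> hpoint x \<Longrightarrow> x \<noteq> 0 \<Longrightarrow> q x = 0 \<Longrightarrow> y \<noteq> 0 \<and> q y = 0" for x y :: "'a^3"
    by (auto simp: mem_hpoint_iff is_form_homogeneous[OF q_form])
  thus ?thesis unfolding zeros_def by fastforce
qed

lemma conic:
  assumes Q: "parametrisation q Q"
  shows "\<exists>N. parametrised_conic (zeros {q}) Q N"
proof -
  obtain N L \<kappa> where N: "forms_over UNIV 1 N" "forms_over UNIV 1 L" "\<forall>y. L (N y) = y" "\<forall>u. N (L u) = u"
    "\<forall>z. N (Q z) = sq2 z" "\<kappa> \<noteq> 0" "\<forall>y. q y = \<kappa> * ((N y $ 2)^2 - N y $ 1 * N y $ 3)"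
    using param_coordinates[OF Q] by (elim exE conjE) (rule that)
  have Q0: "Q 0 = 0"
    using quadratic_map_expand[of Q 0] Q by (simp add: parametrisation_def)
  have "parametrised_conic (zeros {q}) Q N"
  proof unfold_locales
    show "zeros {q} \<subseteq> {hpoint x |x. x \<noteq> 0}" unfolding zeros_def by blast
    show "\<Union>(zeros {q}) = Q ` {z. z \<noteq> 0}"
      unfolding conic_zeros using Q Q0 unfolding parametrisation_def by (auto simp: image_iff)
  qed (use Q N in \<open>auto simp: parametrisation_def\<close>)
  thus ?thesis by blast
qed

end

section \<open>Normal forms of the two curves\<close>

lemma inverse_linear:
  assumes T: "forms_over UNIV 1 T" and inv: "\<And>x. T (T' x) = x" "\<And>x. T' (T x) = x"
  shows "forms_over UNIV 1 T'"
proof (rule forms_over1I)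
  fix x y show "T' (x + y) = T' x + T' y" using forms1_add[OF T, of "T' x" "T' y"] inv by metis
next
  fix c x show "T' (c *s x) = c *s T' x" using forms1_scale[OF T, of c "T' x"] inv by metis
qed

text \<open>The part of both constructions that is visible over the closure. \<open>F\<close> and
  \<open>G\<close> enter only through their meaning: \<open>on_D\<close> and \<open>D_intro\<close>
  say that \<open>D\<close> consists of the pairs of parameters whose two conic points come from one
  vector \<open>r w\<close>, and \<open>FG_comb\<close> says that the members of their pencil come
  from linear relations between the two sets of linear forms.\<close>

locale covering_data =
  c1: pencil_cone q1 m1 W1 W2 v1 + c2: pencil_cone q2 m2 W2 W1 v2
  for q1 q2 :: "'a::{alg_closed_field, field_char_0}^3 \<Rightarrow> 'a" and m1 m2 :: "'a^4 \<Rightarrow> 'a^3"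
    and W1 W2 :: "'a^4 \<Rightarrow> 'a" and v1 v2 :: "'a^4" +
  fixes Q R :: "'a^2 \<Rightarrow> 'a^3" and zz zz' :: "'a^4 \<Rightarrow> 'a^2" and J :: "'a^2 \<Rightarrow> 'a^2 \<Rightarrow> 'a^4"
    and r :: "'a^4 \<Rightarrow> 'a^4" and F G :: "'a^4 \<Rightarrow> 'a"
  assumes pencil: "\<And>x s t. x \<noteq> 0 \<Longrightarrow> W1 x = 0 \<Longrightarrow> W2 x = 0 \<Longrightarrow> (\<And>y. s * polar W1 x y + t * polar W2 x y = 0) \<Longrightarrow> s = 0 \<and> t = 0"
    and Q: "parametrisation q1 Q" and R: "parametrisation q2 R"
    and zz_form: "forms_over UNIV 1 zz" and zz'_form: "forms_over UNIV 1 zz'"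
    and zz_J: "\<And>z z'. zz (J z z') = z" and zz'_J: "\<And>z z'. zz' (J z z') = z'" and J_zz: "\<And>w. J (zz w) (zz' w) = w"
    and r_form: "forms_over UNIV 2 r" and F_form: "is_form UNIV 2 F" and G_form: "is_form UNIV 2 G"
    and on_D: "\<And>w. F w = 0 \<Longrightarrow> G w = 0 \<Longrightarrow> m1 (r w) = Q (zz w) \<and> m2 (r w) = R (zz' w)"
    and D_intro: "\<And>w x. m1 x = Q (zz w) \<Longrightarrow> m2 x = R (zz' w) \<Longrightarrow> F w = 0 \<and> G w = 0 \<and> r w = x"
    and FG_comb: "\<And>s t. (s, t) \<noteq> (0, 0) \<Longrightarrow> \<exists>\<rho>1 \<rho>2. is_form UNIV 1 \<rho>1 \<and> is_form UNIV 1 \<rho>2 \<and>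
      ((\<exists>y. \<rho>1 y \<noteq> 0) \<or> (\<exists>y. \<rho>2 y \<noteq> 0)) \<and> (\<forall>x. \<rho>1 (m1 x) + \<rho>2 (m2 x) = 0) \<and>
      (\<forall>w. s * F w + t * G w = \<rho>1 (Q (zz w)) + \<rho>2 (R (zz' w)))"
begin

definition Cset where "Cset = {x. x \<noteq> 0 \<and> W1 x = 0 \<and> W2 x = 0}"
definition Dset where "Dset = {w. w \<noteq> 0 \<and> F w = 0 \<and> G w = 0}"

lemma zz_zero: "zz w = 0 \<Longrightarrow> zz' w = 0 \<Longrightarrow> w = 0"
  using J_zz[of w] J_zz[of 0] forms1_zero[OF zz_form] forms1_zero[OF zz'_form] by metis

lemma param_0: "Q 0 = 0" "R 0 = 0"
  using quadratic_map_expand[of Q 0] quadratic_map_expand[of R 0] Q R by (simp_all add: parametrisation_def)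

lemma r_zero_on_D: "F w = 0 \<Longrightarrow> G w = 0 \<Longrightarrow> r w = 0 \<Longrightarrow> w = 0"
  using on_D[of w] forms1_zero[OF c1.m_form] forms1_zero[OF c2.m_form] Q R zz_zero
  unfolding parametrisation_def by metis

lemma r_in_C:
  assumes "w \<in> Dset" shows "r w \<in> Cset"
proof -
  have w: "w \<noteq> 0" "F w = 0" "G w = 0" using assms by (auto simp: Dset_def)
  have e: "m1 (r w) = Q (zz w)" "m2 (r w) = R (zz' w)" using on_D[OF w(2,3)] by auto
  have "q1 (Q z) = 0" for z
    using Q param_0 is_form_at_0[OF c1.q_form] by (cases "z = 0") (auto simp: parametrisation_def)
  moreover have "q2 (R z) = 0" for z
    using R param_0 is_form_at_0[OF c2.q_form] by (cases "z = 0") (auto simp: parametrisation_def)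
  ultimately have "W1 (r w) = 0" "W2 (r w) = 0" by (simp_all add: c1.W_eq c2.W_eq e)
  thus ?thesis using r_zero_on_D w unfolding Cset_def by blast
qed

lemma r_onto_C:
  assumes "x \<in> Cset" shows "\<exists>w\<in>Dset. r w = x"
proof -
  have x: "x \<noteq> 0" "W1 x = 0" "W2 x = 0" using assms by (auto simp: Cset_def)
  have "m1 x \<noteq> 0" "q1 (m1 x) = 0" using c1.m_nonzero[OF x] x(2) by (auto simp: c1.W_eq)
  then obtain z where z: "Q z = m1 x" using Q unfolding parametrisation_def by blast
  have "m2 x \<noteq> 0" "q2 (m2 x) = 0" using c2.m_nonzero[OF x(1,3,2)] x(3) by (auto simp: c2.W_eq)
  then obtain z' where z': "R z' = m2 x" using R unfolding parametrisation_def by blast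
  have w: "F (J z z') = 0 \<and> G (J z z') = 0 \<and> r (J z z') = x"
    by (rule D_intro) (simp_all add: zz_J zz'_J z z')
  have "J z z' \<noteq> 0"
  proof
    assume "J z z' = 0"
    hence "z = 0" using zz_J[of z z'] forms1_zero[OF zz_form] by simp
    thus False using z param_0 \<open>m1 x \<noteq> 0\<close> by simp
  qed
  thus ?thesis using w unfolding Dset_def by blast
qed

lemma r_image: "Cset = r ` Dset"
  using r_in_C r_onto_C by blast

lemma m1_image: "{y. y \<noteq> 0 \<and> q1 y = 0} = m1 ` Cset"
proof
  show "{y. y \<noteq> 0 \<and> q1 y = 0} \<subseteq> m1 ` Cset"
  proof
    fix y assume "y \<in> {y. y \<noteq> 0 \<and> q1 y = 0}"
    then obtain x where "x \<noteq> 0" "m1 x = y" "W1 x = 0" "W2 x = 0" using c1.lift_to_curve by blast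
    thus "y \<in> m1 ` Cset" unfolding Cset_def by blast
  qed
  show "m1 ` Cset \<subseteq> {y. y \<noteq> 0 \<and> q1 y = 0}"
    using c1.m_nonzero c1.W_eq unfolding Cset_def by auto
qed

lemma m2_image: "{y. y \<noteq> 0 \<and> q2 y = 0} = m2 ` Cset"
proof
  show "{y. y \<noteq> 0 \<and> q2 y = 0} \<subseteq> m2 ` Cset"
  proof
    fix y assume "y \<in> {y. y \<noteq> 0 \<and> q2 y = 0}"
    then obtain x where "x \<noteq> 0" "m2 x = y" "W1 x = 0" "W2 x = 0" using c2.lift_to_curve by blast
    thus "y \<in> m2 ` Cset" unfolding Cset_def by blast
  qed
  show "m2 ` Cset \<subseteq> {y. y \<noteq> 0 \<and> q2 y = 0}"
    using c2.m_nonzero c2.W_eq unfolding Cset_def by auto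
qed

lemma zz_nonzero_on_D: "w \<in> Dset \<Longrightarrow> zz w \<noteq> 0" "w \<in> Dset \<Longrightarrow> zz' w \<noteq> 0"
proof -
  assume w: "w \<in> Dset"
  have "m1 (r w) \<noteq> 0" "m2 (r w) \<noteq> 0"
    using r_in_C[OF w] c1.m_nonzero c2.m_nonzero unfolding Cset_def by auto
  thus "zz w \<noteq> 0" "zz' w \<noteq> 0" using on_D[of w] w param_0 unfolding Dset_def by auto
qed

end

text \<open>Each parametrisation is normalised at the projection of the vertex of the other cone, a
  point off the conic.\<close>

locale covering_normal = covering_data +
  fixes S1 S1' N1 L1 \<kappa>1 S2 S2' N2 L2 \<kappa>2
  assumes S1: "forms_over UNIV 1 S1" "forms_over UNIV 1 S1'" "\<And>p. S1' (S1 p) = p" "\<And>z. S1 (S1' z) = z"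
    and N1: "forms_over UNIV 1 N1" "forms_over UNIV 1 L1" "\<And>y. L1 (N1 y) = y" "\<And>u. N1 (L1 u) = u"
      "\<And>p. N1 (Q (S1 p)) = sq2 p" "\<kappa>1 \<noteq> 0" "\<And>y. q1 y = \<kappa>1 * ((N1 y $ 2)^2 - N1 y $ 1 * N1 y $ 3)"
    and N1_v2: "N1 (m1 v2) = vector [0, 1, 0]"
    and S2: "forms_over UNIV 1 S2" "forms_over UNIV 1 S2'" "\<And>p. S2' (S2 p) = p" "\<And>z. S2 (S2' z) = z"
    and N2: "forms_over UNIV 1 N2" "forms_over UNIV 1 L2" "\<And>y. L2 (N2 y) = y" "\<And>u. N2 (L2 u) = u"
      "\<And>p. N2 (R (S2 p)) = sq2 p" "\<kappa>2 \<noteq> 0" "\<And>y. q2 y = \<kappa>2 * ((N2 y $ 2)^2 - N2 y $ 1 * N2 y $ 3)"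
    and N2_v1: "N2 (m2 v1) = vector [0, 1, 0]"
begin

definition n1 where "n1 x = N1 (m1 x)"
definition n2 where "n2 x = N2 (m2 x)"

lemma n1_form: "forms_over UNIV 1 n1" and n2_form: "forms_over UNIV 1 n2"
proof -
  have "forms_over UNIV (1 * 1) (\<lambda>x. N1 (m1 x))" "forms_over UNIV (1 * 1) (\<lambda>x. N2 (m2 x))"
    using forms_over_comp[OF coeff_ring_UNIV N1(1) c1.m_form] forms_over_comp[OF coeff_ring_UNIV N2(1) c2.m_form] .
  thus "forms_over UNIV 1 n1" "forms_over UNIV 1 n2" by (simp_all add: n1_def[abs_def] n2_def[abs_def])
qed

lemmas n_lin = forms1_add[OF n1_form] forms1_add[OF n2_form] forms1_scale[OF n1_form] forms1_scale[OF n2_form]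
  forms1_diff[OF n1_form] forms1_diff[OF n2_form]

lemma n_v: "n1 v1 = 0" "n1 v2 = vector [0, 1, 0]" "n2 v1 = vector [0, 1, 0]" "n2 v2 = 0"
  by (simp_all add: n1_def n2_def c1.m_v c2.m_v N1_v2 N2_v1 forms1_zero[OF N1(1)] forms1_zero[OF N2(1)])

lemma m_of_n: "m1 x = L1 (n1 x)" "m2 x = L2 (n2 x)"
  by (simp_all add: n1_def n2_def N1(3) N2(3))

lemma n1_zero: "n1 x = 0 \<Longrightarrow> \<exists>c. x = c *s v1"
  by (rule c1.kernel_m) (simp add: m_of_n forms1_zero[OF N1(2)])

lemma n2_zero: "n2 x = 0 \<Longrightarrow> \<exists>c. x = c *s v2"
  by (rule c2.kernel_m) (simp add: m_of_n forms1_zero[OF N2(2)])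

text \<open>Moving along \<open>v1\<close> leaves \<open>n1\<close> fixed and changes only the
  middle coordinate of \<open>n2\<close>.\<close>

lemma lift_n1: "\<exists>x. n1 x = u \<and> n2 x $ 2 = 0"
proof -
  obtain x0 where "m1 x0 = L1 u" using c1.m_surj by (metis surjD)
  hence x0: "n1 x0 = u" by (simp add: n1_def N1(4))
  show ?thesis
    by (rule exI[of _ "x0 - (n2 x0 $ 2) *s v1"]) (simp add: n_lin n_v x0)
qed

definition xc where "xc = (SOME x. n1 x = vector [1, 0, 0] \<and> n2 x $ 2 = 0)"
definition xd where "xd = (SOME x. n1 x = vector [0, 0, 1] \<and> n2 x $ 2 = 0)"

lemma xc: "n1 xc = vector [1, 0, 0]" "n2 xc $ 2 = 0" and xd: "n1 xd = vector [0, 0, 1]" "n2 xd $ 2 = 0"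
  using someI_ex[OF lift_n1, of "vector [1, 0, 0]"] someI_ex[OF lift_n1, of "vector [0, 0, 1]"]
  by (simp_all add: xc_def xd_def)

text \<open>The outer coordinates of \<open>n1\<close> and those of \<open>n2\<close> both describe
  the quotient of the space by the two vertices, so they differ by an invertible 2 by 2 matrix;
  these are its entries.\<close>

definition \<alpha> where "\<alpha> = n2 xc $ 1"
definition \<beta> where "\<beta> = n2 xd $ 1"
definition \<gamma> where "\<gamma> = n2 xc $ 3"
definition \<delta> where "\<delta> = n2 xd $ 3"

text \<open>The coordinates \<open>(c, d, \<theta>, \<psi>)\<close> of the normal form: the outer
  pair of \<open>n1\<close>, then the middle coordinates of \<open>n2\<close> and of
  \<open>n1\<close>.\<close>

definition T where "T (x :: 'a^4) = (vector [n1 x $ 1, n1 x $ 3, n2 x $ 2, n1 x $ 2] :: 'a^4)"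
definition T' where "T' (w :: 'a^4) = w $ 1 *s xc + w $ 2 *s xd + w $ 3 *s v1 + w $ 4 *s v2"

lemma T_form: "forms_over UNIV 1 T"
  by (rule forms_over1I) (simp_all add: T_def vec_eq_iff forall_4 vector_4 n_lin)

lemma T'_form: "forms_over UNIV 1 T'"
  by (rule forms_over1I) (simp_all add: T'_def vec_eq_iff algebra_simps)

lemma n_T': "n1 (T' w) = vector [w $ 1, w $ 4, w $ 2]"
  "n2 (T' w) = vector [\<alpha> * w $ 1 + \<beta> * w $ 2, w $ 3, \<gamma> * w $ 1 + \<delta> * w $ 2]"
  unfolding T'_def n_lin n_v xc(1) xd(1)
  by (simp_all add: vec_eq_iff forall_3 xc xd \<alpha>_def \<beta>_def \<gamma>_def \<delta>_def mult.commute)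

lemma T_T': "T (T' w) = w"
  by (simp add: T_def n_T' vec_eq_iff forall_4 vector_4)

lemma T'_T: "T' (T x) = x"
proof -
  have "n1 (x - T' (T x)) = 0" unfolding n_lin n_T' by (simp add: T_def vec_eq_iff forall_3 vector_4)
  then obtain c where c: "x - T' (T x) = c *s v1" using n1_zero by blast
  have "n2 (x - T' (T x)) $ 2 = 0" unfolding n_lin n_T' by (simp add: T_def vector_4)
  hence "c = 0" unfolding c n_lin n_v by simp
  thus ?thesis using c by simp
qed

lemma n2_components: "n2 x $ 1 = \<alpha> * n1 x $ 1 + \<beta> * n1 x $ 3" "n2 x $ 3 = \<gamma> * n1 x $ 1 + \<delta> * n1 x $ 3"
proof -
  have e: "n2 x = n2 (T' (T x))" by (simp add: T'_T)
  show "n2 x $ 1 = \<alpha> * n1 x $ 1 + \<beta> * n1 x $ 3" "n2 x $ 3 = \<gamma> * n1 x $ 1 + \<delta> * n1 x $ 3"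
    by (subst e, simp add: n_T' T_def vector_4)+
qed

lemma det_nonzero: "\<alpha> * z1 + \<beta> * z2 = 0 \<Longrightarrow> \<gamma> * z1 + \<delta> * z2 = 0 \<Longrightarrow> z1 = 0 \<and> z2 = 0"
proof -
  assume e: "\<alpha> * z1 + \<beta> * z2 = 0" "\<gamma> * z1 + \<delta> * z2 = 0"
  let ?x = "T' (vector [z1, z2, 0, 0])"
  have "n2 ?x = 0" unfolding n_T' using e by (simp add: vec_eq_iff forall_3 vector_4)
  then obtain c where "?x = c *s v2" using n2_zero by blast
  hence "n1 ?x = c *s n1 v2" by (simp add: n_lin)
  thus ?thesis unfolding n_T' n_v by (simp add: vec_eq_iff forall_3 vector_4)
qed

definition f1 where "f1 z = \<alpha> * z $ 1 + \<beta> * (z :: 'a^2) $ 2"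
definition f2 where "f2 z = \<gamma> * z $ 1 + \<delta> * (z :: 'a^2) $ 2"
definition f3 where "f3 z = (z :: 'a^2) $ 1"
definition f4 where "f4 z = (z :: 'a^2) $ 2"

lemma f_form: "is_form UNIV 1 f1" "is_form UNIV 1 f2" "is_form UNIV 1 f3" "is_form UNIV 1 f4"
  unfolding f1_def[abs_def] f2_def[abs_def] f3_def[abs_def] f4_def[abs_def]
  by (intro is_form_add is_form_smult is_form_component; simp)+

lemma W1_T: "W1 x = \<kappa>1 * ((T x $ 4)^2 - f3 (pr (T x)) * f4 (pr (T x)))"
  by (simp add: c1.W_eq N1(7) n1_def[symmetric] T_def vector_4 f3_def f4_def)

lemma W2_T: "W2 x = \<kappa>2 * ((T x $ 3)^2 - f1 (pr (T x)) * f2 (pr (T x)))"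
  by (simp add: c2.W_eq N2(7) n2_def[symmetric] T_def vector_4 f1_def f2_def n2_components)

text \<open>A common root of the two binary forms would be a singular point of \<open>C\<close>.\<close>

lemma no_common_root:
  assumes g: "is_form UNIV 1 g" "is_form UNIV 1 g'" "is_form UNIV 1 h" "is_form UNIV 1 h'"
    and W1: "\<And>x. W1 x = \<kappa>1 * ((T x $ 4)^2 - h (pr (T x)) * h' (pr (T x)))"
    and W2: "\<And>x. W2 x = \<kappa>2 * ((T x $ 3)^2 - g (pr (T x)) * g' (pr (T x)))"
    and z: "g z = 0" "h z = 0"
  shows "z = 0"
proof (rule ccontr)
  assume z0: "z \<noteq> 0"
  \<comment> \<open>The point above the common root with both square roots equal to 0; there both
    gradients are multiples of linear forms with the same zero \<open>z\<close>.\<close>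
  define x where "x = T' (vector [z $ 1, z $ 2, 0, 0])"
  have Tx: "T x = vector [z $ 1, z $ 2, 0, 0]" by (simp add: x_def T_T')
  have px: "pr (T x) = z" "T x $ 3 = 0" "T x $ 4 = 0" by (simp_all add: Tx vec_eq_iff forall_2 vector_4)
  have "pr 0 = (0 :: 'a^2)" by (simp add: vec_eq_iff forall_2)
  hence x0: "x \<noteq> 0" using px(1) z0 forms1_zero[OF T_form] by metis
  have Wx: "W1 x = 0" "W2 x = 0" unfolding W1 W2 px z by simp_all
  have pa: "pr (u + w) = pr u + pr w" for u w :: "'a^4" by (simp add: vec_eq_iff forall_2)
  have p1: "polar W1 x y = - (\<kappa>1 * h' z) * h (pr (T y))" for y
    unfolding polar_def W1 forms1_add[OF T_form] pa linear_form_add[OF g(3)] linear_form_add[OF g(4)] px z vector_add_component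
    by (simp add: algebra_simps)
  have p2: "polar W2 x y = - (\<kappa>2 * g' z) * g (pr (T y))" for y
    unfolding polar_def W2 forms1_add[OF T_form] pa linear_form_add[OF g(1)] linear_form_add[OF g(2)] px z vector_add_component
    by (simp add: algebra_simps)
  have "\<exists>u. h u \<noteq> 0"
  proof (rule ccontr)
    assume "\<not> ?thesis"
    hence "1 * polar W1 x y + 0 * polar W2 x y = 0" for y unfolding p1 by simp
    from pencil[OF x0 Wx this] show False by simp
  qed
  then obtain u where u: "h u \<noteq> 0" by blast
  define e where "e = g u / h u"
  have ge: "g y = e * h y" for y
    using linear2_proportional[OF g(3) g(1) z0 z(2) z(1), of y u] u by (simp add: e_def field_simps)
  define a1 where "a1 = \<kappa>1 * h' z"
  define a2 where "a2 = \<kappa>2 * g' z * e"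
  have P1: "polar W1 x y = - a1 * h (pr (T y))" for y unfolding p1 a1_def by simp
  have P2: "polar W2 x y = - a2 * h (pr (T y))" for y unfolding p2 ge a2_def by simp
  have "a2 * polar W1 x y + (- a1) * polar W2 x y = 0" for y unfolding P1 P2 by simp
  from pencil[OF x0 Wx this] have "a1 = 0" by simp
  hence "1 * polar W1 x y + 0 * polar W2 x y = 0" for y unfolding P1 by simp
  from pencil[OF x0 Wx this] show False by simp
qed

lemma nf_C: "nf_curve f1 f2 f3 f4"
proof unfold_locales
  fix z
  show "z = 0" if "f1 z = 0" "f2 z = 0" using det_nonzero[of "z $ 1" "z $ 2"] that by (simp add: f1_def f2_def vec_eq_iff forall_2)
  show "z = 0" if "f1 z = 0" "f3 z = 0" by (rule no_common_root[OF f_form(1,2,3,4) W1_T W2_T that])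
  show "z = 0" if "f1 z = 0" "f4 z = 0"
    by (rule no_common_root[OF f_form(1,2,4,3) _ W2_T that]) (simp add: W1_T mult.commute)
  show "z = 0" if "f2 z = 0" "f3 z = 0"
    by (rule no_common_root[OF f_form(2,1,3,4) W1_T _ that]) (simp add: W2_T mult.commute)
  show "z = 0" if "f2 z = 0" "f4 z = 0"
    by (rule no_common_root[OF f_form(2,1,4,3) _ _ that]) (simp_all add: W1_T W2_T mult.commute)
  show "z = 0" if "f3 z = 0" "f4 z = 0" using that by (simp add: f3_def f4_def vec_eq_iff forall_2)
qed (rule f_form)+

text \<open>Neither \<open>c\<close> nor \<open>d\<close> shares its zero with a factor of the other
  quadric. This keeps the two binary quadratic forms that define \<open>D\<close> free of multiple
  zeros.\<close>

lemma coefficients_nonzero: "\<alpha> \<noteq> 0" "\<beta> \<noteq> 0" "\<gamma> \<noteq> 0" "\<delta> \<noteq> 0"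
proof -
  interpret nf_curve f1 f2 f3 f4 by (rule nf_C)
  have "f1 (vector [1, 0]) = \<alpha>" "f1 (vector [0, 1]) = \<beta>" "f2 (vector [1, 0]) = \<gamma>" "f2 (vector [0, 1]) = \<delta>"
    "f3 (vector [0, 1]) = 0" "f4 (vector [1, 0]) = 0" "vector [1, 0] \<noteq> (0 :: 'a^2)" "vector [0, 1] \<noteq> (0 :: 'a^2)"
    by (simp_all add: f1_def f2_def f3_def f4_def vec_eq_iff forall_2)
  thus "\<alpha> \<noteq> 0" "\<beta> \<noteq> 0" "\<gamma> \<noteq> 0" "\<delta> \<noteq> 0" using indep by metis+
qed

lemma T_zero: "T x = 0 \<longleftrightarrow> x = 0"
  using T'_T[of x] forms1_zero[OF T'_form] forms1_zero[OF T_form] by metis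

lemma smooth_C: "smooth_curve (hpoint ` Cset)" "\<Union>(hpoint ` Cset) = Cset"
proof -
  interpret nf_curve f1 f2 f3 f4 by (rule nf_C)
  have "x \<in> Cset \<longleftrightarrow> T x \<in> nfset" for x
    unfolding Cset_def nfset_def a_def b_def using W1_T[of x] W2_T[of x] N1(6) N2(6) T_zero[of x] by auto
  hence C: "Cset = {x. T x \<in> \<Union>nfV}" unfolding Union_nfV by blast
  show "smooth_curve (hpoint ` Cset)" "\<Union>(hpoint ` Cset) = Cset"
    using smooth_curve_transport[OF smooth_nfV T_form T'_form T_T' T'_T refl] unfolding C by auto
qed

section \<open>The covering curve in normal coordinates\<close>

definition TD where "TD (w :: 'a^4) = (vector [S1' (zz w) $ 1, S1' (zz w) $ 2, S2' (zz' w) $ 1, S2' (zz' w) $ 2] :: 'a^4)"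
definition TD' where "TD' (u :: 'a^4) = J (S1 (pr u)) (S2 (pr' u))"

lemma TD_form: "forms_over UNIV 1 TD"
  by (rule forms_over1I)
     (simp_all add: TD_def vec_eq_iff forall_4 vector_4 forms1_add[OF S1(2)] forms1_add[OF S2(2)] forms1_scale[OF S1(2)]
      forms1_scale[OF S2(2)] forms1_add[OF zz_form] forms1_add[OF zz'_form] forms1_scale[OF zz_form] forms1_scale[OF zz'_form])

lemma pr_TD: "pr (TD w) = S1' (zz w)" "pr' (TD w) = S2' (zz' w)"
  by (simp_all add: TD_def vec_eq_iff forall_2 vector_4)

lemma TD'_TD: "TD' (TD w) = w"
  by (simp add: TD'_def pr_TD S1(4) S2(4) J_zz)

lemma TD_TD': "TD (TD' u) = u"
  by (simp add: TD_def TD'_def zz_J zz'_J S1(3) S2(3) vec_eq_iff forall_4 vector_4)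

lemma TD'_form: "forms_over UNIV 1 TD'"
  by (rule inverse_linear[OF TD_form TD_TD' TD'_TD])

lemma TD_zero: "TD w = 0 \<longleftrightarrow> w = 0"
  using TD'_TD[of w] forms1_zero[OF TD'_form] forms1_zero[OF TD_form] by metis

text \<open>Two points in Veronese coordinates come from one vector exactly when their outer
  coordinates satisfy the relations of \<open>n2_components\<close>. The middle coordinates are
  free: they supply the other two coordinates of that vector.\<close>

lemma Dset_iff: "w \<in> Dset \<longleftrightarrow> w \<noteq> 0 \<and> (TD w $ 3)^2 = \<alpha> * (TD w $ 1)^2 + \<beta> * (TD w $ 2)^2 \<and>
   (TD w $ 4)^2 = \<gamma> * (TD w $ 1)^2 + \<delta> * (TD w $ 2)^2"
proof -
  define p where "p = S1' (zz w)"
  define p' where "p' = S2' (zz' w)"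
  have zzp: "zz w = S1 p" "zz' w = S2 p'" by (simp_all add: p_def p'_def S1 S2)
  have TDp: "TD w $ 1 = p $ 1" "TD w $ 2 = p $ 2" "TD w $ 3 = p' $ 1" "TD w $ 4 = p' $ 2"
    by (simp_all add: TD_def p_def p'_def vector_4)
  have "F w = 0 \<and> G w = 0 \<longleftrightarrow> (p' $ 1)^2 = \<alpha> * (p $ 1)^2 + \<beta> * (p $ 2)^2 \<and> (p' $ 2)^2 = \<gamma> * (p $ 1)^2 + \<delta> * (p $ 2)^2"
  proof
    assume "F w = 0 \<and> G w = 0"
    hence "m1 (r w) = Q (zz w)" "m2 (r w) = R (zz' w)" using on_D by auto
    hence "n1 (r w) = sq2 p" "n2 (r w) = sq2 p'" by (simp_all add: n1_def n2_def zzp N1(5) N2(5))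
    thus "(p' $ 1)^2 = \<alpha> * (p $ 1)^2 + \<beta> * (p $ 2)^2 \<and> (p' $ 2)^2 = \<gamma> * (p $ 1)^2 + \<delta> * (p $ 2)^2"
      using n2_components[of "r w"] by (simp add: sq2_nth)
  next
    assume e: "(p' $ 1)^2 = \<alpha> * (p $ 1)^2 + \<beta> * (p $ 2)^2 \<and> (p' $ 2)^2 = \<gamma> * (p $ 1)^2 + \<delta> * (p $ 2)^2"
    define x where "x = T' (vector [(p $ 1)^2, (p $ 2)^2, p' $ 1 * p' $ 2, p $ 1 * p $ 2])"
    have "n1 x = sq2 p" "n2 x = sq2 p'"
      unfolding x_def n_T' using e by (simp_all add: vec_eq_iff forall_3 vector_4 sq2_nth)
    hence "m1 x = L1 (N1 (Q (S1 p)))" "m2 x = L2 (N2 (R (S2 p')))" by (simp_all add: m_of_n N1(5) N2(5))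
    hence "m1 x = Q (zz w)" "m2 x = R (zz' w)" by (simp_all add: N1(3) N2(3) zzp)
    thus "F w = 0 \<and> G w = 0" using D_intro by blast
  qed
  thus ?thesis unfolding Dset_def TDp by blast
qed

text \<open>Square roots of the coefficients split both binary quadratic forms. A common zero of a
  factor of one and a factor of the other is a common zero of the forms, and
  \<open>det_nonzero\<close>, applied to the squares of the coordinates, excludes it.\<close>

lemma nf_D: "\<exists>g1 g2 g3 g4. nf_curve g1 g2 g3 g4 \<and> (\<forall>z. g1 z * g2 z = \<alpha> * (z $ 1)^2 + \<beta> * (z $ 2)^2) \<and>
  (\<forall>z. g3 z * g4 z = \<gamma> * (z $ 1)^2 + \<delta> * ((z :: 'a^2) $ 2)^2)"
proof -
  obtain ea where ea: "ea ^ 2 = \<alpha>" using nth_root_exists[of 2 \<alpha>] by auto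
  obtain eb where eb: "eb ^ 2 = - \<beta>" using nth_root_exists[of 2 "- \<beta>"] by auto
  obtain ec where ec: "ec ^ 2 = \<gamma>" using nth_root_exists[of 2 \<gamma>] by auto
  obtain ed where ed: "ed ^ 2 = - \<delta>" using nth_root_exists[of 2 "- \<delta>"] by auto
  have nz: "ea \<noteq> 0" "eb \<noteq> 0" "ec \<noteq> 0" "ed \<noteq> 0" using ea eb ec ed coefficients_nonzero by auto
  define g1 where "g1 = (\<lambda>z :: 'a^2. ea * z $ 1 + eb * z $ 2)"
  define g2 where "g2 = (\<lambda>z :: 'a^2. ea * z $ 1 - eb * z $ 2)"
  define g3 where "g3 = (\<lambda>z :: 'a^2. ec * z $ 1 + ed * z $ 2)"
  define g4 where "g4 = (\<lambda>z :: 'a^2. ec * z $ 1 - ed * z $ 2)"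
  have F: "is_form UNIV 1 g1" "is_form UNIV 1 g2" "is_form UNIV 1 g3" "is_form UNIV 1 g4"
    unfolding g1_def g2_def g3_def g4_def by (intro is_form_add is_form_diff is_form_smult is_form_component; simp)+
  have p12: "g1 z * g2 z = \<alpha> * (z $ 1)^2 + \<beta> * (z $ 2)^2" for z
  proof -
    have "g1 z * g2 z = ea^2 * (z $ 1)^2 - eb^2 * (z $ 2)^2"
      by (simp add: g1_def g2_def algebra_simps power2_eq_square)
    thus ?thesis unfolding ea eb by simp
  qed
  have p34: "g3 z * g4 z = \<gamma> * (z $ 1)^2 + \<delta> * (z $ 2)^2" for z
  proof -
    have "g3 z * g4 z = ec^2 * (z $ 1)^2 - ed^2 * (z $ 2)^2"
      by (simp add: g3_def g4_def algebra_simps power2_eq_square)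
    thus ?thesis unfolding ec ed by simp
  qed
  have both: "z = 0" if "g1 z * g2 z = 0" "g3 z * g4 z = 0" for z
    using det_nonzero[of "(z $ 1)^2" "(z $ 2)^2"] that unfolding p12 p34 by (simp add: vec_eq_iff forall_2)
  have pair: "x = 0 \<and> y = 0" if "s * x + t * y = 0" "s * x - t * y = 0" "s \<noteq> 0" "t \<noteq> 0" for s t x y :: 'a
  proof -
    have "2 * (s * x) = (s * x + t * y) + (s * x - t * y)" "2 * (t * y) = (s * x + t * y) - (s * x - t * y)" by simp_all
    hence "2 * (s * x) = 0" "2 * (t * y) = 0" unfolding that(1,2) by simp_all
    thus ?thesis using that(3,4) by simp
  qed
  have "nf_curve g1 g2 g3 g4"
  proof unfold_locales
    fix z
    show "z = 0" if "g1 z = 0" "g2 z = 0"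
      using pair[of ea "z $ 1" eb "z $ 2"] that nz by (simp add: g1_def g2_def vec_eq_iff forall_2)
    show "z = 0" if "g3 z = 0" "g4 z = 0"
      using pair[of ec "z $ 1" ed "z $ 2"] that nz by (simp add: g3_def g4_def vec_eq_iff forall_2)
  qed (use F both in auto)
  thus ?thesis using p12 p34 by blast
qed

lemma Dset_nf: "\<exists>g1 g2 g3 g4. nf_curve g1 g2 g3 g4 \<and> Dset = {w. TD w \<in> nf_curve.nfset g1 g2 g3 g4}"
proof -
  obtain g1 g2 g3 g4 where g: "nf_curve g1 g2 g3 g4" "\<forall>z. g1 z * g2 z = \<alpha> * (z $ 1)^2 + \<beta> * (z $ 2)^2"
    "\<forall>z. g3 z * g4 z = \<gamma> * (z $ 1)^2 + \<delta> * ((z :: 'a^2) $ 2)^2" using nf_D by (elim exE conjE) (rule that)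
  interpret nf_curve g1 g2 g3 g4 by (rule g(1))
  have "w \<in> Dset \<longleftrightarrow> TD w \<in> nfset" for w
    unfolding Dset_iff nfset_def a_def b_def using g(2,3) TD_zero[of w] by simp
  thus ?thesis using g(1) by blast
qed

lemma smooth_D: "smooth_curve (hpoint ` Dset)" "\<Union>(hpoint ` Dset) = Dset"
proof -
  obtain g1 g2 g3 g4 where g: "nf_curve g1 g2 g3 g4" and D: "Dset = {w. TD w \<in> nf_curve.nfset g1 g2 g3 g4}"
    using Dset_nf by blast
  interpret nf_curve g1 g2 g3 g4 by (rule g)
  have D': "Dset = {w. TD w \<in> \<Union>nfV}" unfolding D Union_nfV ..
  show "smooth_curve (hpoint ` Dset)" "\<Union>(hpoint ` Dset) = Dset"
    using smooth_curve_transport[OF smooth_nfV TD_form TD'_form TD_TD' TD'_TD refl] unfolding D' by auto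
qed

lemma linear_form_on_D:
  assumes h: "is_form UNIV 1 h" "\<And>w. w \<in> Dset \<Longrightarrow> h w = 0"
  shows "h w = 0"
proof -
  obtain g1 g2 g3 g4 where g: "nf_curve g1 g2 g3 g4" and D: "Dset = {w. TD w \<in> nf_curve.nfset g1 g2 g3 g4}"
    using Dset_nf by blast
  interpret nf_curve g1 g2 g3 g4 by (rule g)
  have "h (TD' u) = 0" for u
  proof (rule linear_form_zero_on[where f = "\<lambda>u. h (TD' u)"])
    show "is_form UNIV 1 (\<lambda>u. h (TD' u))" by (rule is_form_comp_linear[OF _ h(1) TD'_form]) simp
    show "h (TD' u) = 0" if "u \<in> nfset" for u
      by (rule h(2)) (use that in \<open>simp add: D TD_TD'\<close>)
  qed
  thus "h w = 0" using TD'_TD[of w] by metis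
qed

text \<open>In the coordinates \<open>TD\<close> every member of the pencil is a diagonal quadric,
  since its linear relation has no middle terms. The coefficients of the first two squares are
  determined by those of the last two, so a singular point would have all its coordinates equal to
  0.\<close>

lemma nonsingular_D:
  assumes w: "w \<in> Dset" and st: "\<And>y. polar (\<lambda>x. s * F x + t * G x) w y = 0"
  shows "s = 0 \<and> t = 0"
proof (rule ccontr)
  assume n: "\<not> ?thesis"
  obtain \<rho>1 \<rho>2 where rho: "is_form UNIV 1 \<rho>1" "is_form UNIV 1 \<rho>2" "(\<exists>y. \<rho>1 y \<noteq> 0) \<or> (\<exists>y. \<rho>2 y \<noteq> 0)"
    "\<forall>x. \<rho>1 (m1 x) + \<rho>2 (m2 x) = 0" "\<forall>w. s * F w + t * G w = \<rho>1 (Q (zz w)) + \<rho>2 (R (zz' w))"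
    using FG_comb[of s t] n by auto
  define e where "e = \<rho>1 (L1 (vector [1, 0, 0]))"
  define f where "f = \<rho>1 (L1 (vector [0, 0, 1]))"
  define e' where "e' = \<rho>2 (L2 (vector [1, 0, 0]))"
  define f' where "f' = \<rho>2 (L2 (vector [0, 0, 1]))"
  have "m1 v2 = L1 (vector [0, 1, 0])" "m2 v1 = L2 (vector [0, 1, 0])" by (simp_all add: m_of_n n_v)
  \<comment> \<open>The relation is evaluated at the two vertices, each of which is killed by one
    projection and is the middle unit vector under the other.\<close>
  hence mid: "\<rho>1 (L1 (vector [0, 1, 0])) = 0" "\<rho>2 (L2 (vector [0, 1, 0])) = 0"
    using rho(4)[rule_format, of v2] rho(4)[rule_format, of v1] c1.m_v c2.m_v linear_form_zero[OF rho(1)] linear_form_zero[OF rho(2)]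
    by auto
  have r1: "\<rho>1 (L1 u) = e * u $ 1 + f * u $ 3" for u
  proof -
    have "\<rho>1 (L1 u) = \<rho>1 (L1 (u $ 1 *s vector [1, 0, 0] + u $ 2 *s vector [0, 1, 0] + u $ 3 *s vector [0, 0, 1]))"
      using vec3_expand[of u] by simp
    thus ?thesis unfolding forms1_add[OF N1(2)] forms1_scale[OF N1(2)] linear_form_add[OF rho(1)] linear_form_scale[OF rho(1)] mid
      by (simp add: e_def f_def mult.commute)
  qed
  have r2: "\<rho>2 (L2 u) = e' * u $ 1 + f' * u $ 3" for u
  proof -
    have "\<rho>2 (L2 u) = \<rho>2 (L2 (u $ 1 *s vector [1, 0, 0] + u $ 2 *s vector [0, 1, 0] + u $ 3 *s vector [0, 0, 1]))"
      using vec3_expand[of u] by simp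
    thus ?thesis unfolding forms1_add[OF N2(2)] forms1_scale[OF N2(2)] linear_form_add[OF rho(2)] linear_form_scale[OF rho(2)] mid
      by (simp add: e'_def f'_def mult.commute)
  qed
  have rm1: "\<rho>1 (m1 x) = e * n1 x $ 1 + f * n1 x $ 3" for x
    by (subst m_of_n(1)) (rule r1)
  have rm2: "\<rho>2 (m2 x) = e' * n2 x $ 1 + f' * n2 x $ 3" for x
    by (subst m_of_n(2)) (rule r2)
  have "e * n1 xc $ 1 + f * n1 xc $ 3 + (e' * n2 xc $ 1 + f' * n2 xc $ 3) = 0"
    "e * n1 xd $ 1 + f * n1 xd $ 3 + (e' * n2 xd $ 1 + f' * n2 xd $ 3) = 0"
    using rho(4)[rule_format, of xc] rho(4)[rule_format, of xd] unfolding rm1 rm2 .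
  hence "e + (e' * \<alpha> + f' * \<gamma>) = 0" "f + (e' * \<beta> + f' * \<delta>) = 0"
    unfolding xc(1) xd(1) \<alpha>_def \<beta>_def \<gamma>_def \<delta>_def by simp_all
  hence rel: "e = - (e' * \<alpha> + f' * \<gamma>)" "f = - (e' * \<beta> + f' * \<delta>)"
    by (simp_all only: eq_neg_iff_add_eq_0)
  have nz: "e' \<noteq> 0 \<or> f' \<noteq> 0"
  proof (rule ccontr)
    assume "\<not> ?thesis"
    hence "\<rho>1 (L1 u) = 0" "\<rho>2 (L2 u) = 0" for u unfolding r1 r2 rel by simp_all
    hence "\<rho>1 y = 0" "\<rho>2 y = 0" for y using N1(3)[of y] N2(3)[of y] by metis+
    thus False using rho(3) by simp
  qed
  have FG: "s * F y + t * G y = e * (TD y $ 1)^2 + f * (TD y $ 2)^2 + e' * (TD y $ 3)^2 + f' * (TD y $ 4)^2" for y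
  proof -
    have "N1 (Q (zz y)) = sq2 (S1' (zz y))" using N1(5)[of "S1' (zz y)"] unfolding S1(4) .
    hence QL: "Q (zz y) = L1 (sq2 (S1' (zz y)))" using N1(3)[of "Q (zz y)"] by simp
    have "N2 (R (zz' y)) = sq2 (S2' (zz' y))" using N2(5)[of "S2' (zz' y)"] unfolding S2(4) .
    hence RL: "R (zz' y) = L2 (sq2 (S2' (zz' y)))" using N2(3)[of "R (zz' y)"] by simp
    have "\<rho>1 (Q (zz y)) + \<rho>2 (R (zz' y)) = \<rho>1 (L1 (sq2 (S1' (zz y)))) + \<rho>2 (L2 (sq2 (S2' (zz' y))))"
      by (simp only: QL[symmetric] RL[symmetric])
    also have "\<dots> = e * (TD y $ 1)^2 + f * (TD y $ 2)^2 + e' * (TD y $ 3)^2 + f' * (TD y $ 4)^2"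
      unfolding r1 r2 by (simp add: sq2_nth TD_def vector_4)
    finally show ?thesis using rho(5) by simp
  qed
  have "polar (\<lambda>x. s * F x + t * G x) w y = 2 * (e * TD w $ 1 * TD y $ 1 + f * TD w $ 2 * TD y $ 2 + e' * TD w $ 3 * TD y $ 3 + f' * TD w $ 4 * TD y $ 4)" for y
    unfolding polar_def FG forms1_add[OF TD_form] vector_add_component by (simp add: algebra_simps power2_eq_square)
  hence P: "2 * (e * TD w $ 1 * u $ 1 + f * TD w $ 2 * u $ 2 + e' * TD w $ 3 * u $ 3 + f' * TD w $ 4 * u $ 4) = 0" for u :: "'a^4"
    using st[of "TD' u"] by (simp add: TD_TD')
  have g: "e * TD w $ 1 = 0" "f * TD w $ 2 = 0" "e' * TD w $ 3 = 0" "f' * TD w $ 4 = 0"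
    using P[of "axis 1 1"] P[of "axis 2 1"] P[of "axis 3 1"] P[of "axis 4 1"] by (simp_all add: axis_def)
  have wD: "w \<noteq> 0" "(TD w $ 3)^2 = \<alpha> * (TD w $ 1)^2 + \<beta> * (TD w $ 2)^2" "(TD w $ 4)^2 = \<gamma> * (TD w $ 1)^2 + \<delta> * (TD w $ 2)^2"
    using w unfolding Dset_iff by auto
  have "TD w $ 1 = 0 \<and> TD w $ 2 = 0"
  proof -
    \<comment> \<open>If both of the last coefficients are nonzero, the last two coordinates vanish
      and the determinant kills the first two; if only one is, the first two coefficients are
      nonzero multiples of it.\<close>
    consider "e' \<noteq> 0" "f' \<noteq> 0" | "e' \<noteq> 0" "f' = 0" | "e' = 0" "f' \<noteq> 0" using nz by blast
    thus ?thesis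
    proof cases
      case 1
      hence "TD w $ 3 = 0" "TD w $ 4 = 0" using g by auto
      thus ?thesis using det_nonzero[of "(TD w $ 1)^2" "(TD w $ 2)^2"] wD(2,3) by simp
    next
      case 2
      hence "e \<noteq> 0" "f \<noteq> 0" using rel coefficients_nonzero by auto
      thus ?thesis using g by simp
    next
      case 3
      hence "e \<noteq> 0" "f \<noteq> 0" using rel coefficients_nonzero by auto
      thus ?thesis using g by simp
    qed
  qed
  hence "TD w = 0" using wD(2,3) by (simp add: vec_eq_iff forall_4)
  thus False using TD_zero wD(1) by blast
qed

end

section \<open>Hyperplane sections of the covering curve\<close>

context covering_data
begin

lemma normal_exists: "\<exists>S1 S1' N1 L1 \<kappa>1 S2 S2' N2 L2 \<kappa>2.
  covering_normal q1 q2 m1 m2 W1 W2 v1 v2 Q R zz zz' J r F G S1 S1' N1 L1 \<kappa>1 S2 S2' N2 L2 \<kappa>2"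
proof -
  have 1: "q1 (m1 v2) \<noteq> 0" using c2.W'_v by (simp add: c1.W_eq)
  have 2: "q2 (m2 v1) \<noteq> 0" using c1.W'_v by (simp add: c2.W_eq)
  obtain S1 S1' N1 L1 \<kappa>1 where A: "forms_over UNIV 1 S1" "forms_over UNIV 1 S1'" "\<forall>p. S1' (S1 p) = p" "\<forall>z. S1 (S1' z) = z"
    "forms_over UNIV 1 N1" "forms_over UNIV 1 L1" "\<forall>y. L1 (N1 y) = y" "\<forall>u. N1 (L1 u) = u"
    "\<forall>p. N1 (Q (S1 p)) = sq2 p" "\<kappa>1 \<noteq> 0" "\<forall>y. q1 y = \<kappa>1 * ((N1 y $ 2)^2 - N1 y $ 1 * N1 y $ 3)" "N1 (m1 v2) = vector [0, 1, 0]"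
    using c1.param_normalise[OF Q 1] by (elim exE conjE) (rule that)
  obtain S2 S2' N2 L2 \<kappa>2 where B: "forms_over UNIV 1 S2" "forms_over UNIV 1 S2'" "\<forall>p. S2' (S2 p) = p" "\<forall>z. S2 (S2' z) = z"
    "forms_over UNIV 1 N2" "forms_over UNIV 1 L2" "\<forall>y. L2 (N2 y) = y" "\<forall>u. N2 (L2 u) = u"
    "\<forall>p. N2 (R (S2 p)) = sq2 p" "\<kappa>2 \<noteq> 0" "\<forall>y. q2 y = \<kappa>2 * ((N2 y $ 2)^2 - N2 y $ 1 * N2 y $ 3)" "N2 (m2 v1) = vector [0, 1, 0]"
    using c2.param_normalise[OF R 2] by (elim exE conjE) (rule that)
  have "covering_normal q1 q2 m1 m2 W1 W2 v1 v2 Q R zz zz' J r F G S1 S1' N1 L1 \<kappa>1 S2 S2' N2 L2 \<kappa>2"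
    by unfold_locales (use A B in blast)+
  thus ?thesis by blast
qed

lemma curve_C: "smooth_curve (hpoint ` Cset)" "\<Union>(hpoint ` Cset) = Cset"
  and curve_D: "smooth_curve (hpoint ` Dset)" "\<Union>(hpoint ` Dset) = Dset"
  and D_spans: "is_form UNIV 1 h \<Longrightarrow> (\<And>w. w \<in> Dset \<Longrightarrow> h w = 0) \<Longrightarrow> h w = 0"
  and D_nonsingular: "w \<in> Dset \<Longrightarrow> (\<And>y. polar (\<lambda>x. s * F x + t * G x) w y = 0) \<Longrightarrow> s = 0 \<and> t = 0"
proof -
  obtain S1 S1' N1 L1 \<kappa>1 S2 S2' N2 L2 \<kappa>2 where
    "covering_normal q1 q2 m1 m2 W1 W2 v1 v2 Q R zz zz' J r F G S1 S1' N1 L1 \<kappa>1 S2 S2' N2 L2 \<kappa>2"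
    using normal_exists by (elim exE) (rule that)
  then interpret n: covering_normal q1 q2 m1 m2 W1 W2 v1 v2 Q R zz zz' J r F G S1 S1' N1 L1 \<kappa>1 S2 S2' N2 L2 \<kappa>2 .
  show "smooth_curve (hpoint ` Cset)" "\<Union>(hpoint ` Cset) = Cset" "smooth_curve (hpoint ` Dset)" "\<Union>(hpoint ` Dset) = Dset"
    by (rule n.smooth_C n.smooth_D)+
  show "is_form UNIV 1 h \<Longrightarrow> (\<And>w. w \<in> Dset \<Longrightarrow> h w = 0) \<Longrightarrow> h w = 0" by (rule n.linear_form_on_D)
  show "w \<in> Dset \<Longrightarrow> (\<And>y. polar (\<lambda>x. s * F x + t * G x) w y = 0) \<Longrightarrow> s = 0 \<and> t = 0" by (rule n.nonsingular_D)
qed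

text \<open>The hyperplane cut out by \<open>l (zz w) = 0\<close>, where \<open>l\<close> vanishes at the parameter of \<open>p\<close>, meets \<open>D\<close>
  exactly in the pullback of \<open>p\<close>, with the right multiplicities.\<close>

lemma pullback_is_hyperplane_section:
  fixes q :: "'a^3 \<Rightarrow> 'a" and z :: "'a^4 \<Rightarrow> 'a^2"
  assumes conic: "parametrised_conic (zeros {q}) P N" and P: "parametrisation q P" and m: "forms_over UNIV 1 m"
    and Gm: "\<Union>(zeros {q}) = m ` Cset" and z: "forms_over UNIV 1 z" "\<And>x. \<exists>w. z w = x"
    and D: "\<And>w. w \<in> Dset \<Longrightarrow> m (r w) = P (z w) \<and> z w \<noteq> 0" and p: "p \<in> zeros {q}"
  shows "\<exists>h. is_form UNIV 1 h \<and> \<not> zero_on (hpoint ` Dset) h \<and> hyperplane_divisor (hpoint ` Dset) h =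
     pullback_divisor (hpoint ` Dset) (hpoint ` Cset) r (pullback_divisor (hpoint ` Cset) (zeros {q}) m (point_divisor p))"
proof -
  interpret parametrised_conic "zeros {q}" P N by (rule conic)
  interpret Gi: irreducible_set "zeros {q}" by (rule irreducible)
  obtain y0 where y0: "y0 \<in> \<Union>(zeros {q})" "p = hpoint y0" by (rule Gi.point_rep[OF p])
  obtain z0 where z0: "z0 \<noteq> 0" "y0 = P z0" using y0(1) unfolding G_Union by blast
  obtain l u mu where lm: "is_form UNIV 1 l" "l z0 = 0" "l u \<noteq> 0" "is_form UNIV 1 mu" "mu z0 = 1"
    by (rule linear_pair[OF z0(1)]) (rule that)
  obtain t t0 where t: "curve_point (zeros {q}) (P z0) t t0" "\<forall>z. t (P z) = l z * mu z" "\<forall>z. t0 (P z) = mu z ^ 2"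
    using uniformizer[OF z0(1) lm] by (elim exE conjE) (rule that)
  have tord: "ord_at (zeros {q}) (P z0) 1 t 1"
    unfolding ord_at_def using t(1) curve_germ.has_order_t[OF curve_point_germ[OF t(1)]] by blast
  have t0F: "is_form UNIV 1 t0" using curve_germ.t0_form[OF curve_point_germ[OF t(1)]] .
  have tF: "is_form UNIV 1 t" using curve_germ.t_form[OF curve_point_germ[OF t(1)]] .
  let ?h = "\<lambda>w. l (z w)" and ?h' = "\<lambda>w. mu (z w)"
  have hF: "is_form UNIV 1 ?h" "is_form UNIV 1 ?h'"
    by (rule is_form_comp_linear[OF _ lm(1) z(1)], simp) (rule is_form_comp_linear[OF _ lm(4) z(1)], simp)
  have hnz: "\<not> zero_on (hpoint ` Dset) ?h"
  proof
    assume "zero_on (hpoint ` Dset) ?h"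
    hence "?h w = 0" for w using D_spans[OF hF(1)] unfolding zero_on_def curve_D(2) by blast
    moreover obtain w where "z w = u" using z(2) by blast
    ultimately show False using lm(3) by metis
  qed
  \<comment> \<open>The only common zero of \<open>l\<close> and \<open>mu\<close> is the origin, so
    a zero of \<open>l\<close> is \<open>z0\<close> scaled by its value under
    \<open>mu\<close>.\<close>
  have scal: "x = c *s z0 \<and> c = mu x" if "l x = 0" "c = mu x" for x c
  proof -
    have d: "l (x - mu x *s z0) = 0" "mu (x - mu x *s z0) = 0"
      using that lm(2,5) by (simp_all add: linear_form_diff[OF lm(1)] linear_form_scale[OF lm(1)] linear_form_diff[OF lm(4)] linear_form_scale[OF lm(4)])
    have "x - mu x *s z0 = 0"
    proof (rule ccontr)
      assume n: "x - mu x *s z0 \<noteq> 0"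
      from linear2_proportional[OF lm(1,4) n d(1,2), of z0 u] show False using lm(2,3,5) by simp
    qed
    thus ?thesis using that(2) by simp
  qed
  have Phom: "P (c *s x) = c^2 *s P x" for c x
    using Q_form is_form_homogeneous unfolding forms_over_def vec_eq_iff vector_smult_component by blast
  \<comment> \<open>On \<open>D\<close> the uniformiser of the conic pulls back to
    \<open>l (z w) * mu (z w)\<close>. The second factor is nonzero where the first vanishes, and
    \<open>1 + 1 = 2\<close> is the degree of the forms in \<open>r\<close>.\<close>
  have "hyperplane_divisor (hpoint ` Dset) ?h =
     pullback_divisor (hpoint ` Dset) (hpoint ` Cset) r (pullback_divisor (hpoint ` Cset) (zeros {q}) m (point_divisor (hpoint (P z0))))"
  proof (rule hyperplane_divisor_eq_pullback[OF curve_D(1) curve_C(1) smooth r_form _ m _ hF(1) hnz hF(2) tord])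
    show "\<Union>(hpoint ` Cset) = r ` \<Union>(hpoint ` Dset)" unfolding curve_C(2) curve_D(2) by (rule r_image)
    show "\<Union>(zeros {q}) = m ` \<Union>(hpoint ` Cset)" unfolding curve_C(2) by (rule Gm)
    show "(1::nat) + 1 = 2" by simp
    fix w assume "w \<in> \<Union>(hpoint ` Dset)"
    hence w: "w \<in> Dset" unfolding curve_D(2) .
    have mr: "m (r w) = P (z w)" and zw: "z w \<noteq> 0" using D[OF w] by auto
    show "t (m (r w)) = ?h w * ?h' w" unfolding mr using t(2) by blast
    show nv: "?h' w \<noteq> 0" if "?h w = 0"
    proof
      assume "?h' w = 0"
      thus False using scal[OF that refl] zw by simp
    qed
    show "?h w = 0 \<longleftrightarrow> hpoint (m (r w)) = hpoint (P z0)"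
    proof
      assume h0: "?h w = 0"
      define c where "c = mu (z w)"
      have "z w = c *s z0" "c \<noteq> 0" using scal[OF h0 refl] nv[OF h0] by (simp_all add: c_def)
      thus "hpoint (m (r w)) = hpoint (P z0)" unfolding mr by (simp add: Phom hpoint_eqI)
    next
      assume "hpoint (m (r w)) = hpoint (P z0)"
      then obtain c where c: "c \<noteq> 0" "P (z w) = c *s P z0" unfolding mr hpoint_eq_iff by blast
      have "l (z w) * mu (z w) = c * (l z0 * mu z0)"
        using t(2)[rule_format, of "z w"] t(2)[rule_format, of z0] c(2) linear_form_scale[OF tF] by simp
      moreover have "mu (z w) ^ 2 = c * mu z0 ^ 2"
        using t(3)[rule_format, of "z w"] t(3)[rule_format, of z0] c(2) linear_form_scale[OF t0F] by simp
      ultimately show "?h w = 0" using lm(2,5) c(1) by auto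
    qed
  qed
  thus ?thesis using hF(1) hnz y0(2) z0(2) by blast
qed

theorem hyperplane_sections:
  assumes h: "is_form UNIV 1 h" "h \<noteq> (\<lambda>_. 0)"
  shows "p \<in> zeros {q1} \<Longrightarrow> lin_equiv (hpoint ` Dset) (hyperplane_divisor (hpoint ` Dset) h)
      (pullback_divisor (hpoint ` Dset) (hpoint ` Cset) r (pullback_divisor (hpoint ` Cset) (zeros {q1}) m1 (point_divisor p)))"
    and "p \<in> zeros {q2} \<Longrightarrow> lin_equiv (hpoint ` Dset) (hyperplane_divisor (hpoint ` Dset) h)
      (pullback_divisor (hpoint ` Dset) (hpoint ` Cset) r (pullback_divisor (hpoint ` Cset) (zeros {q2}) m2 (point_divisor p)))"
proof -
  have hnz: "\<not> zero_on (hpoint ` Dset) h"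
    using D_spans[OF h(1)] h(2) unfolding zero_on_def curve_D(2) by blast
  obtain N where N: "parametrised_conic (zeros {q1}) Q N" using c1.conic[OF Q] by blast
  obtain N' where N': "parametrised_conic (zeros {q2}) R N'" using c2.conic[OF R] by blast
  have s: "\<exists>w. zz w = x" "\<exists>w. zz' w = x" for x using zz_J zz'_J by blast+
  have D1: "m1 (r w) = Q (zz w) \<and> zz w \<noteq> 0" "m2 (r w) = R (zz' w) \<and> zz' w \<noteq> 0" if "w \<in> Dset" for w
    using that on_D[of w] zz_nonzero_on_D[OF that] unfolding Dset_def by auto
  show "lin_equiv (hpoint ` Dset) (hyperplane_divisor (hpoint ` Dset) h)
      (pullback_divisor (hpoint ` Dset) (hpoint ` Cset) r (pullback_divisor (hpoint ` Cset) (zeros {q1}) m1 (point_divisor p)))"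
    if p: "p \<in> zeros {q1}"
  proof -
    have G: "\<Union>(zeros {q1}) = m1 ` Cset" unfolding c1.conic_zeros by (rule m1_image)
    obtain h' where h': "is_form UNIV 1 h'" "\<not> zero_on (hpoint ` Dset) h'" "hyperplane_divisor (hpoint ` Dset) h' =
      pullback_divisor (hpoint ` Dset) (hpoint ` Cset) r (pullback_divisor (hpoint ` Cset) (zeros {q1}) m1 (point_divisor p))"
      using pullback_is_hyperplane_section[OF N Q c1.m_form G zz_form s(1) D1(1) p] by blast
    show ?thesis unfolding h'(3)[symmetric] by (rule hyperplane_divisors_lin_equiv[OF curve_D(1) h(1) hnz h'(1,2)])
  qed
  show "lin_equiv (hpoint ` Dset) (hyperplane_divisor (hpoint ` Dset) h)
      (pullback_divisor (hpoint ` Dset) (hpoint ` Cset) r (pullback_divisor (hpoint ` Cset) (zeros {q2}) m2 (point_divisor p)))"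
    if p: "p \<in> zeros {q2}"
  proof -
    have G: "\<Union>(zeros {q2}) = m2 ` Cset" unfolding c2.conic_zeros by (rule m2_image)
    obtain h' where h': "is_form UNIV 1 h'" "\<not> zero_on (hpoint ` Dset) h'" "hyperplane_divisor (hpoint ` Dset) h' =
      pullback_divisor (hpoint ` Dset) (hpoint ` Cset) r (pullback_divisor (hpoint ` Cset) (zeros {q2}) m2 (point_divisor p))"
      using pullback_is_hyperplane_section[OF N' R c2.m_form G zz'_form s(2) D1(2) p] by blast
    show ?thesis unfolding h'(3)[symmetric] by (rule hyperplane_divisors_lin_equiv[OF curve_D(1) h(1) hnz h'(1,2)])
  qed
qed

end

section \<open>The degree of the covering over the ground field\<close>

text \<open>Write a function as \<open>f (g \<circ> \<tau>) / (g (g \<circ> \<tau>))\<close> and split the numerator into its even and odd parts under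
  \<open>\<tau>\<close>; invariant forms are pullbacks, and the odd part becomes invariant after multiplication by \<open>e1\<close>.\<close>

lemma degree_two:
  fixes K :: "'a::field_char_0 set" and D C :: "('a^4) set set" and r \<tau> :: "'a^4 \<Rightarrow> 'a^4"
  assumes K: "coeff_field K" and D: "irreducible_set D" and C: "irreducible_set C"
    and r: "forms_over K 2 r" and surj: "\<Union>C = r ` \<Union>D"
    and tau: "forms_over K 1 \<tau>" "\<And>w. \<tau> (\<tau> w) = dd *s w" and dd: "dd \<in> K" "dd \<noteq> 0"
    and tau_D: "\<And>w. w \<in> \<Union>D \<Longrightarrow> \<tau> w \<in> \<Union>D" and r_tau: "\<And>w. w \<in> \<Union>D \<Longrightarrow> r (\<tau> w) = dd *s r w"
    and e1: "is_form K 2 e1" "\<And>w. e1 (\<tau> w) = - dd * e1 w" "\<not> zero_on D e1"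
    and descent: "\<And>e f. is_form K (2 * e) f \<Longrightarrow> (\<And>w. f (\<tau> w) = dd ^ e * f w) \<Longrightarrow>
      \<exists>h. is_form K e h \<and> (\<forall>w\<in>\<Union>D. f w = h (r w))"
  shows "has_degree K D C r 2"
proof -
  interpret D: irreducible_set D by (rule D)
  interpret C: irreducible_set C by (rule C)
  have S: "coeff_ring K" by (rule coeff_field_ring[OF K])
  interpret R: cring "D.FF K" by (rule D.cring_FF[OF S])
  define kk where "kk = pullback_fun K D r ` carrier (C.FF K)"
  have kkI: "ratio K D (\<lambda>w. f (r w)) (\<lambda>w. g (r w)) \<in> kk" "((\<lambda>w. f (r w)), (\<lambda>w. g (r w))) \<in> fracs K D"
    if fg: "(f, g) \<in> fracs K C" for f g
    using pullback_fun_ratio[OF D C S r surj fg] C.ratio_in_FF[OF fg] unfolding kk_def o_def by (auto intro: rev_image_eqI)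
  have kkE: "\<exists>f g. (f, g) \<in> fracs K C \<and> U = ratio K D (\<lambda>w. f (r w)) (\<lambda>w. g (r w))" if U: "U \<in> kk" for U
  proof -
    obtain V where V: "V \<in> carrier (C.FF K)" "U = pullback_fun K D r V" using U unfolding kk_def by blast
    obtain f g where fg: "(f, g) \<in> fracs K C" "V = ratio K C f g" using V(1) by (rule C.FF_cases)
    show ?thesis using pullback_fun_ratio(2)[OF D C S r surj fg(1)] fg V(2) unfolding o_def by blast
  qed
  have kk_sub: "kk \<subseteq> carrier (D.FF K)" using kkE kkI(2) D.ratio_in_FF by blast
  have one_zero: "\<one>\<^bsub>D.FF K\<^esub> \<noteq> \<zero>\<^bsub>D.FF K\<^esub>"
    unfolding D.zero_FF D.one_FF D.ratio_eq_iff[OF D.fracs_const[OF S coeff_ringD(2)[OF S]] D.fracs_const[OF S coeff_ringD(1)[OF S]]]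
    using D.point_exists by auto
  have ext1: "R.line_extension kk \<one>\<^bsub>D.FF K\<^esub> {\<zero>\<^bsub>D.FF K\<^esub>} = kk"
  proof -
    have "R.line_extension kk \<one>\<^bsub>D.FF K\<^esub> {\<zero>\<^bsub>D.FF K\<^esub>} = (\<lambda>u. u \<otimes>\<^bsub>D.FF K\<^esub> \<one>\<^bsub>D.FF K\<^esub> \<oplus>\<^bsub>D.FF K\<^esub> \<zero>\<^bsub>D.FF K\<^esub>) ` kk"
      unfolding R.line_extension_def set_add_def' r_coset_def by auto
    also have "\<dots> = id ` kk" by (rule image_cong) (use kk_sub in auto)
    finally show ?thesis by simp
  qed
  have dim1: "R.dimension 1 kk kk"
    using R.Suc_dim[OF R.one_closed _ R.zero_dim[of kk]] one_zero ext1 by simp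
  obtain x where x: "x \<in> \<Union>D" using D.point_exists by blast
  have rx: "r x \<noteq> 0" using surj x C.point_nonzero by blast
  then obtain i where i: "r x $ i \<noteq> 0" by (auto simp: vec_eq_iff)
  \<comment> \<open>A coordinate of \<open>r\<close> that does not vanish on \<open>D\<close>: on
    \<open>D\<close> it has the multiplier of an invariant quadratic form, so that
    \<open>e1 / e2\<close> is an anti-invariant function.\<close>
  define e2 where "e2 = (\<lambda>w. r w $ i)"
  have e2: "is_form K 2 e2" using r unfolding e2_def forms_over_def by simp
  have e2nz: "\<not> zero_on D e2" using x i unfolding zero_on_def e2_def by blast
  have e2_tau: "e2 (\<tau> w) = dd * e2 w" if "w \<in> \<Union>D" for w using r_tau[OF that] by (simp add: e2_def)
  have fv: "(e1, e2) \<in> fracs K D" using e1 e2 e2nz unfolding D.fracs_iff by blast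
  define v where "v = ratio K D e1 e2"
  have vc: "v \<in> carrier (D.FF K)" unfolding v_def by (rule D.ratio_in_FF[OF fv])
  note U = is_form_UNIV
  \<comment> \<open>Elements of \<open>kk\<close> are invariant under \<open>\<tau>\<close>, while
    \<open>v\<close> changes sign; in characteristic 0 both together would make \<open>e1\<close>
    vanish on \<open>D\<close>.\<close>
  have v_notin: "v \<notin> kk"
  proof
    assume "v \<in> kk"
    then obtain h1 h2 where h: "(h1, h2) \<in> fracs K C" "v = ratio K D (\<lambda>w. h1 (r w)) (\<lambda>w. h2 (r w))" using kkE by blast
    obtain k where k: "is_form K k h1" "is_form K k h2" using h(1) unfolding C.fracs_iff by blast
    have eq: "\<forall>w\<in>\<Union>D. e1 w * h2 (r w) = h1 (r w) * e2 w"
      using h(2) unfolding v_def D.ratio_eq_iff[OF fv kkI(2)[OF h(1)]] by blast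
    have "zero_on D (\<lambda>w. e1 w * h2 (r w))"
      unfolding zero_on_def
    proof
      fix w assume w: "w \<in> \<Union>D"
      have "e1 (\<tau> w) * h2 (r (\<tau> w)) = h1 (r (\<tau> w)) * (dd * e2 w)" using eq[rule_format, OF tau_D[OF w]] unfolding e2_tau[OF w] .
      hence "- dd * e1 w * (dd ^ k * h2 (r w)) = dd ^ k * h1 (r w) * (dd * e2 w)"
        by (simp add: e1(2) r_tau[OF w] is_form_homogeneous[OF k(1)] is_form_homogeneous[OF k(2)])
      moreover have "dd * dd ^ k * (e1 w * h2 (r w) + h1 (r w) * e2 w)
          = dd ^ k * h1 (r w) * (dd * e2 w) - (- dd * e1 w * (dd ^ k * h2 (r w)))" by (simp add: algebra_simps)
      ultimately have "dd * dd ^ k * (e1 w * h2 (r w) + h1 (r w) * e2 w) = 0" by (simp only: diff_self)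
      hence "e1 w * h2 (r w) + h1 (r w) * e2 w = 0" using dd(2) by simp
      thus "e1 w * h2 (r w) = 0" using eq[rule_format, OF w] by (simp add: add_self_div_2 flip: mult_2)
    qed
    moreover have "is_form UNIV (k * 2) (\<lambda>w. h2 (r w))" by (rule U[OF is_form_comp[OF S k(2) r]])
    ultimately have "zero_on D e1 \<or> zero_on D (\<lambda>w. h2 (r w))" using D.prime[OF U[OF e1(1)]] by blast
    thus False using e1(3) kkI(2)[OF h(1)] unfolding D.fracs_iff by blast
  qed
  have "carrier (D.FF K) = R.line_extension kk v kk"
  proof
    show "R.line_extension kk v kk \<subseteq> carrier (D.FF K)"
      unfolding R.line_extension_def set_add_def' r_coset_def using kk_sub vc by auto
    show "carrier (D.FF K) \<subseteq> R.line_extension kk v kk"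
    proof
      fix Z assume "Z \<in> carrier (D.FF K)"
      then obtain f g where fg: "(f, g) \<in> fracs K D" "Z = ratio K D f g" by (rule D.FF_cases)
      then obtain n where n: "is_form K n f" "is_form K n g" and gnz: "\<not> zero_on D g" unfolding D.fracs_iff by blast
      have half: "1 / 2 \<in> K" using coeff_field_divide[OF K coeff_ringD(2)[OF S] coeff_ring_numeral[OF S]] .
      have ddn: "1 / dd ^ n \<in> K" using coeff_field_divide[OF K coeff_ringD(2)[OF S] coeff_ring_power[OF S dd(1)]] .
      \<comment> \<open>Multiplying with the conjugate of \<open>g\<close> makes the denominator
        \<open>Nn\<close> invariant, so only the numerator has to be split.\<close>
      define gt where "gt = (\<lambda>w. g (\<tau> w))"
      define p where "p = (\<lambda>w. f w * gt w)"
      define Nn where "Nn = (\<lambda>w. g w * gt w)"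
      \<comment> \<open>\<open>\<tau>\<close> applied twice is scaling by \<open>dd\<close>, so on
        forms of degree \<open>2 * n\<close> the substitution divided by \<open>dd ^ n\<close> is an
        involution; \<open>Ev\<close> and \<open>Od\<close> are the two eigencomponents.\<close>
      define Ev where "Ev = (\<lambda>w. 1 / 2 * (p w + 1 / dd ^ n * p (\<tau> w)))"
      define Od where "Od = (\<lambda>w. 1 / 2 * (p w - 1 / dd ^ n * p (\<tau> w)))"
      have gtF: "is_form K n gt" unfolding gt_def by (rule is_form_comp_linear[OF S n(2) tau(1)])
      have pF: "is_form K (2 * n) p" using is_form_mult[OF S n(1) gtF] unfolding p_def by (simp add: mult_2)
      have NF: "is_form K (2 * n) Nn" using is_form_mult[OF S n(2) gtF] unfolding Nn_def by (simp add: mult_2)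
      have ptF: "is_form K (2 * n) (\<lambda>w. p (\<tau> w))" by (rule is_form_comp_linear[OF S pF tau(1)])
      have EF: "is_form K (2 * n) Ev" unfolding Ev_def by (intro is_form_smult is_form_add S half ddn pF ptF)
      have OF': "is_form K (2 * n) Od" unfolding Od_def by (intro is_form_smult is_form_diff S half ddn pF ptF)
      have gtt: "gt (\<tau> w) = dd ^ n * g w" for w unfolding gt_def tau(2) by (rule is_form_homogeneous[OF n(2)])
      have ptt: "p (\<tau> (\<tau> w)) = dd ^ n * (dd ^ n * p w)" for w
        unfolding tau(2) is_form_homogeneous[OF pF] by (simp add: mult_2 power_add mult.assoc)
      have N_tau: "Nn (\<tau> w) = dd ^ n * Nn w" for w unfolding Nn_def gtt by (simp add: gt_def)
      have E_tau: "Ev (\<tau> w) = dd ^ n * Ev w" for w unfolding Ev_def ptt using dd(2) by (simp add: field_simps)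
      have O_tau: "Od (\<tau> w) = - (dd ^ n * Od w)" for w unfolding Od_def ptt using dd(2) by (simp add: field_simps)
      have EO: "Ev w + Od w = p w" for w unfolding Ev_def Od_def by (simp add: field_simps)
      obtain hE where hE: "is_form K n hE" "\<forall>w\<in>\<Union>D. Ev w = hE (r w)" using descent[OF EF E_tau] by blast
      obtain hN where hN: "is_form K n hN" "\<forall>w\<in>\<Union>D. Nn w = hN (r w)" using descent[OF NF N_tau] by blast
      have coord: "is_form K 2 e2" by (rule e2)
      have e11: "is_form K (2 * (n + 2)) (\<lambda>w. Nn w * (e1 w * e1 w))"
      proof -
        have "2 * n + (2 + 2) = 2 * (n + 2)" by simp
        thus ?thesis using is_form_mult[OF S NF is_form_mult[OF S e1(1) e1(1)]] by (simp only:)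
      qed
      have "Nn (\<tau> w) * (e1 (\<tau> w) * e1 (\<tau> w)) = dd ^ (n + 2) * (Nn w * (e1 w * e1 w))" for w
        unfolding N_tau e1(2) by (simp add: power_add power2_eq_square mult_ac)
      then obtain hM where hM: "is_form K (n + 2) hM" "\<forall>w\<in>\<Union>D. Nn w * (e1 w * e1 w) = hM (r w)"
        using descent[OF e11] by blast
      have oe: "is_form K (2 * (n + 1)) (\<lambda>w. Od w * e1 w)" using is_form_mult[OF S OF' e1(1)] by simp
      have "Od (\<tau> w) * e1 (\<tau> w) = dd ^ (n + 1) * (Od w * e1 w)" for w
        unfolding O_tau e1(2) by (simp add: mult_ac)
      then obtain hO where hO: "is_form K (n + 1) hO" "\<forall>w\<in>\<Union>D. Od w * e1 w = hO (r w)"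
        using descent[OF oe] by blast
      \<comment> \<open>The factor \<open>y $ i\<close> pulls back to \<open>e2\<close> and raises
        the degree to that of \<open>hM\<close>. Now \<open>hO' / hM\<close> pulls back to
        \<open>Od * e1 * e2\<close> over \<open>Nn * (e1 * e1)\<close>, and multiplication with
        \<open>v\<close>, which is \<open>e1 / e2\<close>, leaves \<open>Od / Nn\<close>.\<close>
      define hO' where "hO' = (\<lambda>y. hO y * y $ i)"
      have hO'F: "is_form K (n + 2) hO'" using is_form_mult[OF S hO(1) is_form_component[OF S]] unfolding hO'_def by simp
      have gtnz: "\<not> zero_on D gt"
      proof
        assume z: "zero_on D gt"
        have "g w = 0" if w: "w \<in> \<Union>D" for w
        proof -
          have "gt (\<tau> w) = 0" using z tau_D[OF w] unfolding zero_on_def by blast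
          thus ?thesis using gtt dd(2) by simp
        qed
        thus False using gnz unfolding zero_on_def by blast
      qed
      have Nnz: "\<not> zero_on D Nn" using D.prime[OF U[OF n(2)] U[OF gtF]] gnz gtnz unfolding Nn_def by blast
      have e1e1: "\<not> zero_on D (\<lambda>w. e1 w * e1 w)" using D.prime[OF U[OF e1(1)] U[OF e1(1)]] e1(3) by blast
      have Mnz: "\<not> zero_on D (\<lambda>w. Nn w * (e1 w * e1 w))"
        using D.prime[OF U[OF NF] U[OF is_form_mult[OF S e1(1) e1(1)]]] Nnz e1e1 by blast
      have hnz: "\<not> zero_on C h" if h: "\<not> zero_on D u" "\<forall>w\<in>\<Union>D. u w = h (r w)" for u h
      proof
        assume z: "zero_on C h"
        have "u w = 0" if w: "w \<in> \<Union>D" for w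
        proof -
          have "r w \<in> \<Union>C" using w unfolding surj by (rule imageI)
          hence "h (r w) = 0" using z unfolding zero_on_def by blast
          thus ?thesis using h(2)[rule_format, OF w] by simp
        qed
        thus False using h(1) unfolding zero_on_def by blast
      qed
      have hNnz: "\<not> zero_on C hN" by (rule hnz[OF Nnz hN(2)])
      have hMnz: "\<not> zero_on C hM" by (rule hnz[OF Mnz hM(2)])
      have fA: "(hE, hN) \<in> fracs K C" using hE(1) hN(1) hNnz unfolding C.fracs_iff by blast
      have fB: "(hO', hM) \<in> fracs K C" using hO'F hM(1) hMnz unfolding C.fracs_iff by blast
      let ?A = "ratio K D (\<lambda>w. hE (r w)) (\<lambda>w. hN (r w))" and ?B = "ratio K D (\<lambda>w. hO' (r w)) (\<lambda>w. hM (r w))"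
      note fA' = kkI(2)[OF fA] and fB' = kkI(2)[OF fB]
      have fBv: "(\<lambda>w. hO' (r w) * e1 w, \<lambda>w. hM (r w) * e2 w) \<in> fracs K D" by (rule D.fracs_mult[OF S fB' fv])
      have "?B \<otimes>\<^bsub>D.FF K\<^esub> v \<oplus>\<^bsub>D.FF K\<^esub> ?A = ratio K D (\<lambda>w. hO' (r w) * e1 w * hN (r w) + hE (r w) * (hM (r w) * e2 w))
          (\<lambda>w. hM (r w) * e2 w * hN (r w))"
        unfolding v_def D.mult_ratio[OF S fB' fv] by (rule D.add_ratio[OF S fBv fA'])
      also have "\<dots> = Z"
      proof -
        have "(hO' (r w) * e1 w * hN (r w) + hE (r w) * (hM (r w) * e2 w)) * g w = f w * (hM (r w) * e2 w * hN (r w))"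
          if w: "w \<in> \<Union>D" for w
        proof -
          have s: "hN (r w) = Nn w" "hM (r w) = Nn w * (e1 w * e1 w)" "hO' (r w) = Od w * e1 w * e2 w" "hE (r w) = Ev w"
            using hN(2) hM(2) hO(2) hE(2) w by (auto simp: hO'_def e2_def)
          have "(hO' (r w) * e1 w * hN (r w) + hE (r w) * (hM (r w) * e2 w)) * g w
              = Nn w * (e1 w * e1 w) * e2 w * (Ev w + Od w) * g w"
            unfolding s by (simp add: algebra_simps)
          also have "\<dots> = f w * (hM (r w) * e2 w * hN (r w))"
            unfolding EO s p_def by (simp add: Nn_def mult_ac)
          finally show ?thesis .
        qed
        thus ?thesis unfolding fg(2) D.ratio_eq_iff[OF D.fracs_add[OF S fBv fA'] fg(1)] by blast
      qed
      finally have "Z = ?B \<otimes>\<^bsub>D.FF K\<^esub> v \<oplus>\<^bsub>D.FF K\<^esub> ?A" ..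
      thus "Z \<in> R.line_extension kk v kk"
        unfolding R.line_extension_def set_add_def' r_coset_def using kkI(1)[OF fA] kkI(1)[OF fB] by blast
    qed
  qed
  hence "R.dimension (Suc 1) kk (carrier (D.FF K))"
    using R.Suc_dim[OF vc v_notin dim1] by simp
  thus ?thesis unfolding has_degree_def kk_def by (simp add: numeral_2_eq_2)
qed

section \<open>Linear algebra and descent over the field of definition\<close>

lemma matrix_inverse_over:
  fixes M :: "'a::field^'n^'n"
  assumes S: "coeff_field S" and M: "\<And>i j. M $ i $ j \<in> S" and d: "det M \<noteq> 0"
  shows "\<exists>B. (\<forall>i j. B $ i $ j \<in> S) \<and> B ** M = mat 1"
proof -
  have R: "coeff_ring S" by (rule coeff_field_ring[OF S])
  have detS: "det A \<in> S" if "\<And>i j. A $ i $ j \<in> S" for A :: "'a^'n^'n"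
  proof -
    have "of_int (sign p) \<in> S" for p :: "'n \<Rightarrow> 'n"
      by (cases rule: sign_cases[of p]) (use coeff_ringD[OF R] in auto)
    thus ?thesis unfolding det_def
      by (intro coeff_ring_sum[OF R] coeff_ringD(4)[OF R] coeff_ring_prod[OF R] that)
  qed
  define B where "B = (\<chi> k j. det (\<chi> i l. if l = k then (axis j 1 :: 'a^'n) $ i else M $ i $ l) / det M)"
  have BS: "B $ k $ j \<in> S" for k j
  proof -
    have "(\<chi> i l. if l = k then (axis j 1 :: 'a^'n) $ i else M $ i $ l) $ i' $ l' \<in> S" for i' l'
      using M coeff_ringD(1,2)[OF R] by (simp add: axis_def)
    thus ?thesis unfolding B_def by (simp add: coeff_field_divide[OF S] detS M)
  qed
  have "M *v column j B = axis j 1" for j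
  proof -
    have "column j B = (\<chi> k. det (\<chi> i l. if l = k then (axis j 1 :: 'a^'n) $ i else M $ i $ l) / det M)"
      by (simp add: column_def B_def)
    thus ?thesis using cramer[OF d, of "column j B" "axis j 1"] by simp
  qed
  hence "(M ** B) $ i $ j = mat 1 $ i $ j" for i j
    by (simp add: matrix_matrix_mult_def matrix_vector_mult_def column_def mat_def axis_def vec_eq_iff)
  hence "M ** B = mat 1" by (simp add: vec_eq_iff)
  thus ?thesis using BS matrix_left_right_inverse by blast
qed

text \<open>The given \<open>N\<close> is only geometric, but it inverts the matrix
  \<open>M\<close>, whose columns are built from values of \<open>Q\<close> at parameters 0 and 1;
  Cramer's rule keeps the inverse in \<open>S\<close>.\<close>

lemma param_coordinates_over:
  fixes Q :: "'a::field_char_0^2 \<Rightarrow> 'a^3"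
  assumes S: "coeff_field S" and Q: "forms_over S 2 Q" and N: "forms_over UNIV 1 N" "\<And>z. N (Q z) = sq2 z"
  shows "\<exists>N'. forms_over S 1 N' \<and> (\<forall>z. N' (Q z) = sq2 z)"
proof -
  have R: "coeff_ring S" by (rule coeff_field_ring[OF S])
  define a b c where "a = Q (vector [1, 0])" and "b = Q (vector [1, 1]) - Q (vector [1, 0]) - Q (vector [0, 1])"
    and "c = Q (vector [0, 1])"
  define M :: "'a^3^3" where "M = (\<chi> i j. if j = 1 then a $ i else if j = 2 then b $ i else c $ i)"
  have val: "Q (vector [s, t]) $ i \<in> S" if "s \<in> S" "t \<in> S" for s t i
  proof -
    have "vector [s, t] $ j \<in> S" for j :: 2 using exhaust_2[of j] that by auto
    thus ?thesis using Q is_form_value_in[OF R] unfolding forms_over_def by blast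
  qed
  note 01 = coeff_ringD(1,2)[OF R]
  have MS: "M $ i $ j \<in> S" for i j
    unfolding M_def a_def b_def c_def using val 01 by (simp add: coeff_ringD(6)[OF R])
  have Mv: "M *v u = u $ 1 *s a + u $ 2 *s b + u $ 3 *s c" for u
    by (simp add: vec_eq_iff matrix_vector_mult_def sum_3 M_def mult.commute)
  have MQ: "M *v sq2 z = Q z" for z
    unfolding Mv sq2_nth a_def b_def c_def by (rule quadratic_map_expand[OF forms_over_UNIV[OF Q], symmetric])
  have NM: "N (M *v u) = u" for u
  proof -
    have "N a = vector [1, 0, 0]" "N c = vector [0, 0, 1]" "N b = vector [0, 1, 0]"
      unfolding a_def b_def c_def forms1_diff[OF N(1)] N(2) by (simp_all add: vec_eq_iff forall_3 sq2_nth)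
    thus ?thesis unfolding Mv forms1_add[OF N(1)] forms1_scale[OF N(1)] using vec3_expand[of u] by simp
  qed
  have "\<forall>u. M *v u = 0 \<longrightarrow> u = 0" using NM forms1_zero[OF N(1)] by metis
  hence "\<exists>B. B ** M = mat 1" unfolding matrix_left_invertible_ker .
  hence "invertible M" using invertible_left_inverse by blast
  hence "det M \<noteq> 0" by (simp add: invertible_det_nz)
  then obtain B where B: "\<forall>i j. B $ i $ j \<in> S" "B ** M = mat 1" using matrix_inverse_over[OF S MS] by blast
  have "B *v Q z = sq2 z" for z
    unfolding MQ[symmetric] matrix_vector_mul_assoc B(2) by (rule matrix_vector_mul_lid)
  thus ?thesis using forms_over_matrix[OF R] B(1) by blast
qed

text \<open>In the coordinates \<open>T\<close> the substitution \<open>\<tau>\<close> is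
  \<open>flip4\<close> followed by scaling with \<open>\<delta>\<close>. In even degree that scaling
  contributes a power of \<open>dd\<close>, which cancels the multiplier of \<open>f\<close> and
  leaves invariance under \<open>flip4\<close>.\<close>

lemma invariant_form_factor:
  fixes T T' \<tau> :: "'a::field_char_0^4 \<Rightarrow> 'a^4" and s :: "'a^4 \<Rightarrow> 'a^(3+3)"
  assumes L: "coeff_ring L" and T: "forms_over L 1 T'" "\<And>u. T (T' u) = u" "\<And>w. T' (T w) = w"
    and M: "forms_over L 1 M" "\<And>w. sq4 (T w) = M (s w)"
    and tau: "\<And>w. T (\<tau> w) = \<delta> *s flip4 (T w)" and d: "\<delta>^2 = dd" "dd \<noteq> 0"
    and f: "is_form L (2 * e) f" "\<And>w. f (\<tau> w) = dd ^ e * f w"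
  shows "\<exists>h. is_form L e h \<and> (\<forall>w. f w = h (s w))"
proof -
  define f' where "f' = (\<lambda>u. f (T' u))"
  have f'F: "is_form L (2 * e) f'" unfolding f'_def by (rule is_form_comp_linear[OF L f(1) T(1)])
  have "f' (flip4 u) = f' u" for u
  proof -
    have "\<tau> (T' u) = T' (\<delta> *s flip4 u)" using tau[of "T' u"] T(2,3) by metis
    also have "\<dots> = \<delta> *s T' (flip4 u)" by (rule forms1_scale[OF T(1)])
    finally have "f (\<tau> (T' u)) = \<delta> ^ (2 * e) * f' (flip4 u)"
      unfolding f'_def by (simp add: is_form_homogeneous[OF f(1)])
    hence "dd ^ e * f' u = dd ^ e * f' (flip4 u)" unfolding f(2) f'_def by (simp add: d(1)[symmetric] power_mult)
    thus ?thesis using d(2) by simp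
  qed
  from even_invariant_form[OF L f'F this] obtain h where h: "is_form L e h" "\<forall>u. f' u = h (sq4 u)" by blast
  have "f w = h (M (s w))" for w
    using h(2)[rule_format, of "T w"] unfolding f'_def T(3) M(2) .
  thus ?thesis using is_form_comp_linear[OF L h(1) M(1)] by (intro exI[of _ "\<lambda>y. h (M y)"]) simp
qed

lemma form_split_basis:
  fixes H :: "'a::field^'n \<Rightarrow> 'a"
  assumes K: "coeff_ring K" and L: "\<And>x. x \<in> L \<Longrightarrow> \<exists>a\<in>K. \<exists>b\<in>K. x = a + \<beta> * b" and H: "is_form L d H"
  shows "\<exists>H0 H1. is_form K d H0 \<and> is_form K d H1 \<and> (\<forall>x. H x = H0 x + \<beta> * H1 x)"
proof -
  obtain c where c: "\<And>e. c e \<in> L" "H = (\<lambda>x. \<Sum>e | sum e UNIV = d. c e * (\<Prod>i\<in>UNIV. (x $ i) ^ e i))"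
    using H by (rule is_formE) (rule that)
  have "\<forall>e. \<exists>a. a \<in> K \<and> (\<exists>b. b \<in> K \<and> c e = a + \<beta> * b)" using L c(1) by blast
  from choice[OF this] obtain a where "\<forall>e. a e \<in> K \<and> (\<exists>b. b \<in> K \<and> c e = a e + \<beta> * b)" by blast
  hence a: "\<forall>e. a e \<in> K" "\<forall>e. \<exists>b. b \<in> K \<and> c e = a e + \<beta> * b" by auto
  from choice[OF a(2)] obtain b where b: "\<forall>e. b e \<in> K \<and> c e = a e + \<beta> * b e" by blast
  have "H x = (\<Sum>e | sum e UNIV = d. a e * (\<Prod>i\<in>UNIV. (x $ i) ^ e i)) +
      \<beta> * (\<Sum>e | sum e UNIV = d. b e * (\<Prod>i\<in>UNIV. (x $ i) ^ e i))" for x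
    unfolding c(2) sum_distrib_left sum.distrib[symmetric] using b by (intro sum.cong) (auto simp: algebra_simps)
  thus ?thesis using a(1) b
    by (intro exI[of _ "\<lambda>x. \<Sum>e | sum e UNIV = d. a e * (\<Prod>i\<in>UNIV. (x $ i) ^ e i)"]
        exI[of _ "\<lambda>x. \<Sum>e | sum e UNIV = d. b e * (\<Prod>i\<in>UNIV. (x $ i) ^ e i)"] conjI is_formI[OF _ refl] allI) auto
qed

text \<open>At a point with coordinates in \<open>K\<close> the relation would express
  \<open>\<beta>\<close> by elements of \<open>K\<close> unless both values are 0, and points with
  natural coordinates determine a form.\<close>

lemma form_basis_zero:
  fixes f g :: "'a::field_char_0^'n \<Rightarrow> 'a"
  assumes K: "coeff_field K" and b: "\<beta> \<notin> K" and f: "is_form K d f" and g: "is_form K d g"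
    and eq: "\<And>x. f x + \<beta> * g x = 0"
  shows "f x = 0"
proof -
  have R: "coeff_ring K" by (rule coeff_field_ring[OF K])
  show ?thesis
  proof (rule form_eq_0_if_nat_points[OF f])
    fix x :: "'a^'n" assume "\<And>i. x $ i \<in> range of_nat"
    hence xK: "x $ i \<in> K" for i using coeff_ring_of_nat[OF R] by (metis imageE)
    have fK: "f x \<in> K" "g x \<in> K" using is_form_value_in[OF R f xK] is_form_value_in[OF R g xK] by auto
    show "f x = 0"
    proof (cases "g x = 0")
      case True thus ?thesis using eq[of x] by simp
    next
      case False
      hence "\<beta> = - f x / g x" using eq[of x] by (simp add: field_simps add_eq_0_iff2)
      thus ?thesis using b coeff_field_divide[OF K coeff_ringD(5)[OF R fK(1)] fK(2)] by simp
    qed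
  qed
qed

text \<open>In the basis 1, \<open>\<beta>\<close> only the component of \<open>H\<close> along 1
  can contribute, because \<open>f\<close> has coefficients in \<open>K\<close>.\<close>

lemma invariant_form_descent:
  fixes H :: "'a::field_char_0^'m \<Rightarrow> 'a" and s :: "'a^'n \<Rightarrow> 'a^'m"
  assumes K: "coeff_field K" and b: "\<beta> \<notin> K" and L: "\<And>x. x \<in> L \<Longrightarrow> \<exists>a\<in>K. \<exists>b\<in>K. x = a + \<beta> * b"
    and s: "forms_over K 2 s" and f: "is_form K (2 * e) f" and H: "is_form L e H" "\<And>w. f w = H (s w)"
  shows "\<exists>h. is_form K e h \<and> (\<forall>w. f w = h (s w))"
proof -
  have R: "coeff_ring K" by (rule coeff_field_ring[OF K])
  obtain H0 H1 where H01: "is_form K e H0" "is_form K e H1" "\<forall>x. H x = H0 x + \<beta> * H1 x"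
    using form_split_basis[OF R L H(1)] by blast
  have F0: "is_form K (2 * e) (\<lambda>w. H0 (s w))" "is_form K (2 * e) (\<lambda>w. H1 (s w))"
    using is_form_comp[OF R H01(1) s] is_form_comp[OF R H01(2) s] by (simp_all add: mult.commute)
  have "H0 (s w) - f w = 0" for w
  proof (rule form_basis_zero[OF K b _ F0(2)])
    show "is_form K (2 * e) (\<lambda>w. H0 (s w) - f w)" by (intro is_form_diff R F0 f)
    show "H0 (s w) - f w + \<beta> * H1 (s w) = 0" for w using H(2) H01(3) by simp
  qed
  thus ?thesis using H01(1) by (intro exI[of _ H0]) simp
qed

section \<open>Galois conjugation\<close>

text \<open>The dimension yields some basis \<open>v1\<close>, \<open>v2\<close>, and 1 and
  \<open>\<beta>\<close> have to be shown to form one too. The determinant \<open>\<Delta>\<close>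
  of the change of basis could vanish only if \<open>\<beta>\<close> were a quotient of elements of
  \<open>K\<close>.\<close>

lemma quadratic_extension_basis:
  fixes K :: "'a::field set"
  assumes K: "coeff_field K" and L: "quadratic_extension K L \<beta>"
  shows "\<beta> \<notin> K" "L = {a + \<beta> * b |a b. a \<in> K \<and> b \<in> K}" "\<exists>p\<in>K. \<exists>q\<in>K. \<beta>^2 = p * \<beta> + q"
proof -
  interpret R: Ring.field "ring_of_type_algebra :: 'a ring" by blast
  have S: "coeff_ring K" by (rule coeff_field_ring[OF K])
  note ops = ring_of_type_algebra_def
  note mem = coeff_ringD[OF S] coeff_field_divide[OF K]
  have Ls: "L = R.simple_extension K \<beta>" and dim: "R.dimension 2 K L"
    using L by (auto simp: quadratic_extension_def)
  have zeroL: "0 \<in> L" unfolding Ls using R.simple_extension.zero[of K \<beta>] by (simp add: ops)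
  have linL: "k * \<beta> + c \<in> L" if "k \<in> L" "c \<in> K" for k c
    using R.simple_extension.lin[of k K \<beta> c] that unfolding Ls by (simp add: ops)
  have KL: "c \<in> L" if "c \<in> K" for c using linL[OF zeroL that] by simp
  have bL: "a + \<beta> * b \<in> L" if "a \<in> K" "b \<in> K" for a b
    using linL[OF KL[OF that(2)] that(1)] by (simp add: mult.commute add.commute)
  obtain v1 E where 1: "v1 \<notin> E" "R.dimension (Suc 0) K E" "L = R.line_extension K v1 E"
    using dim unfolding numeral_2_eq_2 by cases auto
  obtain v2 E' where 2: "v2 \<notin> E'" "R.dimension 0 K E'" "E = R.line_extension K v2 E'"
    using 1(2) by cases auto
  have E': "E' = {0}" using 2(2) by cases (auto simp: ops)
  have E: "E = {k * v2 |k. k \<in> K}" unfolding 2(3) E' set_eq_iff R.line_extension_mem_iff by (auto simp: ops)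
  have Leq: "L = {k * v1 + k' * v2 |k k'. k \<in> K \<and> k' \<in> K}"
    unfolding 1(3) E set_eq_iff R.line_extension_mem_iff by (auto simp: ops)
  have v2: "v2 \<noteq> 0" using 2(1) E' by simp
  show bK: "\<beta> \<notin> K"
  proof
    assume b: "\<beta> \<in> K"
    have "x \<in> R.simple_extension K \<beta> \<Longrightarrow> x \<in> K" for x
      by (induction rule: R.simple_extension.induct) (use b mem in \<open>auto simp: ops\<close>)
    hence "L \<subseteq> K" unfolding Ls by blast
    moreover have "v1 \<in> L" "v2 \<in> L"
    proof -
      have "1 * v1 + 0 * v2 \<in> L" "0 * v1 + 1 * v2 \<in> L" unfolding Leq using mem(1,2) by blast+
      thus "v1 \<in> L" "v2 \<in> L" by simp_all
    qed
    ultimately have "v1 \<in> K" "v2 \<in> K" by blast+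
    hence "v1 / v2 \<in> K" by (rule mem(7))
    hence "v1 \<in> E" unfolding E using v2 by (auto intro!: exI[of _ "v1 / v2"])
    thus False using 1(1) by blast
  qed
  show L: "L = {a + \<beta> * b |a b. a \<in> K \<and> b \<in> K}"
  proof
    show "{a + \<beta> * b |a b. a \<in> K \<and> b \<in> K} \<subseteq> L" using bL by blast
    have "1 \<in> L" "\<beta> \<in> L" using bL[of 1 0] bL[of 0 1] mem(1,2) by simp_all
    then obtain a b c d where e: "1 = a * v1 + b * v2" "\<beta> = c * v1 + d * v2" and abcd: "a \<in> K" "b \<in> K" "c \<in> K" "d \<in> K"
      unfolding Leq by blast
    define \<Delta> where "\<Delta> = a * d - b * c"
    have i: "\<Delta> * v1 = d - b * \<beta>" "\<Delta> * v2 = a * \<beta> - c"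
    proof -
      have "\<Delta> * v1 = d * (a * v1 + b * v2) - b * (c * v1 + d * v2)" "\<Delta> * v2 = a * (c * v1 + d * v2) - c * (a * v1 + b * v2)"
        by (simp_all add: \<Delta>_def algebra_simps)
      thus "\<Delta> * v1 = d - b * \<beta>" "\<Delta> * v2 = a * \<beta> - c" unfolding e[symmetric] by simp_all
    qed
    have D: "\<Delta> \<noteq> 0"
    proof
      assume D: "\<Delta> = 0"
      have b0: "b = 0"
      proof (rule ccontr)
        assume "b \<noteq> 0"
        hence "\<beta> = d / b" using i(1) D by (simp add: field_simps)
        thus False using bK mem(7)[OF abcd(4,2)] by simp
      qed
      hence "d = 0" using i D by simp
      hence "\<beta> = c * v1" "1 = a * v1" using e b0 by simp_all
      hence "\<beta> = c / a" by (metis mult_zero_left nonzero_eq_divide_eq mult.assoc mult.commute mult.right_neutral zero_neq_one)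
      thus False using bK mem(7)[OF abcd(3,1)] by simp
    qed
    hence v: "v1 = (d - b * \<beta>) / \<Delta>" "v2 = (a * \<beta> - c) / \<Delta>" using i by (simp_all add: field_simps)
    have DK: "\<Delta> \<in> K" unfolding \<Delta>_def by (intro mem(6) mem(4) abcd)
    show "L \<subseteq> {a + \<beta> * b |a b. a \<in> K \<and> b \<in> K}"
    proof
      fix x assume "x \<in> L"
      then obtain k k' where k: "x = k * v1 + k' * v2" "k \<in> K" "k' \<in> K" unfolding Leq by blast
      have "x = (k * d - k' * c) / \<Delta> + \<beta> * ((k' * a - k * b) / \<Delta>)"
        unfolding k(1) v using D by (simp add: field_simps)
      moreover have "(k * d - k' * c) / \<Delta> \<in> K" "(k' * a - k * b) / \<Delta> \<in> K" by (intro mem(7) mem(6) mem(4) k(2,3) abcd DK)+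
      ultimately show "x \<in> {a + \<beta> * b |a b. a \<in> K \<and> b \<in> K}" by blast
    qed
  qed
  have "\<beta> * \<beta> + 0 \<in> L" using linL[OF _ mem(1)] bL[of 0 1] mem(1,2) by simp
  then obtain a b where "\<beta> * \<beta> + 0 = a + \<beta> * b" "a \<in> K" "b \<in> K" unfolding L by blast
  thus "\<exists>p\<in>K. \<exists>q\<in>K. \<beta>^2 = p * \<beta> + q"
    by (intro bexI[of _ b] bexI[of _ a]) (simp_all add: power2_eq_square algebra_simps)
qed

text \<open>Graphs of \<open>K\<close>-embeddings of intermediate rings; the automorphism is obtained from a maximal one.\<close>

definition embedding_graph :: "'a::field set \<Rightarrow> ('a \<times> 'a) set \<Rightarrow> bool" where
  "embedding_graph K R \<longleftrightarrow> (\<forall>k\<in>K. (k, k) \<in> R) \<and>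
     (\<forall>x y x' y'. (x, y) \<in> R \<longrightarrow> (x', y') \<in> R \<longrightarrow> (x + x', y + y') \<in> R \<and> (x * x', y * y') \<in> R) \<and>
     (\<forall>y. (0, y) \<in> R \<longrightarrow> y = 0)"

lemma embedding_graphD:
  assumes "embedding_graph K R"
  shows "k \<in> K \<Longrightarrow> (k, k) \<in> R" "(x, y) \<in> R \<Longrightarrow> (x', y') \<in> R \<Longrightarrow> (x + x', y + y') \<in> R"
    "(x, y) \<in> R \<Longrightarrow> (x', y') \<in> R \<Longrightarrow> (x * x', y * y') \<in> R" "(0, y) \<in> R \<Longrightarrow> y = 0"
  using assms[unfolded embedding_graph_def, THEN conjunct1]
    assms[unfolded embedding_graph_def, THEN conjunct2, THEN conjunct1, rule_format, of x y x' y']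
    assms[unfolded embedding_graph_def, THEN conjunct2, THEN conjunct2] by simp_all

lemma embedding_graph_uminus:
  assumes K: "coeff_ring K" and R: "embedding_graph K R" and xy: "(x, y) \<in> R"
  shows "(- x, - y) \<in> R"
  using embedding_graphD(3)[OF R embedding_graphD(1)[OF R, of "- 1"] xy] coeff_ringD[OF K] by simp

lemma embedding_graph_unique:
  assumes K: "coeff_ring K" and R: "embedding_graph K R" and xy: "(x, y) \<in> R" "(x, y') \<in> R"
  shows "y = y'"
  using embedding_graphD(2)[OF R xy(1) embedding_graph_uminus[OF K R xy(2)]] embedding_graphD(4)[OF R] by fastforce

lemma embedding_graph_sum:
  assumes K: "coeff_ring K" and R: "embedding_graph K R" and "\<And>i. i \<in> I \<Longrightarrow> (f i, g i) \<in> R"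
  shows "(sum f I, sum g I) \<in> R"
  using assms(3)
  by (induction I rule: infinite_finite_induct)
    (auto intro: embedding_graphD[OF R] coeff_ringD[OF K])

lemma embedding_graph_poly:
  assumes K: "coeff_ring K" and R: "embedding_graph K R" and xy: "(x, y) \<in> R" and p: "\<And>i. Polynomial.coeff p i \<in> K"
  shows "(poly p x, poly p y) \<in> R"
  unfolding poly_altdef
proof (rule embedding_graph_sum[OF K R])
  have "(x ^ i, y ^ i) \<in> R" for i
    by (induction i) (auto intro: embedding_graphD[OF R] coeff_ringD[OF K] xy)
  thus "(Polynomial.coeff p i * x ^ i, Polynomial.coeff p i * y ^ i) \<in> R" for i
    by (rule embedding_graphD(3)[OF R embedding_graphD(1)[OF R p]])
qed

text \<open>Factors \<open>x\<close> are removed from an annihilating polynomial until its constant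
  term is nonzero. The inverse of \<open>x\<close> is then a polynomial in \<open>x\<close> over
  \<open>K\<close>, so a graph closed under sums and products is closed under division.\<close>

lemma algebraic_inverse:
  fixes x :: "'a::field"
  assumes K: "coeff_field K" and alg: "algebraic_over_all K" and x: "x \<noteq> 0"
  shows "\<exists>p. (\<forall>i. Polynomial.coeff p i \<in> K) \<and> x * poly p x = 1"
proof -
  have S: "coeff_ring K" by (rule coeff_field_ring[OF K])
  obtain p where "p \<noteq> 0" "\<forall>i. Polynomial.coeff p i \<in> K" "poly p x = 0"
    using alg unfolding algebraic_over_all_def by blast
  thus ?thesis
  proof (induction p rule: pCons_induct)
    case 0 thus ?case by simp
  next
    case (pCons a p)
    have a: "a \<in> K" and p: "\<forall>i. Polynomial.coeff p i \<in> K"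
      using pCons.prems(2)[rule_format, of 0] pCons.prems(2)[rule_format, of "Suc i" for i] by auto
    show ?case
    proof (cases "a = 0")
      case True
      hence "p \<noteq> 0" "poly p x = 0" using pCons.prems x by auto
      thus ?thesis using pCons.IH p by blast
    next
      case False
      have "a + x * poly p x = 0" using pCons.prems(3) by simp
      hence "x * poly p x = - a" by (simp add: eq_neg_iff_add_eq_0 add.commute)
      hence "x * poly (Polynomial.smult (- 1 / a) p) x = 1" using False by (simp add: field_simps)
      moreover have k: "- 1 / a \<in> K" by (rule coeff_field_divide[OF K coeff_ringD(5)[OF S coeff_ringD(2)[OF S]] a])
      moreover have "Polynomial.coeff (Polynomial.smult (- 1 / a) p) i \<in> K" for i
        unfolding coeff_smult by (rule coeff_ringD(4)[OF S k p[rule_format]])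
      ultimately show ?thesis by blast
    qed
  qed
qed

lemma embedding_graph_divide:
  assumes K: "coeff_field K" and alg: "algebraic_over_all K" and R: "embedding_graph K R"
    and xy: "(x, y) \<in> R" "x \<noteq> 0" and x'y': "(x', y') \<in> R"
  shows "y \<noteq> 0 \<and> (x' / x, y' / y) \<in> R"
proof -
  have S: "coeff_ring K" by (rule coeff_field_ring[OF K])
  obtain p where p: "\<forall>i. Polynomial.coeff p i \<in> K" "x * poly p x = 1" using algebraic_inverse[OF K alg xy(2)] by blast
  have P: "(poly p x, poly p y) \<in> R" using embedding_graph_poly[OF S R xy(1)] p(1) by blast
  have "(1, y * poly p y) \<in> R" using embedding_graphD(3)[OF R xy(1) P] p(2) by simp
  hence e: "y * poly p y = 1" using embedding_graph_unique[OF S R _ embedding_graphD(1)[OF R coeff_ringD(2)[OF S]]] by blast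
  hence y: "y \<noteq> 0" by auto
  have "poly p x = 1 / x" "poly p y = 1 / y" using p(2) e xy(2) y by (simp_all add: field_simps)
  thus ?thesis using embedding_graphD(3)[OF R x'y' P] y by simp
qed

text \<open>Turning a graph around gives a graph of the same kind; this reduces surjectivity of the
  maximal embedding to totality.\<close>

lemma embedding_graph_inverse:
  assumes K: "coeff_field K" and alg: "algebraic_over_all K" and R: "embedding_graph K R"
  shows "embedding_graph K (R\<inverse>)"
proof -
  have "x = 0" if "(x, 0) \<in> R" for x
    using embedding_graph_divide[OF K alg R that _ that] by blast
  thus ?thesis using R unfolding embedding_graph_def by simp
qed

text \<open>The extension of an embedding to a simple algebraic extension, without quotient rings.
  \<open>P\<close> pairs polynomials with related coefficients, and the new graph pairs their values
  at \<open>z\<close> and at a root \<open>z'\<close> of the partner of a polynomial of least degree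
  that kills \<open>z\<close>.\<close>

lemma embedding_graph_adjoin:
  fixes K :: "'a::alg_closed_field set"
  assumes K: "coeff_field K" and alg: "algebraic_over_all K" and R: "embedding_graph K R"
  shows "\<exists>R'. embedding_graph K R' \<and> R \<subseteq> R' \<and> z \<in> Domain R'"
proof -
  have S: "coeff_ring K" by (rule coeff_field_ring[OF K])
  note E = embedding_graphD[OF R]
  have E0: "(0, 0) \<in> R" using E(1) coeff_ringD(1)[OF S] by blast
  define P where "P = {(g, g'). \<forall>i. (Polynomial.coeff g i, Polynomial.coeff g' i) \<in> R}"
  have PD: "(Polynomial.coeff g i, Polynomial.coeff g' i) \<in> R" if "(g, g') \<in> P" for g g' i
    using that unfolding P_def by simp
  have PI: "(g, g') \<in> P" if "\<And>i. (Polynomial.coeff g i, Polynomial.coeff g' i) \<in> R" for g g'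
    using that unfolding P_def by simp
  have P_add: "(g + h, g' + h') \<in> P" if "(g, g') \<in> P" "(h, h') \<in> P" for g g' h h'
    by (rule PI) (simp add: E(2)[OF PD[OF that(1)] PD[OF that(2)]])
  have P_mult: "(g * h, g' * h') \<in> P" if "(g, g') \<in> P" "(h, h') \<in> P" for g g' h h'
    by (rule PI) (simp add: coeff_mult, intro embedding_graph_sum[OF S R] E(3)[OF PD[OF that(1)] PD[OF that(2)]])
  have P_monom: "(Polynomial.monom c n, Polynomial.monom c' n) \<in> P" if "(c, c') \<in> R" for c c' n
    by (rule PI) (simp add: that E0)
  have P_minus: "(g - h, g' - h') \<in> P" if "(g, g') \<in> P" "(h, h') \<in> P" for g g' h h'
    by (rule PI) (use E(2)[OF PD[OF that(1)] embedding_graph_uminus[OF S R PD[OF that(2)]]] in simp)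
  have inj: "x = 0 \<longleftrightarrow> y = 0" if "(x, y) \<in> R" for x y
    using embedding_graph_divide[OF K alg R that _ that] E(4)[of y] that by auto
  have P_degree: "Polynomial.degree g = Polynomial.degree g'" if "(g, g') \<in> P" for g g'
    using inj[OF PD[OF that]] unfolding Polynomial.degree_def by simp
  define good where "good = (\<lambda>g. g \<noteq> 0 \<and> poly g z = 0 \<and> (\<exists>g'. (g, g') \<in> P))"
  have "\<exists>g. good g"
  proof -
    obtain p where "p \<noteq> 0" "\<forall>i. Polynomial.coeff p i \<in> K" "poly p z = 0"
      using alg unfolding algebraic_over_all_def by blast
    moreover have "(p, p) \<in> P" if "\<forall>i. Polynomial.coeff p i \<in> K" for p
      by (rule PI) (rule E(1)[OF that[rule_format]])
    ultimately show ?thesis unfolding good_def by blast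
  qed
  then obtain p where p: "good p" and pmin: "\<And>g. good g \<Longrightarrow> Polynomial.degree p \<le> Polynomial.degree g"
    using arg_min_natI arg_min_nat_le[of good _ Polynomial.degree] by metis
  obtain p' where p': "(p, p') \<in> P" using p unfolding good_def by blast
  have "Polynomial.degree p \<noteq> 0"
  proof
    assume "Polynomial.degree p = 0"
    then obtain c where "p = [:c:]" by (metis degree_eq_zeroE)
    thus False using p unfolding good_def by auto
  qed
  hence "Polynomial.degree p' > 0" using P_degree[OF p'] by simp
  then obtain z' where z': "poly p' z' = 0" using alg_closed_imp_poly_has_root by blast
  \<comment> \<open>This makes the new relation single-valued. It is division with remainder by
    \<open>p\<close>, one leading term at a time and on both components of the pair; minimality of
    \<open>p\<close> guarantees that the leading term can be removed.\<close>
  have vanish: "poly g' z' = 0" if "(g, g') \<in> P" "poly g z = 0" for g g'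
    using that
  proof (induction "Polynomial.degree g" arbitrary: g g' rule: less_induct)
    case less
    show ?case
    proof (cases "g = 0")
      case True
      hence "g' = 0" using PD[OF less.prems(1)] E(4) by (simp add: poly_eq_iff)
      thus ?thesis by simp
    next
      case False
      define n where "n = Polynomial.degree g - Polynomial.degree p"
      have dg: "Polynomial.degree p + n = Polynomial.degree g"
      proof -
        have "good g" unfolding good_def using False less.prems by blast
        thus ?thesis using pmin[of g] unfolding n_def by simp
      qed
      define c c' where "c = Polynomial.lead_coeff g / Polynomial.lead_coeff p" and "c' = Polynomial.lead_coeff g' / Polynomial.lead_coeff p'"
      have lp: "Polynomial.lead_coeff p \<noteq> 0" using p unfolding good_def by simp
      have "(Polynomial.lead_coeff p, Polynomial.lead_coeff p') \<in> R" "(Polynomial.lead_coeff g, Polynomial.lead_coeff g') \<in> R"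
        using PD[OF p', of "Polynomial.degree p"] PD[OF less.prems(1), of "Polynomial.degree g"]
        unfolding P_degree[OF p'] P_degree[OF less.prems(1)] by simp_all
      hence c: "(c, c') \<in> R" using embedding_graph_divide[OF K alg R _ lp] unfolding c_def c'_def by simp
      define g1 g1' where "g1 = g - p * Polynomial.monom c n" and "g1' = g' - p' * Polynomial.monom c' n"
      have g1: "(g1, g1') \<in> P" unfolding g1_def g1'_def by (intro P_minus less.prems P_mult p' P_monom c)
      have z1: "poly g1 z = 0" using less.prems(2) p unfolding g1_def good_def by simp
      have c0: "c \<noteq> 0" using False lp by (simp add: c_def)
      have dm: "Polynomial.degree (p * Polynomial.monom c n) = Polynomial.degree g"
        
      proof -
        have "p \<noteq> 0" "Polynomial.monom c n \<noteq> 0" using lp c0 by auto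
        thus ?thesis using c0 dg by (simp add: degree_mult_eq degree_monom_eq)
      qed
      have lm: "Polynomial.coeff (p * Polynomial.monom c n) (Polynomial.degree g) = Polynomial.lead_coeff g"
      proof -
        have "Polynomial.lead_coeff (p * Polynomial.monom c n) = Polynomial.lead_coeff p * c" unfolding lead_coeff_mult lead_coeff_monom ..
        thus ?thesis unfolding dm using lp by (simp add: c_def)
      qed
      have "poly g1' z' = 0"
      proof (cases "Polynomial.degree g1 < Polynomial.degree g")
        case True thus ?thesis using less.hyps g1 z1 by blast
      next
        case False
        have "Polynomial.degree g1 \<le> Polynomial.degree g" unfolding g1_def by (rule degree_diff_le) (simp_all add: dm)
        hence "Polynomial.lead_coeff g1 = 0" using False lm unfolding g1_def by simp
        hence "g1 = 0" by simp
        hence "g1' = 0" using PD[OF g1] E(4) by (simp add: poly_eq_iff)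
        thus ?thesis by simp
      qed
      thus ?thesis using z' by (simp add: g1'_def)
    qed
  qed
  define R' where "R' = {(poly g z, poly g' z') |g g'. (g, g') \<in> P}"
  have RR': "R \<subseteq> R'"
  proof (clarify)
    fix x y assume "(x, y) \<in> R"
    from P_monom[OF this, of 0] have "(poly (Polynomial.monom x 0) z, poly (Polynomial.monom y 0) z') \<in> R'"
      unfolding R'_def by blast
    thus "(x, y) \<in> R'" by (simp add: poly_monom)
  qed
  moreover have "embedding_graph K R'"
    unfolding embedding_graph_def
  proof (intro conjI ballI allI impI)
    show "(k, k) \<in> R'" if "k \<in> K" for k using RR' E(1) that by blast
    show "y = 0" if "(0, y) \<in> R'" for y using that vanish unfolding R'_def by auto
    fix x y x' y' assume "(x, y) \<in> R'" "(x', y') \<in> R'"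
    then obtain g g' h h' where gh: "(g, g') \<in> P" "(h, h') \<in> P" "x = poly g z" "y = poly g' z'" "x' = poly h z" "y' = poly h' z'"
      unfolding R'_def by blast
    have "(poly (g + h) z, poly (g' + h') z') \<in> R'" "(poly (g * h) z, poly (g' * h') z') \<in> R'"
      unfolding R'_def using P_add[OF gh(1,2)] P_mult[OF gh(1,2)] by blast+
    thus "(x + x', y + y') \<in> R'" "(x * x', y * y') \<in> R'" unfolding gh(3-) by simp_all
  qed
  moreover have "z \<in> Domain R'"
  proof -
    have "(Polynomial.monom 1 1, Polynomial.monom 1 1) \<in> P" by (rule P_monom[OF E(1)[OF coeff_ringD(2)[OF S]]])
    hence "(poly (Polynomial.monom 1 1) z, poly (Polynomial.monom 1 1) z') \<in> R'" unfolding R'_def by blast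
    thus ?thesis by (auto simp: poly_monom)
  qed
  ultimately show ?thesis by blast
qed

text \<open>The union of a chain of graphs is again a graph, so a maximal one exists. It is total
  since any element can be adjoined, and its range is everything since the same can be done to its
  converse.\<close>

lemma embedding_extends:
  fixes K :: "'a::alg_closed_field set"
  assumes K: "coeff_field K" and alg: "algebraic_over_all K" and R0: "embedding_graph K R0"
  shows "\<exists>\<sigma>\<in>gal K. \<forall>(x, y)\<in>R0. \<sigma> x = y"
proof -
  have S: "coeff_ring K" by (rule coeff_field_ring[OF K])
  define A where "A = {R. embedding_graph K R \<and> R0 \<subseteq> R}"
  have "\<exists>M\<in>A. \<forall>R\<in>A. M \<subseteq> R \<longrightarrow> R = M"
  proof (rule subset_Zorn_nonempty)
    show "A \<noteq> {}" using R0 unfolding A_def by blast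
    fix Ch assume Ch: "Ch \<noteq> {}" "subset.chain A Ch"
    have chain: "R \<subseteq> R' \<or> R' \<subseteq> R" if "R \<in> Ch" "R' \<in> Ch" for R R'
      using Ch(2) that unfolding subset_chain_def by blast
    have mem: "embedding_graph K R" "R0 \<subseteq> R" if "R \<in> Ch" for R using Ch(2) that unfolding subset_chain_def A_def by blast+
    have "embedding_graph K (\<Union>Ch)"
      unfolding embedding_graph_def
    proof (intro conjI ballI allI impI)
      show "(k, k) \<in> \<Union>Ch" if "k \<in> K" for k using that Ch(1) embedding_graphD(1)[OF mem(1)] by blast
      show "y = 0" if "(0, y) \<in> \<Union>Ch" for y using that embedding_graphD(4)[OF mem(1)] by blast
      fix x y x' y' assume "(x, y) \<in> \<Union>Ch" "(x', y') \<in> \<Union>Ch"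
      then obtain R R' where "R \<in> Ch" "R' \<in> Ch" "(x, y) \<in> R" "(x', y') \<in> R'" by blast
      then obtain R where r: "R \<in> Ch" "(x, y) \<in> R" "(x', y') \<in> R" using chain by blast
      show "(x + x', y + y') \<in> \<Union>Ch" using embedding_graphD(2)[OF mem(1)[OF r(1)] r(2,3)] r(1) by blast
      show "(x * x', y * y') \<in> \<Union>Ch" using embedding_graphD(3)[OF mem(1)[OF r(1)] r(2,3)] r(1) by blast
    qed
    moreover have "R0 \<subseteq> \<Union>Ch" using mem(2) Ch(1) by blast
    ultimately show "\<Union>Ch \<in> A" unfolding A_def by blast
  qed
  then obtain M where MA: "M \<in> A" "\<forall>R\<in>A. M \<subseteq> R \<longrightarrow> R = M" by (elim bexE)
  have M: "embedding_graph K M" "R0 \<subseteq> M" using MA(1) by (simp_all add: A_def)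
  have max: "R = M" if "embedding_graph K R" "M \<subseteq> R" for R
  proof -
    have "R \<in> A" using that M(2) by (simp add: A_def)
    thus ?thesis using MA(2) that(2) by simp
  qed
  have dom: "z \<in> Domain M" for z
  proof -
    obtain R where R: "embedding_graph K R" "M \<subseteq> R" "z \<in> Domain R"
      using embedding_graph_adjoin[OF K alg M(1), of z] by (elim exE conjE)
    show ?thesis using R(3) max[OF R(1,2)] by simp
  qed
  have M': "embedding_graph K (M\<inverse>)" by (rule embedding_graph_inverse[OF K alg M(1)])
  have ran: "z \<in> Range M" for z
  proof -
    obtain R where R: "embedding_graph K R" "M\<inverse> \<subseteq> R" "z \<in> Domain R" using embedding_graph_adjoin[OF K alg M', of z] by (elim exE conjE)
    have "M \<subseteq> R\<inverse>" using R(2) by auto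
    hence "R\<inverse> = M" by (rule max[OF embedding_graph_inverse[OF K alg R(1)]])
    thus ?thesis using R(3) by auto
  qed
  define \<sigma> where "\<sigma> x = (THE y. (x, y) \<in> M)" for x
  have sM: "(x, \<sigma> x) \<in> M" for x
    unfolding \<sigma>_def using dom[of x] embedding_graph_unique[OF S M(1)] by (metis DomainE theI)
  have sI: "\<sigma> x = y" if "(x, y) \<in> M" for x y using embedding_graph_unique[OF S M(1) sM that] .
  have "inj \<sigma>" using embedding_graph_unique[OF S M'] sM by (metis converse_iff injI)
  moreover have "surj \<sigma>" using ran sI by (metis RangeE surjI surj_def)
  ultimately have "\<sigma> \<in> gal K"
    unfolding gal_def bij_def mem_Collect_eq
    using sI[OF embedding_graphD(1)[OF M(1)]] sI[OF embedding_graphD(2)[OF M(1) sM sM]] sI[OF embedding_graphD(3)[OF M(1) sM sM]]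
    by simp
  thus ?thesis using sI M(2) by blast
qed

text \<open>\<open>p - \<beta>\<close> is the other root of the same quadratic equation, and the
  product of two expressions \<open>a + c * t\<close> is computed from that equation alone.\<close>

lemma quadratic_conjugation:
  fixes K :: "'a::{alg_closed_field, field_char_0} set"
  assumes K: "coeff_field K" and alg: "algebraic_over_all K" and b: "\<beta> \<notin> K"
    and pq: "p \<in> K" "q \<in> K" "\<beta>^2 = p * \<beta> + q"
  shows "\<exists>\<sigma>\<in>gal K. \<sigma> \<beta> = p - \<beta>"
proof -
  have S: "coeff_ring K" by (rule coeff_field_ring[OF K])
  define \<beta>' where "\<beta>' = p - \<beta>"
  have b2: "\<beta> * \<beta> = p * \<beta> + q" using pq(3) by (simp add: power2_eq_square)
  have b'2: "\<beta>' * \<beta>' = p * \<beta>' + q" using b2 by (simp add: \<beta>'_def algebra_simps)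
  define R where "R = {(a + b * \<beta>, a + b * \<beta>') |a b. a \<in> K \<and> b \<in> K}"
  have RI: "(a + b * \<beta>, a + b * \<beta>') \<in> R" if "a \<in> K" "b \<in> K" for a b using that unfolding R_def by blast
  have "embedding_graph K R"
    unfolding embedding_graph_def
  proof (intro conjI ballI allI impI)
    show "(k, k) \<in> R" if "k \<in> K" for k using RI[OF that coeff_ringD(1)[OF S]] by simp
    show "y = 0" if "(0, y) \<in> R" for y
    proof -
      obtain a c where ac: "a + c * \<beta> = 0" "y = a + c * \<beta>'" "a \<in> K" "c \<in> K" using \<open>(0, y) \<in> R\<close> unfolding R_def by auto
      have "c = 0"
      proof (rule ccontr)
        assume "c \<noteq> 0"
        hence "\<beta> = (- a) / c" using ac(1) by (simp add: field_simps eq_neg_iff_add_eq_0)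
        thus False using b coeff_field_divide[OF K coeff_ringD(5)[OF S ac(3)] ac(4)] by simp
      qed
      thus ?thesis using ac by simp
    qed
    fix x y x' y' assume "(x, y) \<in> R" "(x', y') \<in> R"
    then obtain a c a' c' where e: "x = a + c * \<beta>" "y = a + c * \<beta>'" "x' = a' + c' * \<beta>" "y' = a' + c' * \<beta>'"
      and m: "a \<in> K" "c \<in> K" "a' \<in> K" "c' \<in> K" unfolding R_def by blast
    have "((a + a') + (c + c') * \<beta>, (a + a') + (c + c') * \<beta>') \<in> R" by (intro RI coeff_ringD(3)[OF S] m)
    thus "(x + x', y + y') \<in> R" unfolding e by (simp add: algebra_simps)
    have "((a * a' + c * c' * q) + (a * c' + a' * c + c * c' * p) * \<beta>, (a * a' + c * c' * q) + (a * c' + a' * c + c * c' * p) * \<beta>') \<in> R"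
      by (intro RI coeff_ringD(3,4)[OF S] m pq)
    moreover have "(a + c * t) * (a' + c' * t) = (a * a' + c * c' * q) + (a * c' + a' * c + c * c' * p) * t"
      if "t * t = p * t + q" for t
    proof -
      have "(a + c * t) * (a' + c' * t) = a * a' + (a * c' + a' * c) * t + c * c' * (t * t)" by (simp add: algebra_simps)
      thus ?thesis unfolding that by (simp add: algebra_simps)
    qed
    ultimately show "(x * x', y * y') \<in> R" unfolding e using b2 b'2 by simp
  qed
  from embedding_extends[OF K alg this] obtain \<sigma> where s: "\<sigma> \<in> gal K" "\<forall>(x, y)\<in>R. \<sigma> x = y" by blast
  have "(\<beta>, \<beta>') \<in> R" using RI[OF coeff_ringD(1,2)[OF S]] by simp
  hence "\<sigma> \<beta> = \<beta>'" using s(2) by auto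
  thus ?thesis using s(1) unfolding \<beta>'_def by (rule bexI)
qed

subsection \<open>Conjugate forms\<close>

definition conj_vec :: "('a \<Rightarrow> 'a) \<Rightarrow> 'a::field^'n \<Rightarrow> 'a^'n" where
  "conj_vec \<sigma> x = (\<chi> i. \<sigma> (x $ i))"

lemma conj_vec_nth [simp]: "conj_vec \<sigma> x $ i = \<sigma> (x $ i)"
  by (simp add: conj_vec_def)

lemma galD:
  assumes "\<sigma> \<in> gal K"
  shows "bij \<sigma>" "\<sigma> (x + y) = \<sigma> x + \<sigma> y" "\<sigma> (x * y) = \<sigma> x * \<sigma> y" "k \<in> K \<Longrightarrow> \<sigma> k = k"
  using assms by (simp_all add: gal_def)

lemma gal_simps:
  assumes "\<sigma> \<in> gal K"
  shows "\<sigma> 0 = 0" "\<sigma> 1 = 1" "\<sigma> x = 0 \<longleftrightarrow> x = 0" "\<sigma> (x ^ n) = \<sigma> x ^ n"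
    "\<sigma> (sum f I) = (\<Sum>i\<in>I. \<sigma> (f i))" "\<sigma> (prod f I) = (\<Prod>i\<in>I. \<sigma> (f i))"
proof -
  have inj: "\<sigma> u = \<sigma> v \<longleftrightarrow> u = v" for u v using galD(1)[OF assms] by (auto simp: bij_def inj_def)
  have "\<sigma> 0 + 0 = \<sigma> 0 + \<sigma> 0" using galD(2)[OF assms, of 0 0] by (metis add_0_right)
  thus z: "\<sigma> 0 = 0" by (metis add_left_imp_eq)
  show 0: "\<sigma> x = 0 \<longleftrightarrow> x = 0" for x using inj[of x 0] z by simp
  show 1: "\<sigma> 1 = 1" using galD(3)[OF assms, of 1 1] 0[of 1] by simp
  show "\<sigma> (x ^ n) = \<sigma> x ^ n" by (induction n) (simp_all add: 1 galD(3)[OF assms])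
  show "\<sigma> (sum f I) = (\<Sum>i\<in>I. \<sigma> (f i))"
    by (induction I rule: infinite_finite_induct) (simp_all add: z galD(2)[OF assms])
  show "\<sigma> (prod f I) = (\<Prod>i\<in>I. \<sigma> (f i))"
    by (induction I rule: infinite_finite_induct) (simp_all add: 1 galD(3)[OF assms])
qed

lemma conj_vec_linear:
  assumes "\<sigma> \<in> gal K"
  shows "conj_vec \<sigma> (x + y) = conj_vec \<sigma> x + conj_vec \<sigma> y" "conj_vec \<sigma> (c *s x) = \<sigma> c *s conj_vec \<sigma> x"
    "conj_vec \<sigma> x = 0 \<longleftrightarrow> x = 0" "conj_vec \<sigma> 0 = 0"
  by (simp_all add: vec_eq_iff galD[OF assms] gal_simps[OF assms])

lemma conj_vec_surj:
  assumes "\<sigma> \<in> gal K"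
  shows "\<exists>x. y = conj_vec \<sigma> x"
proof -
  have "\<sigma> (inv_into UNIV \<sigma> u) = u" for u using galD(1)[OF assms] by (simp add: bij_is_surj surj_f_inv_f)
  thus ?thesis by (intro exI[of _ "\<chi> i. inv_into UNIV \<sigma> (y $ i)"]) (simp add: vec_eq_iff)
qed

text \<open>The conjugate form has the conjugate coefficients; stating it through values at
  conjugate vectors determines it, as every vector is a conjugate.\<close>

lemma conj_form:
  assumes s: "\<sigma> \<in> gal K" and L: "\<And>x. x \<in> L \<Longrightarrow> \<sigma> x \<in> L'" and f: "is_form L d f"
  shows "\<exists>f'. is_form L' d f' \<and> (\<forall>x. \<sigma> (f x) = f' (conj_vec \<sigma> x))"
proof -
  obtain c where c: "\<And>e. c e \<in> L" "f = (\<lambda>x. \<Sum>e | sum e UNIV = d. c e * (\<Prod>i\<in>UNIV. (x $ i) ^ e i))"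
    using f by (rule is_formE) (rule that)
  have "\<sigma> (f x) = (\<Sum>e | sum e UNIV = d. \<sigma> (c e) * (\<Prod>i\<in>UNIV. (conj_vec \<sigma> x $ i) ^ e i))" for x
    unfolding c(2) by (simp add: gal_simps[OF s] galD(3)[OF s])
  thus ?thesis
    by (intro exI[of _ "\<lambda>x. \<Sum>e | sum e UNIV = d. \<sigma> (c e) * (\<Prod>i\<in>UNIV. (x $ i) ^ e i)"] conjI is_formI[OF _ refl])
      (simp_all add: L c(1))
qed

lemma conj_form_fixed:
  assumes s: "\<sigma> \<in> gal K" and f: "is_form K d f"
  shows "\<sigma> (f x) = f (conj_vec \<sigma> x)"
proof -
  obtain c where c: "\<And>e. c e \<in> K" "f = (\<lambda>x. \<Sum>e | sum e UNIV = d. c e * (\<Prod>i\<in>UNIV. (x $ i) ^ e i))"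
    using f by (rule is_formE) (rule that)
  show ?thesis unfolding c(2) by (simp add: gal_simps[OF s] galD(3)[OF s] galD(4)[OF s c(1)])
qed

lemma conj_forms:
  assumes s: "\<sigma> \<in> gal K" and L: "\<And>x. x \<in> L \<Longrightarrow> \<sigma> x \<in> L'" and m: "forms_over L d m"
  shows "\<exists>m'. forms_over L' d m' \<and> (\<forall>x. conj_vec \<sigma> (m x) = m' (conj_vec \<sigma> x))"
proof -
  have "\<forall>i. \<exists>f'. is_form L' d f' \<and> (\<forall>x. \<sigma> (m x $ i) = f' (conj_vec \<sigma> x))"
    using conj_form[OF s L] m unfolding forms_over_def by blast
  from choice[OF this] obtain f' where "\<forall>i. is_form L' d (f' i) \<and> (\<forall>x. \<sigma> (m x $ i) = f' i (conj_vec \<sigma> x))" by blast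
  thus ?thesis by (intro exI[of _ "\<lambda>x. \<chi> i. f' i x"]) (simp add: forms_over_def vec_eq_iff)
qed

lemma conj_forms_fixed:
  assumes s: "\<sigma> \<in> gal K" and m: "forms_over K d m"
  shows "conj_vec \<sigma> (m x) = m (conj_vec \<sigma> x)"
  unfolding vec_eq_iff conj_vec_nth
proof
  fix i
  have "is_form K d (\<lambda>x. m x $ i)" using m by (simp add: forms_over_def)
  from conj_form_fixed[OF s this] show "\<sigma> (m x $ i) = m (conj_vec \<sigma> x) $ i" .
qed

lemma gal_point_zeros:
  assumes s: "\<sigma> \<in> gal K" and f: "\<And>x. \<sigma> (f x) = f' (conj_vec \<sigma> x)"
  shows "gal_point \<sigma> ` zeros {f} = zeros {f'}"
proof -
  have hp: "gal_point \<sigma> (hpoint x) = hpoint (conj_vec \<sigma> x)" for x :: "'a^'n"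
  proof
    show "gal_point \<sigma> (hpoint x) \<subseteq> hpoint (conj_vec \<sigma> x)"
      unfolding gal_point_def hpoint_def conj_vec_def[symmetric]
      by (auto simp: conj_vec_linear(2)[OF s] gal_simps(3)[OF s])
    show "hpoint (conj_vec \<sigma> x) \<subseteq> gal_point \<sigma> (hpoint x)"
    proof
      fix y assume "y \<in> hpoint (conj_vec \<sigma> x)"
      then obtain c where c: "y = c *s conj_vec \<sigma> x" "c \<noteq> 0" unfolding hpoint_def by blast
      obtain c' where c': "c = \<sigma> c'" using galD(1)[OF s] by (metis bij_pointE)
      have "y = conj_vec \<sigma> (c' *s x)" "c' \<noteq> 0" using c c' by (auto simp: conj_vec_linear(2)[OF s] gal_simps(1)[OF s])
      thus "y \<in> gal_point \<sigma> (hpoint x)" unfolding gal_point_def hpoint_def conj_vec_def[symmetric] by blast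
    qed
  qed
  show ?thesis
  proof
    show "gal_point \<sigma> ` zeros {f} \<subseteq> zeros {f'}"
    proof
      fix P assume "P \<in> gal_point \<sigma> ` zeros {f}"
      then obtain x where x: "x \<noteq> 0" "f x = 0" "P = hpoint (conj_vec \<sigma> x)" unfolding zeros_def using hp by auto
      have "conj_vec \<sigma> x \<noteq> 0" "f' (conj_vec \<sigma> x) = 0"
        using x f[of x] by (simp_all add: gal_simps(1)[OF s] conj_vec_linear(3)[OF s])
      thus "P \<in> zeros {f'}" unfolding zeros_def x(3) by auto
    qed
    show "zeros {f'} \<subseteq> gal_point \<sigma> ` zeros {f}"
    proof
      fix P assume "P \<in> zeros {f'}"
      then obtain y where y: "y \<noteq> 0" "f' y = 0" "P = hpoint y" unfolding zeros_def by auto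
      obtain x where x: "y = conj_vec \<sigma> x" using conj_vec_surj[OF s] by blast
      have "x \<noteq> 0" "f x = 0" using y f[of x] x by (auto simp: gal_simps(3)[OF s] conj_vec_linear(3)[OF s])
      hence "hpoint x \<in> zeros {f}" unfolding zeros_def by auto
      thus "P \<in> gal_point \<sigma> ` zeros {f}" using hp[of x] y(3) x by (metis imageI)
    qed
  qed
qed

section \<open>The recombined equations\<close>

lemma join_eq_iff: "join x y = join x' y' \<longleftrightarrow> x = x' \<and> y = y'"
proof
  assume e: "join x y = join x' y'"
  have "x $ i = x' $ i" "y $ j = y' $ j" for i j
    using arg_cong[OF e, of "\<lambda>v. v $ Inl i"] arg_cong[OF e, of "\<lambda>v. v $ Inr j"] by simp_all
  thus "x = x' \<and> y = y'" by (simp add: vec_eq_iff)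
qed simp

lemma vec_sum_eqI: "(\<And>i. x $ Inl i = y $ Inl i) \<Longrightarrow> (\<And>j. x $ Inr j = y $ Inr j) \<Longrightarrow> x = y"
  unfolding vec_eq_iff by (metis sum.exhaust)

lemma forms_over_join:
  assumes "forms_over S d f" "forms_over S d g"
  shows "forms_over S d (\<lambda>x. join (f x) (g x))"
  unfolding forms_over_def
proof
  fix i show "is_form S d (\<lambda>x. join (f x) (g x) $ i)"
    using assms unfolding forms_over_def by (cases i) simp_all
qed

text \<open>Invertibility of \<open>M\<close> makes the six equations equivalent to their
  recombination. For the last claim, the last two rows of \<open>M\<close> with weights
  \<open>s\<close> and \<open>t\<close> give a nonzero linear form that kills the left sides and
  takes the value \<open>s * F w + t * G w\<close> on the right sides.\<close>

lemma recombination: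
  fixes l0 l1 s0 s1 :: "'a::field_char_0^4 \<Rightarrow> 'a^3"
  assumes K: "coeff_ring K" and s: "forms_over K 2 s0" "forms_over K 2 s1"
    and rec: "recombines_to K (\<lambda>x. join (l0 x) (l1 x)) (\<lambda>w. join (s0 w) (s1 w)) r F G"
  shows "forms_over K 2 r" "is_form K 2 F" "is_form K 2 G"
    and "\<And>w. F w = 0 \<Longrightarrow> G w = 0 \<Longrightarrow> l0 (r w) = s0 w \<and> l1 (r w) = s1 w"
    and "\<And>w x. l0 x = s0 w \<Longrightarrow> l1 x = s1 w \<Longrightarrow> F w = 0 \<and> G w = 0 \<and> r w = x"
    and "\<And>s t. (s, t) \<noteq> (0, 0) \<Longrightarrow> \<exists>\<rho> \<rho>'. is_form UNIV 1 \<rho> \<and> is_form UNIV 1 \<rho>' \<and>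
      ((\<exists>y. \<rho> y \<noteq> 0) \<or> (\<exists>y. \<rho>' y \<noteq> 0)) \<and> (\<forall>x. \<rho> (l0 x) + \<rho>' (l1 x) = 0) \<and>
      (\<forall>w. s * F w + t * G w = \<rho> (s0 w) + \<rho>' (s1 w))"
proof -
  obtain M :: "'a^(3+3)^(4+2)" where M: "\<And>i j. M $ i $ j \<in> K" "invertible M"
      "\<And>x. M *v join (l0 x) (l1 x) = join x 0" "\<And>w. M *v join (s0 w) (s1 w) = join (r w) (vector [F w, G w])"
    using rec unfolding recombines_to_def by blast
  obtain M' where M': "M ** M' = mat 1" "M' ** M = mat 1" using M(2) unfolding invertible_def by blast
  have inj: "u = u'" if "M *v u = M *v u'" for u u'
  proof -
    have "M' *v (M *v u) = M' *v (M *v u')" using that by simp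
    thus ?thesis by (simp add: matrix_vector_mul_assoc M'(2))
  qed
  have MF: "forms_over K 1 (\<lambda>u. M *v u)" by (rule forms_over_matrix[OF K M(1)])
  have "forms_over K (1 * 2) (\<lambda>w. M *v join (s0 w) (s1 w))"
    by (rule forms_over_comp[OF K MF forms_over_join[OF s]])
  hence Ms: "is_form K 2 (\<lambda>w. join (r w) (vector [F w, G w] :: 'a^2) $ i)" for i
    unfolding M(4) forms_over_def by simp
  show "forms_over K 2 r" unfolding forms_over_def using Ms[of "Inl i" for i] by simp
  show "is_form K 2 F" "is_form K 2 G" using Ms[of "Inr 1"] Ms[of "Inr 2"] by simp_all
  show "l0 (r w) = s0 w \<and> l1 (r w) = s1 w" if "F w = 0" "G w = 0" for w
  proof -
    have "vector [F w, G w] = (0 :: 'a^2)" using that by (simp add: vec_eq_iff forall_2)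
    hence "M *v join (l0 (r w)) (l1 (r w)) = M *v join (s0 w) (s1 w)" unfolding M(3,4) by simp
    from inj[OF this] show ?thesis by (simp add: join_eq_iff)
  qed
  show "F w = 0 \<and> G w = 0 \<and> r w = x" if "l0 x = s0 w" "l1 x = s1 w" for w x
  proof -
    have "join (r w) (vector [F w, G w]) = join x (0 :: 'a^2)" unfolding M(3,4)[symmetric] that ..
    hence "vector [F w, G w] = (0 :: 'a^2)" "r w = x" unfolding join_eq_iff by blast+
    thus ?thesis by (simp add: vec_eq_iff forall_2)
  qed
  fix s t :: 'a assume st: "(s, t) \<noteq> (0, 0)"
  define P where "P = (\<lambda>u. s * (M *v u) $ Inr 1 + t * (M *v u) $ Inr 2)"
  have MF': "is_form UNIV 1 (\<lambda>u. (M *v u) $ i)" for i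
    using forms_over_UNIV[OF MF] by (simp add: forms_over_def del: One_nat_def)
  have P: "is_form UNIV 1 P" unfolding P_def by (intro is_form_add is_form_smult MF') auto
  have zero: "forms_over UNIV 1 (\<lambda>_. 0 :: 'a^3)" by (rule forms_over1I) (simp_all add: vec_eq_iff)
  have idF: "forms_over UNIV 1 (\<lambda>y :: 'a^3. y)" by (rule forms_over1I) simp_all
  define \<rho> \<rho>' where "\<rho> = (\<lambda>y. P (join y 0))" and "\<rho>' = (\<lambda>y. P (join 0 y))"
  have split: "P (join y y') = \<rho> y + \<rho>' y'" for y y'
  proof -
    have "join y y' = join y 0 + join 0 y'" by (rule vec_sum_eqI) simp_all
    thus ?thesis unfolding \<rho>_def \<rho>'_def by (simp add: linear_form_add[OF P])
  qed
  have "is_form UNIV 1 \<rho>" "is_form UNIV 1 \<rho>'"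
    unfolding \<rho>_def \<rho>'_def
    by (intro is_form_comp_linear[OF coeff_ring_UNIV P] forms_over_join zero idF)+
  moreover have "(\<exists>y. \<rho> y \<noteq> 0) \<or> (\<exists>y. \<rho>' y \<noteq> 0)"
  proof (rule ccontr)
    assume "\<not> ?thesis"
    hence z: "\<rho> y = 0" "\<rho>' y = 0" for y by auto
    have P0: "P u = 0" for u
    proof -
      have "u = join (\<chi> i. u $ Inl i) (\<chi> i. u $ Inr i)" by (rule vec_sum_eqI) simp_all
      hence "P u = P (join (\<chi> i. u $ Inl i) (\<chi> i. u $ Inr i))" by simp
      thus ?thesis unfolding split z by simp
    qed
    have "M *v (M' *v v) = v" for v :: "'a^(4+2)" by (simp add: matrix_vector_mul_assoc M'(1))
    hence "s * v $ Inr 1 + t * v $ Inr 2 = 0" for v :: "'a^(4+2)" using P0[of "M' *v v"] unfolding P_def by simp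
    from this[of "join 0 (vector [1, 0])"] this[of "join 0 (vector [0, 1])"] show False using st by simp
  qed
  moreover have "\<rho> (l0 x) + \<rho>' (l1 x) = 0" for x unfolding split[symmetric] P_def M(3) by simp
  moreover have "s * F w + t * G w = \<rho> (s0 w) + \<rho>' (s1 w)" for w unfolding split[symmetric] P_def M(4) by simp
  ultimately show "\<exists>\<rho> \<rho>'. is_form UNIV 1 \<rho> \<and> is_form UNIV 1 \<rho>' \<and>
      ((\<exists>y. \<rho> y \<noteq> 0) \<or> (\<exists>y. \<rho>' y \<noteq> 0)) \<and> (\<forall>x. \<rho> (l0 x) + \<rho>' (l1 x) = 0) \<and>
      (\<forall>w. s * F w + t * G w = \<rho> (s0 w) + \<rho>' (s1 w))" by blast
qed

lemma parametrisation_comp_linear: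
  fixes g g' :: "'a::field^3 \<Rightarrow> 'a^3" and Q' :: "'a^2 \<Rightarrow> 'a^3"
  assumes g: "forms_over UNIV 1 g" "forms_over UNIV 1 g'" "\<And>y. g (g' y) = y" "\<And>y. g' (g y) = y"
    and Q': "parametrisation (\<lambda>y. q2 (g y)) Q'"
  shows "parametrisation q2 (\<lambda>z. g (Q' z))"
  unfolding parametrisation_def
proof (intro conjI allI impI)
  have "forms_over UNIV (1 * 2) (\<lambda>z. g (Q' z))"
    using Q' by (intro forms_over_comp[OF _ g(1)]) (auto simp: parametrisation_def)
  thus "forms_over UNIV 2 (\<lambda>z. g (Q' z))" by simp
  fix z :: "'a^2" assume z: "z \<noteq> 0"
  show "g (Q' z) \<noteq> 0"
  proof
    assume "g (Q' z) = 0"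
    hence "Q' z = 0" using g(4)[of "Q' z"] forms1_zero[OF g(2)] by simp
    thus False using Q' z by (simp add: parametrisation_def)
  qed
  show "q2 (g (Q' z)) = 0" using Q' z by (simp add: parametrisation_def)
next
  fix y assume y: "y \<noteq> 0" "q2 y = 0"
  have "g' y \<noteq> 0" using g(3)[of y] forms1_zero[OF g(1)] y(1) by auto
  moreover have "q2 (g (g' y)) = 0" using y(2) by (simp add: g(3))
  ultimately obtain z where "Q' z = g' y" using Q' unfolding parametrisation_def by blast
  thus "\<exists>z. g (Q' z) = y" using g(3) by metis
qed

text \<open>Both constructions at once: \<open>(m\<^sub>1, m\<^sub>2)\<close> is obtained from \<open>(l\<^sub>0, l\<^sub>1)\<close> by the invertible matrix
  \<open>(a, b; c, d)\<close> and the linear change of coordinates \<open>g\<close> of the second conic.\<close>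

locale two_covering =
  c1: pencil_cone q1 m1 W1 W2 v1 + c2: pencil_cone q2 m2 W2 W1 v2
  for q1 q2 :: "'a::{alg_closed_field, field_char_0}^3 \<Rightarrow> 'a" and m1 m2 :: "'a^4 \<Rightarrow> 'a^3"
    and W1 W2 :: "'a^4 \<Rightarrow> 'a" and v1 v2 :: "'a^4" +
  fixes K L :: "'a set" and Q Q' :: "'a^2 \<Rightarrow> 'a^3" and g g' :: "'a^3 \<Rightarrow> 'a^3"
    and zz zz' :: "'a^4 \<Rightarrow> 'a^2" and J :: "'a^2 \<Rightarrow> 'a^2 \<Rightarrow> 'a^4"
    and l0 l1 s0 s1 :: "'a^4 \<Rightarrow> 'a^3" and a b c d :: 'a
    and r :: "'a^4 \<Rightarrow> 'a^4" and F G :: "'a^4 \<Rightarrow> 'a" and \<tau> :: "'a^4 \<Rightarrow> 'a^4" and \<delta> :: 'a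
  assumes K: "coeff_field K" and L: "coeff_field L" and KL: "K \<subseteq> L"
    and pencil: "\<And>x s t. x \<noteq> 0 \<Longrightarrow> W1 x = 0 \<Longrightarrow> W2 x = 0 \<Longrightarrow> (\<And>y. s * polar W1 x y + t * polar W2 x y = 0) \<Longrightarrow> s = 0 \<and> t = 0"
    and QL: "parametrisation q1 Q" "forms_over L 2 Q"
    and QL': "parametrisation (\<lambda>y. q2 (g y)) Q'" "forms_over L 2 Q'"
    and g: "forms_over UNIV 1 g" "forms_over UNIV 1 g'" "\<And>y. g (g' y) = y" "\<And>y. g' (g y) = y"
    and zz: "forms_over UNIV 1 zz" "forms_over UNIV 1 zz'" "\<And>z z'. zz (J z z') = z" "\<And>z z'. zz' (J z z') = z'"
      "\<And>w. J (zz w) (zz' w) = w" "forms_over L 1 (\<lambda>u. J (pr u) (pr' u))"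
    and ls: "forms_over K 1 l0" "forms_over K 1 l1" "forms_over K 2 s0" "forms_over K 2 s1"
    and abcd: "a \<in> L" "b \<in> L" "c \<in> L" "d \<in> L" "a * d - b * c \<noteq> 0"
    and m1_l: "\<And>x. m1 x = a *s l0 x + b *s l1 x" and m2_l: "\<And>x. m2 x = g (c *s l0 x + d *s l1 x)"
    and Q_s: "\<And>w. Q (zz w) = a *s s0 w + b *s s1 w" and Q'_s: "\<And>w. Q' (zz' w) = c *s s0 w + d *s s1 w"
    and rec: "recombines_to K (\<lambda>x. join (l0 x) (l1 x)) (\<lambda>w. join (s0 w) (s1 w)) r F G"
    and tau: "forms_over K 1 \<tau>" "\<And>w. zz (\<tau> w) = \<delta> *s zz w" "\<And>w. zz' (\<tau> w) = - \<delta> *s zz' w" "\<delta>^2 \<in> K" "\<delta> \<noteq> 0"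
    and e1: "is_form K 2 (\<lambda>w. zz w $ 1 * zz' w $ 1)"
    and descent: "\<And>(s :: 'a^4 \<Rightarrow> 'a^(3+3)) f H e. forms_over K 2 s \<Longrightarrow> is_form K (2 * e) f \<Longrightarrow> is_form L e H \<Longrightarrow>
      (\<And>w. f w = H (s w)) \<Longrightarrow> \<exists>h. is_form K e h \<and> (\<forall>w. f w = h (s w))"
begin

lemma Kr: "coeff_ring K" and Lr: "coeff_ring L"
  by (simp_all add: coeff_field_ring K L)

lemmas recs = recombination[OF Kr ls(3,4) rec]

lemma l_eq_s:
  assumes "m1 x = Q (zz w)" "m2 x = g (Q' (zz' w))"
  shows "l0 x = s0 w" "l1 x = s1 w"
proof -
  have "g' (g (c *s l0 x + d *s l1 x)) = g' (g (Q' (zz' w)))" using assms(2) unfolding m2_l by simp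
  hence e: "c * l0 x $ i + d * l1 x $ i = c * s0 w $ i + d * s1 w $ i"
    "a * l0 x $ i + b * l1 x $ i = a * s0 w $ i + b * s1 w $ i" for i
    using assms(1) unfolding g(4) m1_l Q_s Q'_s by (simp_all add: vec_eq_iff)
  have "(a * d - b * c) * (l0 x $ i - s0 w $ i)
      = d * (a * l0 x $ i + b * l1 x $ i - (a * s0 w $ i + b * s1 w $ i)) - b * (c * l0 x $ i + d * l1 x $ i - (c * s0 w $ i + d * s1 w $ i))"
    "(a * d - b * c) * (l1 x $ i - s1 w $ i)
      = a * (c * l0 x $ i + d * l1 x $ i - (c * s0 w $ i + d * s1 w $ i)) - c * (a * l0 x $ i + b * l1 x $ i - (a * s0 w $ i + b * s1 w $ i))"
    for i by (simp_all add: algebra_simps)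
  hence "(a * d - b * c) * (l0 x $ i - s0 w $ i) = 0" "(a * d - b * c) * (l1 x $ i - s1 w $ i) = 0" for i
    unfolding e by simp_all
  thus "l0 x = s0 w" "l1 x = s1 w" using abcd(5) by (simp_all add: vec_eq_iff)
qed

lemma parametrisation_R: "parametrisation q2 (\<lambda>z. g (Q' z))"
  by (rule parametrisation_comp_linear[OF g QL'(1)])

sublocale covering_data q1 q2 m1 m2 W1 W2 v1 v2 Q "\<lambda>z. g (Q' z)" zz zz' J r F G
proof unfold_locales
  show "parametrisation q1 Q" "parametrisation q2 (\<lambda>z. g (Q' z))" by (rule QL(1) parametrisation_R)+
  show "forms_over UNIV 1 zz" "forms_over UNIV 1 zz'" by (rule zz)+
  show "zz (J z z') = z" "zz' (J z z') = z'" "J (zz w) (zz' w) = w" for z z' w by (rule zz)+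
  show "forms_over UNIV 2 r" "is_form UNIV 2 F" "is_form UNIV 2 G"
    by (rule forms_over_UNIV[OF recs(1)] is_form_UNIV[OF recs(2)] is_form_UNIV[OF recs(3)])+
  show "m1 (r w) = Q (zz w) \<and> m2 (r w) = g (Q' (zz' w))" if "F w = 0" "G w = 0" for w
    using recs(4)[OF that] by (simp add: m1_l m2_l Q_s Q'_s)
  show "F w = 0 \<and> G w = 0 \<and> r w = x" if "m1 x = Q (zz w)" "m2 x = g (Q' (zz' w))" for w x
    using recs(5) l_eq_s[OF that] .
  show "s = 0 \<and> t = 0" if "x \<noteq> 0" "W1 x = 0" "W2 x = 0" "\<And>y. s * polar W1 x y + t * polar W2 x y = 0" for x s t
    by (rule pencil[OF that])
  fix s t :: 'a assume "(s, t) \<noteq> (0, 0)"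
  then obtain \<rho> \<rho>' where rho: "is_form UNIV 1 \<rho>" "is_form UNIV 1 \<rho>'" "(\<exists>y. \<rho> y \<noteq> 0) \<or> (\<exists>y. \<rho>' y \<noteq> 0)"
      "\<forall>x. \<rho> (l0 x) + \<rho>' (l1 x) = 0" "\<forall>w. s * F w + t * G w = \<rho> (s0 w) + \<rho>' (s1 w)"
    by (rule recs(6)[THEN exE], elim exE conjE) (rule that)
  define \<Delta> where "\<Delta> = a * d - b * c"
  have D0: "\<Delta> \<noteq> 0" using abcd(5) by (simp add: \<Delta>_def)
  \<comment> \<open>A relation between \<open>l0\<close> and \<open>l1\<close> is rewritten for
    \<open>m1\<close> and \<open>m2\<close>, so the linear forms change by the transposed inverse of
    the matrix \<open>(a, b; c, d)\<close>.\<close>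
  define \<rho>1 where "\<rho>1 = (\<lambda>y. d / \<Delta> * \<rho> y - c / \<Delta> * \<rho>' y)"
  define \<rho>2' where "\<rho>2' = (\<lambda>y. a / \<Delta> * \<rho>' y - b / \<Delta> * \<rho> y)"
  define \<rho>2 where "\<rho>2 = (\<lambda>y. \<rho>2' (g' y))"
  have F: "is_form UNIV 1 \<rho>1" "is_form UNIV 1 \<rho>2'"
    unfolding \<rho>1_def \<rho>2'_def by (intro is_form_diff is_form_smult rho(1,2); simp)+
  have F2: "is_form UNIV 1 \<rho>2" unfolding \<rho>2_def by (rule is_form_comp_linear[OF coeff_ring_UNIV F(2) g(2)])
  have lin: "\<rho> (u *s x + v *s y) = u * \<rho> x + v * \<rho> y" "\<rho>' (u *s x + v *s y) = u * \<rho>' x + v * \<rho>' y" for u v x y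
    by (simp_all add: linear_form_add[OF rho(1)] linear_form_add[OF rho(2)] linear_form_scale[OF rho(1)] linear_form_scale[OF rho(2)])
  have key: "\<rho>1 (a *s x + b *s y) + \<rho>2 (g (c *s x + d *s y)) = \<rho> x + \<rho>' y" for x y
  proof -
    have "\<rho>1 (a *s x + b *s y) + \<rho>2 (g (c *s x + d *s y)) = (\<Delta> / \<Delta>) * (\<rho> x + \<rho>' y)"
      unfolding \<rho>1_def \<rho>2_def \<rho>2'_def g(4) lin using D0
      by (simp add: field_simps) (simp add: \<Delta>_def algebra_simps)
    thus ?thesis using D0 by simp
  qed
  have "(\<exists>y. \<rho>1 y \<noteq> 0) \<or> (\<exists>y. \<rho>2 y \<noteq> 0)"
  proof (rule ccontr)
    assume "\<not> ?thesis"
    hence "\<rho> x + \<rho>' y = 0" for x y using key[of x y] by simp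
    hence "\<rho> x = 0" "\<rho>' y = 0" for x y
      using linear_form_zero[OF rho(1)] linear_form_zero[OF rho(2)] by (metis add.right_neutral, metis add.left_neutral)
    thus False using rho(3) by blast
  qed
  moreover have "\<rho>1 (m1 x) + \<rho>2 (m2 x) = 0" for x unfolding m1_l m2_l key using rho(4) by simp
  moreover have "s * F w + t * G w = \<rho>1 (Q (zz w)) + \<rho>2 (g (Q' (zz' w)))" for w unfolding Q_s Q'_s key using rho(5) by simp
  ultimately show "\<exists>\<rho>1 \<rho>2. is_form UNIV 1 \<rho>1 \<and> is_form UNIV 1 \<rho>2 \<and>
      ((\<exists>y. \<rho>1 y \<noteq> 0) \<or> (\<exists>y. \<rho>2 y \<noteq> 0)) \<and> (\<forall>x. \<rho>1 (m1 x) + \<rho>2 (m2 x) = 0) \<and>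
      (\<forall>w. s * F w + t * G w = \<rho>1 (Q (zz w)) + \<rho>2 (g (Q' (zz' w))))"
    using F(1) F2 by blast
qed

lemma tau_squared: "\<tau> (\<tau> w) = \<delta>^2 *s w"
proof -
  have "zz (\<tau> (\<tau> w)) = zz (\<delta>^2 *s w)" "zz' (\<tau> (\<tau> w)) = zz' (\<delta>^2 *s w)"
    by (simp_all add: tau(2,3) forms1_scale[OF zz(1)] forms1_scale[OF zz(2)] vec_eq_iff power2_eq_square)
  thus ?thesis using zz(5) by metis
qed

text \<open>The two parameters are scaled by \<open>\<delta>\<close> and \<open>- \<delta>\<close>.
  Quadratic forms do not see the sign, so both conic points are scaled by the same square.\<close>

lemma tau_on_D:
  assumes w: "w \<in> Dset"
  shows "\<tau> w \<in> Dset" "r (\<tau> w) = \<delta>^2 *s r w"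
proof -
  have D: "w \<noteq> 0" "F w = 0" "G w = 0" using w by (auto simp: Dset_def)
  have Qh: "Q (u *s z) = u^2 *s Q z" "Q' (u *s z) = u^2 *s Q' z" for u z
    using is_form_homogeneous[of L 2 "\<lambda>z. Q z $ i" u z for i] is_form_homogeneous[of L 2 "\<lambda>z. Q' z $ i" u z for i] QL(2) QL'(2)
    unfolding forms_over_def by (simp_all add: vec_eq_iff)
  have m: "m1 (r w) = Q (zz w)" "m2 (r w) = g (Q' (zz' w))" using on_D[OF D(2,3)] by auto
  have "m1 (\<delta>^2 *s r w) = Q (zz (\<tau> w))" unfolding tau(2) Qh forms1_scale[OF c1.m_form] m ..
  moreover have "m2 (\<delta>^2 *s r w) = g (Q' (zz' (\<tau> w)))"
    unfolding tau(3) Qh forms1_scale[OF c2.m_form] forms1_scale[OF g(1)] power2_minus m ..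
  ultimately have "F (\<tau> w) = 0 \<and> G (\<tau> w) = 0 \<and> r (\<tau> w) = \<delta>^2 *s r w" by (rule D_intro)
  hence e: "F (\<tau> w) = 0" "G (\<tau> w) = 0" "r (\<tau> w) = \<delta>^2 *s r w" by auto
  have "\<tau> w \<noteq> 0"
  proof
    assume "\<tau> w = 0"
    hence "\<delta>^2 *s w = 0" using tau_squared[of w] forms1_zero[OF tau(1)] by simp
    thus False using D(1) tau(5) by (simp add: vec_eq_iff)
  qed
  thus "\<tau> w \<in> Dset" "r (\<tau> w) = \<delta>^2 *s r w" using e by (auto simp: Dset_def)
qed

text \<open>The entries of \<open>sq4\<close> are linear over \<open>L\<close> in the right sides
  \<open>s0\<close>, \<open>s1\<close>, so an invariant form is a form over \<open>L\<close> in
  them, and this form can be descended to \<open>K\<close>. On \<open>D\<close> the right sides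
  agree with the left sides, which are linear in \<open>r w\<close>.\<close>

lemma descent_form:
  assumes f: "is_form K (2 * e) f" "\<And>w. f (\<tau> w) = (\<delta>^2) ^ e * f w"
  shows "\<exists>h. is_form K e h \<and> (\<forall>w\<in>Dset. f w = h (r w))"
proof -
  obtain N1 where "forms_over UNIV 1 N1" "\<And>z. N1 (Q z) = sq2 z"
    using c1.param_coordinates[OF QL(1)] by (elim exE conjE) (rule that, auto)
  then obtain N1' where N1: "forms_over L 1 N1'" "\<And>z. N1' (Q z) = sq2 z" using param_coordinates_over[OF L QL(2)] by blast
  obtain N2 where N2: "forms_over UNIV 1 N2" "\<And>z. N2 (g (Q' z)) = sq2 z"
    using c2.param_coordinates[OF parametrisation_R] by (elim exE conjE) (rule that, auto)
  have "forms_over UNIV (1 * 1) (\<lambda>y. N2 (g y))" by (rule forms_over_comp[OF coeff_ring_UNIV N2(1) g(1)])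
  hence "forms_over UNIV 1 (\<lambda>y. N2 (g y))" by simp
  then obtain N2' where N2': "forms_over L 1 N2'" "\<And>z. N2' (Q' z) = sq2 z"
    using param_coordinates_over[OF L QL'(2)] N2(2) by blast
  define s where "s w = join (s0 w) (s1 w)" for w
  define T where "T w = (vector [zz w $ 1, zz w $ 2, zz' w $ 1, zz' w $ 2] :: 'a^4)" for w
  have prT: "pr (T w) = zz w" "pr' (T w) = zz' w" for w
    by (simp_all add: T_def vec_eq_iff forall_2 vector_4)
  define M where "M u = join (N1' (a *s (\<chi> i. u $ Inl i) + b *s (\<chi> i. u $ Inr i))) (N2' (c *s (\<chi> i. u $ Inl i) + d *s (\<chi> i. u $ Inr i)))"
    for u :: "'a^(3+3)"
  have comb: "forms_over L 1 (\<lambda>u :: 'a^(3+3). u1 *s (\<chi> i. u $ Inl i) + u2 *s (\<chi> i. u $ Inr i))" if "u1 \<in> L" "u2 \<in> L" for u1 u2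
    unfolding forms_over_def by (simp del: One_nat_def) (intro allI is_form_add is_form_smult is_form_component Lr that)
  have MF: "forms_over L 1 M"
    unfolding M_def[abs_def]
    using forms_over_comp[OF Lr N1(1) comb[OF abcd(1,2)]] forms_over_comp[OF Lr N2'(1) comb[OF abcd(3,4)]]
    by (intro forms_over_join) simp_all
  have Ms: "sq4 (T w) = M (s w)" for w
    unfolding M_def s_def sq4_def prT using N1(2)[of "zz w"] N2'(2)[of "zz' w"]
    by (simp add: Q_s Q'_s)
  have TJ: "T (J (pr u) (pr' u)) = u" for u by (simp add: T_def zz(3,4) vec_eq_iff forall_4 vector_4)
  have JT: "J (pr (T w)) (pr' (T w)) = w" for w by (simp add: prT zz(5))
  have Tt: "T (\<tau> w) = \<delta> *s flip4 (T w)" for w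
    by (simp add: T_def tau(2,3) vec_eq_iff forall_4 vector_4 flip4_nth)
  have "\<exists>h. is_form L e h \<and> (\<forall>w. f w = h (s w))"
  proof (rule invariant_form_factor[where T' = "\<lambda>u. J (pr u) (pr' u)" and T = T and M = M and dd = "\<delta>^2" and s = s and \<tau> = \<tau> and \<delta> = \<delta> and f = f and e = e, OF Lr zz(6) TJ JT MF Ms Tt refl _ _ f(2)])
    show "\<delta>^2 \<noteq> 0" using tau(5) by simp
    show "is_form L (2 * e) f" by (rule is_form_mono[OF KL f(1)])
  qed
  then obtain H where H: "is_form L e H" "\<And>w. f w = H (s w)" by blast
  have sF: "forms_over K 2 s" unfolding s_def[abs_def] by (rule forms_over_join[OF ls(3,4)])
  obtain h where h: "is_form K e h" "\<forall>w. f w = h (s w)" using descent[OF sF f(1) H] by blast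
  have "f w = h (join (l0 (r w)) (l1 (r w)))" if "w \<in> Dset" for w
    using h(2)[rule_format, of w] recs(4)[of w] that by (simp add: s_def Dset_def)
  moreover have "is_form K e (\<lambda>x. h (join (l0 x) (l1 x)))"
    by (rule is_form_comp_linear[OF Kr h(1) forms_over_join[OF ls(1,2)]])
  ultimately show ?thesis by blast
qed

lemma D_eq: "zeros {F, G} = hpoint ` Dset" and C_eq: "zeros {W1, W2} = hpoint ` Cset"
  unfolding zeros_def Dset_def Cset_def by auto

lemma nonsingular_D: "nonsingular_quadric_intersection K F G"
  unfolding nonsingular_polar[OF recs(2,3)] using D_nonsingular unfolding Dset_def by blast

lemma morphism_r: "is_morphism K (hpoint ` Dset) (hpoint ` Cset) r"
proof -
  have irr: "irreducible_set (hpoint ` Dset)" by (rule smooth_curve_irreducible[OF curve_D(1)])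
  obtain w where w: "w \<in> Dset" using irreducible_set.point_exists[OF irr] curve_D(2) by auto
  have mp: "map_point (hpoint ` Dset) r (hpoint x) = hpoint (r x)" "represents_at (hpoint ` Dset) r (hpoint x) r"
    if "x \<in> Dset" for x
  proof -
    have x: "x \<in> \<Union>(hpoint ` Dset)" "r x \<noteq> 0" using that curve_D(2) r_in_C[OF that] by (auto simp: Cset_def)
    show "map_point (hpoint ` Dset) r (hpoint x) = hpoint (r x)" "represents_at (hpoint ` Dset) r (hpoint x) r"
      by (rule map_point_hpoint[OF irr r_form x])+
  qed
  have "rational_map K (hpoint ` Dset) (hpoint ` Cset) r"
    unfolding rational_map_def
  proof (intro conjI ballI impI)
    show "\<exists>d. forms_over K d r" using recs(1) by blast
    show "\<exists>P\<in>hpoint ` Dset. \<exists>x\<in>P. r x \<noteq> 0" using w r_in_C[OF w] hpoint_self[of w] unfolding Cset_def by blast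
    fix P x assume "P \<in> hpoint ` Dset" "x \<in> P"
    hence "x \<in> Dset" using curve_D(2) by blast
    thus "hpoint (r x) \<in> hpoint ` Cset" using r_in_C by blast
  qed
  thus ?thesis unfolding is_morphism_def using mp r_in_C by auto
qed

lemma degree_r: "has_degree K (hpoint ` Dset) (hpoint ` Cset) r 2"
proof (rule degree_two[OF K _ _ recs(1) _ tau(1) tau_squared tau(4)])
  show irr: "irreducible_set (hpoint ` Dset)" "irreducible_set (hpoint ` Cset)"
    by (rule smooth_curve_irreducible[OF curve_D(1)] smooth_curve_irreducible[OF curve_C(1)])+
  show "\<Union>(hpoint ` Cset) = r ` \<Union>(hpoint ` Dset)" unfolding curve_C(2) curve_D(2) by (rule r_image)
  show "\<delta>^2 \<noteq> 0" using tau(5) by simp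
  show "\<tau> w \<in> \<Union>(hpoint ` Dset)" "r (\<tau> w) = \<delta>^2 *s r w" if "w \<in> \<Union>(hpoint ` Dset)" for w
    using tau_on_D that unfolding curve_D(2) by auto
  show "is_form K 2 (\<lambda>w. zz w $ 1 * zz' w $ 1)" by (rule e1)
  show "zz (\<tau> w) $ 1 * zz' (\<tau> w) $ 1 = - (\<delta>^2) * (zz w $ 1 * zz' w $ 1)" for w
    by (simp add: tau(2,3) power2_eq_square)
  show "\<not> zero_on (hpoint ` Dset) (\<lambda>w. zz w $ 1 * zz' w $ 1)"
  proof
    assume z: "zero_on (hpoint ` Dset) (\<lambda>w. zz w $ 1 * zz' w $ 1)"
    have F1: "is_form UNIV 1 (\<lambda>w. zz w $ 1)" "is_form UNIV 1 (\<lambda>w. zz' w $ 1)"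
      using zz(1,2) unfolding forms_over_def by simp_all
    have one: "zz (J (vector [1, 0]) (vector [1, 0])) $ 1 = 1" "zz' (J (vector [1, 0]) (vector [1, 0])) $ 1 = 1"
      by (simp_all add: zz(3,4))
    have "\<not> zero_on (hpoint ` Dset) (\<lambda>w. zz w $ 1)" "\<not> zero_on (hpoint ` Dset) (\<lambda>w. zz' w $ 1)"
      using D_spans[OF F1(1), of "J (vector [1, 0]) (vector [1, 0])"] D_spans[OF F1(2), of "J (vector [1, 0]) (vector [1, 0])"] one
      unfolding zero_on_def curve_D(2) by auto
    thus False using irreducible_set.prime[OF irr(1) F1 z] by blast
  qed
  show "\<exists>h. is_form K e h \<and> (\<forall>w\<in>\<Union>(hpoint ` Dset). f w = h (r w))"
    if "is_form K (2 * e) f" "\<And>w. f (\<tau> w) = (\<delta>^2) ^ e * f w" for e f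
    unfolding curve_D(2) by (rule descent_form[OF that])
qed

end

section \<open>The cones in the pencil\<close>

lemma partial_zero_iff_polar:
  fixes W :: "'a::field_char_0^'n \<Rightarrow> 'a"
  assumes "is_form UNIV 2 W"
  shows "(\<forall>i. partial i W x = 0) \<longleftrightarrow> (\<forall>y. polar W x y = 0)"
  using linear_form_eq_0[OF polar_form[OF assms, of x]] by (auto simp: partial_quadratic[OF assms])

text \<open>A projective preimage hits a vector only up to a scalar; a square root of that scalar
  corrects the preimage, as \<open>Q\<close> is quadratic.\<close>

lemma parametrises_parametrisation:
  fixes q :: "'a::alg_closed_field^3 \<Rightarrow> 'a"
  assumes q: "is_form S' 2 q" and Q: "parametrises S Q q"
  shows "parametrisation q Q"
  unfolding parametrisation_def
proof (intro conjI allI impI)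
  have QF: "forms_over S 2 Q" and on: "z \<noteq> 0 \<Longrightarrow> hpoint (Q z) \<in> zeros {q}"
    and ex1: "\<forall>P\<in>zeros {q}. \<exists>!Z. \<exists>z. z \<noteq> 0 \<and> Z = hpoint z \<and> hpoint (Q z) = P" for z
    using Q unfolding parametrises_def by simp_all
  have onto: "\<exists>z. hpoint (Q z) = P" if "P \<in> zeros {q}" for P
    using ex1[rule_format, OF that] by (elim ex1E exE conjE) (rule exI)
  show "forms_over UNIV 2 Q" by (rule forms_over_UNIV[OF QF])
  {
    fix z :: "'a^2" assume "z \<noteq> 0"
    from on[OF this] obtain x where x: "x \<noteq> 0" "q x = 0" "hpoint (Q z) = hpoint x" unfolding zeros_def by blast
    then obtain c where "c \<noteq> 0" "Q z = c *s x" unfolding hpoint_eq_iff by blast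
    thus "Q z \<noteq> 0" "q (Q z) = 0" using x by (simp_all add: is_form_homogeneous[OF q])
  }
  fix y assume "y \<noteq> 0" "q y = 0"
  hence "hpoint y \<in> zeros {q}" unfolding zeros_def by blast
  from onto[OF this] obtain z where "hpoint y = hpoint (Q z)" by (elim exE) (rule that, rule sym)
  then obtain c where c: "y = c *s Q z" unfolding hpoint_eq_iff by blast
  obtain t where "- c + t * 0 + t^2 * 1 = 0" using quadratic_root[of 1 "- c" 0] by auto
  hence "t^2 = c" by simp
  moreover have "Q (t *s z) = t^2 *s Q z"
    using QF is_form_homogeneous[of S 2 "\<lambda>z. Q z $ i" t z for i] unfolding forms_over_def by (simp add: vec_eq_iff)
  ultimately show "\<exists>z. Q z = y" using c by (intro exI[of _ "t *s z"]) simp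
qed

text \<open>The inclusion of kernels makes \<open>m'\<close> factor through \<open>m\<close> by a
  surjective linear map of 3-space, which is then bijective; \<open>g\<close> is its
  inverse.\<close>

lemma linear_factor:
  fixes m m' :: "'a::field^4 \<Rightarrow> 'a^3"
  assumes m: "forms_over UNIV 1 m" "surj m" and m': "forms_over UNIV 1 m'" "surj m'"
    and ker: "\<And>x. m x = 0 \<Longrightarrow> m' x = 0"
  shows "\<exists>g g'. forms_over UNIV 1 g \<and> forms_over UNIV 1 g' \<and> (\<forall>y. g (g' y) = y) \<and> (\<forall>y. g' (g y) = y) \<and> (\<forall>x. m x = g (m' x))"
proof -
  define h where "h y = m' (inv_into UNIV m y)" for y
  have h: "h (m x) = m' x" for x
  proof -
    have "m (inv_into UNIV m (m x)) = m x" using m(2) by (simp add: surj_f_inv_f)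
    hence "m (inv_into UNIV m (m x) - x) = 0" by (simp add: forms1_diff[OF m(1)])
    from ker[OF this] show ?thesis by (simp add: h_def forms1_diff[OF m'(1)])
  qed
  have ex: "\<exists>x. m x = y" for y using m(2) by (metis surjD)
  have hF: "forms_over UNIV 1 h"
  proof (rule forms_over1I)
    fix y y' obtain x x' where x: "m x = y" "m x' = y'" using ex by meson
    have "h (m (x + x')) = h (m x) + h (m x')" unfolding h by (rule forms1_add[OF m'(1)])
    thus "h (y + y') = h y + h y'" unfolding forms1_add[OF m(1)] x .
  next
    fix c y obtain x where x: "m x = y" using ex by meson
    have "h (m (c *s x)) = c *s h (m x)" unfolding h by (rule forms1_scale[OF m'(1)])
    thus "h (c *s y) = c *s h y" unfolding forms1_scale[OF m(1)] x .
  qed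
  obtain M where M: "h = (\<lambda>y. M *v y)" using matrix_of_forms1[OF coeff_ring_UNIV hF] by blast
  have "\<exists>z. y = h z" for y
  proof -
    obtain x where "y = m' x" using m'(2) by (rule surjE)
    hence "y = h (m x)" by (simp only: h)
    thus ?thesis by (rule exI)
  qed
  hence "surj (\<lambda>y. M *v y)" unfolding M[symmetric] surj_def by blast
  then obtain B where B: "M ** B = mat 1" using matrix_right_invertible_surjective by blast
  hence B': "B ** M = mat 1" using matrix_left_right_inverse by blast
  have BM: "B *v h y = y" "h (B *v y) = y" for y unfolding M by (simp_all add: matrix_vector_mul_assoc B B')
  have "m x = B *v m' x" for x using BM(1)[of "m x"] unfolding h ..
  thus ?thesis using hF BM forms_over_matrix[of UNIV B]
    by (intro exI[of _ "\<lambda>y. B *v y"] exI[of _ h]) simp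
qed

locale cone_pencil =
  fixes K :: "'a::{alg_closed_field, field_char_0} set" and A B :: "'a^4 \<Rightarrow> 'a"
    and q :: "4 \<Rightarrow> 'a^3 \<Rightarrow> 'a" and m :: "4 \<Rightarrow> 'a^4 \<Rightarrow> 'a^3"
  assumes nonsingular: "nonsingular_quadric_intersection K A B" and cones: "four_cones A B q m"
begin

abbreviation W where "W i \<equiv> (\<lambda>x. q i (m i x))"

lemma AB_form: "is_form K 2 A" "is_form K 2 B"
  using nonsingular by (simp_all add: nonsingular_quadric_intersection_def)

lemma nonsing: "x \<noteq> 0 \<Longrightarrow> A x = 0 \<Longrightarrow> B x = 0 \<Longrightarrow> (\<And>y. s * polar A x y + t * polar B x y = 0) \<Longrightarrow> s = 0 \<and> t = 0"
  using nonsingular unfolding nonsingular_polar[OF AB_form] polar_lincomb by blast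

lemma cone: "is_form UNIV 2 (q i)" "forms_over UNIV 1 (m i)" "surj (m i)" "W i \<in> singular_pencil_members A B"
proof -
  have "cone_over_conic UNIV (q i) (m i) \<and> q i \<circ> m i \<in> singular_pencil_members A B"
    using cones unfolding four_cones_def by blast
  thus "is_form UNIV 2 (q i)" "forms_over UNIV 1 (m i)" "surj (m i)" "W i \<in> singular_pencil_members A B"
    unfolding cone_over_conic_def o_def by simp_all
qed

lemma W_form: "is_form UNIV 2 (W i)"
  by (rule is_form_comp_linear[OF coeff_ring_UNIV cone(1,2)])

lemma W_comb: "\<exists>s t. (s, t) \<noteq> (0, 0) \<and> W i = (\<lambda>x. s * A x + t * B x)"
  using cone(4)[of i] unfolding singular_pencil_members_def by blast

lemma vertex: "\<exists>v. v \<noteq> 0 \<and> (\<forall>y. polar (W i) v y = 0)"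
  using cone(4)[of i] unfolding singular_pencil_members_def partial_zero_iff_polar[OF W_form, symmetric] by blast

lemma member_unique: "U \<in> singular_pencil_members A B \<Longrightarrow> \<exists>!i. \<exists>c. U = (\<lambda>x. c * W i x)"
  using cones unfolding four_cones_def by blast

lemma not_proportional: "i \<noteq> j \<Longrightarrow> W i \<noteq> (\<lambda>x. c * W j x)"
proof
  assume ij: "i \<noteq> j" and e: "W i = (\<lambda>x. c * W j x)"
  have "\<exists>c. W i = (\<lambda>x. c * W i x)" by (rule exI[of _ 1]) simp
  moreover have "\<exists>c. W i = (\<lambda>x. c * W j x)" using e by (rule exI)
  ultimately show False using member_unique[OF cone(4)[of i]] ij by (metis (no_types, lifting))
qed

lemma pair_coefficients:
  assumes ij: "i \<noteq> j"
  obtains s t s' t' where "W i = (\<lambda>x. s * A x + t * B x)" "W j = (\<lambda>x. s' * A x + t' * B x)" "s * t' - t * s' \<noteq> 0"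
proof -
  obtain s t where 1: "W i = (\<lambda>x. s * A x + t * B x)" using W_comb[of i] by blast
  obtain s' t' where 2: "(s', t') \<noteq> (0, 0)" "W j = (\<lambda>x. s' * A x + t' * B x)" using W_comb[of j] by blast
  have "s * t' - t * s' \<noteq> 0"
  proof
    assume D: "s * t' - t * s' = 0"
    define c where "c = (if s' = 0 then t / t' else s / s')"
    have "s = c * s'" "t = c * t'" using D 2(1) by (auto simp: c_def field_simps)
    hence "W i = (\<lambda>x. c * W j x)" unfolding 1 by (simp add: fun_eq_iff fun_cong[OF 2(2)] algebra_simps)
    thus False using not_proportional[OF ij] by blast
  qed
  thus thesis by (rule that[OF 1 2(2)])
qed

lemma pair_zeros: 
  assumes "i \<noteq> j" shows "A x = 0 \<and> B x = 0 \<longleftrightarrow> W i x = 0 \<and> W j x = 0"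
proof -
  obtain s t s' t' where c: "W i = (\<lambda>x. s * A x + t * B x)" "W j = (\<lambda>x. s' * A x + t' * B x)" and D: "s * t' - t * s' \<noteq> 0"
    using pair_coefficients[OF assms] .
  have "(s * t' - t * s') * A x = t' * W i x - t * W j x" "(s * t' - t * s') * B x = s * W j x - s' * W i x"
    unfolding fun_cong[OF c(1)] fun_cong[OF c(2)] by (simp_all add: algebra_simps)
  thus ?thesis using D fun_cong[OF c(1), of x] fun_cong[OF c(2), of x] by auto
qed

lemma pair_nonsing:
  assumes ij: "i \<noteq> j" and x: "x \<noteq> 0" "W i x = 0" "W j x = 0" and 0: "\<And>y. u * polar (W i) x y + v * polar (W j) x y = 0"
  shows "u = 0 \<and> v = 0"
proof -
  obtain s t s' t' where c: "W i = (\<lambda>x. s * A x + t * B x)" "W j = (\<lambda>x. s' * A x + t' * B x)" and D: "s * t' - t * s' \<noteq> 0"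
    using pair_coefficients[OF ij] .
  have "A x = 0" "B x = 0" using pair_zeros[OF ij, of x] x by auto
  moreover have "(u * s + v * s') * polar A x y + (u * t + v * t') * polar B x y = 0" for y
    using 0[of y] unfolding c polar_lincomb by (simp add: algebra_simps)
  ultimately have "u * s + v * s' = 0 \<and> u * t + v * t' = 0" by (rule nonsing[OF x(1)])
  hence e: "u * s + v * s' = 0" "u * t + v * t' = 0" by auto
  have "(s * t' - t * s') * u = t' * (u * s + v * s') - s' * (u * t + v * t')"
    "(s * t' - t * s') * v = s * (u * t + v * t') - t * (u * s + v * s')" by (simp_all add: algebra_simps)
  thus ?thesis unfolding e using D by simp
qed

lemma pair_nonsing1:
  assumes ij: "i \<noteq> j" and x: "x \<noteq> 0" "W i x = 0" "W j x = 0"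
  shows "\<exists>y. polar (W i) x y \<noteq> 0"
proof (rule ccontr)
  assume "\<not> ?thesis"
  hence "1 * polar (W i) x y + 0 * polar (W j) x y = 0" for y by simp
  from pair_nonsing[OF ij x this] show False by simp
qed

lemma pencil_cone_W:
  assumes "i \<noteq> j" and "v \<noteq> 0" "\<And>y. polar (W i) v y = 0" and "parametrisation (q i) Q"
  shows "pencil_cone (q i) (m i) (W i) (W j) v"
  by unfold_locales (use assms cone W_form pair_nonsing1 in blast)+

text \<open>The Galois condition concerns zero sets, while the construction needs the equations. The
  conjugate of \<open>W i\<close> is again a singular member of the pencil because \<open>A\<close>
  and \<open>B\<close> are defined over \<open>K\<close>, so it is a multiple of some
  \<open>W k\<close>; for \<open>k \<noteq> j\<close> the vertex of \<open>W j\<close> would lie on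
  \<open>W k\<close> and be a singular point of the intersection.\<close>

lemma conj_W:
  assumes s: "\<sigma> \<in> gal K" and ij: "i \<noteq> j" and zeros: "gal_point \<sigma> ` zeros {W i} = zeros {W j}"
    and U: "\<And>x. \<sigma> (W i x) = U (conj_vec \<sigma> x)"
  shows "\<exists>c. c \<noteq> 0 \<and> U = (\<lambda>x. c * W j x)"
proof -
  obtain a b where ab: "(a, b) \<noteq> (0, 0)" "W i = (\<lambda>x. a * A x + b * B x)" using W_comb by blast
  obtain v where v: "v \<noteq> 0" "\<And>y. polar (W i) v y = 0" using vertex by blast
  have U_eq: "U x = \<sigma> a * A x + \<sigma> b * B x" for x
  proof -
    obtain u where u: "x = conj_vec \<sigma> u" using conj_vec_surj[OF s] by blast
    have "U x = \<sigma> (a * A u + b * B u)" unfolding u U[symmetric] using fun_cong[OF ab(2), of u] by simp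
    thus ?thesis unfolding u galD(2,3)[OF s] conj_form_fixed[OF s AB_form(1)] conj_form_fixed[OF s AB_form(2)] .
  qed
  have UF: "is_form UNIV 2 U"
    unfolding U_eq[abs_def] by (intro is_form_add is_form_smult is_form_UNIV[OF AB_form(1)] is_form_UNIV[OF AB_form(2)]) auto
  have polarU: "polar U (conj_vec \<sigma> x) (conj_vec \<sigma> y) = \<sigma> (polar (W i) x y)" for x y
  proof -
    have "\<sigma> (W i (x + y)) = \<sigma> (polar (W i) x y + W i x + W i y)" by (simp add: polar_def)
    thus ?thesis unfolding galD(2)[OF s] U conj_vec_linear(1)[OF s] by (simp add: polar_def)
  qed
  have rad: "polar U (conj_vec \<sigma> v) y = 0" for y
  proof -
    obtain u where u: "y = conj_vec \<sigma> u" using conj_vec_surj[OF s] by blast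
    show ?thesis unfolding u polarU v(2) by (rule gal_simps(1)[OF s])
  qed
  have cv: "conj_vec \<sigma> v \<noteq> 0" using v(1) by (simp add: conj_vec_linear(3)[OF s])
  have "2 * U (conj_vec \<sigma> v) = 0" using rad polar_self[OF UF] by metis
  hence "U (conj_vec \<sigma> v) = 0" by simp
  hence "U \<in> singular_pencil_members A B"
    unfolding singular_pencil_members_def mem_Collect_eq partial_zero_iff_polar[OF UF]
    using ab(1) U_eq cv rad
    by (intro conjI exI[of _ "\<sigma> a"] exI[of _ "\<sigma> b"] exI[of _ "conj_vec \<sigma> v"]) (auto simp: gal_simps(3)[OF s] fun_eq_iff)
  from member_unique[OF this] obtain k c where kc: "U = (\<lambda>x. c * W k x)" by (elim ex1E exE) (rule that)
  have c: "c \<noteq> 0"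
  proof
    assume c0: "c = 0"
    have "W i x = 0" for x using U[of x] fun_cong[OF kc, of "conj_vec \<sigma> x"] c0 by (simp add: gal_simps(3)[OF s])
    hence "W i = (\<lambda>x. 0 * W j x)" by (simp add: fun_eq_iff)
    thus False using not_proportional[OF ij] by blast
  qed
  have "k = j"
  proof (rule ccontr)
    assume kj: "k \<noteq> j"
    obtain v' where v': "v' \<noteq> 0" "\<And>y. polar (W j) v' y = 0" using vertex by blast
    have "2 * W j v' = 0" using v'(2) polar_self[OF W_form] by metis
    hence j0: "W j v' = 0" by simp
    hence "hpoint v' \<in> zeros {W j}" using v'(1) unfolding zeros_def by blast
    hence "hpoint v' \<in> zeros {U}" using zeros gal_point_zeros[where f = "W i" and f' = U, OF s U] by metis
    then obtain x where "U x = 0" "hpoint v' = hpoint x" unfolding zeros_def by blast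
    then obtain d where "U x = 0" "v' = d *s x" unfolding hpoint_eq_iff by blast
    hence "U v' = 0" by (simp add: is_form_homogeneous[OF UF])
    hence "W k v' = 0" using fun_cong[OF kc, of v'] c by simp
    thus False using pair_nonsing1[of j k v'] kj v' j0 by metis
  qed
  thus ?thesis using kc c by blast
qed

lemma C_zeros: "i \<noteq> j \<Longrightarrow> zeros {A, B} = zeros {W i, W j}"
  unfolding zeros_def using pair_zeros[of i j] by auto

end

section \<open>The two constructions\<close>

context two_covering
begin

theorem covering_conclusion:
  "nonsingular_quadric_intersection K F G" "is_morphism K (zeros {F, G}) (zeros {W1, W2}) r"
  "has_degree K (zeros {F, G}) (zeros {W1, W2}) r 2"
  "is_form UNIV 1 h \<Longrightarrow> h \<noteq> (\<lambda>_. 0) \<Longrightarrow> p \<in> zeros {q1} \<Longrightarrow> lin_equiv (zeros {F, G}) (hyperplane_divisor (zeros {F, G}) h)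
     (pullback_divisor (zeros {F, G}) (zeros {W1, W2}) r (pullback_divisor (zeros {W1, W2}) (zeros {q1}) m1 (point_divisor p)))"
  "is_form UNIV 1 h \<Longrightarrow> h \<noteq> (\<lambda>_. 0) \<Longrightarrow> p \<in> zeros {q2} \<Longrightarrow> lin_equiv (zeros {F, G}) (hyperplane_divisor (zeros {F, G}) h)
     (pullback_divisor (zeros {F, G}) (zeros {W1, W2}) r (pullback_divisor (zeros {W1, W2}) (zeros {q2}) m2 (point_divisor p)))"
  unfolding D_eq C_eq
  using nonsingular_D morphism_r degree_r hyperplane_sections by blast+

end

definition join22 :: "'a::field^2 \<Rightarrow> 'a^2 \<Rightarrow> 'a^4" where
  "join22 z z' = vector [z $ 1, z $ 2, z' $ 1, z' $ 2]"

lemma join22_nth [simp]: "join22 z z' $ 1 = z $ 1" "join22 z z' $ 2 = z $ 2" "join22 z z' $ 3 = z' $ 1" "join22 z z' $ 4 = z' $ 2"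
  by (simp_all add: join22_def vector_4)

lemma forms_over_vec4I:
  assumes "is_form S d (\<lambda>w. f w $ 1)" "is_form S d (\<lambda>w. f w $ 2)" "is_form S d (\<lambda>w. f w $ 3)" "is_form S d (\<lambda>w. f w $ (4 :: 4))"
  shows "forms_over S d f"
  unfolding forms_over_def using assms by (simp add: forall_4)

lemma forms_over_vec2I:
  assumes "is_form S d (\<lambda>w. f w $ 1)" "is_form S d (\<lambda>w. f w $ (2 :: 2))"
  shows "forms_over S d f"
  unfolding forms_over_def using assms by (simp add: forall_2)

text \<open>The two parameters are the two halves of the coordinates: \<open>L\<close> is
  \<open>K\<close>, the matrix is the identity, and the involution is \<open>flip4\<close>, which is
  already defined over \<open>K\<close>.\<close>

lemma (in cone_pencil) split_two_covering:
  assumes K: "coeff_field K" and con: "split_construction K (q 1) (m 1) (q 2) (m 2) P1 P2 Q R r F G"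
  shows "\<exists>v1 v2. two_covering (q 1) (q 2) (m 1) (m 2) (W 1) (W 2) v1 v2 K K Q R (\<lambda>y. y) (\<lambda>y. y) pr pr' join22
    (m 1) (m 2) (\<lambda>w. Q (pr w)) (\<lambda>w. R (pr' w)) 1 0 0 1 r F G flip4 1"
proof -
  have S: "coeff_ring K" by (rule coeff_field_ring[OF K])
  have mF: "forms_over K 1 (m 1)" "forms_over K 1 (m 2)" and Qp: "parametrises K Q (q 1)" "parametrises K R (q 2)"
    and rec: "recombines_to K (\<lambda>x. join (m 1 x) (m 2 x)) (\<lambda>w. join (Q (pr w)) (R (pr' w))) r F G"
    using con unfolding split_construction_def cone_over_conic_def pr_def pr'_def by blast+
  note 01 = coeff_ringD(1,2)[OF S]
  have QR: "parametrisation (q 1) Q" "parametrisation (q 2) R"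
    by (rule parametrises_parametrisation[OF cone(1)], rule Qp)+
  have QF: "forms_over K 2 Q" "forms_over K 2 R" using Qp unfolding parametrises_def by blast+
  obtain v1 where v1: "v1 \<noteq> 0" "\<And>y. polar (W 1) v1 y = 0" using vertex by blast
  obtain v2 where v2: "v2 \<noteq> 0" "\<And>y. polar (W 2) v2 y = 0" using vertex by blast
  have ne: "(1 :: 4) \<noteq> 2" "(2 :: 4) \<noteq> 1" by simp_all
  interpret c1: pencil_cone "q 1" "m 1" "W 1" "W 2" v1 by (rule pencil_cone_W[OF ne(1) v1 QR(1)])
  interpret c2: pencil_cone "q 2" "m 2" "W 2" "W 1" v2 by (rule pencil_cone_W[OF ne(2) v2 QR(2)])
  have prK: "forms_over K 1 pr" "forms_over K 1 pr'"
    by (rule forms_over_vec2I; simp del: One_nat_def; rule is_form_component[OF S])+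
  have Qpr: "forms_over K 2 (\<lambda>w. Q (pr w))" "forms_over K 2 (\<lambda>w. R (pr' w))"
    using forms_over_comp[OF S QF(1) prK(1)] forms_over_comp[OF S QF(2) prK(2)] by simp_all
  have idF: "forms_over UNIV 1 (\<lambda>y :: 'a^3. y)" by (rule forms_over1I) simp_all
  have JK: "forms_over K 1 (\<lambda>u :: 'a^4. join22 (pr u) (pr' u))"
    by (rule forms_over_vec4I; simp del: One_nat_def; rule is_form_component[OF S])
  have flip: "forms_over K 1 (flip4 :: 'a^4 \<Rightarrow> 'a^4)"
    by (rule forms_over_vec4I; simp add: flip4_nth del: One_nat_def; intro is_form_uminus is_form_component S)
  have e1: "is_form K (1 + 1) (\<lambda>w :: 'a^4. pr w $ 1 * pr' w $ 1)"
    by (rule is_form_mult[OF S]; simp del: One_nat_def; rule is_form_component[OF S])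
  have "two_covering (q 1) (q 2) (m 1) (m 2) (W 1) (W 2) v1 v2 K K Q R (\<lambda>y. y) (\<lambda>y. y) pr pr' join22
    (m 1) (m 2) (\<lambda>w. Q (pr w)) (\<lambda>w. R (pr' w)) 1 0 0 1 r F G flip4 1"
  proof (unfold_locales)
    show "\<exists>h. is_form K e h \<and> (\<forall>w. f w = h (s w))"
      if "is_form K e H" "\<And>w. f w = H (s w)" for e f H and s :: "'a^4 \<Rightarrow> 'a^(3+3)" using that by blast
    show "is_form K 2 (\<lambda>w :: 'a^4. pr w $ 1 * pr' w $ 1)" using e1 by (simp only: one_add_one)
    show "s = 0 \<and> t = 0" if "x \<noteq> 0" "W 1 x = 0" "W 2 x = 0" "\<And>y. s * polar (W 1) x y + t * polar (W 2) x y = 0" for x s t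
      by (rule pair_nonsing[OF ne(1) that])
    show "recombines_to K (\<lambda>x. join (m 1 x) (m 2 x)) (\<lambda>w. join (Q (pr w)) (R (pr' w))) r F G" by (rule rec)
    show "pr (join22 z z') = z" "pr' (join22 z z') = z'" for z z' :: "'a^2" by (simp_all add: vec_eq_iff forall_2)
    show "join22 (pr w) (pr' w) = w" for w :: "'a^4" by (simp add: vec_eq_iff forall_4)
    show "pr (flip4 w) = 1 *s pr w" "pr' (flip4 w) = - 1 *s pr' w" for w :: "'a^4"
      by (simp_all add: vec_eq_iff forall_2 flip4_nth)
  qed (use K QR QF idF prK forms_over_UNIV JK mF Qpr flip 01 in \<open>simp_all add: del: One_nat_def\<close>)
  thus ?thesis by blast
qed

lemma quadratic_extension_field:
  fixes K :: "'a::field_char_0 set"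
  assumes K: "coeff_field K" and L: "L = {a + \<beta> * b |a b. a \<in> K \<and> b \<in> K}" and b: "\<beta> \<notin> K"
    and pq: "p \<in> K" "q \<in> K" "\<beta>^2 = p * \<beta> + q"
  shows "coeff_field L" "K \<subseteq> L" "\<beta> \<in> L" "p - \<beta> \<in> L"
proof -
  have S: "coeff_ring K" by (rule coeff_field_ring[OF K])
  note mem = coeff_ringD[OF S] coeff_field_divide[OF K]
  have LI: "a + \<beta> * b \<in> L" if "a \<in> K" "b \<in> K" for a b using that unfolding L by blast
  have bb: "\<beta> * \<beta> = p * \<beta> + q" using pq(3) by (simp add: power2_eq_square)
  show KL: "K \<subseteq> L" using LI[OF _ mem(1)] by auto
  show bL: "\<beta> \<in> L" using LI[OF mem(1,2)] by simp
  show "p - \<beta> \<in> L" using LI[OF pq(1) mem(5)[OF mem(2)]] by simp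
  have "coeff_ring L"
    unfolding coeff_ring_def
  proof (intro conjI ballI)
    show "0 \<in> L" "1 \<in> L" using KL mem(1,2) by blast+
    fix x assume "x \<in> L"
    then obtain a c where x: "x = a + \<beta> * c" "a \<in> K" "c \<in> K" unfolding L by blast
    show "- x \<in> L" using LI[OF mem(5)[OF x(2)] mem(5)[OF x(3)]] by (simp add: x(1))
    fix y assume "y \<in> L"
    then obtain a' c' where y: "y = a' + \<beta> * c'" "a' \<in> K" "c' \<in> K" unfolding L by blast
    have "(a + a') + \<beta> * (c + c') \<in> L" by (intro LI mem(3) x y)
    thus "x + y \<in> L" by (simp add: x(1) y(1) algebra_simps)
    have "(a * a' + q * (c * c')) + \<beta> * (a * c' + a' * c + p * (c * c')) \<in> L" by (intro LI mem(3,4) x y pq)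
    moreover have "x * y = a * a' + \<beta> * (a * c' + a' * c) + (\<beta> * \<beta>) * (c * c')" unfolding x(1) y(1) by (simp add: algebra_simps)
    ultimately show "x * y \<in> L" unfolding bb by (simp add: algebra_simps)
  qed
  moreover have "inverse x \<in> L" if "x \<in> L" for x
  proof -
    obtain a c where x: "x = a + \<beta> * c" "a \<in> K" "c \<in> K" using \<open>x \<in> L\<close> unfolding L by blast
    \<comment> \<open>The norm of \<open>x\<close>: the conjugate of \<open>a + \<beta> * c\<close>
      is \<open>a + p * c - \<beta> * c\<close>.\<close>
    define n where "n = a * a + a * (p * c) - q * (c * c)"
    have nK: "n \<in> K" unfolding n_def by (intro mem(6) mem(3) mem(4) x pq)
    have n: "x * ((a + p * c) - \<beta> * c) = n"
    proof -
      have "x * ((a + p * c) - \<beta> * c) = a * a + a * (p * c) + (p * \<beta>) * (c * c) - (\<beta> * \<beta>) * (c * c)"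
        unfolding x(1) by (simp add: algebra_simps)
      thus ?thesis unfolding bb n_def by (simp add: algebra_simps)
    qed
    have z: "a = 0 \<and> c = 0" if "a + t * c = 0" "t \<notin> K" "a \<in> K" "c \<in> K" for a c t
    proof (cases "c = 0")
      case False
      hence "t = - a / c" using that(1) by (simp add: field_simps eq_neg_iff_add_eq_0)
      thus ?thesis using that mem(7)[OF mem(5)[OF that(3)] that(4)] by simp
    qed (use that in simp)
    show ?thesis
    proof (cases "x = 0")
      case True thus ?thesis using KL mem(1) by auto
    next
      case False
      have "(a + p * c) - \<beta> * c \<noteq> 0"
      proof
        assume "(a + p * c) - \<beta> * c = 0"
        hence "(a + p * c) + \<beta> * (- c) = 0" by simp
        from z[OF this b mem(3)[OF x(2) mem(4)[OF pq(1) x(3)]] mem(5)[OF x(3)]] have "a = 0" "c = 0" by auto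
        thus False using False x(1) by simp
      qed
      hence n0: "n \<noteq> 0" unfolding n[symmetric] using False by simp
      hence "inverse x = ((a + p * c) - \<beta> * c) / n" using n False by (simp add: field_simps)
      also have "\<dots> = (a + p * c) / n + \<beta> * (- c / n)" using n0 by (simp add: field_simps)
      finally show ?thesis using LI[OF mem(7)[OF mem(3)[OF x(2) mem(4)[OF pq(1) x(3)]] nK] mem(7)[OF mem(5)[OF x(3)] nK]] by simp
    qed
  qed
  ultimately show "coeff_field L" unfolding coeff_field_def by blast
qed

text \<open>A parametrisation is given for the first conic only; conjugation by
  \<open>\<sigma>\<close> supplies one for the conjugate cone. That cone has the equation of the
  second one up to a factor, but its conic \<open>q'\<close> and projection \<open>m'\<close> need
  not be \<open>q 2\<close> and \<open>m 2\<close>; the linear map \<open>g\<close> mediates between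
  them.\<close>

lemma (in cone_pencil) nonsplit_two_covering:
  assumes K: "coeff_field K" and alg: "algebraic_over_all K"
    and con: "nonsplit_construction K L \<beta> (q 1) (m 1) (q 2) (m 2) P1 Q r F G"
  shows "\<exists>v1 v2 Q' g g' zz zz' J l0 l1 s0 s1 a b c d \<tau> \<delta>.
    two_covering (q 1) (q 2) (m 1) (m 2) (W 1) (W 2) v1 v2 K L Q Q' g g' zz zz' J l0 l1 s0 s1 a b c d r F G \<tau> \<delta>"
proof -
  have S: "coeff_ring K" by (rule coeff_field_ring[OF K])
  note 01 = coeff_ringD(1,2)[OF S]
  have qext: "quadratic_extension K L \<beta>" and mL: "forms_over L 1 (m 1)" "forms_over L 1 (m 2)"
    and Qp: "parametrises L Q (q 1)"
    and act: "\<And>\<sigma>. \<sigma> \<in> gal K \<Longrightarrow> \<sigma> \<beta> \<noteq> \<beta> \<Longrightarrow> gal_point \<sigma> ` zeros {W 1} = zeros {W 2}"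
    using con unfolding nonsplit_construction_def cone_over_conic_def o_def by blast+
  obtain l0 l1 s0 s1 where ls: "forms_over K 1 l0" "forms_over K 1 l1" "forms_over K 2 s0" "forms_over K 2 s1"
    and m1_l0: "\<forall>x. m 1 x = l0 x + \<beta> *s l1 x"
    and Q_s0: "\<forall>w. Q (vector [w $ 1 + \<beta> * w $ 2, w $ 3 + \<beta> * w $ 4]) = s0 w + \<beta> *s s1 w"
    and rec: "recombines_to K (\<lambda>x. join (l0 x) (l1 x)) (\<lambda>w. join (s0 w) (s1 w)) r F G"
    using con unfolding nonsplit_construction_def by (elim conjE exE) (rule that, assumption+)
  note m1_l = m1_l0[rule_format] and Q_s = Q_s0[rule_format]
  note ext = quadratic_extension_basis[OF K qext]
  obtain p n where pn: "p \<in> K" "n \<in> K" "\<beta>^2 = p * \<beta> + n" using ext(3) by blast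
  note Lf = quadratic_extension_field[OF K ext(2,1) pn]
  have Lr: "coeff_ring L" by (rule coeff_field_ring[OF Lf(1)])
  define \<beta>' where "\<beta>' = p - \<beta>"
  \<comment> \<open>As \<open>\<delta>\<close> is \<open>2 * \<beta> - p\<close>, its square is the
    discriminant \<open>p * p + 4 * n\<close> and lies in \<open>K\<close>, although
    \<open>\<delta>\<close> does not.\<close>
  define \<delta> where "\<delta> = \<beta> - \<beta>'"
  have bb: "\<beta> * \<beta> = p * \<beta> + n" using pn(3) by (simp add: power2_eq_square)
  have b'b': "\<beta>' * \<beta>' = p * \<beta>' + n" using bb by (simp add: \<beta>'_def algebra_simps)
  have bb': "\<beta> * \<beta>' = - n" using bb by (simp add: \<beta>'_def algebra_simps)
  have d0: "\<delta> \<noteq> 0"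
  proof
    assume "\<delta> = 0"
    hence "\<beta> = p / 2" by (simp add: \<delta>_def \<beta>'_def field_simps)
    moreover have "p / 2 \<in> K" by (rule coeff_field_divide[OF K pn(1) coeff_ring_numeral[OF S]])
    ultimately show False using ext(1) by metis
  qed
  have dd: "\<delta>^2 \<in> K"
  proof -
    have "\<delta>^2 = 4 * (\<beta> * \<beta>) - 4 * p * \<beta> + p * p" by (simp add: \<delta>_def \<beta>'_def power2_eq_square algebra_simps)
    hence "\<delta>^2 = 4 * n + p * p" unfolding bb by (simp add: algebra_simps)
    thus ?thesis using coeff_ringD(3)[OF S coeff_ringD(4)[OF S coeff_ring_numeral[OF S] pn(2)] coeff_ringD(4)[OF S pn(1) pn(1)]] by simp
  qed
  obtain \<sigma> where s: "\<sigma> \<in> gal K" "\<sigma> \<beta> = \<beta>'" using quadratic_conjugation[OF K alg ext(1) pn] unfolding \<beta>'_def by blast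
  have sL: "\<sigma> x \<in> L" if "x \<in> L" for x
  proof -
    obtain a c where x: "x = a + \<beta> * c" "a \<in> K" "c \<in> K" using \<open>x \<in> L\<close> unfolding ext(2) by blast
    have "\<sigma> x = a + \<beta>' * c" unfolding x(1) galD(2,3)[OF s(1)] galD(4)[OF s(1) x(2)] galD(4)[OF s(1) x(3)] s(2) ..
    moreover have "a \<in> L" "c \<in> L" using x(2,3) Lf(2) by blast+
    ultimately show ?thesis using coeff_ringD(3)[OF Lr _ coeff_ringD(4)[OF Lr Lf(4)]] unfolding \<beta>'_def by simp
  qed
  have Q1: "parametrisation (q 1) Q" by (rule parametrises_parametrisation[OF cone(1) Qp])
  have QF: "forms_over L 2 Q" using Qp unfolding parametrises_def by blast
  obtain Q' where Q': "forms_over L 2 Q'" "\<And>z. conj_vec \<sigma> (Q z) = Q' (conj_vec \<sigma> z)"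
    using conj_forms[OF s(1) sL QF] by blast
  obtain m' where m': "forms_over L 1 m'" "\<And>x. conj_vec \<sigma> (m 1 x) = m' (conj_vec \<sigma> x)"
    using conj_forms[OF s(1) sL mL(1)] by blast
  obtain q' where q': "is_form UNIV 2 q'" "\<And>y. \<sigma> (q 1 y) = q' (conj_vec \<sigma> y)"
    using conj_form[OF s(1) _ cone(1), of UNIV] by blast
  note m'F = forms_over_UNIV[OF m'(1)]
  define U where "U x = q' (m' x)" for x
  have U: "\<sigma> (W 1 x) = U (conj_vec \<sigma> x)" for x by (simp add: U_def q'(2) m'(2))
  have ne: "(1 :: 4) \<noteq> 2" "(2 :: 4) \<noteq> 1" by simp_all
  have "\<sigma> \<beta> \<noteq> \<beta>" using d0 s(2) by (simp add: \<delta>_def)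
  from conj_W[OF s(1) ne(1) act[OF s(1) this] U] obtain \<kappa> where k: "\<kappa> \<noteq> 0" "\<And>x. U x = \<kappa> * W 2 x" by (metis (mono_tags))
  have polarU: "polar U x y = \<kappa> * polar (W 2) x y" for x y by (simp add: polar_def k(2) algebra_simps)
  have m'surj: "surj m'"
    unfolding surj_def
  proof
    fix y :: "'a^3"
    obtain u where u: "y = conj_vec \<sigma> u" using conj_vec_surj[OF s(1)] by blast
    have "m 1 (inv_into UNIV (m 1) u) = u" using cone(3)[of 1] by (simp add: surj_f_inv_f)
    hence "m' (conj_vec \<sigma> (inv_into UNIV (m 1) u)) = y" unfolding m'(2)[symmetric] u by simp
    thus "\<exists>x. y = m' x" by blast
  qed
  have Q'1: "parametrisation q' Q'"
    unfolding parametrisation_def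
  proof (intro conjI allI impI)
    show "forms_over UNIV 2 Q'" by (rule forms_over_UNIV[OF Q'(1)])
    fix z :: "'a^2" assume z: "z \<noteq> 0"
    obtain u where u: "z = conj_vec \<sigma> u" using conj_vec_surj[OF s(1)] by blast
    have "u \<noteq> 0" using z u conj_vec_linear(4)[OF s(1)] by metis
    hence "Q u \<noteq> 0" "q 1 (Q u) = 0" using Q1 unfolding parametrisation_def by blast+
    thus "Q' z \<noteq> 0" "q' (Q' z) = 0" unfolding u Q'(2)[symmetric] q'(2)[symmetric]
      by (simp_all add: conj_vec_linear(3)[OF s(1)] gal_simps(1)[OF s(1)])
  next
    fix y :: "'a^3" assume y: "y \<noteq> 0" "q' y = 0"
    obtain u where u: "y = conj_vec \<sigma> u" using conj_vec_surj[OF s(1)] by blast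
    have "u \<noteq> 0" using y(1) u conj_vec_linear(4)[OF s(1)] by metis
    moreover have "q 1 u = 0" using y(2) unfolding u q'(2)[symmetric] by (simp add: gal_simps(3)[OF s(1)])
    ultimately obtain z where "Q z = u" using Q1 unfolding parametrisation_def by blast
    hence "Q' (conj_vec \<sigma> z) = y" using Q'(2)[of z] u by simp
    thus "\<exists>z. Q' z = y" by blast
  qed
  \<comment> \<open>A nonzero vector killed by \<open>m 2\<close> is in the radical of
    \<open>W 2\<close>, hence of \<open>U\<close>; read as a vertex of the conjugate cone, it is
    killed by \<open>m'\<close>.\<close>
  have rad: "m' x = 0" if "m 2 x = 0" for x
  proof (cases "x = 0")
    case True thus ?thesis using forms1_zero[OF m'(1)] by simp
  next
    case False
    have "polar (W 2) x y = 0" for y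
      using that is_form_at_0[OF cone(1)] by (simp add: polar_def forms1_add[OF cone(2)])
    hence U0: "polar U x y = 0" for y by (simp add: polarU)
    have Uns: "\<exists>y. polar U z y \<noteq> 0" if z: "z \<noteq> 0" "U z = 0" "W 1 z = 0" for z
    proof -
      have "W 2 z = 0" using z(2) k by simp
      from pair_nonsing1[OF ne(2) z(1) this z(3)] show ?thesis using k(1) by (simp add: polarU)
    qed
    have exQ: "\<exists>Q. parametrisation q' Q" using Q'1 by blast
    interpret x: pencil_cone q' m' U "W 1" x
      by unfold_locales (fact q'(1) m'F m'surj W_form U_def False exQ Uns U0)+
    show ?thesis by (rule x.m_v)
  qed
  have "\<exists>g g'. forms_over UNIV 1 g \<and> forms_over UNIV 1 g' \<and> (\<forall>y. g (g' y) = y) \<and> (\<forall>y. g' (g y) = y) \<and> (\<forall>x. m 2 x = g (m' x))"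
    by (rule linear_factor[OF cone(2,3) m'F m'surj]) (rule rad)
  then obtain g g' where gF: "forms_over UNIV 1 g" "forms_over UNIV 1 g'"
    and g0: "\<forall>y. g (g' y) = y" "\<forall>y. g' (g y) = y" "\<forall>x. m 2 x = g (m' x)"
    by (elim exE conjE) (rule that)
  note g = gF g0(1,2)[rule_format] and m2_g = g0(3)[rule_format]
  have q2g: "q' y = \<kappa> * q 2 (g y)" for y
  proof -
    obtain x where x: "m' x = y" using m'surj by (metis surjD)
    show ?thesis using k(2)[of x] unfolding U_def m2_g x .
  qed
  have Q'2: "parametrisation (\<lambda>y. q 2 (g y)) Q'" using Q'1 k(1) unfolding parametrisation_def q2g by simp
  have R: "parametrisation (q 2) (\<lambda>z. g (Q' z))" by (rule parametrisation_comp_linear[OF g Q'2])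
  obtain v1 where v1: "v1 \<noteq> 0" "\<And>y. polar (W 1) v1 y = 0" using vertex by blast
  obtain v2 where v2: "v2 \<noteq> 0" "\<And>y. polar (W 2) v2 y = 0" using vertex by blast
  interpret c1: pencil_cone "q 1" "m 1" "W 1" "W 2" v1 by (rule pencil_cone_W[OF ne(1) v1 Q1])
  interpret c2: pencil_cone "q 2" "m 2" "W 2" "W 1" v2 by (rule pencil_cone_W[OF ne(2) v2 R])
  \<comment> \<open>The parameter over \<open>L\<close> and its conjugate. Over the closure they are
    independent coordinates, and \<open>J\<close> solves for \<open>w\<close> with denominator
    \<open>\<delta>\<close>.\<close>
  define zz zz' where "zz w = (vector [w $ 1 + \<beta> * w $ 2, w $ 3 + \<beta> * w $ 4] :: 'a^2)"
    and "zz' w = (vector [w $ 1 + \<beta>' * w $ 2, w $ 3 + \<beta>' * w $ 4] :: 'a^2)" for w :: "'a^4"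
  define J where "J z z' = (vector [(\<beta> * z' $ 1 - \<beta>' * z $ 1) / \<delta>, (z $ 1 - z' $ 1) / \<delta>,
    (\<beta> * z' $ 2 - \<beta>' * z $ 2) / \<delta>, (z $ 2 - z' $ 2) / \<delta>] :: 'a^4)" for z z' :: "'a^2"
  \<comment> \<open>Multiplication by \<open>2 * \<beta> - p\<close> on
    \<open>x + \<beta> * y\<close>, written in the basis 1, \<open>\<beta>\<close> with
    \<open>\<beta>^2 = p * \<beta> + n\<close>. It is defined over \<open>K\<close> and acts on the
    conjugate parameter as \<open>- \<delta>\<close>.\<close>
  define \<tau> where "\<tau> w = (vector [2 * n * w $ 2 - p * w $ 1, 2 * w $ 1 + p * w $ 2,
    2 * n * w $ 4 - p * w $ 3, 2 * w $ 3 + p * w $ 4] :: 'a^4)" for w :: "'a^4"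
  have zz_conj: "zz' (conj_vec \<sigma> w) = conj_vec \<sigma> (zz w)" for w
    by (simp add: zz_def zz'_def vec_eq_iff forall_2 galD(2,3)[OF s(1)] s(2))
  have m2_l: "m 2 x = g (1 *s l0 x + \<beta>' *s l1 x)" for x
  proof -
    obtain u where u: "x = conj_vec \<sigma> u" using conj_vec_surj[OF s(1)] by blast
    have "m' x = l0 x + \<beta>' *s l1 x"
      unfolding u m'(2)[symmetric] m1_l conj_vec_linear(1,2)[OF s(1)] s(2) conj_forms_fixed[OF s(1) ls(1)] conj_forms_fixed[OF s(1) ls(2)] ..
    thus ?thesis by (simp add: m2_g)
  qed
  have Q'_s: "Q' (zz' w) = 1 *s s0 w + \<beta>' *s s1 w" for w
  proof -
    obtain u where u: "w = conj_vec \<sigma> u" using conj_vec_surj[OF s(1)] by blast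
    have "Q' (zz' w) = conj_vec \<sigma> (s0 u + \<beta> *s s1 u)" unfolding u zz_conj Q'(2)[symmetric] unfolding zz_def Q_s ..
    thus ?thesis
      unfolding u conj_vec_linear(1,2)[OF s(1)] s(2) conj_forms_fixed[OF s(1) ls(3)] conj_forms_fixed[OF s(1) ls(4)] by simp
  qed
  have bL: "\<beta> \<in> L" "\<beta>' \<in> L" "\<delta> \<in> L" "1 / \<delta> \<in> L"
    using Lf(3,4) coeff_ringD(6)[OF Lr Lf(3,4)] coeff_field_divide[OF Lf(1) coeff_ringD(2)[OF Lr] coeff_ringD(6)[OF Lr Lf(3,4)]]
    by (simp_all add: \<beta>'_def \<delta>_def)
  note comp = is_form_component
  have zzF: "forms_over L 1 zz" "forms_over L 1 zz'"
    by (rule forms_over_vec2I; simp add: zz_def zz'_def del: One_nat_def; intro is_form_add is_form_smult comp Lr bL)+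
  have JF: "forms_over L 1 (\<lambda>u. J (pr u) (pr' u))"
  proof (rule forms_over_vec4I)
    have f: "is_form L 1 (\<lambda>u :: 'a^4. (1 / \<delta>) * (\<beta> * u $ i - \<beta>' * u $ j))" "is_form L 1 (\<lambda>u :: 'a^4. (1 / \<delta>) * (u $ i - u $ j))" for i j
      by (intro is_form_smult is_form_diff comp Lr bL)+
    show "is_form L 1 (\<lambda>w. J (pr w) (pr' w) $ 1)" "is_form L 1 (\<lambda>w. J (pr w) (pr' w) $ 2)"
      "is_form L 1 (\<lambda>w. J (pr w) (pr' w) $ 3)" "is_form L 1 (\<lambda>w. J (pr w) (pr' w) $ 4)"
      using f(1)[of 3 1] f(2)[of 1 3] f(1)[of 4 2] f(2)[of 2 4] by (simp_all add: J_def vector_4 del: One_nat_def)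
  qed
  have tauF: "forms_over K 1 \<tau>"
  proof -
    have "2 * n \<in> K" by (rule coeff_ringD(4)[OF S coeff_ring_numeral[OF S] pn(2)])
    note c = this coeff_ring_numeral[OF S, of "num.Bit0 num.One"]
    show ?thesis
      by (rule forms_over_vec4I; simp add: \<tau>_def vector_4 del: One_nat_def; intro is_form_add is_form_diff is_form_smult comp S c pn)
  qed
  have Jz: "zz (J z z') = z" "zz' (J z z') = z'" for z z'
  proof -
    have "(\<beta> * t' - \<beta>' * t) / \<delta> + \<beta> * ((t - t') / \<delta>) = t" "(\<beta> * t' - \<beta>' * t) / \<delta> + \<beta>' * ((t - t') / \<delta>) = t'" for t t'
    proof -
      have "(\<beta> * t' - \<beta>' * t) / \<delta> + \<beta> * ((t - t') / \<delta>) = (\<delta> * t) / \<delta>" "(\<beta> * t' - \<beta>' * t) / \<delta> + \<beta>' * ((t - t') / \<delta>) = (\<delta> * t') / \<delta>"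
        unfolding times_divide_eq_right add_divide_distrib[symmetric] by (simp_all add: \<delta>_def algebra_simps)
      thus "(\<beta> * t' - \<beta>' * t) / \<delta> + \<beta> * ((t - t') / \<delta>) = t" "(\<beta> * t' - \<beta>' * t) / \<delta> + \<beta>' * ((t - t') / \<delta>) = t'" using d0 by simp_all
    qed
    thus "zz (J z z') = z" "zz' (J z z') = z'" by (simp_all add: zz_def zz'_def J_def vector_4 vec_eq_iff forall_2)
  qed
  have zJ: "J (zz w) (zz' w) = w" for w
  proof -
    have "(\<beta> * (x + \<beta>' * y) - \<beta>' * (x + \<beta> * y)) / \<delta> = x" "((x + \<beta> * y) - (x + \<beta>' * y)) / \<delta> = y" for x y
    proof -
      have "\<beta> * (x + \<beta>' * y) - \<beta>' * (x + \<beta> * y) = \<delta> * x" "(x + \<beta> * y) - (x + \<beta>' * y) = \<delta> * y" by (simp_all add: \<delta>_def algebra_simps)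
      thus "(\<beta> * (x + \<beta>' * y) - \<beta>' * (x + \<beta> * y)) / \<delta> = x" "((x + \<beta> * y) - (x + \<beta>' * y)) / \<delta> = y" using d0 by simp_all
    qed
    thus ?thesis by (simp add: zz_def zz'_def J_def vector_4 vec_eq_iff forall_4)
  qed
  have tz: "zz (\<tau> w) = \<delta> *s zz w" "zz' (\<tau> w) = - \<delta> *s zz' w" for w
  proof -
    have "2 * n * y - p * x + \<beta> * (2 * x + p * y) = \<delta> * (x + \<beta> * y)" "2 * n * y - p * x + \<beta>' * (2 * x + p * y) = - \<delta> * (x + \<beta>' * y)" for x y
    proof -
      have "\<delta> * (x + \<beta> * y) = (2 * \<beta> - p) * x + (2 * (\<beta> * \<beta>) - p * \<beta>) * y" by (simp add: \<delta>_def \<beta>'_def algebra_simps)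
      thus "2 * n * y - p * x + \<beta> * (2 * x + p * y) = \<delta> * (x + \<beta> * y)" unfolding bb by (simp add: algebra_simps)
      have "- \<delta> = 2 * \<beta>' - p" by (simp add: \<delta>_def \<beta>'_def)
      hence "- \<delta> * (x + \<beta>' * y) = (2 * \<beta>' - p) * x + (2 * (\<beta>' * \<beta>') - p * \<beta>') * y" by (simp add: algebra_simps)
      thus "2 * n * y - p * x + \<beta>' * (2 * x + p * y) = - \<delta> * (x + \<beta>' * y)" unfolding b'b' by (simp add: algebra_simps)
    qed
    thus "zz (\<tau> w) = \<delta> *s zz w" "zz' (\<tau> w) = - \<delta> *s zz' w"
      unfolding vec_eq_iff forall_2 vector_smult_component zz_def zz'_def \<tau>_def vector_4 vector_2 by simp_all
  qed
  \<comment> \<open>The product of conjugate parameters is the norm of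
    \<open>x + \<beta> * y\<close>, so its coefficients lie in \<open>K\<close>; under
    \<open>\<tau>\<close> it is multiplied by the negative of \<open>\<delta>^2\<close>.\<close>
  have e1: "is_form K 2 (\<lambda>w. zz w $ 1 * zz' w $ 1)"
  proof -
    have "zz w $ 1 * zz' w $ 1 = w $ 1 * w $ 1 + (p * (w $ 1 * w $ 2) - n * (w $ 2 * w $ 2))" for w
    proof -
      have "zz w $ 1 * zz' w $ 1 = w $ 1 * w $ 1 + (\<beta> + \<beta>') * (w $ 1 * w $ 2) + (\<beta> * \<beta>') * (w $ 2 * w $ 2)"
        by (simp add: zz_def zz'_def algebra_simps)
      thus ?thesis unfolding bb' by (simp add: \<beta>'_def)
    qed
    moreover have "is_form K (1 + 1) (\<lambda>w :: 'a^4. w $ 1 * w $ 1 + (p * (w $ 1 * w $ 2) - n * (w $ 2 * w $ 2)))"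
      by (intro is_form_add is_form_diff is_form_smult is_form_mult comp S pn)
    ultimately show ?thesis by (simp only: one_add_one)
  qed
  have det: "1 * \<beta>' - \<beta> * 1 \<noteq> 0" using d0 by (simp add: \<delta>_def)
  have m1_l': "m 1 x = 1 *s l0 x + \<beta> *s l1 x" for x by (simp add: m1_l)
  have Q_s': "Q (zz w) = 1 *s s0 w + \<beta> *s s1 w" for w by (simp add: zz_def Q_s)
  have "two_covering (q 1) (q 2) (m 1) (m 2) (W 1) (W 2) v1 v2 K L Q Q' g g' zz zz' J l0 l1 s0 s1 1 \<beta> 1 \<beta>' r F G \<tau> \<delta>"
  proof unfold_locales
    show "s = 0 \<and> t = 0" if "x \<noteq> 0" "W 1 x = 0" "W 2 x = 0" "\<And>y. s * polar (W 1) x y + t * polar (W 2) x y = 0" for x s t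
      by (rule pair_nonsing[OF ne(1) that])
    show "\<exists>h. is_form K e h \<and> (\<forall>w. f w = h (s w))"
      if "forms_over K 2 s" "is_form K (2 * e) f" "is_form L e H" "\<And>w. f w = H (s w)" for e f H and s :: "'a^4 \<Rightarrow> 'a^(3+3)"
    proof (rule invariant_form_descent[OF K ext(1) _ that])
      show "\<exists>a\<in>K. \<exists>b\<in>K. x = a + \<beta> * b" if "x \<in> L" for x using that unfolding ext(2) by blast
    qed
  qed (fact K Lf Q1 QF Q'2 Q'(1) g forms_over_UNIV[OF zzF(1)] forms_over_UNIV[OF zzF(2)] Jz zJ JF ls coeff_ringD(2)[OF Lr] bL det
      m1_l' m2_l Q_s' Q'_s rec tauF tz dd d0 e1)+
  thus ?thesis by blast
qed

theorem theorem7p2: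
  fixes K :: "'a::{alg_closed_field, field_char_0} set"
    and A B F G :: "'a^4 \<Rightarrow> 'a"
    and C D :: "('a^4) set set"
    and q :: "4 \<Rightarrow> 'a^3 \<Rightarrow> 'a"
    and m :: "4 \<Rightarrow> 'a^4 \<Rightarrow> 'a^3"
    and \<Gamma> :: "4 \<Rightarrow> ('a^3) set set"
    and p :: "4 \<Rightarrow> ('a^3) set"
    and \<aa> :: "4 \<Rightarrow> ('a, 4) divisor"
    and T :: "('a, 4) divisor set"
    and r :: "'a^4 \<Rightarrow> 'a^4"
  assumes "number_field K" and "algebraic_over_all K"
    and "nonsingular_quadric_intersection K A B"
    and "C = zeros {A, B}"
    and "four_cones A B q m"
    and "\<And>i. \<Gamma> i = zeros {q i}"
    and "\<And>i. p i \<in> \<Gamma> i"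
    and "\<And>i. \<aa> i = pullback_divisor C (\<Gamma> i) (m i) (point_divisor (p i))"
    and "T \<in> jacobian_rational_points K C"
    and "T \<noteq> \<one>\<^bsub>Pic0 C\<^esub>" and "T [^]\<^bsub>Pic0 C\<^esub> (2::nat) = \<one>\<^bsub>Pic0 C\<^esub>"
    and "lin_equiv C (\<lambda>P. \<aa> 1 P - \<aa> 2 P) (\<lambda>P. \<aa> 3 P - \<aa> 4 P)"
    and "T = Pic0_class C (\<lambda>P. \<aa> 1 P - \<aa> 2 P)"
    and "\<And>\<sigma>. \<sigma> \<in> gal K \<Longrightarrow>
           \<exists>\<tau> \<in> {id, Transposition.transpose 1 2, Transposition.transpose 3 4,
                  Transposition.transpose 1 2 \<circ> Transposition.transpose 3 4}.
             \<forall>i. gal_point \<sigma> ` zeros {q i \<circ> m i} = zeros {q (\<tau> i) \<circ> m (\<tau> i)}"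
    and "(\<exists>L \<beta> P1 Q. nonsplit_construction K L \<beta> (q 1) (m 1) (q 2) (m 2) P1 Q r F G) \<or>
         (\<exists>P1 P2 Q R. split_construction K (q 1) (m 1) (q 2) (m 2) P1 P2 Q R r F G)"
    and "D = zeros {F, G}"
  shows "nonsingular_quadric_intersection K F G \<and>
         is_morphism K D C r \<and> has_degree K D C r 2 \<and>
         (\<forall>h. is_form UNIV 1 h \<and> h \<noteq> (\<lambda>_. 0) \<longrightarrow>
           lin_equiv D (hyperplane_divisor D h) (pullback_divisor D C r (\<aa> 1)) \<and>
           lin_equiv D (hyperplane_divisor D h) (pullback_divisor D C r (\<aa> 2)))"
proof -
  have K: "coeff_field K" using assms(1) unfolding number_field_def by (blast intro: subfield_coeff_field)
  interpret cone_pencil K A B q m by unfold_locales (rule assms(3,5))+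
  note CW = assms(4)[unfolded C_zeros[of 1 2, simplified]]
  \<comment> \<open>Both constructions are instances of the same covering, so the conclusion is
    drawn once, with \<open>C\<close> rewritten as the intersection of the first two cones.\<close>
  have concl: ?thesis
    if "two_covering (q 1) (q 2) (m 1) (m 2) (W 1) (W 2) v1 v2 K L Q Q' g g' zz zz' J l0 l1 s0 s1 a b c d r F G \<tau> \<delta>"
    for v1 v2 L Q Q' g g' zz zz' J l0 l1 s0 s1 a b c d \<tau> \<delta>
  proof -
    interpret two_covering "q 1" "q 2" "m 1" "m 2" "W 1" "W 2" v1 v2 K L Q Q' g g' zz zz' J l0 l1 s0 s1 a b c d r F G \<tau> \<delta>
      by (rule that)
    have p: "p 1 \<in> zeros {q 1}" "p 2 \<in> zeros {q 2}" using assms(7)[of 1] assms(7)[of 2] by (simp_all only: assms(6))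
    show ?thesis
      unfolding assms(8,6,16) CW
      using covering_conclusion(1-3) covering_conclusion(4)[OF _ _ p(1)] covering_conclusion(5)[OF _ _ p(2)] by blast
  qed
  from assms(15) show ?thesis
  proof (elim disjE exE)
    fix L \<beta> P1 Q
    assume "nonsplit_construction K L \<beta> (q 1) (m 1) (q 2) (m 2) P1 Q r F G"
    from nonsplit_two_covering[OF K assms(2) this] show ?thesis by (elim exE) (rule concl)
  next
    fix P1 P2 Q R
    assume "split_construction K (q 1) (m 1) (q 2) (m 2) P1 P2 Q R r F G"
    from split_two_covering[OF K this] show ?thesis by (elim exE) (rule concl)
  qed
qed

end
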